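(* Assume that $a_0=A-\lambda_{\mathrm c}\leq\gamma_0\varepsilon$ and that $\sigma\leq(|a_0|\vee\varepsilon)^{3/4}$. Then there exist positive constants $\kappa,h_1,h_2,c_0,C$ such that the following properties hold for all sufficiently small $\varepsilon$. (1) The probability that a sample path starting (at time $-1/2$) near one potential well crosses the potential barrier during one period, i.e. during $[-1/2,1/2]$, is smaller than $$\frac C\varepsilon\, e^{-\kappa(|a_0|\vee\varepsilon)^{3/2}/\sigma^2}.$$ (2) Case Ia: Assume that either $a_0\geq-\varepsilon$ or $\sigma\leq\sqrt{\varepsilon}/\bigl|\log|a_0|\bigr|$. Then $$\mathbb P\bigl\{|\mathcal A(\varepsilon,\sigma)-\mathcal A(\varepsilon,0)|\geq H\bigr\}\leq \begin{cases}\dfrac C\varepsilon\, e^{-\kappa H^2/(\sigma^2\varepsilon)} & \text{for } 0\leq H\leq H_1(\varepsilon,a_0),\\[2mm] \dfrac C\varepsilon\, e^{-\kappa H^4/\sigma^2} & \text{for } H\geq h_2,\end{cases}\qquad(\ast)$$ where $H_1(\varepsilon,a_0)=h_1\sqrt\varepsilon\,(|a_0|\vee\varepsilon)^{3/4}\wedge\bigl(\varepsilon/|\log(|a_0|\vee\varepsilon)|\bigr)$. Furthermore, under the slightly stronger assumption $\sigma|\log\varepsilon|\leq c_0(|a_0|\vee\varepsilon)^{3/4}$, $$\bigl|\mathbb E\{\mathcal A(\varepsilon,\sigma)-\mathcal A(\varepsilon,0)\}\bigr|\leq\mathcal O\bigl(\sigma^2|\log(|a_0|\vee\varepsilon)|\bigr),\qquad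 \operatorname{Var}\{\mathcal A(\varepsilon,\sigma)-\mathcal A(\varepsilon,0)\}\asymp\sigma^2\varepsilon.$$ (3) Case Ib: Assume now that $a_0\leq-\varepsilon$ and $\sigma\geq\sqrt\varepsilon/\bigl|\log|a_0|\bigr|$. Then $(\ast)$ still holds, and in addition $$\mathbb P\bigl\{|\mathcal A(\varepsilon,\sigma)-\mathcal A(\varepsilon,0)|\geq H\bigr\}\leq\frac C\varepsilon\, e^{-\kappa H/(\sigma^2|\log|a_0||)}$$ for $\varepsilon/\bigl|\log|a_0|\bigr|\leq H\leq H_2(\varepsilon,a_0)=h_1|a_0|^{3/2}\bigl|\log|a_0|\bigr|$. Moreover, under the slightly stronger assumption $\sigma|\log\varepsilon|\leq c_0(|a_0|\vee\varepsilon)^{3/4}$, $$\bigl|\mathbb E\{\mathcal A(\varepsilon,\sigma)-\mathcal A(\varepsilon,0)\}\bigr|\leq\mathcal O\bigl(\sigma^2\bigl|\log|a_0|\bigr|\bigr),\qquad \operatorname{Var}\{\mathcal A(\varepsilon,\sigma)-\mathcal A(\varepsilon,0)\}\leq\mathcal O\bigl(\sigma^4\bigl|\log|a_0|\bigr|^2\bigr).$$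
   Context: Let $A>0$, $\lambda_{\mathrm c}=2/(3\sqrt3)$, $a_0=A-\lambda_{\mathrm c}$, $\lambda(t)=-A\cos(2\pi t)$, $F(x,\lambda)=x-x^3+\lambda$. For $|\lambda|<\lambda_{\mathrm c}$, $F(\cdot,\lambda)$ has zeros $X^\star_-(\lambda)<X^\star_0(\lambda)<X^\star_+(\lambda)$ (stable, unstable, stable); $X^\star_+$ is continued as the only zero for $\lambda>\lambda_{\mathrm c}$ and $X^\star_-$ as the only zero for $\lambda<-\lambda_{\mathrm c}$. With $W$ a standard Brownian motion, consider $$dx_t=\frac1\varepsilon F(x_t,\lambda(t))\,dt+\frac{\sigma}{\sqrt\varepsilon}\,dW_t ,$$ and, for $\sigma=0$, the ODE $\varepsilon\,\frac{dx_t}{dt}=F(x_t,\lambda(t))$. The constant $\gamma_0>0$ is fixed, small enough that for $a_0\leq\gamma_0\varepsilon$ and $\varepsilon$ sufficiently small the ODE has exactly two stable periodic solutions $x^{\mathrm{per},\pm}_t$ and one unstable periodic solution $x^{\mathrm{per},0}_t$, tracking $X^\star_\pm(\lambda(t))$ and $X^\star_0(\lambda(t))$ respectively at distance at most $\mathcal O(\varepsilon|a_0|^{-1/2}\wedge\sqrt\varepsilon)$, all solutions not starting on $x^{\mathrm{per},0}$ being attracted by $x^{\mathrm{per},+}$ or $x^{\mathrm{per},-}$. The initial condition is $x_{-1/2}=x_0>0$ deterministic, with $|x_0-x^{\mathrm{per},+}_{-1/2}|$ smaller than a sufficiently small constant of order one (so that the deterministic solution starting there is attracted by $x^{\mathrm{per},+}$).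 The area is $\mathcal A(\varepsilon,\sigma)=-\int_{-1/2}^{1/2}x_t\,\lambda'(t)\,dt$ (a random variable), and $\mathcal A(\varepsilon,0)$ is the same quantity for $\sigma=0$ with the same initial condition. The two wells are those associated with $X^\star_+$ and $X^\star_-$. "Crossing the potential barrier" means that the path makes a transition towards the other well, i.e. reaches the level $x=0$ (from above if it started near $X^\star_+(\lambda(-1/2))$, from below if it started near $X^\star_-(\lambda(-1/2))$). Conventions: $a_0$ and $\sigma$ are regarded as (possibly constant) functions of $\varepsilon$; constants do not depend on $\varepsilon$ (hence not on $\sigma$, $a_0$). $u\vee v$, $u\wedge v$ are maximum and minimum. $\psi\asymp\varphi$ means $c_-\varphi\leq\psi\leq c_+\varphi$ for constants $c_\pm>0$ and all small $\varepsilon$; $\mathcal O(u)$ denotes a quantity at most a constant times $u$.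
   Formalization: The lower constant in Var ≍ σ²ε may depend on a positive lower bound for A (the bound fails if A(ε)→0, as the area is proportional to A), and "near" the left well means within a small constant times (|a0|∨ε)^{1/2}, since order-one starts above it cross deterministically. *)

theory Defs
  imports "HOL-Probability.Probability"
begin

definition lambda_c :: real where
  "lambda_c = 2 / (3 * sqrt 3)"

definition lam :: "real \<Rightarrow> real \<Rightarrow> real" where
  "lam A t = - A * cos (2 * pi * t)"

definition F :: "real \<Rightarrow> real \<Rightarrow> real" where
  "F x l = x - x ^ 3 + l"

text \<open>
  Equilibrium branches. The largest zero of \<open>F (_, l)\<close> is the upper stable branch, including its
  continuation as the only zero for \<open>l > lambda_c\<close>; it is meaningful for \<open>l > - lambda_c\<close>.
  Symmetrically, \<open>X_minus l\<close> is meaningful for \<open>l < lambda_c\<close>, and \<open>X_zero l\<close> for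
  \<open>\<bar>l\<bar> < lambda_c\<close>. They are used only in these ranges.
\<close>

definition X_plus :: "real \<Rightarrow> real" where
  "X_plus l = Max {x. F x l = 0}"

definition X_minus :: "real \<Rightarrow> real" where
  "X_minus l = Min {x. F x l = 0}"

definition X_zero :: "real \<Rightarrow> real" where
  "X_zero l = (THE x. F x l = 0 \<and> X_minus l < x \<and> x < X_plus l)"

definition ode_solution :: "real \<Rightarrow> real \<Rightarrow> real set \<Rightarrow> (real \<Rightarrow> real) \<Rightarrow> bool" where
  "ode_solution \<epsilon> A T x \<longleftrightarrow>
     (\<forall>t\<in>T. (x has_real_derivative F (x t) (lam A t) / \<epsilon>) (at t within T))"

definition periodic_solution :: "real \<Rightarrow> real \<Rightarrow> (real \<Rightarrow> real) \<Rightarrow> bool" where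
  "periodic_solution \<epsilon> A x \<longleftrightarrow> ode_solution \<epsilon> A UNIV x \<and> (\<forall>t. x (t + 1) = x t)"

text \<open>Lyapunov stability, uniformly in the starting time; unstable means not stable in this sense.\<close>

definition stable_solution :: "real \<Rightarrow> real \<Rightarrow> (real \<Rightarrow> real) \<Rightarrow> bool" where
  "stable_solution \<epsilon> A x \<longleftrightarrow>
     (\<forall>\<eta>>0. \<exists>d>0. \<forall>s y. ode_solution \<epsilon> A {s..} y \<and> \<bar>y s - x s\<bar> < d \<longrightarrow>
        (\<forall>t\<ge>s. \<bar>y t - x t\<bar> < \<eta>))"

text \<open>
  \<open>periodic_orbits \<gamma> xp xm xz\<close>: for all small \<open>\<epsilon>\<close> and all \<open>a0 \<le> \<gamma> * \<epsilon>\<close>, the functions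
  \<open>xp \<epsilon> a0\<close>, \<open>xm \<epsilon> a0\<close> are exactly the stable periodic solutions and \<open>xz \<epsilon> a0\<close> is the only
  unstable one; they track the upper, lower and middle equilibrium branch wherever that branch
  exists; and every solution not starting on \<open>xz \<epsilon> a0\<close> is attracted by one of the stable ones.
  The tracking distance \<open>min (\<epsilon> * \<bar>a0\<bar> powr (-1/2)) (sqrt \<epsilon>)\<close> is written as
  \<open>\<epsilon> / sqrt (max \<bar>a0\<bar> \<epsilon>)\<close>, which is the same number if \<open>a0 \<noteq> 0\<close> and has the intended value
  \<open>sqrt \<epsilon>\<close> (rather than 0) if \<open>a0 = 0\<close>. The condition \<open>- lambda_c < a0\<close> is positivity of the
  amplitude \<open>A = lambda_c + a0\<close>.
\<close>

definition periodic_orbits ::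
    "real \<Rightarrow> (real \<Rightarrow> real \<Rightarrow> real \<Rightarrow> real) \<Rightarrow> (real \<Rightarrow> real \<Rightarrow> real \<Rightarrow> real)
      \<Rightarrow> (real \<Rightarrow> real \<Rightarrow> real \<Rightarrow> real) \<Rightarrow> bool" where
  "periodic_orbits \<gamma> xp xm xz \<longleftrightarrow>
     (\<exists>K>0. \<exists>\<epsilon>0>0. \<forall>\<epsilon> a0. 0 < \<epsilon> \<and> \<epsilon> < \<epsilon>0 \<and> - lambda_c < a0 \<and> a0 \<le> \<gamma> * \<epsilon> \<longrightarrow>
        (let A = lambda_c + a0; r = K * (\<epsilon> / sqrt (max \<bar>a0\<bar> \<epsilon>)) in
           xp \<epsilon> a0 \<noteq> xm \<epsilon> a0
         \<and> {x. periodic_solution \<epsilon> A x \<and> stable_solution \<epsilon> A x} = {xp \<epsilon> a0, xm \<epsilon> a0}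
         \<and> {x. periodic_solution \<epsilon> A x \<and> \<not> stable_solution \<epsilon> A x} = {xz \<epsilon> a0}
         \<and> (\<forall>t. lam A t > - lambda_c \<longrightarrow> \<bar>xp \<epsilon> a0 t - X_plus (lam A t)\<bar> \<le> r)
         \<and> (\<forall>t. lam A t < lambda_c \<longrightarrow> \<bar>xm \<epsilon> a0 t - X_minus (lam A t)\<bar> \<le> r)
         \<and> (\<forall>t. \<bar>lam A t\<bar> < lambda_c \<longrightarrow> \<bar>xz \<epsilon> a0 t - X_zero (lam A t)\<bar> \<le> r)
         \<and> (\<forall>s y. ode_solution \<epsilon> A {s..} y \<and> y s \<noteq> xz \<epsilon> a0 s \<longrightarrow>
              ((\<lambda>t. y t - xp \<epsilon> a0 t) \<longlongrightarrow> 0) at_top \<or>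
              ((\<lambda>t. y t - xm \<epsilon> a0 t) \<longlongrightarrow> 0) at_top)))"

locale standard_brownian_motion = prob_space M
  for M :: "'w measure" and t0 :: real and W :: "real \<Rightarrow> 'w \<Rightarrow> real" +
  assumes BM_measurable: "\<And>t. t0 \<le> t \<Longrightarrow> W t \<in> borel_measurable M"
    and BM_start: "\<And>\<omega>. \<omega> \<in> space M \<Longrightarrow> W t0 \<omega> = 0"
    and BM_continuous: "\<And>\<omega>. \<omega> \<in> space M \<Longrightarrow> continuous_on {t0..} (\<lambda>t. W t \<omega>)"
    and BM_increment: "\<And>s t. t0 \<le> s \<Longrightarrow> s < t \<Longrightarrow>
        distributed M lborel (\<lambda>\<omega>. W t \<omega> - W s \<omega>) (normal_density 0 (sqrt (t - s)))"
    and BM_indep: "\<And>n (\<tau> :: nat \<Rightarrow> real). t0 \<le> \<tau> 0 \<Longrightarrow> (\<And>i. i < n \<Longrightarrow> \<tau> i \<le> \<tau> (Suc i)) \<Longrightarrow>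
        indep_vars (\<lambda>_. borel) (\<lambda>i \<omega>. W (\<tau> (Suc i)) \<omega> - W (\<tau> i) \<omega>) {..<n}"

text \<open>
  The noise is additive, so the equation is the pathwise integral equation below and no stochastic
  integral is involved. All paths are required to be continuous (the equation itself only almost
  surely), so that events on whole paths and the area are measurable without completing \<open>M\<close>.
\<close>

definition sde_solution ::
    "'w measure \<Rightarrow> (real \<Rightarrow> 'w \<Rightarrow> real) \<Rightarrow> real \<Rightarrow> real \<Rightarrow> real \<Rightarrow> real \<Rightarrow> (real \<Rightarrow> 'w \<Rightarrow> real) \<Rightarrow> bool"
  where
  "sde_solution M W \<epsilon> \<sigma> A x0 X \<longleftrightarrow>
     (\<forall>t\<in>{-1/2..1/2}. X t \<in> borel_measurable M)
   \<and> (\<forall>\<omega>\<in>space M. continuous_on {-1/2..1/2} (\<lambda>t. X t \<omega>))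
   \<and> (AE \<omega> in M. \<forall>t\<in>{-1/2..1/2}.
        X t \<omega> = x0 + 1 / \<epsilon> * integral {-1/2..t} (\<lambda>s. F (X s \<omega>) (lam A s))
                   + \<sigma> / sqrt \<epsilon> * (W t \<omega> - W (-1/2) \<omega>))"

definition area :: "real \<Rightarrow> (real \<Rightarrow> real) \<Rightarrow> real" where
  "area A x = - integral {-1/2..1/2} (\<lambda>t. x t * deriv (lam A) t)"

text \<open>
  Starting near a well at time \<open>-1/2\<close>. There \<open>lam A (-1/2) = A\<close>: the right well is at its
  deepest and \<open>near\<close> is at scale one. The left well is at its shallowest: its basin only extends a
  distance of order \<open>sqrt (max \<bar>a0\<bar> \<epsilon>)\<close> upwards, so this is the scale of \<open>near\<close>; moreover the
  branch \<open>X_minus\<close> does not exist there if \<open>a0 > 0\<close>, whereas \<open>xm\<close> always does. Both the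
  equilibrium and the periodic solution tracking it are admitted as centre.
\<close>

definition near_right_well ::
    "(real \<Rightarrow> real \<Rightarrow> real \<Rightarrow> real) \<Rightarrow> real \<Rightarrow> real \<Rightarrow> real \<Rightarrow> real \<Rightarrow> bool" where
  "near_right_well xp \<delta> \<epsilon> a0 x0 \<longleftrightarrow> 0 < x0 \<and>
     (\<bar>x0 - xp \<epsilon> a0 (-1/2)\<bar> < \<delta> \<or>
      \<bar>x0 - X_plus (lam (lambda_c + a0) (-1/2))\<bar> < \<delta>)"

definition near_left_well ::
    "(real \<Rightarrow> real \<Rightarrow> real \<Rightarrow> real) \<Rightarrow> real \<Rightarrow> real \<Rightarrow> real \<Rightarrow> real \<Rightarrow> bool" where
  "near_left_well xm \<delta> \<epsilon> a0 x0 \<longleftrightarrow> x0 < 0 \<and>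
     (\<bar>x0 - xm \<epsilon> a0 (-1/2)\<bar> < \<delta> * sqrt (max \<bar>a0\<bar> \<epsilon>) \<or>
      a0 < 0 \<and> \<bar>x0 - X_minus (lam (lambda_c + a0) (-1/2))\<bar> < \<delta> * sqrt (max \<bar>a0\<bar> \<epsilon>))"

definition H1 :: "real \<Rightarrow> real \<Rightarrow> real \<Rightarrow> real" where
  "H1 h1 \<epsilon> a0 =
     min (h1 * sqrt \<epsilon> * (max \<bar>a0\<bar> \<epsilon>) powr (3/4)) (\<epsilon> / \<bar>ln (max \<bar>a0\<bar> \<epsilon>)\<bar>)"

definition H2 :: "real \<Rightarrow> real \<Rightarrow> real" where
  "H2 h1 a0 = h1 * \<bar>a0\<bar> powr (3/2) * \<bar>ln \<bar>a0\<bar>\<bar>"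

definition tail_bound ::
    "'w measure \<Rightarrow> ('w \<Rightarrow> real) \<Rightarrow> real \<Rightarrow> real \<Rightarrow> real \<Rightarrow> real \<Rightarrow> real \<Rightarrow> real \<Rightarrow> real \<Rightarrow> bool" where
  "tail_bound M D \<kappa> C h1 h2 \<epsilon> a0 \<sigma> \<longleftrightarrow>
     (\<forall>H. 0 \<le> H \<and> H \<le> H1 h1 \<epsilon> a0 \<longrightarrow>
        measure M {\<omega>\<in>space M. \<bar>D \<omega>\<bar> \<ge> H} \<le> C / \<epsilon> * exp (- \<kappa> * H\<^sup>2 / (\<sigma>\<^sup>2 * \<epsilon>)))
   \<and> (\<forall>H. h2 \<le> H \<longrightarrow>
        measure M {\<omega>\<in>space M. \<bar>D \<omega>\<bar> \<ge> H} \<le> C / \<epsilon> * exp (- \<kappa> * H ^ 4 / \<sigma>\<^sup>2))"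

end

theory Submission
  imports Defs
begin

text \<open>
  Write a path as \<open>X = z + y\<close>, where \<open>z\<close> is a solution (or subsolution) following a stable branch. With
  \<open>m = max \<bar>a0\<bar> \<epsilon>\<close> (in the lemmas \<open>\<epsilon>\<close> is called \<open>e\<close>) and \<open>\<rho>(t)^2 = L * m + sin(\<pi> t)^2\<close>, the linearisation \<open>a = 1 - 3 z^2\<close> is at most
  \<open>- c1 * \<rho>\<close> up to an excess with time integral \<open>O(\<epsilon>)\<close>: near the fold \<open>a\<close> may be positive, but only
  at height \<open>sqrt \<epsilon>\<close> and for a time of order \<open>sqrt \<epsilon>\<close>. Exponential weights are then those of a stable
  equation up to constants, and the linear Gaussian process \<open>\<zeta>\<close> has variance \<open>O(\<sigma>^2 / \<rho>)\<close>. Outside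
  an event controlled by chaining, \<open>\<bar>\<zeta>\<bar> <= h / sqrt \<rho>\<close>; for \<open>h\<close> of order \<open>m^(3/4)\<close> a barrier argument
  confines \<open>y\<close> to \<open>O(\<rho>)\<close>, so that 0 is not reached. The left well is treated by reflection.

  The area difference is \<open>- A * (D0 + R)\<close> with \<open>D0\<close> linear in \<open>\<zeta>\<close>, hence Gaussian with variance of
  order \<open>\<sigma>^2 * \<epsilon>\<close>, and \<open>\<bar>R\<bar>\<close> at most a constant times the integral of \<open>\<zeta>^2\<close>, which is of order
  \<open>\<sigma>^2 * \<bar>ln m\<bar>\<close>. For the lower bound on the variance, the part of \<open>R\<close> quadratic in the noise is
  uncorrelated with \<open>D0\<close>, because odd Gaussian moments vanish, and the rest is of order
  \<open>\<sigma>^3 * m^(- 3/4)\<close>. A large area forces a large excursion of the path, which the cubic drift opposes;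
  this gives the rate \<open>H^4 / \<sigma>^2\<close>.
\<close>

text \<open>Near the fold the linearisation may be positive, so no pointwise stability estimate
  exists; every damping bound passes through the bounded integrating factor \<open>wgt\<close>, and
  its constants come from \<open>c1\<close> and \<open>C1\<close>. Uniformity in \<open>e\<close>,
  \<open>a0\<close> and \<open>\<sigma>\<close> is the real burden: locale constants are later
  matched with closed formulas that can be fixed before any path is given. The additive noise
  cancels in \<open>X - z - k * lin w\<close>, which makes the nonlinear estimates statements about
  differentiable functions; Gaussian laws are needed for linear functionals of \<open>W\<close>
  alone. Outside the good event the path is not confined, and only moments growing like powers of
  \<open>1 / e\<close> are available; the logarithm in the stronger assumption on
  \<open>\<sigma>\<close> lets the small probability beat them. For the lower variance bound,
  estimating \<open>R\<close> by its size would not do: in case Ia its second moment, of order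
  \<open>\<sigma>^4 * \<bar>ln m\<bar>^2\<close>, is only bounded by a multiple of
  \<open>\<sigma>^2 * e\<close>, not small against it.\<close>

lemmas hk_le = Henstock_Kurzweil_Integration.integral_le
lemmas hk_nonneg = Henstock_Kurzweil_Integration.integral_nonneg
lemmas hk_add = Henstock_Kurzweil_Integration.integral_add
lemmas hk_combine = Henstock_Kurzweil_Integration.integral_combine
lemmas hk_diff = Henstock_Kurzweil_Integration.integral_diff

section \<open>Barriers and primitives\<close>

text \<open>Compactness of the zero set yields a first zero, and a positive derivative there
  contradicts positivity just before it. The derivative matters at contact points only, so a barrier
  has to beat the dynamics merely where the two touch.\<close>

lemma barrier_pos:
 fixes g :: "real \<Rightarrow> real"
 assumes g: "continuous_on {p..q} g" and g0: "0 < g p"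
  and contact: "\<And>t. p < t \<Longrightarrow> t <= q \<Longrightarrow> g t = 0 \<Longrightarrow>
   \<exists>d>0. (g has_real_derivative d) (at t within {p..q})"
  and t: "t \<in> {p..q}"
 shows "0 < g t"
proof (rule ccontr)
 assume neg: "\<not> 0 < g t"
 define Z where "Z = {s \<in> {p..t}. g s = 0}"
 have sub: "{p..t} \<subseteq> {p..q}" using t by auto
 have cont: "continuous_on {p..t} g" using g sub continuous_on_subset by blast
 have "\<exists>s\<ge>p. s <= t \<and> g s = 0"
  by (rule IVT2') (use neg g0 t cont in auto)
 then have ne: "Z \<noteq> {}" by (auto simp: Z_def)
 have "compact Z"
 proof -
  have "Z = {p..t} \<inter> g -` {0}" by (auto simp: Z_def)
  then have "closed Z" using continuous_closed_preimage[OF cont] by auto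
  moreover have "bounded Z" unfolding Z_def by (rule bounded_subset[of "{p..t}"]) auto
  ultimately show ?thesis by (simp add: compact_eq_bounded_closed)
 qed
 then obtain r where r: "r \<in> Z" and rmin: "\<And>s. s \<in> Z \<Longrightarrow> r <= s"
  using compact_attains_inf[OF _ ne] by blast
 have rI: "p <= r" "r <= t" "g r = 0" using r by (auto simp: Z_def)
 have "p \<noteq> r" using rI g0 by auto
 then have pr: "p < r" using rI by simp
 have pos: "0 < g s" if "p <= s" "s < r" for s
 proof (rule ccontr)
  assume "\<not> 0 < g s"
  then have "\<exists>s'\<ge>p. s' <= s \<and> g s' = 0"
   by (intro IVT2') (use g0 that rI cont in \<open>auto intro: continuous_on_subset\<close>)
  then obtain s' where "s' \<ge> p" "s' <= s" "g s' = 0" by blast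
  then have "s' \<in> Z" using that rI by (auto simp: Z_def)
  with rmin that \<open>s' <= s\<close> show False by fastforce
 qed
 obtain d where d: "d > 0" "(g has_real_derivative d) (at r within {p..q})"
  using contact[OF pr] rI t by auto
 have "(g has_real_derivative d) (at r within {p..r})"
  by (rule DERIV_subset[OF d(2)]) (use rI t in auto)
 from has_real_derivative_pos_inc_left[OF this d(1)]
 obtain e where e: "e > 0" "\<And>h. h > 0 \<Longrightarrow> r - h \<in> {p..r} \<Longrightarrow> h < e \<Longrightarrow> g (r - h) < g r" by blast
 define h where "h = min (e/2) (r - p)"
 have "h > 0" "h < e" "r - h \<in> {p..r}" using e pr by (auto simp: h_def)
 then have "g (r - h) < 0" using e(2)[of h] rI by simp
 moreover have "0 < g (r - h)" using pos[of "r - h"] \<open>h > 0\<close> \<open>r - h \<in> {p..r}\<close> by auto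
 ultimately show False by simp
qed

text \<open>Reversing time turns a negative slope into a positive one. This carries information from
  a time after the fold back into a window where tracking gives nothing.\<close>

lemma barrier_pos_backward:
 fixes g :: "real \<Rightarrow> real"
 assumes g: "continuous_on {p..q} g" and g0: "0 < g q"
  and contact: "\<And>t. p <= t \<Longrightarrow> t < q \<Longrightarrow> g t = 0 \<Longrightarrow>
   \<exists>d<0. (g has_real_derivative d) (at t)"
  and t: "t \<in> {p..q}"
 shows "0 < g t"
proof -
 have "0 < g (- (- t))"
 proof (rule barrier_pos[where g = "\<lambda>s. g (- s)" and p = "-q" and q = "-p"])
  show "continuous_on {- q..- p} (\<lambda>s. g (- s))"
   by (rule continuous_on_compose2[OF g]) (auto intro: continuous_intros)
  show "0 < g (- (- q))" using g0 by simp
  fix s assume s: "- q < s" "s <= - p" "g (- s) = 0"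
  then obtain d where d: "d < 0" "(g has_real_derivative d) (at (- s))"
   using contact[of "-s"] by auto
  have "((\<lambda>s. g (- s)) has_real_derivative d * (-1)) (at s)"
   by (rule DERIV_chain2[where g = uminus, OF d(2)]) (auto intro!: derivative_eq_intros)
  then show "\<exists>d>0. ((\<lambda>s. g (- s)) has_real_derivative d) (at s within {- q..- p})"
   using d by (intro exI[of _ "- d"]) (auto intro: has_field_derivative_at_within)
 qed (use t in auto)
 then show ?thesis by simp
qed

text \<open>Integrated energy inequality: \<open>f\<close> plays the energy, \<open>h\<close> the
  dissipation and \<open>k\<close> the source.\<close>

lemma integral_le_of_derivative_le:
 fixes f f' h k :: "real \<Rightarrow> real"
 assumes "p <= q"
  and f: "\<And>t. t \<in> {p..q} \<Longrightarrow> (f has_real_derivative f' t) (at t within {p..q})"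
  and le: "\<And>t. t \<in> {p..q} \<Longrightarrow> f' t <= k t - h t"
  and h: "continuous_on {p..q} h" and k: "continuous_on {p..q} k"
 shows "f q + integral {p..q} h <= f p + integral {p..q} k"
proof -
 have "(f' has_integral (f q - f p)) {p..q}"
  by (rule fundamental_theorem_of_calculus)
    (use assms in \<open>auto simp: has_real_derivative_iff_has_vector_derivative\<close>)
 moreover have "((\<lambda>t. k t - h t) has_integral (integral {p..q} k - integral {p..q} h)) {p..q}"
  by (intro has_integral_diff integrable_integral integrable_continuous_real h k)
 ultimately have "f q - f p <= integral {p..q} k - integral {p..q} h"
  by (rule has_integral_le) (use le in auto)
 then show ?thesis by simp
qed

lemma integral_has_derivative_within:
 fixes f :: "real \<Rightarrow> real"
 assumes "continuous_on {p..q} f" "t \<in> {p..q}"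
 shows "((\<lambda>t. integral {p..t} f) has_real_derivative f t) (at t within {p..q})"
 using integral_has_real_derivative[OF assms] .

lemma integral_has_derivative_within':
 fixes f :: "real \<Rightarrow> real"
 assumes f: "continuous_on {p..q} f" and t: "t \<in> {p..q}"
 shows "((\<lambda>t. integral {t..q} f) has_real_derivative - f t) (at t within {p..q})"
proof -
 have eq: "integral {s..q} f = integral {p..q} f - integral {p..s} f" if "s \<in> {p..q}" for s
  using hk_combine[OF _ _ integrable_continuous_real[OF f], of s] that by auto
 have "((\<lambda>s. integral {p..q} f - integral {p..s} f) has_real_derivative 0 - f t) (at t within {p..q})"
  by (intro DERIV_diff DERIV_const integral_has_derivative_within[OF f t])
 then have "((\<lambda>s. integral {p..q} f - integral {p..s} f) has_real_derivative - f t) (at t within {p..q})" by simp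
 then show ?thesis
  by (rule has_field_derivative_transform_within[OF _ zero_less_one t]) (rule eq[symmetric])
qed

text \<open>Exchange of the order of integration over a triangle. It follows from the product rule,
  because one primitive vanishes at \<open>p\<close> and the other at \<open>q\<close>; in this way
  time integrals of a process become integrals of an adjoint kernel against the noise.\<close>

lemma integral_by_parts_primitive:
 fixes f k :: "real \<Rightarrow> real"
 assumes "p <= q" and f: "continuous_on {p..q} f" and k: "continuous_on {p..q} k"
 shows "integral {p..q} (\<lambda>t. f t * integral {p..t} k)
    = integral {p..q} (\<lambda>t. integral {t..q} f * k t)"
proof -
 let ?J = "\<lambda>t. integral {p..t} k" and ?P = "\<lambda>t. integral {t..q} f"
 have dJ: "(?J has_real_derivative k t) (at t within {p..q})" if "t \<in> {p..q}" for t
  by (rule integral_has_derivative_within[OF k that])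
 have dP: "(?P has_real_derivative - f t) (at t within {p..q})" if "t \<in> {p..q}" for t
  by (rule integral_has_derivative_within'[OF f that])
 have cJ: "continuous_on {p..q} ?J" and cP: "continuous_on {p..q} ?P"
  by (rule DERIV_continuous_on[OF dJ], simp) (rule DERIV_continuous_on[OF dP], simp)
 have "((\<lambda>t. - f t * ?J t + k t * ?P t) has_integral (?P q * ?J q - ?P p * ?J p)) {p..q}"
  by (rule fundamental_theorem_of_calculus[OF assms(1)])
    (auto simp: has_real_derivative_iff_has_vector_derivative[symmetric] intro!: DERIV_mult[OF dP dJ, simplified])
 then have "integral {p..q} (\<lambda>t. - f t * ?J t + k t * ?P t) = 0"
  by (simp add: integral_unique)
 moreover have "integral {p..q} (\<lambda>t. - f t * ?J t + k t * ?P t)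
   = integral {p..q} (\<lambda>t. - f t * ?J t) + integral {p..q} (\<lambda>t. k t * ?P t)"
  by (intro integral_add integrable_continuous_real continuous_intros f k cJ cP)
 ultimately show ?thesis by (simp add: mult.commute)
qed

section \<open>Linearised dynamics with integrable excess\<close>

abbreviation TI :: "real set" where "TI \<equiv> {- (1/2)..1/2}"

text \<open>\<open>rho_eps\<close> together with \<open>rho'_bound\<close> gives
  \<open>e * \<bar>\<rho>'\<bar> <= c1 * \<rho>^2 / 2\<close>: the motion of the width costs at most
  half of the damping. \<open>excess\<close> is of order \<open>e\<close> because exponents carry a
  factor \<open>1 / e\<close>, so the unstable part changes them by at most
  \<open>C1\<close>.\<close>

locale linear_well =
 fixes e c1 C1 N :: real and a \<rho> \<rho>' :: "real \<Rightarrow> real"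
 assumes eps_pos: "0 < e" and c1_pos: "0 < c1" and C1_nonneg: "0 <= C1"
  and a_cont: "continuous_on TI a"
  and a_bound: "\<And>t. t \<in> TI \<Longrightarrow> \<bar>a t\<bar> <= N"
  and rho_deriv: "\<And>t. t \<in> TI \<Longrightarrow> (\<rho> has_real_derivative \<rho>' t) (at t within TI)"
  and rho'_bound: "\<And>t. t \<in> TI \<Longrightarrow> \<bar>\<rho>' t\<bar> <= 4"
  and rho_pos: "\<And>t. t \<in> TI \<Longrightarrow> 0 < \<rho> t"
  and rho_eps: "\<And>t. t \<in> TI \<Longrightarrow> 8 * e <= c1 * (\<rho> t)^2"
  and excess: "integral TI (\<lambda>t. max 0 (a t + c1 * \<rho> t)) <= C1 * e"
begin

lemma eps_ne [simp]: "e \<noteq> 0" using eps_pos by simp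

lemma rho_cont: "continuous_on TI \<rho>"
 using rho_deriv by (rule DERIV_continuous_on)

lemma N_nonneg: "0 <= N"
 using a_bound[of 0] by auto

definition pos_part :: "real \<Rightarrow> real" where
 "pos_part t = max 0 (a t + c1 * \<rho> t)"

lemma pos_part_ge: "a t + c1 * \<rho> t <= pos_part t" and pos_part_nonneg: "0 <= pos_part t"
 by (simp_all add: pos_part_def)

lemma pos_part_cont: "continuous_on TI pos_part"
 unfolding pos_part_def by (intro continuous_intros a_cont rho_cont)

text \<open>Integrating factor for the unstable excess: \<open>wgt * f\<close> is damped at rate
  \<open>c1 * \<rho> / e\<close> even where \<open>a\<close> is positive. The bound on
  \<open>excess\<close> keeps \<open>wgt\<close> between \<open>exp (- C1)\<close> and 1, so
  removing it costs only a constant.\<close>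

definition wgt :: "real \<Rightarrow> real" where
 "wgt t = exp (- (integral {- (1/2)..t} pos_part / e))"

definition \<alpha> :: "real \<Rightarrow> real" where
 "\<alpha> t = integral {- (1/2)..t} a / e"

lemma omega_start: "wgt (- (1/2)) = 1" and alpha_start: "\<alpha> (- (1/2)) = 0"
 by (simp_all add: wgt_def \<alpha>_def)

lemma omega_pos: "0 < wgt t" by (simp add: wgt_def)

lemma omega_deriv:
 assumes "t \<in> TI"
 shows "(wgt has_real_derivative - (pos_part t / e) * wgt t) (at t within TI)"
proof -
 have "((\<lambda>t. - (integral {- (1/2)..t} pos_part / e)) has_real_derivative - (pos_part t / e)) (at t within TI)"
  by (intro DERIV_minus DERIV_cdivide integral_has_derivative_within[OF pos_part_cont assms])
 from DERIV_chain2[OF DERIV_exp this] show ?thesis unfolding wgt_def by (simp only: mult.commute)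
qed

lemma alpha_deriv:
 assumes "t \<in> TI"
 shows "(\<alpha> has_real_derivative a t / e) (at t within TI)"
 unfolding \<alpha>_def
 by (rule derivative_eq_intros integral_has_derivative_within[OF a_cont assms] refl)+
   (use eps_pos in simp_all)

lemma omega_cont: "continuous_on TI wgt"
 using omega_deriv by (rule DERIV_continuous_on)

lemma alpha_cont: "continuous_on TI \<alpha>"
 using alpha_deriv by (rule DERIV_continuous_on)

lemma omega_le: "t \<in> TI \<Longrightarrow> wgt t <= 1"
 unfolding wgt_def using eps_pos
 by (auto intro!: divide_nonneg_pos hk_nonneg
   integrable_continuous_real continuous_on_subset[OF pos_part_cont] pos_part_nonneg)

lemma omega_ge: assumes "t \<in> TI" shows "exp (- C1) <= wgt t"
proof -
 have "integral {- (1/2)..t} pos_part <= integral TI pos_part"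
  by (rule integral_subset_le)
    (use assms in \<open>auto intro!: integrable_continuous_real continuous_on_subset[OF pos_part_cont]
     simp: pos_part_def\<close>)
 also have "... <= C1 * e" using excess by (simp add: pos_part_def[abs_def])
 finally show ?thesis unfolding wgt_def using eps_pos by (simp add: field_simps)
qed

lemma inverse_omega_le: "t \<in> TI \<Longrightarrow> 1 / wgt t <= exp C1"
 using omega_ge[of t] omega_pos[of t] by (simp add: exp_minus field_simps)

text \<open>The barrier is \<open>- \<eta>1 * \<rho> / wgt\<close>. Its factor
  \<open>1 / wgt\<close> grows exactly at the rate of the unstable excess, so at contact the term
  with \<open>a\<close> is compensated and half of the damping,
  \<open>\<eta>1 * c1 * \<rho>^2 / 2\<close>, is left to beat the quadratic remainder; this is the
  second condition in \<open>eta\<close>. The condition \<open>small\<close> makes the drift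
  inequality available at contact.\<close>

lemma barrier_below:
 assumes u: "\<And>t. t \<in> TI \<Longrightarrow> (u has_real_derivative u' t) (at t within TI)"
  and u': "\<And>t. t \<in> TI \<Longrightarrow> \<bar>u t + \<zeta> t\<bar> <= 1 \<Longrightarrow> a t * u t - 6 * (u t + \<zeta> t)^2 <= e * u' t"
  and zeta: "\<And>t. t \<in> TI \<Longrightarrow> \<bar>\<zeta> t\<bar> <= \<eta>2 * \<rho> t"
  and start: "- \<eta>1 * \<rho> (- (1/2)) < u (- (1/2))"
  and eta: "0 < \<eta>1" "12 * (exp (2 * C1) * \<eta>1^2 + \<eta>2^2) < \<eta>1 * c1 / 2"
  and small: "\<And>t. t \<in> TI \<Longrightarrow> (\<eta>1 * exp C1 + \<eta>2) * \<rho> t <= 1"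
  and t: "t \<in> TI"
 shows "- (\<eta>1 * exp C1 * \<rho> t) < u t"
proof -
 define \<beta> where "\<beta> t = \<eta>1 * \<rho> t / wgt t" for t
 have beta_le: "\<beta> t <= \<eta>1 * exp C1 * \<rho> t" if "t \<in> TI" for t
 proof -
  have "\<beta> t = \<eta>1 * \<rho> t * (1 / wgt t)" by (simp add: \<beta>_def)
  also have "... <= \<eta>1 * \<rho> t * exp C1"
   by (intro mult_left_mono inverse_omega_le that) (use eta rho_pos[OF that] in auto)
  finally show ?thesis by (simp add: ac_simps)
 qed
 have beta_pos: "0 < \<beta> t" if "t \<in> TI" for t
  using eta rho_pos[OF that] omega_pos[of t] by (simp add: \<beta>_def)
 have beta_deriv: "(\<beta> has_real_derivative (\<eta>1 / wgt t) * (\<rho>' t + \<rho> t * (pos_part t / e))) (at t within TI)"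
  if "t \<in> TI" for t
  unfolding \<beta>_def using omega_pos[of t]
  by (auto intro!: derivative_eq_intros rho_deriv omega_deriv that simp: field_simps power2_eq_square)
 have "0 < u t + \<beta> t"
 proof (rule barrier_pos[where g = "\<lambda>t. u t + \<beta> t" and p = "- (1/2)" and q = "1/2"])
  show "continuous_on TI (\<lambda>t. u t + \<beta> t)"
   by (intro continuous_on_add DERIV_continuous_on[OF u] DERIV_continuous_on[OF beta_deriv])
  show "0 < u (- (1/2)) + \<beta> (- (1/2))" using start by (simp add: \<beta>_def omega_start)
  fix t :: real assume "- (1/2) < t" "t <= 1/2" and zero: "u t + \<beta> t = 0"
  then have t: "t \<in> TI" by auto
  have u: "u t = - \<beta> t" using zero by simp
  have abs: "\<bar>u t + \<zeta> t\<bar> <= (\<eta>1 * exp C1 + \<eta>2) * \<rho> t"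
   using beta_le[OF t] beta_pos[OF t] zeta[OF t] u by (auto simp: algebra_simps abs_if split: if_splits)
  have sq: "(u t + \<zeta> t)^2 <= 2 * (exp (2 * C1) * \<eta>1^2 + \<eta>2^2) * (\<rho> t)^2"
  proof -
   have "(u t + \<zeta> t)^2 <= 2 * (u t)^2 + 2 * (\<zeta> t)^2"
    using sum_squares_bound[of "u t" "\<zeta> t"] by (simp add: power2_sum)
   moreover have "(u t)^2 <= (\<eta>1 * exp C1 * \<rho> t)^2"
    using beta_le[OF t] beta_pos[OF t] u by (intro power2_le_iff_abs_le[THEN iffD2]) auto
   moreover have "(\<zeta> t)^2 <= (\<eta>2 * \<rho> t)^2"
    using zeta[OF t] by (intro power2_le_iff_abs_le[THEN iffD2]) auto
   moreover have "exp (2 * C1) = (exp C1)^2" by (simp add: exp_double)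
   ultimately show ?thesis by (simp add: algebra_simps power_mult_distrib)
  qed
  have main: "a t * u t - 6 * (u t + \<zeta> t)^2 <= e * u' t"
   by (rule u'[OF t]) (use abs small[OF t] in linarith)
  have "e * ((\<eta>1 / wgt t) * (\<rho>' t + \<rho> t * (pos_part t / e))) = (\<eta>1 / wgt t) * (e * \<rho>' t + \<rho> t * pos_part t)"
   using eps_pos by (simp add: distrib_left)
  also have "... \<ge> (\<eta>1 / wgt t) * (c1 * (\<rho> t)^2 / 2 + \<rho> t * a t)"
  proof (intro mult_left_mono)
   have "e * \<rho>' t \<ge> e * (- 4)"
    using rho'_bound[OF t] eps_pos by (intro mult_left_mono) auto
   moreover have "\<rho> t * pos_part t \<ge> \<rho> t * (a t + c1 * \<rho> t)"
    by (intro mult_left_mono pos_part_ge) (use rho_pos[OF t] in auto)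
   ultimately show "c1 * (\<rho> t)^2 / 2 + \<rho> t * a t <= e * \<rho>' t + \<rho> t * pos_part t"
    using rho_eps[OF t] by (simp add: algebra_simps power2_eq_square)
  qed (use eta omega_pos[of t] in auto)
  also have "(\<eta>1 / wgt t) * (c1 * (\<rho> t)^2 / 2 + \<rho> t * a t) = (\<eta>1 / wgt t) * (c1 * (\<rho> t)^2 / 2) + a t * \<beta> t"
   by (simp add: \<beta>_def algebra_simps add_divide_distrib)
  finally have b1: "(\<eta>1 / wgt t) * (c1 * (\<rho> t)^2 / 2) + a t * \<beta> t
    <= e * ((\<eta>1 / wgt t) * (\<rho>' t + \<rho> t * (pos_part t / e)))" .
  have b2: "\<eta>1 * (c1 * (\<rho> t)^2 / 2) <= (\<eta>1 / wgt t) * (c1 * (\<rho> t)^2 / 2)"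
   by (intro mult_right_mono) (use eta omega_pos[of t] omega_le[OF t] c1_pos in \<open>auto simp: field_simps\<close>)
  have b3: "6 * (u t + \<zeta> t)^2 < \<eta>1 * (c1 * (\<rho> t)^2 / 2)"
  proof -
   have "6 * (u t + \<zeta> t)^2 <= 12 * (exp (2 * C1) * \<eta>1^2 + \<eta>2^2) * (\<rho> t)^2" using sq by (simp add: algebra_simps)
   also have "... < \<eta>1 * c1 / 2 * (\<rho> t)^2"
    by (intro mult_strict_right_mono eta) (use rho_pos[OF t] in simp)
   finally show ?thesis by (simp add: ac_simps)
  qed
  define d where "d = u' t + (\<eta>1 / wgt t) * (\<rho>' t + \<rho> t * (pos_part t / e))"
  have "a t * u t = - (a t * \<beta> t)" using u by simp
  then have "0 < e * d"
   unfolding d_def distrib_left[of e "u' t"] using main b1 b2 b3 by linarith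
  then have "0 < d" using eps_pos by (simp add: zero_less_mult_iff)
  moreover have "((\<lambda>t. u t + \<beta> t) has_real_derivative d) (at t within TI)"
   unfolding d_def by (intro DERIV_add assms(1) beta_deriv t)
  ultimately show "\<exists>d>0. ((\<lambda>t. u t + \<beta> t) has_real_derivative d) (at t within TI)" by blast
 qed (use t in auto)
 then show ?thesis using beta_le[OF t] by linarith
qed

text \<open>Testing with the sign of \<open>f\<close>, smoothed to
  \<open>f / sqrt (f^2 + \<tau>^2)\<close>. Damping and source carry the same factor
  \<open>1 / e\<close>, so the estimate is free of \<open>e\<close>; the smoothing costs
  \<open>(e + N) * \<tau>\<close>, which disappears as \<open>\<tau>\<close> tends to 0.\<close>

lemma linear_L1:
 assumes f: "\<And>t. t \<in> TI \<Longrightarrow> (f has_real_derivative (a t * f t + r t) / e) (at t within TI)"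
  and r: "continuous_on TI r" and f0: "f (- (1/2)) = 0"
 shows "c1 * exp (- C1) * integral TI (\<lambda>t. \<rho> t * \<bar>f t\<bar>) <= integral TI (\<lambda>t. \<bar>r t\<bar>)"
proof -
 have fc: "continuous_on TI f" using f by (rule DERIV_continuous_on)
 have step: "c1 * exp (- C1) * integral TI (\<lambda>t. \<rho> t * \<bar>f t\<bar>)
   <= integral TI (\<lambda>t. \<bar>r t\<bar>) + (e + N) * \<tau>" if \<tau>: "0 < \<tau>" for \<tau>
 proof -
  define g where "g t = sqrt ((f t)^2 + \<tau>^2)" for t
  have g_pos: "0 < g t" for t using \<tau> by (simp add: g_def add_nonneg_pos)
  have g_sq: "(g t)^2 = (f t)^2 + \<tau>^2" for t by (simp add: g_def)
  have g_f: "\<bar>f t\<bar> <= g t" and g_tau: "\<tau> <= g t" for t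
   using \<tau> by (auto simp: g_def intro!: real_le_rsqrt)
  define w' where "w' t = - (pos_part t / e) * wgt t * g t + wgt t * (f t * ((a t * f t + r t) / e) / g t)" for t
  have g_deriv: "(g has_real_derivative f t * ((a t * f t + r t) / e) / g t) (at t within TI)"
   if "t \<in> TI" for t
  proof -
   have pos: "0 < (f t)^2 + \<tau>^2" using \<tau> by (simp add: add_nonneg_pos)
   have "((\<lambda>t. (f t)\<^sup>2 + \<tau>^2) has_real_derivative 2 * f t * ((a t * f t + r t) / e)) (at t within TI)"
    by (rule f[OF that] derivative_eq_intros refl)+ simp
   from DERIV_chain2[OF DERIV_real_sqrt[OF pos] this] show ?thesis
    unfolding g_def by (simp only: inverse_eq_divide) (simp add: mult.commute)
  qed
  have "wgt (1/2) * g (1/2) + integral TI (\<lambda>t. c1 * exp (- C1) / e * (\<rho> t * \<bar>f t\<bar>))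
    <= wgt (- (1/2)) * g (- (1/2)) + integral TI (\<lambda>t. (\<bar>r t\<bar> + N * \<tau>) / e)"
  proof (rule integral_le_of_derivative_le[where f' = w'])
   fix t assume t: "t \<in> TI"
   show "((\<lambda>t. wgt t * g t) has_real_derivative w' t) (at t within TI)"
    unfolding w'_def
    by (auto intro!: derivative_eq_intros omega_deriv g_deriv t simp: algebra_simps)
   have e1: "e * w' t = - (pos_part t) * wgt t * g t + wgt t * (a t * (f t)^2 / g t + f t * r t / g t)"
    unfolding w'_def using eps_pos g_pos[of t] by (simp add: field_simps power2_eq_square)
   have e2: "a t * (f t)^2 / g t = a t * g t - a t * \<tau>^2 / g t"
   proof -
    have f2: "(f t)^2 = (g t)^2 - \<tau>^2" using g_sq by simp
    show ?thesis unfolding f2 using g_pos[of t] by (simp add: field_simps power2_eq_square)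
   qed
   have e3: "- (a t * \<tau>^2 / g t) <= N * \<tau>"
   proof -
    have "- (a t * \<tau>^2 / g t) <= \<bar>a t\<bar> * (\<tau>^2 / g t)"
     by (metis abs_ge_minus_self abs_mult abs_of_nonneg divide_nonneg_pos g_pos times_divide_eq_right zero_le_power2)
    also have "... <= N * \<tau>"
     by (intro mult_mono a_bound t N_nonneg)
       (use g_tau[of t] g_pos[of t] \<tau> in \<open>auto simp: field_simps power2_eq_square intro: mult_left_mono\<close>)
    finally show ?thesis .
   qed
   have e4: "f t * r t / g t <= \<bar>r t\<bar>"
   proof -
    have "f t * r t <= \<bar>f t\<bar> * \<bar>r t\<bar>" by (metis abs_ge_self abs_mult)
    also have "... <= g t * \<bar>r t\<bar>" by (intro mult_right_mono g_f) auto
    finally show ?thesis using g_pos[of t] by (simp add: field_simps)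
   qed
   have "e * w' t <= - (pos_part t) * wgt t * g t + wgt t * (a t * g t + N * \<tau> + \<bar>r t\<bar>)"
    unfolding e1 by (intro add_left_mono mult_left_mono) (use e2 e3 e4 omega_pos[of t] in auto)
   also have "... = (a t - pos_part t) * (wgt t * g t) + wgt t * (N * \<tau> + \<bar>r t\<bar>)"
    by (simp add: algebra_simps)
   also have "... <= (- c1 * \<rho> t) * (wgt t * g t) + 1 * (N * \<tau> + \<bar>r t\<bar>)"
    by (intro add_mono mult_right_mono omega_le t)
      (use pos_part_ge[of t] omega_pos[of t] g_pos[of t] N_nonneg \<tau> in auto)
   also have "... <= (N * \<tau> + \<bar>r t\<bar>) - c1 * \<rho> t * (exp (- C1) * \<bar>f t\<bar>)"
   proof -
    have "c1 * \<rho> t * (exp (- C1) * \<bar>f t\<bar>) <= c1 * \<rho> t * (wgt t * g t)"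
     by (intro mult_left_mono mult_mono omega_ge g_f t) (use omega_pos[of t] c1_pos rho_pos[OF t] in auto)
    then show ?thesis by simp
   qed
   finally have "w' t <= ((N * \<tau> + \<bar>r t\<bar>) - c1 * \<rho> t * (exp (- C1) * \<bar>f t\<bar>)) / e"
    using eps_pos by (simp add: field_simps)
   then show "w' t <= (\<bar>r t\<bar> + N * \<tau>) / e - c1 * exp (- C1) / e * (\<rho> t * \<bar>f t\<bar>)"
    by (simp add: diff_divide_distrib add_divide_distrib algebra_simps)
  qed (auto intro!: continuous_intros rho_cont fc r)
  moreover have "integral TI (\<lambda>t. (\<bar>r t\<bar> + N * \<tau>) / e) = (integral TI (\<lambda>t. \<bar>r t\<bar>) + N * \<tau>) / e"
   by (simp add: integral_add integrable_continuous_real continuous_intros r)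
  moreover have "integral TI (\<lambda>t. c1 * exp (- C1) / e * (\<rho> t * \<bar>f t\<bar>))
    = c1 * exp (- C1) / e * integral TI (\<lambda>t. \<rho> t * \<bar>f t\<bar>)" by simp
  moreover have "g (- (1/2)) = \<tau>" using f0 \<tau> by (simp add: g_def)
  moreover have "0 < wgt (1/2) * g (1/2)" using omega_pos g_pos by simp
  ultimately have "c1 * exp (- C1) / e * integral TI (\<lambda>t. \<rho> t * \<bar>f t\<bar>)
    <= \<tau> + (integral TI (\<lambda>t. \<bar>r t\<bar>) + N * \<tau>) / e"
   by (simp add: omega_start)
  then show ?thesis using eps_pos by (simp add: field_simps)
 qed
 show ?thesis
 proof (rule field_le_epsilon)
  fix d :: real assume "0 < d"
  show "c1 * exp (- C1) * integral TI (\<lambda>t. \<rho> t * \<bar>f t\<bar>) <= integral TI (\<lambda>t. \<bar>r t\<bar>) + d"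
   using step[of "d / (e + N)"] \<open>0 < d\<close> eps_pos N_nonneg by (simp add: add_pos_nonneg)
 qed
qed

text \<open>Energy estimate for \<open>(wgt * f)^2\<close>: Young's inequality with weight
  \<open>c1 * \<rho>\<close> spends half of the damping on the source. Weighting with
  \<open>\<rho>\<close> on the left and \<open>1 / \<rho>\<close> on the right fits a process whose
  size varies with \<open>\<rho>\<close>.\<close>

lemma linear_L2:
 assumes f: "\<And>t. t \<in> TI \<Longrightarrow> (f has_real_derivative (a t * f t + r t) / e) (at t within TI)"
  and r: "continuous_on TI r" and f0: "f (- (1/2)) = 0"
 shows "c1^2 * exp (- 2 * C1) * integral TI (\<lambda>t. \<rho> t * (f t)^2) <= integral TI (\<lambda>t. (r t)\<^sup>2 / \<rho> t)"
proof -
 have fc: "continuous_on TI f" using f by (rule DERIV_continuous_on)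
 define w' where "w' t = 2 * (wgt t * f t) * (- (pos_part t / e) * wgt t * f t + wgt t * ((a t * f t + r t) / e))" for t
 have "(wgt (1/2) * f (1/2))^2 + integral TI (\<lambda>t. c1 * exp (- 2 * C1) / e * (\<rho> t * (f t)^2))
   <= (wgt (- (1/2)) * f (- (1/2)))^2 + integral TI (\<lambda>t. 1 / (c1 * e) * ((r t)^2 / \<rho> t))"
 proof (rule integral_le_of_derivative_le[where f' = w'])
  fix t assume t: "t \<in> TI"
  show "((\<lambda>t. (wgt t * f t)\<^sup>2) has_real_derivative w' t) (at t within TI)"
   unfolding w'_def
   by (auto intro!: derivative_eq_intros omega_deriv f t simp: field_simps power2_eq_square)
  have am: "2 * (\<bar>f t\<bar> * \<bar>r t\<bar>) <= c1 * \<rho> t * (f t)^2 + (r t)^2 / (c1 * \<rho> t)"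
  proof -
   have k: "0 < c1 * \<rho> t" using c1_pos rho_pos[OF t] by simp
   have "0 <= (c1 * \<rho> t * \<bar>f t\<bar> - \<bar>r t\<bar>)^2 / (c1 * \<rho> t)" using k by simp
   also have "... = c1 * \<rho> t * (f t)^2 - 2 * (\<bar>f t\<bar> * \<bar>r t\<bar>) + (r t)^2 / (c1 * \<rho> t)"
    using c1_pos rho_pos[OF t] by (simp add: power2_diff field_simps power2_eq_square)
   finally show ?thesis by simp
  qed
  have "e * w' t = 2 * ((wgt t)^2 * ((a t - pos_part t) * (f t)^2 + f t * r t))"
   unfolding w'_def using eps_pos by (simp add: field_simps power2_eq_square)
  also have "... <= 2 * ((wgt t)^2 * ((- c1 * \<rho> t) * (f t)^2 + \<bar>f t\<bar> * \<bar>r t\<bar>))"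
   by (intro mult_left_mono add_mono mult_right_mono)
     (use pos_part_ge[of t] in \<open>auto simp: abs_mult[symmetric]\<close>)
  also have "... = (wgt t)^2 * (- 2 * (c1 * \<rho> t * (f t)^2) + 2 * (\<bar>f t\<bar> * \<bar>r t\<bar>))" by (simp add: algebra_simps)
  also have "... <= (wgt t)^2 * (- (c1 * \<rho> t * (f t)^2) + (r t)^2 / (c1 * \<rho> t))"
   by (intro mult_left_mono) (use am in auto)
  also have "... <= 1 * ((r t)^2 / (c1 * \<rho> t)) - (exp (- C1))^2 * (c1 * \<rho> t * (f t)^2)"
  proof -
   have "(wgt t)^2 * ((r t)^2 / (c1 * \<rho> t)) <= 1 * ((r t)^2 / (c1 * \<rho> t))"
    by (intro mult_right_mono power_le_one omega_le t) (use omega_pos[of t] c1_pos rho_pos[OF t] in auto)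
   moreover have "(exp (- C1))^2 * (c1 * \<rho> t * (f t)^2) <= (wgt t)^2 * (c1 * \<rho> t * (f t)^2)"
    by (intro mult_right_mono power_mono omega_ge t) (use c1_pos rho_pos[OF t] in auto)
   ultimately show ?thesis by (simp add: right_diff_distrib)
  qed
  finally have "w' t <= ((r t)^2 / (c1 * \<rho> t) - (exp (- C1))^2 * (c1 * \<rho> t * (f t)^2)) / e"
   using eps_pos by (simp add: field_simps)
  moreover have "exp (- 2 * C1) = (exp (- C1))^2" using exp_double[of "- C1"] by simp
  ultimately show "w' t <= 1 / (c1 * e) * ((r t)^2 / \<rho> t) - c1 * exp (- 2 * C1) / e * (\<rho> t * (f t)^2)"
   by (simp add: diff_divide_distrib ac_simps)
 qed (use rho_pos c1_pos in \<open>auto intro!: continuous_intros rho_cont fc r simp: less_imp_neq[symmetric]\<close>)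
 then have "c1 * exp (- 2 * C1) / e * integral TI (\<lambda>t. \<rho> t * (f t)^2)
   <= 1 / (c1 * e) * integral TI (\<lambda>t. (r t)\<^sup>2 / \<rho> t)"
  unfolding integral_mult_right f0 using zero_le_power2[of "wgt (1/2) * f (1/2)"]
  by (simp only: mult_zero_right zero_power2 add_0_left)
 then show ?thesis using eps_pos c1_pos by (simp add: field_simps power2_eq_square)
qed

text \<open>Variance of the linear process divided by \<open>\<sigma>^2\<close>. It is the solution
  of \<open>e * v' = 2 * a * v + 1\<close> that vanishes at the initial time.\<close>

definition vt :: "real \<Rightarrow> real" where
 "vt t = exp (2 * \<alpha> t) * integral {- (1/2)..t} (\<lambda>s. exp (- 2 * \<alpha> s) / e)"

text \<open>\<open>wgt^2 * vt\<close> is kept below \<open>1 / (c1 * \<rho>)\<close> by a barrier.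
  At contact, in units where the noise feeds in at most 1, the damping removes at least 2 and the
  motion of \<open>\<rho>\<close> accounts for at most \<open>1/2\<close>.\<close>

lemma vt_le: assumes t: "t \<in> TI" shows "vt t <= exp (2 * C1) / (c1 * \<rho> t)"
proof -
 have c: "continuous_on TI (\<lambda>s. exp (- 2 * \<alpha> s) / e)"
  using eps_pos by (intro continuous_intros alpha_cont) auto
 have vt_deriv: "(vt has_real_derivative (2 * a t * vt t + 1) / e) (at t within TI)" if "t \<in> TI" for t
  unfolding vt_def
  by (rule derivative_eq_intros alpha_deriv[OF that] integral_has_derivative_within[OF c that] refl)+
    (use eps_pos in \<open>simp add: field_simps exp_minus\<close>)
 have "0 < 1 / (c1 * \<rho> t) - (wgt t)^2 * vt t"
 proof (rule barrier_pos[where g = "\<lambda>t. 1 / (c1 * \<rho> t) - (wgt t)^2 * vt t" and p = "- (1/2)" and q = "1/2"])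
  show "continuous_on TI (\<lambda>t. 1 / (c1 * \<rho> t) - (wgt t)^2 * vt t)"
   using c1_pos rho_pos
   by (intro continuous_intros rho_cont omega_cont DERIV_continuous_on[OF vt_deriv]) (auto simp: less_imp_neq[symmetric])
  show "0 < 1 / (c1 * \<rho> (- (1/2))) - (wgt (- (1/2)))^2 * vt (- (1/2))"
   using c1_pos rho_pos[of "- (1/2)"] by (simp add: vt_def)
  fix t :: real assume "- (1/2) < t" "t <= 1/2" and zero: "1 / (c1 * \<rho> t) - (wgt t)^2 * vt t = 0"
  then have t: "t \<in> TI" by auto
  have r: "0 < \<rho> t" using rho_pos[OF t] .
  define d where "d = - (\<rho>' t / (c1 * (\<rho> t)^2)) - (2 * wgt t * (- (pos_part t / e) * wgt t) * vt t + (wgt t)^2 * ((2 * a t * vt t + 1) / e))"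
  have d: "((\<lambda>t. 1 / (c1 * \<rho> t) - (wgt t)^2 * vt t) has_real_derivative d) (at t within TI)"
   unfolding d_def using c1_pos r
   by (auto intro!: derivative_eq_intros rho_deriv[OF t] omega_deriv[OF t] vt_deriv[OF t] simp: field_simps power2_eq_square)
  have z: "(wgt t)^2 * vt t = 1 / (c1 * \<rho> t)" using zero by simp
  have "e * d = - (e * \<rho>' t / (c1 * (\<rho> t)^2)) + 2 * (pos_part t - a t) * ((wgt t)^2 * vt t) - (wgt t)^2"
   unfolding d_def using eps_pos by (simp add: field_simps power2_eq_square)
  also have "... \<ge> - (1/2) + 2 - 1"
  proof -
   have "e * \<rho>' t <= e * 4" using rho'_bound[OF t] eps_pos by (intro mult_left_mono) auto
   then have "e * \<rho>' t <= (1/2) * (c1 * (\<rho> t)^2)" using rho_eps[OF t] by linarith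
   then have "e * \<rho>' t / (c1 * (\<rho> t)^2) <= 1/2"
    using c1_pos r by (simp add: divide_le_eq)
   moreover have "2 <= 2 * (pos_part t - a t) * ((wgt t)^2 * vt t)"
    unfolding z using pos_part_ge[of t] c1_pos r by (simp add: field_simps)
   moreover have "(wgt t)^2 <= 1" using omega_le[OF t] omega_pos[of t] by (simp add: power_le_one)
   ultimately show ?thesis by linarith
  qed
  finally have "0 < e * d" by simp
  then have "0 < d" using eps_pos by (simp add: zero_less_mult_iff)
  then show "\<exists>d>0. ((\<lambda>t. 1 / (c1 * \<rho> t) - (wgt t)^2 * vt t) has_real_derivative d) (at t within TI)"
   using d by blast
 qed (use t in auto)
 then have "(wgt t)^2 * vt t <= 1 / (c1 * \<rho> t)" by simp
 then have "(1 / wgt t)^2 * ((wgt t)^2 * vt t) <= (1 / wgt t)^2 * (1 / (c1 * \<rho> t))"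
  by (intro mult_left_mono) auto
 then have "vt t <= (1 / wgt t)^2 * (1 / (c1 * \<rho> t))"
  using omega_pos[of t] by (simp add: power_divide)
 also have "... <= (exp C1)^2 * (1 / (c1 * \<rho> t))"
  by (intro mult_right_mono power_mono inverse_omega_le t) (use omega_pos[of t] c1_pos rho_pos[OF t] in \<open>auto simp: less_imp_le\<close>)
 finally show ?thesis by (simp add: exp_double)
qed

text \<open>Backward counterpart of the damping: the response to an impulse at time
  \<open>s\<close>, weighted with \<open>\<rho>\<close> and summed over all later times, is of order
  \<open>e\<close>. This factor reduces the variance of the linear part of the area to order
  \<open>\<sigma>^2 * e\<close>.\<close>

lemma adjoint_le:
 assumes s: "s \<in> TI"
 shows "integral {s..1/2} (\<lambda>t. \<rho> t * exp (\<alpha> t)) <= exp C1 * e / c1 * exp (\<alpha> s)"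
proof -
 have sub: "{s..1/2} \<subseteq> TI" using s by auto
 have "exp (\<alpha> (1/2)) * wgt (1/2) + integral {s..1/2} (\<lambda>t. c1 * exp (- C1) / e * (\<rho> t * exp (\<alpha> t)))
   <= exp (\<alpha> s) * wgt s + integral {s..1/2} (\<lambda>t. 0)"
 proof (rule integral_le_of_derivative_le[where f' = "\<lambda>t. exp (\<alpha> t) * wgt t * ((a t - pos_part t) / e)"])
  fix t assume t: "t \<in> {s..1/2}"
  then have tI: "t \<in> TI" using sub by auto
  show "((\<lambda>t. exp (\<alpha> t) * wgt t) has_real_derivative exp (\<alpha> t) * wgt t * ((a t - pos_part t) / e)) (at t within {s..1/2})"
   by (rule DERIV_subset[OF _ sub])
     ((rule derivative_eq_intros alpha_deriv[OF tI] omega_deriv[OF tI] refl)+, simp add: algebra_simps diff_divide_distrib)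
  have "exp (\<alpha> t) * wgt t * (a t - pos_part t) <= exp (\<alpha> t) * wgt t * (- (c1 * \<rho> t))"
   by (intro mult_left_mono) (use pos_part_ge[of t] omega_pos[of t] in auto)
  also have "... <= - (exp (\<alpha> t) * exp (- C1) * (c1 * \<rho> t))"
  proof -
   have "exp (\<alpha> t) * exp (- C1) * (c1 * \<rho> t) <= exp (\<alpha> t) * wgt t * (c1 * \<rho> t)"
    by (intro mult_right_mono mult_left_mono omega_ge tI) (use c1_pos rho_pos[OF tI] in auto)
   then show ?thesis by simp
  qed
  finally have "exp (\<alpha> t) * wgt t * (a t - pos_part t) / e <= - (exp (\<alpha> t) * exp (- C1) * (c1 * \<rho> t)) / e"
   using eps_pos by (intro divide_right_mono) auto
  then show "exp (\<alpha> t) * wgt t * ((a t - pos_part t) / e) <= 0 - c1 * exp (- C1) / e * (\<rho> t * exp (\<alpha> t))"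
   by (simp add: ac_simps)
 qed (use s in \<open>auto intro!: continuous_intros continuous_on_subset[OF rho_cont sub] continuous_on_subset[OF alpha_cont sub]\<close>)
 moreover have "exp (\<alpha> s) * wgt s <= exp (\<alpha> s)" using omega_le[OF s] by simp
 moreover have "0 < exp (\<alpha> (1/2)) * wgt (1/2)" using omega_pos by simp
 ultimately have "c1 * exp (- C1) / e * integral {s..1/2} (\<lambda>t. \<rho> t * exp (\<alpha> t)) <= exp (\<alpha> s)"
  unfolding integral_mult_right integral_0 by linarith
 then show ?thesis using eps_pos c1_pos by (simp add: field_simps exp_minus)
qed

end

section \<open>Wiener integrals as pathwise functionals\<close>

definition grid :: "real \<Rightarrow> real \<Rightarrow> nat \<Rightarrow> nat \<Rightarrow> real" where
 "grid p q n i = p + (q - p) * (real i / real n)"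

lemma grid_0 [simp]: "grid p q n 0 = p"
 by (simp add: grid_def)

lemma grid_n [simp]: "0 < n \<Longrightarrow> grid p q n n = q"
 by (simp add: grid_def)

lemma grid_Suc: "grid p q n (Suc i) - grid p q n i = (q - p) / n"
 by (simp add: grid_def field_simps add_divide_distrib)

lemma grid_mono: "p <= q \<Longrightarrow> i <= j \<Longrightarrow> grid p q n i <= grid p q n j"
 unfolding grid_def by (intro add_left_mono mult_left_mono divide_right_mono) auto

lemma grid_mem: "p <= q \<Longrightarrow> i <= n \<Longrightarrow> 0 < n \<Longrightarrow> grid p q n i \<in> {p..q}"
 using grid_mono[of p q 0 i n] grid_mono[of p q i n n] by simp

lemma sum_integral_grid:
 fixes f :: "real \<Rightarrow> real"
 assumes "p <= q" "0 < n" and f: "continuous_on {p..q} f" and "k <= n"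
 shows "(\<Sum>i<k. integral {grid p q n i..grid p q n (Suc i)} f) = integral {p..grid p q n k} f"
 using \<open>k <= n\<close>
proof (induction k)
 case (Suc k)
 have "integral {p..grid p q n k} f + integral {grid p q n k..grid p q n (Suc k)} f
   = integral {p..grid p q n (Suc k)} f"
  using assms Suc.prems grid_mem[of p q k n] grid_mem[of p q "Suc k" n] grid_mono[of p q k "Suc k" n]
  by (intro hk_combine integrable_continuous_real
    continuous_on_subset[OF f]) auto
 then show ?case using Suc by simp
qed simp

lemma continuous_on_bound:
 fixes f :: "real \<Rightarrow> real"
 assumes "continuous_on {p..q} f"
 obtains B where "0 <= B" "\<And>x. x \<in> {p..q} \<Longrightarrow> \<bar>f x\<bar> <= B"
proof -
 have "bounded (f ` {p..q})"
  by (intro compact_imp_bounded compact_continuous_image assms compact_Icc)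
 then obtain B where "\<And>x. x \<in> {p..q} \<Longrightarrow> \<bar>f x\<bar> <= B"
  unfolding bounded_iff by (metis imageI real_norm_def)
 then show ?thesis using that[of "max B 0"] by (auto simp: le_max_iff_disj)
qed

text \<open>The Wiener integral of \<open>g\<close>, with derivative \<open>g'\<close>, after integration by parts.\<close>

definition wint :: "(real \<Rightarrow> real) \<Rightarrow> (real \<Rightarrow> real) \<Rightarrow> real \<Rightarrow> real \<Rightarrow> (real \<Rightarrow> real) \<Rightarrow> real" where
 "wint g g' p q w = g q * w q - g p * w p - integral {p..q} (\<lambda>s. g' s * w s)"

text \<open>Abel summation moves the increments from \<open>w\<close> to \<open>g\<close>, which is
  differentiable; the error is the bound on \<open>g'\<close> times the oscillation of
  \<open>w\<close> over one cell. The convergence holds for each continuous path separately.\<close>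

lemma wint_approx:
 assumes pq: "p <= q"
  and g: "\<And>t. t \<in> {p..q} \<Longrightarrow> (g has_real_derivative g' t) (at t within {p..q})"
  and g': "continuous_on {p..q} g'" and w: "continuous_on {p..q} w"
 shows "(\<lambda>n. \<Sum>i<n. g (grid p q n i) * (w (grid p q n (Suc i)) - w (grid p q n i))) \<longlonglongrightarrow> wint g g' p q w"
proof -
 obtain B where B: "0 <= B" "\<And>x. x \<in> {p..q} \<Longrightarrow> \<bar>g' x\<bar> <= B"
  using continuous_on_bound[OF g'] by blast
 have uc: "uniformly_continuous_on {p..q} w"
  by (rule compact_uniformly_continuous[OF w compact_Icc])
 let ?\<tau> = "grid p q"
 have key: "\<bar>(\<Sum>i<n. g (?\<tau> n i) * (w (?\<tau> n (Suc i)) - w (?\<tau> n i))) - wint g g' p q w\<bar> <= B * e * (q - p)"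
  if e: "0 < e" and n: "0 < n"
   and osc: "\<And>x y. x \<in> {p..q} \<Longrightarrow> y \<in> {p..q} \<Longrightarrow> \<bar>x - y\<bar> <= (q - p) / n \<Longrightarrow> \<bar>w x - w y\<bar> <= e" for e n
 proof -
  have abel: "(\<Sum>i<k. g (?\<tau> n i) * (w (?\<tau> n (Suc i)) - w (?\<tau> n i)))
    = g (?\<tau> n k) * w (?\<tau> n k) - g p * w p - (\<Sum>i<k. w (?\<tau> n (Suc i)) * (g (?\<tau> n (Suc i)) - g (?\<tau> n i)))" for k
   by (induction k) (auto simp: algebra_simps)
  have gi: "g (?\<tau> n (Suc i)) - g (?\<tau> n i) = integral {?\<tau> n i..?\<tau> n (Suc i)} g'" if "i < n" for i
  proof (rule integral_unique[symmetric], rule fundamental_theorem_of_calculus)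
   have "{?\<tau> n i..?\<tau> n (Suc i)} \<subseteq> {p..q}"
    using grid_mem[OF pq, of i n] grid_mem[OF pq, of "Suc i" n] that by auto
   then show "(g has_vector_derivative g' x) (at x within {?\<tau> n i..?\<tau> n (Suc i)})"
    if "x \<in> {?\<tau> n i..?\<tau> n (Suc i)}" for x
    using g[of x] that DERIV_subset
    unfolding has_real_derivative_iff_has_vector_derivative[symmetric] by blast
  qed (simp add: grid_mono pq)
  have c: "continuous_on {p..q} (\<lambda>s. g' s * w s)" by (intro continuous_intros g' w)
  have "(\<Sum>i<n. g (?\<tau> n i) * (w (?\<tau> n (Suc i)) - w (?\<tau> n i))) - wint g g' p q w
    = (\<Sum>i<n. integral {?\<tau> n i..?\<tau> n (Suc i)} (\<lambda>s. g' s * w s))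
     - (\<Sum>i<n. w (?\<tau> n (Suc i)) * (g (?\<tau> n (Suc i)) - g (?\<tau> n i)))"
   using sum_integral_grid[OF pq n c order_refl] n by (simp add: abel wint_def)
  also have "... = (\<Sum>i<n. integral {?\<tau> n i..?\<tau> n (Suc i)} (\<lambda>s. g' s * (w s - w (?\<tau> n (Suc i)))))"
   unfolding sum_subtractf[symmetric]
  proof (rule sum.cong[OF refl])
   fix i assume "i \<in> {..<n}"
   then have i: "i < n" by simp
   have sub: "{?\<tau> n i..?\<tau> n (Suc i)} \<subseteq> {p..q}"
    using grid_mem[OF pq, of i n] grid_mem[OF pq, of "Suc i" n] i by auto
   have "integral {?\<tau> n i..?\<tau> n (Suc i)} (\<lambda>s. g' s * w s - w (?\<tau> n (Suc i)) * g' s)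
    = integral {?\<tau> n i..?\<tau> n (Suc i)} (\<lambda>s. g' s * w s) - integral {?\<tau> n i..?\<tau> n (Suc i)} (\<lambda>s. w (?\<tau> n (Suc i)) * g' s)"
    by (intro hk_diff integrable_continuous_real continuous_intros continuous_on_subset[OF g' sub]
      continuous_on_subset[OF w sub])
   then show "integral {?\<tau> n i..?\<tau> n (Suc i)} (\<lambda>s. g' s * w s) - w (?\<tau> n (Suc i)) * (g (?\<tau> n (Suc i)) - g (?\<tau> n i))
     = integral {?\<tau> n i..?\<tau> n (Suc i)} (\<lambda>s. g' s * (w s - w (?\<tau> n (Suc i))))"
    by (simp add: gi[OF i] algebra_simps)
  qed
  finally have "\<bar>(\<Sum>i<n. g (?\<tau> n i) * (w (?\<tau> n (Suc i)) - w (?\<tau> n i))) - wint g g' p q w\<bar>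
    <= (\<Sum>i<n. \<bar>integral {?\<tau> n i..?\<tau> n (Suc i)} (\<lambda>s. g' s * (w s - w (?\<tau> n (Suc i))))\<bar>)"
   by (simp only: sum_abs)
  also have "... <= (\<Sum>i<n. B * e * ((q - p) / n))"
  proof (rule sum_mono)
   fix i assume "i \<in> {..<n}"
   then have i: "i < n" by simp
   have sub: "{?\<tau> n i..?\<tau> n (Suc i)} \<subseteq> {p..q}"
    using grid_mem[OF pq, of i n] grid_mem[OF pq, of "Suc i" n] i by auto
   have "norm (integral {?\<tau> n i..?\<tau> n (Suc i)} (\<lambda>s. g' s * (w s - w (?\<tau> n (Suc i))))) <= B * e * (?\<tau> n (Suc i) - ?\<tau> n i)"
   proof (rule integral_bound)
    show "?\<tau> n i <= ?\<tau> n (Suc i)" by (simp add: grid_mono pq)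
    then have m: "?\<tau> n (Suc i) \<in> {p..q}" using sub by auto
    show "continuous_on {?\<tau> n i..?\<tau> n (Suc i)} (\<lambda>s. g' s * (w s - w (?\<tau> n (Suc i))))"
     by (intro continuous_intros continuous_on_subset[OF g' sub] continuous_on_subset[OF w sub])
    fix s assume s: "s \<in> {?\<tau> n i..?\<tau> n (Suc i)}"
    have "\<bar>g' s\<bar> * \<bar>w s - w (?\<tau> n (Suc i))\<bar> <= B * e"
     by (intro mult_mono B osc m) (use s sub B grid_Suc[of p q n i] in auto)
    then show "norm (g' s * (w s - w (?\<tau> n (Suc i)))) <= B * e" by (simp add: abs_mult)
   qed
   then show "\<bar>integral {?\<tau> n i..?\<tau> n (Suc i)} (\<lambda>s. g' s * (w s - w (?\<tau> n (Suc i))))\<bar> <= B * e * ((q - p) / n)"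
    by (simp add: grid_Suc)
  qed
  also have "... = B * e * (q - p)" using n by simp
  finally show ?thesis .
 qed
 show ?thesis
 proof (rule LIMSEQ_I)
  fix r :: real assume r: "0 < r"
  \<comment> \<open>The summand 1 keeps the quotient meaningful if \<open>B\<close> or the length of
    the interval is 0.\<close>
  define e where "e = r / (B * (q - p) + 1)"
  have k: "0 < B * (q - p) + 1" using B pq by (simp add: add_nonneg_pos)
  have e: "0 < e" using r k by (simp add: e_def)
  have er: "B * e * (q - p) < r"
   using r k by (simp add: e_def field_simps)
  obtain d where d: "0 < d" "\<And>x y. x \<in> {p..q} \<Longrightarrow> y \<in> {p..q} \<Longrightarrow> \<bar>x - y\<bar> < d \<Longrightarrow> \<bar>w x - w y\<bar> < e"
   using uc e unfolding uniformly_continuous_on_def dist_real_def by (metis abs_minus_commute)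
  obtain n0 :: nat where n0: "(q - p) / d < n0" using reals_Archimedean2 by blast
  show "\<exists>no. \<forall>n\<ge>no. norm ((\<Sum>i<n. g (?\<tau> n i) * (w (?\<tau> n (Suc i)) - w (?\<tau> n i))) - wint g g' p q w) < r"
  proof (intro exI[of _ "Suc n0"] allI impI)
   fix n assume n: "n \<ge> Suc n0"
   then have "(q - p) / d < n" using n0 by linarith
   then have "(q - p) / n < d" using d n by (simp add: field_simps)
   then have "\<bar>(\<Sum>i<n. g (?\<tau> n i) * (w (?\<tau> n (Suc i)) - w (?\<tau> n i))) - wint g g' p q w\<bar> <= B * e * (q - p)"
    using n by (intro key e) (auto intro!: less_imp_le[OF d(2)])
   then show "norm ((\<Sum>i<n. g (?\<tau> n i) * (w (?\<tau> n (Suc i)) - w (?\<tau> n i))) - wint g g' p q w) < r"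
    using er by simp
  qed
 qed
qed

text \<open>Instance of \<open>wint_approx\<close> with the identity as path and the square of
  \<open>g\<close> as kernel; integrating by parts back gives the ordinary integral.\<close>

lemma riemann_square:
 assumes pq: "p <= q"
  and g: "\<And>t. t \<in> {p..q} \<Longrightarrow> (g has_real_derivative g' t) (at t within {p..q})"
  and g': "continuous_on {p..q} g'"
 shows "(\<lambda>n. \<Sum>i<n. (g (grid p q n i))\<^sup>2 * (grid p q n (Suc i) - grid p q n i)) \<longlonglongrightarrow> integral {p..q} (\<lambda>s. (g s)\<^sup>2)"
proof -
 have gc: "continuous_on {p..q} g" using g by (rule DERIV_continuous_on)
 have "(\<lambda>n. \<Sum>i<n. (g (grid p q n i))\<^sup>2 * (grid p q n (Suc i) - grid p q n i))
   \<longlonglongrightarrow> wint (\<lambda>s. (g s)\<^sup>2) (\<lambda>s. 2 * g s * g' s) p q (\<lambda>s. s)"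
  by (intro wint_approx[OF pq] continuous_intros gc g')
    (auto intro!: derivative_eq_intros g)
 moreover have "wint (\<lambda>s. (g s)\<^sup>2) (\<lambda>s. 2 * g s * g' s) p q (\<lambda>s. s) = integral {p..q} (\<lambda>s. (g s)\<^sup>2)"
 proof -
  have "((\<lambda>s. 2 * g s * g' s * s + (g s)^2) has_integral ((g q)^2 * q - (g p)^2 * p)) {p..q}"
   by (rule fundamental_theorem_of_calculus[OF pq])
     (auto intro!: derivative_eq_intros g simp: has_real_derivative_iff_has_vector_derivative[symmetric])
  then have "integral {p..q} (\<lambda>s. 2 * g s * g' s * s + (g s)^2) = (g q)^2 * q - (g p)^2 * p"
   by (rule integral_unique)
  moreover have "integral {p..q} (\<lambda>s. 2 * g s * g' s * s + (g s)^2)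
    = integral {p..q} (\<lambda>s. 2 * g s * g' s * s) + integral {p..q} (\<lambda>s. (g s)\<^sup>2)"
   by (intro hk_add integrable_continuous_real continuous_intros gc g')
  ultimately show ?thesis by (simp add: wint_def)
 qed
 ultimately show ?thesis by simp
qed

lemma wint_split:
 assumes "p <= s" "s <= q" "continuous_on {p..q} g'" "continuous_on {p..q} w"
 shows "wint g g' p q w = wint g g' p s w + wint g g' s q w"
 using hk_combine[OF assms(1,2) integrable_continuous_real[OF continuous_on_mult[OF assms(3,4)]]]
 by (simp add: wint_def)

section \<open>Characteristic functions, moments and tails of Gaussian variables\<close>

context prob_space
begin

lemma char_distr: "X \<in> borel_measurable M \<Longrightarrow> char (distr M borel X) t = (CLINT w|M. iexp (t * X w))"
 unfolding char_def by (subst integral_distr) auto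

lemma char_distr_scale:
 assumes X: "X \<in> borel_measurable M"
 shows "char (distr M borel (\<lambda>w. c * X w)) t = char (distr M borel X) (t * c)"
 using X by (simp add: char_distr mult.assoc)

lemma char_normal:
 assumes X: "distributed M lborel X (normal_density 0 s)" and s: "0 < s"
 shows "char (distr M borel X) t = complex_of_real (exp (- (t * s)\<^sup>2 / 2))"
proof -
 have Xm: "X \<in> borel_measurable M" using distributed_measurable[OF X] by simp
 have "distributed M lborel (\<lambda>x. (X x - 0) / s) std_normal_density"
  using normal_standard_normal_convert[OF s, of X 0] X by simp
 then have "distr M lborel (\<lambda>x. X x / s) = std_normal_distribution"
  using distributed_distr_eq_density by force
 moreover have "distr M lborel (\<lambda>x. X x / s) = distr M borel (\<lambda>x. X x / s)"
  by (rule distr_cong) auto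
 ultimately have "char (distr M borel (\<lambda>x. X x / s)) u = complex_of_real (exp (- u\<^sup>2 / 2))" for u
  by (simp add: char_std_normal_distribution)
 from this[of "t * s"] have "char (distr M borel (\<lambda>x. (1 / s) * X x)) (t * s) = complex_of_real (exp (- (t * s)\<^sup>2 / 2))"
  by simp
 then show ?thesis using s by (subst (asm) char_distr_scale[OF Xm]) simp
qed

lemma char_limit:
 assumes Z: "\<And>n. Z n \<in> borel_measurable M"
  and lim: "\<And>\<omega>. \<omega> \<in> space M \<Longrightarrow> (\<lambda>n. Z n \<omega>) \<longlonglongrightarrow> L \<omega>"
 shows "L \<in> borel_measurable M" "(\<lambda>n. char (distr M borel (Z n)) t) \<longlonglongrightarrow> char (distr M borel L) t"
proof -
 show L: "L \<in> borel_measurable M" by (rule borel_measurable_LIMSEQ_real[OF lim Z])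
 have "(\<lambda>n. CLINT \<omega>|M. iexp (t * Z n \<omega>)) \<longlonglongrightarrow> (CLINT \<omega>|M. iexp (t * L \<omega>))"
 proof (rule integral_dominated_convergence[where w = "\<lambda>_. 1"])
  show "AE x in M. (\<lambda>n. iexp (t * Z n x)) \<longlonglongrightarrow> iexp (t * L x)"
   by (intro AE_I2 tendsto_intros lim)
 qed (use Z L in auto)
 then show "(\<lambda>n. char (distr M borel (Z n)) t) \<longlonglongrightarrow> char (distr M borel L) t"
  using Z L by (simp add: char_distr)
qed

text \<open>After rescaling to unit variance this is Levy's uniqueness theorem.\<close>

lemma distributed_of_char:
 assumes X: "X \<in> borel_measurable M" and v: "0 < v"
  and char: "\<And>t. char (distr M borel X) t = complex_of_real (exp (- (t^2 * v) / 2))"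
 shows "distributed M lborel X (normal_density 0 (sqrt v))"
proof -
 let ?Y = "\<lambda>x. (1 / sqrt v) * X x"
 have "char (distr M borel ?Y) t = char std_normal_distribution t" for t
  unfolding char_distr_scale[OF X] char char_std_normal_distribution
  using v by (simp add: power_divide)
 then have "distr M borel ?Y = std_normal_distribution"
  by (intro Levy_uniqueness real_dist_normal_dist) (use X in \<open>auto intro!: real_distribution_distr\<close>)
 moreover have "distr M borel ?Y = distr M lborel ?Y" by (rule distr_cong) auto
 ultimately have "distributed M lborel (\<lambda>x. (X x - 0) / sqrt v) std_normal_density"
  unfolding distributed_def using X by auto
 then show ?thesis using normal_standard_normal_convert[of "sqrt v" X 0] v by simp
qed

text \<open>A real characteristic function equals its conjugate, so \<open>X\<close> and
  \<open>- X\<close> have the same law. The argument covers degenerate laws, which have no density,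
  and hence all linear combinations of Gaussian functionals.\<close>

lemma real_char_odd_moment:
 assumes X: "X \<in> borel_measurable M" and real: "\<And>t. char (distr M borel X) t \<in> \<real>" and "odd k"
 shows "expectation (\<lambda>w. X w ^ k) = 0"
proof -
 have cnj: "iexp (t * ((-1) * x)) = cnj (iexp (t * x))" for t x
  by (simp add: exp_cnj)
 have "char (distr M borel (\<lambda>w. (-1) * X w)) t = char (distr M borel X) t" for t
 proof -
  have "char (distr M borel (\<lambda>w. (-1) * X w)) t = (CLINT w|M. cnj (iexp (t * X w)))"
   using X by (subst char_distr) (auto simp only: cnj intro: borel_measurable_times borel_measurable_const)
  also have "... = cnj (char (distr M borel X) t)" by (simp only: Bochner_Integration.integral_cnj char_distr[OF X])
  also have "... = char (distr M borel X) t" using real[of t] by (simp add: Reals_cnj_iff)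
  finally show ?thesis .
 qed
 then have eq: "distr M borel (\<lambda>w. (-1) * X w) = distr M borel X"
  by (intro Levy_uniqueness) (use X in \<open>auto intro!: real_distribution_distr\<close>)
 have "expectation (\<lambda>w. X w ^ k) = (LINT x|distr M borel X. x ^ k)"
  using X by (subst integral_distr) auto
 also have "... = (LINT x|distr M borel (\<lambda>w. (-1) * X w). x ^ k)" unfolding eq ..
 also have "... = expectation (\<lambda>w. ((-1) * X w) ^ k)"
  by (rule integral_distr) (use X in auto)
 also have "... = - expectation (\<lambda>w. X w ^ k)" using \<open>odd k\<close> by simp
 finally show ?thesis by simp
qed

lemma normal_moment:
 assumes X: "distributed M lborel X (normal_density 0 (sqrt v))" and v: "0 < v"
 shows "expectation (\<lambda>w. X w ^ (2 * k)) = fact (2 * k) / (2 ^ k * fact k) * v ^ k"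
  and "integrable M (\<lambda>w. X w ^ j)"
  and "expectation X = 0"
proof -
 have s: "0 < sqrt v" using v by simp
 have "expectation (\<lambda>w. X w ^ (2 * k)) = (LINT x|lborel. normal_density 0 (sqrt v) x * x ^ (2 * k))"
  by (subst distributed_integral[OF X]) auto
 also have "... = fact (2 * k) / ((2 / (sqrt v)^2) ^ k * fact k)"
  using integral_normal_moment_even[OF s, of 0 k] by simp
 finally show "expectation (\<lambda>w. X w ^ (2 * k)) = fact (2 * k) / (2 ^ k * fact k) * v ^ k"
  using v by (simp add: power_divide)
 show "integrable M (\<lambda>w. X w ^ j)"
  using integrable_normal_moment[OF s, of 0 j] by (subst distributed_integrable[OF X, symmetric]) auto
 show "expectation X = 0"
  using distributed_integral[OF X, of "\<lambda>x. x"] integral_normal_moment_odd[OF s, of 0 0] by simp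
qed

text \<open>Markov's inequality for \<open>exp (X^2 / (4 * v))\<close>: multiplying the density by
  this exponential gives \<open>sqrt 2\<close> times the normal density of variance
  \<open>2 * v\<close>, so the expectation is \<open>sqrt 2\<close>.\<close>

lemma normal_tail:
 assumes X: "distributed M lborel X (normal_density 0 (sqrt v))" and v: "0 < v"
  and r: "0 <= r"
 shows "prob {w\<in>space M. r <= \<bar>X w\<bar>} <= 2 * exp (- (r^2 / (4 * v)))"
proof -
 have Xm [measurable]: "X \<in> borel_measurable M" using distributed_measurable[OF X] by simp
 have eq: "normal_density 0 (sqrt v) x * exp (x^2 / (4 * v)) = sqrt 2 * normal_density 0 (sqrt (2 * v)) x" for x
 proof -
  have "- x\<^sup>2 / (2 * v) + x^2 / (4 * v) = - x\<^sup>2 / (2 * (2 * v))" using v by (simp add: field_simps)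
  then have "exp (- x\<^sup>2 / (2 * v)) * exp (x^2 / (4 * v)) = exp (- x\<^sup>2 / (2 * (2 * v)))"
   by (simp add: exp_add[symmetric])
  then show ?thesis using v
   by (simp add: normal_density_def real_sqrt_mult field_simps)
 qed
 have int: "integrable M (\<lambda>w. exp ((X w)^2 / (4 * v)))"
  by (subst distributed_integrable[OF X, symmetric]) (use v in \<open>auto simp: eq\<close>)
 have ex: "expectation (\<lambda>w. exp ((X w)^2 / (4 * v))) = sqrt 2"
  by (subst distributed_integral[OF X, symmetric]) (use v in \<open>auto simp: eq\<close>)
 have "prob {w\<in>space M. r <= \<bar>X w\<bar>} <= prob {w\<in>space M. exp (r^2 / (4 * v)) <= exp ((X w)^2 / (4 * v))}"
 proof (rule finite_measure_mono)
  show "{w\<in>space M. r <= \<bar>X w\<bar>} \<subseteq> {w\<in>space M. exp (r^2 / (4 * v)) <= exp ((X w)^2 / (4 * v))}"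
   using v r by (auto intro!: divide_right_mono simp: abs_le_square_iff[symmetric])
 qed auto
 also have "... <= expectation (\<lambda>w. exp ((X w)^2 / (4 * v))) / exp (r^2 / (4 * v))"
  by (rule integral_Markov_inequality_measure[where A = "{}"]) (use int in auto)
 also have "... <= 2 / exp (r^2 / (4 * v))"
  unfolding ex by (intro divide_right_mono) (auto intro: real_le_lsqrt)
 finally show ?thesis by (simp add: exp_minus field_simps)
qed

end

text \<open>\<open>9/8\<close> is \<open>2 * (3/4)^2\<close>: from one dyadic level to the next the
  variance of an increment halves while its threshold shrinks by \<open>3/4\<close>. Bernoulli's
  inequality makes the exponent grow by at least 2 per level once \<open>x\<close> is at least 16,
  and \<open>exp 2 >= 4\<close> outweighs the doubling of the number of increments.\<close>

lemma exp_nine_eighths_sum: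
 fixes x :: real assumes x: "16 <= x"
 shows "2 ^ n * (2 * exp (- (x * (9/8) ^ n))) <= 2 * exp (- x) * (1/2) ^ n"
proof -
 have "1 + real n * (1/8) <= (1 + 1/8) ^ n" by (rule Bernoulli_inequality) simp
 then have "x * (1 + real n * (1/8)) <= x * (9/8) ^ n"
  using x by (intro mult_left_mono) auto
 moreover have "16 * (real n * (1/8)) <= x * (real n * (1/8))" using x by (intro mult_right_mono) auto
 ultimately have "x + real n * 2 <= x * (9/8) ^ n" by (simp add: algebra_simps)
 then have "exp (- (x * (9/8) ^ n)) <= exp (- x - real n * 2)" by simp
 also have "... = exp (- x) * exp (- 2) ^ n"
  by (simp add: exp_diff exp_minus exp_of_nat_mult[symmetric] field_simps)
 also have "... <= exp (- x) * (1/4) ^ n"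
 proof -
  have "(4::real) <= exp 2"
  proof -
   have "(2::real) * 2 <= exp 1 * exp 1"
    by (intro mult_mono) (use exp_ge_add_one_self[of 1] in auto)
   then show ?thesis by (simp add: exp_add[symmetric])
  qed
  then show ?thesis by (intro mult_left_mono power_mono) (auto simp: exp_minus field_simps)
 qed
 finally have "2 ^ n * (2 * exp (- (x * (9/8) ^ n))) <= 2 ^ n * (2 * (exp (- x) * (1/4) ^ n))"
  by (intro mult_left_mono) auto
 also have "... = 2 * exp (- x) * (2 ^ n * (1/4) ^ n)" by (simp add: algebra_simps)
 also have "2 ^ n * (1/4::real) ^ n = (1/2) ^ n" by (simp flip: power_mult_distrib)
 finally show ?thesis .
qed

text \<open>A point of level \<open>n + 1\<close> with even index already belongs to level
  \<open>n\<close>; one with odd index is a single increment away from such a point.\<close>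

lemma dyadic_chain:
 fixes w :: "real \<Rightarrow> real"
 assumes step: "\<And>n k. k < 2 ^ n \<Longrightarrow> \<bar>w (grid p q (2^n) (Suc k)) - w (grid p q (2^n) k)\<bar> <= r n"
  and r: "\<And>n. 0 <= r n"
 shows "k <= 2 ^ n \<Longrightarrow> \<bar>w (grid p q (2^n) k) - w p\<bar> <= (\<Sum>j\<le>n. r j)"
proof (induction n arbitrary: k)
 case 0
 then show ?case using step[of 0 0] r[of 0] by (cases k) auto
next
 case (Suc n)
 have half: "grid p q (2 ^ Suc n) (2 * j) = grid p q (2 ^ n) j" for j by (simp add: grid_def)
 show ?case
 proof (cases "even k")
  case True
  then obtain j where "k = 2 * j" by (elim evenE)
  then show ?thesis using Suc.IH[of j] Suc.prems half[of j] r[of "Suc n"] by simp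
 next
  case False
  then obtain j where j: "k = Suc (2 * j)" by (elim oddE) simp
  have "\<bar>w (grid p q (2 ^ Suc n) k) - w (grid p q (2 ^ Suc n) (2 * j))\<bar> <= r (Suc n)"
   unfolding j by (rule step) (use Suc.prems j in auto)
  moreover have "\<bar>w (grid p q (2 ^ Suc n) (2 * j)) - w p\<bar> <= (\<Sum>j\<le>n. r j)"
   unfolding half by (rule Suc.IH) (use Suc.prems j in auto)
  ultimately show ?thesis by simp
 qed
qed

lemma dyadic_sup:
 fixes w :: "real \<Rightarrow> real"
 assumes pq: "p <= q" and w: "continuous_on {p..q} w"
  and bd: "\<And>n k. k <= 2 ^ n \<Longrightarrow> \<bar>w (grid p q (2^n) k) - w p\<bar> <= R" and t: "t \<in> {p..q}"
 shows "\<bar>w t - w p\<bar> <= R"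
proof (cases "p = q")
 case True
 then show ?thesis using bd[of 0 0] t by simp
next
 case False
 then have pq: "p < q" using pq by simp
 define x where "x = (t - p) / (q - p)"
 have x: "0 <= x" "x <= 1" using t pq by (auto simp: x_def)
 define k where "k n = nat \<lfloor>2 ^ n * x\<rfloor>" for n :: nat
 have kr: "real (k n) = of_int \<lfloor>2 ^ n * x\<rfloor>" for n using x by (simp add: k_def)
 have k_le: "k n <= 2 ^ n" for n
 proof -
  have "2 ^ n * x <= 2 ^ n * 1" using x by (intro mult_left_mono) auto
  then have "real (k n) <= 2 ^ n" unfolding kr by linarith
  then show ?thesis by (metis of_nat_le_iff of_nat_numeral of_nat_power)
 qed
 have dist: "\<bar>real (k n) / 2 ^ n - x\<bar> <= (1/2) ^ n" for n
 proof -
  have "\<bar>real (k n) - 2 ^ n * x\<bar> <= 1" unfolding kr by linarith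
  then have "\<bar>real (k n) - 2 ^ n * x\<bar> / 2 ^ n <= 1 / 2 ^ n" by (intro divide_right_mono) auto
  moreover have "\<bar>real (k n) - 2 ^ n * x\<bar> / 2 ^ n = \<bar>(real (k n) - 2 ^ n * x) / 2 ^ n\<bar>" by (simp add: abs_divide)
  ultimately show ?thesis by (simp add: diff_divide_distrib power_divide)
 qed
 have "(\<lambda>n. real (k n) / 2 ^ n - x) \<longlonglongrightarrow> 0"
  by (rule tendsto_rabs_zero_cancel, rule real_tendsto_sandwich[of "\<lambda>_. 0" _ _ "\<lambda>n. (1/2) ^ n"])
    (auto simp: dist LIMSEQ_realpow_zero)
 then have "(\<lambda>n. real (k n) / 2 ^ n) \<longlonglongrightarrow> x" by (simp add: LIM_zero_iff)
 then have "(\<lambda>n. p + (q - p) * (real (k n) / 2 ^ n)) \<longlonglongrightarrow> p + (q - p) * x" by (intro tendsto_intros)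
 then have lim: "(\<lambda>n. grid p q (2 ^ n) (k n)) \<longlonglongrightarrow> t" using pq by (simp add: grid_def x_def)
 have mem: "grid p q (2 ^ n) (k n) \<in> {p..q}" for n
  using grid_mem[of p q "k n" "2 ^ n"] k_le pq by simp
 have "(\<lambda>n. w (grid p q (2 ^ n) (k n))) \<longlonglongrightarrow> w t"
  by (rule continuous_on_tendsto_compose[OF w lim t]) (use mem in simp)
 then have "(\<lambda>n. \<bar>w (grid p q (2 ^ n) (k n)) - w p\<bar>) \<longlonglongrightarrow> \<bar>w t - w p\<bar>" by (intro tendsto_intros)
 then show ?thesis by (rule LIMSEQ_le_const2) (use bd k_le in auto)
qed

section \<open>Laws and oscillations of functionals of the Brownian path\<close>

context standard_brownian_motion
begin

lemma path_cont: "w \<in> space M \<Longrightarrow> t0 <= p \<Longrightarrow> continuous_on {p..q} (\<lambda>t. W t w)"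
 by (rule continuous_on_subset[OF BM_continuous]) auto

lemma increment_char:
 assumes "t0 <= s" "s <= t"
 shows "char (distr M borel (\<lambda>w. c * (W t w - W s w))) \<theta> = complex_of_real (exp (- (\<theta>^2 * (c^2 * (t - s))) / 2))"
proof (cases "s = t")
 case True
 then show ?thesis using assms BM_measurable by (subst char_distr) (auto simp: prob_space)
next
 case False
 have m: "(\<lambda>w. W t w - W s w) \<in> borel_measurable M"
  using assms BM_measurable by (intro borel_measurable_diff) auto
 have "char (distr M borel (\<lambda>w. W t w - W s w)) (\<theta> * c) = complex_of_real (exp (- (\<theta> * c * sqrt (t - s))\<^sup>2 / 2))"
  by (rule char_normal[OF BM_increment]) (use assms False in auto)
 then show ?thesis using assms
  unfolding char_distr_scale[OF m] by (simp add: power_mult_distrib mult.assoc)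
qed

lemma increments_char:
 assumes \<tau>: "t0 <= \<tau> 0" "\<And>i. i < n \<Longrightarrow> \<tau> i <= \<tau> (Suc i)"
 shows "(\<lambda>w. \<Sum>i<n. c i * (W (\<tau> (Suc i)) w - W (\<tau> i) w)) \<in> borel_measurable M"
  and "char (distr M borel (\<lambda>w. \<Sum>i<n. c i * (W (\<tau> (Suc i)) w - W (\<tau> i) w))) \<theta>
   = complex_of_real (exp (- (\<theta>^2 * (\<Sum>i<n. (c i)\<^sup>2 * (\<tau> (Suc i) - \<tau> i))) / 2))"
proof -
 have ge: "i <= n \<Longrightarrow> t0 <= \<tau> i" for i
  by (induction i) (use \<tau> in \<open>auto intro: order_trans\<close>)
 show "(\<lambda>w. \<Sum>i<n. c i * (W (\<tau> (Suc i)) w - W (\<tau> i) w)) \<in> borel_measurable M"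
  by (intro borel_measurable_sum borel_measurable_times borel_measurable_diff borel_measurable_const BM_measurable ge) auto
 have ind: "indep_vars (\<lambda>_. borel) (\<lambda>i w. c i * (W (\<tau> (Suc i)) w - W (\<tau> i) w)) {..<n}"
  by (rule indep_vars_compose2[OF BM_indep[OF \<tau>], where Y = "\<lambda>i x. c i * x"]) auto
 have "char (distr M borel (\<lambda>w. \<Sum>i<n. c i * (W (\<tau> (Suc i)) w - W (\<tau> i) w))) \<theta>
   = (\<Prod>i<n. complex_of_real (exp (- (\<theta>^2 * ((c i)^2 * (\<tau> (Suc i) - \<tau> i))) / 2)))"
  unfolding char_distr_sum[OF ind] by (intro prod.cong refl increment_char \<tau> ge) auto
 also have "... = complex_of_real (exp (\<Sum>i<n. - (\<theta>^2 * ((c i)^2 * (\<tau> (Suc i) - \<tau> i))) / 2))"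
  by (simp add: exp_sum)
 also have "(\<Sum>i<n. - (\<theta>^2 * ((c i)^2 * (\<tau> (Suc i) - \<tau> i))) / 2) = - (\<theta>^2 * (\<Sum>i<n. (c i)\<^sup>2 * (\<tau> (Suc i) - \<tau> i))) / 2"
  by (simp add: sum_distrib_left sum_divide_distrib sum_negf)
 finally show "char (distr M borel (\<lambda>w. \<Sum>i<n. c i * (W (\<tau> (Suc i)) w - W (\<tau> i) w))) \<theta>
   = complex_of_real (exp (- (\<theta>^2 * (\<Sum>i<n. (c i)\<^sup>2 * (\<tau> (Suc i) - \<tau> i))) / 2))" .
qed

text \<open>Two kernels on adjacent intervals are needed because the joint law of the process at
  time \<open>s\<close> and of an integral over the whole period involves a kernel that jumps at
  \<open>s\<close>. Both grids are joined into one increasing sequence, to which the independence of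
  increments applies, and the characteristic functions pass to the limit.\<close>

lemma wint2_char:
 assumes p: "t0 <= p" "p <= s" "s <= q"
  and f: "\<And>t. t \<in> {p..s} \<Longrightarrow> (f has_real_derivative f' t) (at t within {p..s})"
  and f': "continuous_on {p..s} f'"
  and g: "\<And>t. t \<in> {s..q} \<Longrightarrow> (g has_real_derivative g' t) (at t within {s..q})"
  and g': "continuous_on {s..q} g'"
 shows "(\<lambda>w. wint f f' p s (\<lambda>t. W t w) + wint g g' s q (\<lambda>t. W t w)) \<in> borel_measurable M" (is "?L \<in> _")
  and "char (distr M borel (\<lambda>w. wint f f' p s (\<lambda>t. W t w) + wint g g' s q (\<lambda>t. W t w))) \<theta>
   = complex_of_real (exp (- (\<theta>^2 * (integral {p..s} (\<lambda>t. (f t)\<^sup>2) + integral {s..q} (\<lambda>t. (g t)\<^sup>2))) / 2))"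
proof -
 \<comment> \<open>The node with index \<open>n\<close> is the last point of the first grid for the
   times and the first point of the second grid for the coefficients; for positive \<open>n\<close>
   both are \<open>s\<close>.\<close>
 define \<tau> where "\<tau> n i = (if i <= n then grid p s n i else grid s q n (i - n))" for n i
 define c where "c n i = (if i < n then f (grid p s n i) else g (grid s q n (i - n)))" for n i
 define Z where "Z n w = (\<Sum>i<n + n. c n i * (W (\<tau> n (Suc i)) w - W (\<tau> n i) w))" for n w
 have tau_hi: "\<tau> n (n + i) = grid s q n i" if "0 < n" for n i
  using that by (auto simp: \<tau>_def)
 have split: "(\<Sum>i<n + n. h (c n i) (\<tau> n (Suc i)) (\<tau> n i))
   = (\<Sum>i<n. h (f (grid p s n i)) (grid p s n (Suc i)) (grid p s n i))
   + (\<Sum>i<n. h (g (grid s q n i)) (grid s q n (Suc i)) (grid s q n i))" for n and h :: "real \<Rightarrow> real \<Rightarrow> real \<Rightarrow> real"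
 proof (cases "n = 0")
  case False
  have "(\<Sum>i<n + n. h (c n i) (\<tau> n (Suc i)) (\<tau> n i))
   = (\<Sum>i<n. h (c n i) (\<tau> n (Suc i)) (\<tau> n i)) + (\<Sum>i<n. h (c n (n + i)) (\<tau> n (Suc (n + i))) (\<tau> n (n + i)))"
   unfolding lessThan_atLeast0 using sum.atLeastLessThan_concat[of 0 n "n + n" "\<lambda>i. h (c n i) (\<tau> n (Suc i)) (\<tau> n i)"]
   sum.shift_bounds_nat_ivl[of "\<lambda>i. h (c n i) (\<tau> n (Suc i)) (\<tau> n i)" 0 n n]
   by (simp add: add.commute)
  also have "(\<Sum>i<n. h (c n i) (\<tau> n (Suc i)) (\<tau> n i)) = (\<Sum>i<n. h (f (grid p s n i)) (grid p s n (Suc i)) (grid p s n i))"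
   by (intro sum.cong) (auto simp: c_def \<tau>_def)
  also have "(\<Sum>i<n. h (c n (n + i)) (\<tau> n (Suc (n + i))) (\<tau> n (n + i))) = (\<Sum>i<n. h (g (grid s q n i)) (grid s q n (Suc i)) (grid s q n i))"
   using tau_hi[of n "Suc _"] tau_hi[of n] False by (intro sum.cong) (auto simp: c_def)
  finally show ?thesis .
 qed simp
 have tau0: "t0 <= \<tau> n 0" for n using p by (auto simp: \<tau>_def)
 have tau_mono: "\<tau> n i <= \<tau> n (Suc i)" if "i < n + n" for n i
 proof (cases "i < n")
  case True
  then show ?thesis using p by (simp add: \<tau>_def grid_mono)
 next
  case False
  then have "i = n + (i - n)" "Suc i = n + Suc (i - n)" "0 < n" using that by auto
  then show ?thesis using tau_hi[of n "i - n"] tau_hi[of n "Suc (i - n)"] p grid_mono[of s q "i - n" "Suc (i - n)" n] by simp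
 qed
 have Zm: "Z n \<in> borel_measurable M" for n
  unfolding Z_def using increments_char(1)[of "\<tau> n" "n + n", OF tau0 tau_mono] by simp
 have Zc: "char (distr M borel (Z n)) \<theta> = complex_of_real (exp (- (\<theta>^2 *
   ((\<Sum>i<n. (f (grid p s n i))\<^sup>2 * (grid p s n (Suc i) - grid p s n i)) +
   (\<Sum>i<n. (g (grid s q n i))\<^sup>2 * (grid s q n (Suc i) - grid s q n i)))) / 2))" for n \<theta>
  unfolding Z_def using increments_char(2)[of "\<tau> n" "n + n" "c n" \<theta>, OF tau0 tau_mono]
   split[of "\<lambda>c t s. c\<^sup>2 * (t - s)" n] by simp
 have lim: "(\<lambda>n. Z n w) \<longlonglongrightarrow> ?L w" if "w \<in> space M" for w
  unfolding Z_def split[of "\<lambda>c t s. c * (W t w - W s w)"]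
  by (intro tendsto_add wint_approx f f' g g' p path_cont that) (use p in auto)
 show "?L \<in> borel_measurable M" by (rule char_limit(1)[OF Zm lim])
 have "(\<lambda>n. char (distr M borel (Z n)) \<theta>) \<longlonglongrightarrow> char (distr M borel ?L) \<theta>" by (rule char_limit(2)[OF Zm lim])
 moreover have "(\<lambda>n. char (distr M borel (Z n)) \<theta>) \<longlonglongrightarrow>
   complex_of_real (exp (- (\<theta>^2 * (integral {p..s} (\<lambda>t. (f t)\<^sup>2) + integral {s..q} (\<lambda>t. (g t)\<^sup>2))) / 2))"
  unfolding Zc
  by (intro tendsto_intros riemann_square[where g = f and g' = f'] riemann_square[where g = g and g' = g'] f f' g g' p) auto
 ultimately show "char (distr M borel ?L) \<theta> = complex_of_real (exp (- (\<theta>^2 * (integral {p..s} (\<lambda>t. (f t)\<^sup>2) + integral {s..q} (\<lambda>t. (g t)\<^sup>2))) / 2))"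
  by (rule LIMSEQ_unique)
qed

text \<open>The second interval of \<open>wint2_char\<close> is shrunk to the point
  \<open>q\<close>, where \<open>wint\<close> vanishes.\<close>

lemma wint_normal:
 assumes p: "t0 <= p" "p <= q"
  and g: "\<And>t. t \<in> {p..q} \<Longrightarrow> (g has_real_derivative g' t) (at t within {p..q})"
  and g': "continuous_on {p..q} g'"
  and pos: "0 < integral {p..q} (\<lambda>t. (g t)\<^sup>2)"
 shows "distributed M lborel (\<lambda>\<omega>. wint g g' p q (\<lambda>t. W t \<omega>)) (normal_density 0 (sqrt (integral {p..q} (\<lambda>t. (g t)\<^sup>2))))"
proof -
 have z: "wint g g' q q w = 0" for w by (simp add: wint_def)
 have d: "(g has_real_derivative g' t) (at t within {q..q})" if "t \<in> {q..q}" for t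
  using g[of t] that p by (auto intro: DERIV_subset)
 have c: "continuous_on {q..q} g'" by simp
 note L = wint2_char[OF p order_refl g g' d c, unfolded z, simplified]
 show ?thesis by (rule distributed_of_char[OF L(1) pos]) (use L(2) in simp)
qed

text \<open>On the first interval the kernels add up, on the second only \<open>g\<close> is left,
  so the combination is again of the form of \<open>wint2_char\<close> and has a real characteristic
  function. Keeping \<open>a\<close> and \<open>b\<close> free allows polarisation.\<close>

lemma wint_odd_moment:
 assumes p: "t0 <= p" "p <= s" "s <= q"
  and f: "\<And>t. t \<in> {p..s} \<Longrightarrow> (f has_real_derivative f' t) (at t within {p..s})"
  and f': "continuous_on {p..s} f'"
  and g: "\<And>t. t \<in> {p..q} \<Longrightarrow> (g has_real_derivative g' t) (at t within {p..q})"
  and g': "continuous_on {p..q} g'" and k: "odd k"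
 shows "expectation (\<lambda>\<omega>. (a * wint f f' p s (\<lambda>t. W t \<omega>) + b * wint g g' p q (\<lambda>t. W t \<omega>)) ^ k) = 0"
proof -
 have sub: "{p..s} \<subseteq> {p..q}" "{s..q} \<subseteq> {p..q}" using p by auto
 let ?h = "\<lambda>t. a * f t + b * g t" and ?h' = "\<lambda>t. a * f' t + b * g' t"
 let ?L = "\<lambda>\<omega>. wint ?h ?h' p s (\<lambda>t. W t \<omega>) + wint (\<lambda>t. b * g t) (\<lambda>t. b * g' t) s q (\<lambda>t. W t \<omega>)"
 have eq: "a * wint f f' p s (\<lambda>t. W t \<omega>) + b * wint g g' p q (\<lambda>t. W t \<omega>) = ?L \<omega>" if \<omega>: "\<omega> \<in> space M" for \<omega>
 proof -
  have w: "continuous_on {p..q} (\<lambda>t. W t \<omega>)" by (rule path_cont[OF \<omega> p(1)])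
  have "integral {p..s} (\<lambda>t. ?h' t * W t \<omega>) = integral {p..s} (\<lambda>t. a * (f' t * W t \<omega>)) + integral {p..s} (\<lambda>t. b * (g' t * W t \<omega>))"
   unfolding distrib_right mult.assoc
   by (intro hk_add integrable_continuous_real continuous_intros f'
     continuous_on_subset[OF g' sub(1)] continuous_on_subset[OF w sub(1)])
  then show ?thesis
   unfolding wint_split[OF p(2,3) g' w] by (simp add: wint_def algebra_simps)
 qed
 have h: "(?h has_real_derivative ?h' t) (at t within {p..s})" if "t \<in> {p..s}" for t
  by (intro DERIV_add DERIV_cmult f that DERIV_subset[OF g sub(1)]) (use that sub in auto)
 have h': "continuous_on {p..s} ?h'"
  by (intro continuous_intros f' continuous_on_subset[OF g' sub(1)])
 have k1: "((\<lambda>t. b * g t) has_real_derivative b * g' t) (at t within {s..q})" if "t \<in> {s..q}" for t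
  by (intro DERIV_cmult DERIV_subset[OF g sub(2)]) (use that sub in auto)
 have k2: "continuous_on {s..q} (\<lambda>t. b * g' t)"
  by (intro continuous_intros continuous_on_subset[OF g' sub(2)])
 note L = wint2_char[where f = ?h and f' = ?h' and g = "\<lambda>t. b * g t" and g' = "\<lambda>t. b * g' t", OF p h h' k1 k2]
 have real: "char (distr M borel ?L) \<theta> \<in> \<real>" for \<theta> by (subst L(2)) (assumption | rule Reals_of_real)+
 have "expectation (\<lambda>\<omega>. (a * wint f f' p s (\<lambda>t. W t \<omega>) + b * wint g g' p q (\<lambda>t. W t \<omega>)) ^ k) = expectation (\<lambda>\<omega>. ?L \<omega> ^ k)"
  by (rule Bochner_Integration.integral_cong) (simp_all add: eq)
 also have "... = 0" by (rule real_char_odd_moment[OF L(1) real k])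
 finally show ?thesis .
qed

lemma increment_tail:
 assumes "t0 <= s" "s < t" "0 <= r"
 shows "prob {w\<in>space M. r < \<bar>W t w - W s w\<bar>} <= 2 * exp (- (r^2 / (4 * (t - s))))"
proof -
 have [measurable]: "W t \<in> borel_measurable M" "W s \<in> borel_measurable M" using assms BM_measurable by auto
 have "prob {w\<in>space M. r < \<bar>W t w - W s w\<bar>} <= prob {w\<in>space M. r <= \<bar>W t w - W s w\<bar>}"
  by (rule finite_measure_mono) auto
 also have "... <= 2 * exp (- (r^2 / (4 * (t - s))))"
  by (rule normal_tail[OF BM_increment]) (use assms in auto)
 finally show ?thesis .
qed

text \<open>Chaining with threshold \<open>r / 4 * (3/4) ^ n\<close> at level \<open>n\<close>;
  these sum to \<open>r\<close>, and the first of them gives the factor 64 in the exponent. The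
  exceptional set is a countable union of events on increments, hence measurable. For exponents
  below 16 the summand \<open>exp 16\<close> makes the bound exceed 1 and the whole space is
  taken.\<close>

lemma oscillation_bound:
 assumes s: "t0 <= s" "s < t" and r: "0 < r"
 obtains B where "B \<in> sets M" "prob B <= (exp 16 + 4) * exp (- (r^2 / (64 * (t - s))))"
  "\<And>\<omega> u. \<omega> \<in> space M - B \<Longrightarrow> u \<in> {s..t} \<Longrightarrow> \<bar>W u \<omega> - W s \<omega>\<bar> <= r"
proof -
 define x where "x = r^2 / (64 * (t - s))"
 show ?thesis
 proof (cases "16 <= x")
  case False
  have "exp (-16) <= exp (- x)" using False by simp
  then have "exp 16 * exp (- 16) <= exp 16 * exp (- x)" by (intro mult_left_mono) auto
  then have "1 <= exp 16 * exp (- x)" by (simp add: exp_minus)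
  also have "... <= (exp 16 + 4) * exp (- x)" by (intro mult_right_mono) auto
  finally have "prob (space M) <= (exp 16 + 4) * exp (- x)" by (simp add: prob_space)
  then show ?thesis by (intro that[of "space M"]) (auto simp: x_def)
 next
  case True
  define rr where "rr n = r / 4 * (3/4) ^ n" for n :: nat
  define E where "E n k = {\<omega>\<in>space M. rr n < \<bar>W (grid s t (2^n) (Suc k)) \<omega> - W (grid s t (2^n) k) \<omega>\<bar>}" for n k
  define B where "B = (\<Union>n. \<Union>k<2^n. E n k)"
  have grid_ge: "t0 <= grid s t m k" for m k
   using s by (auto simp: grid_def intro!: order_trans[of t0 s] mult_nonneg_nonneg)
  have Em [measurable]: "E n k \<in> sets M" for n k
   unfolding E_def using BM_measurable[OF grid_ge] by measurable
  have Bm: "B \<in> sets M" unfolding B_def by measurable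
  have pE: "prob (E n k) <= 2 * exp (- (x * (9/8) ^ n))" for n k
  proof -
   have d: "grid s t (2^n) (Suc k) - grid s t (2^n) k = (t - s) / 2 ^ n"
    by (simp add: grid_Suc)
   have "prob (E n k) <= 2 * exp (- ((rr n)^2 / (4 * (grid s t (2^n) (Suc k) - grid s t (2^n) k))))"
    unfolding E_def
   proof (rule increment_tail[OF grid_ge])
    have "0 < grid s t (2^n) (Suc k) - grid s t (2^n) k" unfolding d using s by simp
    then show "grid s t (2^n) k < grid s t (2^n) (Suc k)" by simp
   qed (use r in \<open>auto simp: rr_def\<close>)
   also have "(rr n)^2 / (4 * (grid s t (2^n) (Suc k) - grid s t (2^n) k)) = x * ((3/4) ^ n * (3/4) ^ n * 2 ^ n)"
    unfolding d rr_def x_def using s by (simp add: power2_eq_square field_simps)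
   also have "(3/4::real) ^ n * (3/4) ^ n * 2 ^ n = (9/8) ^ n" by (simp flip: power_mult_distrib)
   finally show ?thesis .
  qed
  have pn: "prob (\<Union>k<2^n. E n k) <= 2 * exp (- x) * (1/2) ^ n" for n :: nat
  proof -
   have "prob (\<Union>k<2^n. E n k) <= (\<Sum>k<2^n. prob (E n k))"
    by (rule finite_measure_subadditive_finite) auto
   also have "... <= (\<Sum>k<(2::nat)^n. 2 * exp (- (x * (9/8) ^ n)))" by (intro sum_mono pE)
   also have "... = 2 ^ n * (2 * exp (- (x * (9/8) ^ n)))" by simp
   also have "... <= 2 * exp (- x) * (1/2) ^ n" by (rule exp_nine_eighths_sum[OF True])
   finally show ?thesis .
  qed
  have summ: "summable (\<lambda>n. 2 * exp (- x) * (1/2) ^ n)" by (intro summable_mult summable_geometric) simp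
  have "prob B <= (\<Sum>n. prob (\<Union>k<2^n. E n k))"
   unfolding B_def
   by (rule finite_measure_subadditive_countably)
     (auto intro!: summable_comparison_test[OF _ summ] exI[of _ 0] simp: pn)
  also have "... <= (\<Sum>n. 2 * exp (- x) * (1/2) ^ n)"
   by (intro suminf_le pn summ) (auto intro!: summable_comparison_test[OF _ summ] exI[of _ 0] simp: pn)
  also have "... = 4 * exp (- x)"
   by (subst suminf_mult) (auto simp: suminf_geometric intro!: summable_geometric)
  also have "... <= (exp 16 + 4) * exp (- x)" by (intro mult_right_mono) auto
  finally have pB: "prob B <= (exp 16 + 4) * exp (- (r^2 / (64 * (t - s))))" by (simp add: x_def)
  show ?thesis
  proof (rule that[OF Bm pB])
   fix \<omega> u assume \<omega>: "\<omega> \<in> space M - B" and u: "u \<in> {s..t}"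
   have st: "\<bar>W (grid s t (2^n) (Suc k)) \<omega> - W (grid s t (2^n) k) \<omega>\<bar> <= rr n" if "k < 2 ^ n" for n k
    using \<omega> that by (fastforce simp: B_def E_def not_less)
   have rrs: "(\<Sum>j\<le>n. rr j) <= r" for n
   proof -
    have "(\<Sum>j\<le>n. rr j) = r * (1 - (3/4) ^ Suc n)"
     by (induction n) (auto simp: rr_def algebra_simps)
    also have "... <= r * 1" using r by (intro mult_left_mono) auto
    finally show ?thesis by simp
   qed
   show "\<bar>W u \<omega> - W s \<omega>\<bar> <= r"
   proof (rule dyadic_sup[where w = "\<lambda>t. W t \<omega>" and q = t])
    fix n k assume "k <= (2::nat) ^ n"
    then have "\<bar>W (grid s t (2^n) k) \<omega> - W s \<omega>\<bar> <= (\<Sum>j\<le>n. rr j)"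
     by (intro dyadic_chain[where w = "\<lambda>t. W t \<omega>"] st) (use r in \<open>auto simp: rr_def\<close>)
    then show "\<bar>W (grid s t (2^n) k) \<omega> - W s \<omega>\<bar> <= r" using rrs[of n] by linarith
   qed (use \<omega> u s path_cont in auto)
  qed
 qed
qed

end

section \<open>Time integrals of random paths\<close>

definition clampI :: "real \<Rightarrow> real" where
 "clampI t = max (- (1/2)) (min (1/2) t)"

lemma clampI_mem: "clampI t \<in> TI" and clampI_id: "t \<in> TI \<Longrightarrow> clampI t = t"
 by (auto simp: clampI_def)

lemma clampI_cont: "continuous_on UNIV clampI"
 unfolding clampI_def by (intro continuous_intros)

text \<open>\<open>clampI\<close> extends a function from the period to the whole line, so that
  product measures with \<open>lborel\<close> can be used while all hypotheses concern times in
  \<open>TI\<close>.\<close>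

lemma integral_TI_lborel:
 fixes f :: "real \<Rightarrow> real"
 assumes "continuous_on TI f"
 shows "(\<integral>t. indicator TI t * f (clampI t) \<partial>lborel) = integral TI f"
  and "integrable lborel (\<lambda>t. indicator TI t * f (clampI t))"
proof -
 have eq: "(\<lambda>t. indicator TI t * f (clampI t)) = (\<lambda>t. indicator TI t *\<^sub>R f t)"
  by (auto simp: fun_eq_iff clampI_id indicator_def)
 have i: "set_integrable lborel TI f"
  unfolding set_integrable_def by (rule borel_integrable_compact[OF compact_Icc assms])
 show "integrable lborel (\<lambda>t. indicator TI t * f (clampI t))"
  using i unfolding eq set_integrable_def .
 show "(\<integral>t. indicator TI t * f (clampI t) \<partial>lborel) = integral TI f"
  using set_borel_integral_eq_integral(2)[OF i] unfolding eq set_lebesgue_integral_def .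
qed

context prob_space
begin

text \<open>Joint measurability in time and chance follows by freezing the time at multiples of
  \<open>1 / n\<close>, a countable family, and letting \<open>n\<close> grow, by continuity of the
  paths. The function \<open>e\<close> is an integrable majorant for Fubini's theorem.\<close>

lemma path_integral_Fubini:
 fixes Y :: "real \<Rightarrow> 'a \<Rightarrow> real"
 assumes meas: "\<And>t. t \<in> TI \<Longrightarrow> Y t \<in> borel_measurable M"
  and cont: "\<And>w. w \<in> space M \<Longrightarrow> continuous_on TI (\<lambda>t. Y t w)"
 shows path_integral_measurable: "(\<lambda>w. integral TI (\<lambda>t. Y t w)) \<in> borel_measurable M"
  and path_integral_expectation: "\<lbrakk>\<And>t. t \<in> TI \<Longrightarrow> integrable M (Y t); continuous_on TI e;
    \<And>t. t \<in> TI \<Longrightarrow> expectation (\<lambda>w. \<bar>Y t w\<bar>) <= e t\<rbrakk>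
    \<Longrightarrow> integrable M (\<lambda>w. integral TI (\<lambda>t. Y t w)) \<and>
     expectation (\<lambda>w. integral TI (\<lambda>t. Y t w)) = (\<integral>t. indicator TI t * expectation (Y (clampI t)) \<partial>lborel)"
proof -
 define V where "V = (\<lambda>(t, w). indicator TI t * Y (clampI t) w)"
 have Ym [measurable]: "Y (clampI t) \<in> borel_measurable M" for t
  by (rule meas[OF clampI_mem])
 have step: "(\<lambda>(t, w). Y (clampI (of_int \<lfloor>real n * t\<rfloor> / real n)) w) \<in> borel_measurable (lborel \<Otimes>\<^sub>M M)" for n
 proof -
  have "(\<lambda>x. Y (clampI (of_int \<lfloor>real n * fst x\<rfloor> / real n)) (snd x)) \<in> borel_measurable (lborel \<Otimes>\<^sub>M M)"
   by (rule measurable_compose_countable[where f = "\<lambda>i x. Y (clampI (of_int i / real n)) (snd x)" and g = "\<lambda>x. \<lfloor>real n * fst x\<rfloor>"]) measurable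
  then show ?thesis by (simp add: case_prod_beta')
 qed
 have lim: "(\<lambda>x. Y (clampI (fst x)) (snd x)) \<in> borel_measurable (lborel \<Otimes>\<^sub>M M)"
 proof (rule borel_measurable_LIMSEQ_real)
  fix x :: "real \<times> 'a" assume "x \<in> space (lborel \<Otimes>\<^sub>M M)"
  then have w: "snd x \<in> space M" by (auto simp: space_pair_measure)
  have "(\<lambda>n. of_int \<lfloor>real n * fst x\<rfloor> / real n) \<longlonglongrightarrow> fst x"
  proof (rule LIM_zero_cancel, rule tendsto_rabs_zero_cancel, rule real_tendsto_sandwich[of "\<lambda>_. 0" _ _ "\<lambda>n. 1 / real n"])
   show "\<forall>\<^sub>F n in sequentially. \<bar>of_int \<lfloor>real n * fst x\<rfloor> / real n - fst x\<bar> <= 1 / real n"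
   proof (rule eventually_sequentiallyI[of 1])
    fix n :: nat assume n: "1 <= n"
    have "\<bar>of_int \<lfloor>real n * fst x\<rfloor> - real n * fst x\<bar> <= 1" by linarith
    then have "\<bar>of_int \<lfloor>real n * fst x\<rfloor> - real n * fst x\<bar> / real n <= 1 / real n"
     by (intro divide_right_mono) auto
    moreover have "of_int \<lfloor>real n * fst x\<rfloor> / real n - fst x = (of_int \<lfloor>real n * fst x\<rfloor> - real n * fst x) / real n"
     using n by (simp add: field_simps)
    ultimately show "\<bar>of_int \<lfloor>real n * fst x\<rfloor> / real n - fst x\<bar> <= 1 / real n"
     by (simp add: abs_divide)
   qed
  qed (auto intro: lim_1_over_n)
  then have "(\<lambda>n. clampI (of_int \<lfloor>real n * fst x\<rfloor> / real n)) \<longlonglongrightarrow> clampI (fst x)"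
   by (rule continuous_on_tendsto_compose[OF clampI_cont]) auto
  then show "(\<lambda>n. (case x of (t, w) \<Rightarrow> Y (clampI (of_int \<lfloor>real n * t\<rfloor> / real n)) w)) \<longlonglongrightarrow> Y (clampI (fst x)) (snd x)"
   unfolding case_prod_beta'
   by (rule continuous_on_tendsto_compose[OF cont[OF w]]) (auto simp: clampI_mem simp del: atLeastAtMost_iff)
 qed (rule step)
 have Vm: "V \<in> borel_measurable (lborel \<Otimes>\<^sub>M M)"
  unfolding V_def case_prod_beta' using lim by measurable
 interpret L: pair_sigma_finite lborel M ..
 have Vi: "(\<integral>t. V (t, w) \<partial>lborel) = integral TI (\<lambda>t. Y t w)" if "w \<in> space M" for w
  using integral_TI_lborel(1)[OF cont[OF that]] by (simp add: V_def)
 have "(\<lambda>w. \<integral>t. V (t, w) \<partial>lborel) \<in> borel_measurable M"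
 proof -
  have "(\<lambda>(w, t). V (t, w)) \<in> borel_measurable (M \<Otimes>\<^sub>M lborel)"
   using measurable_compose[OF measurable_pair_swap' Vm] by (simp add: case_prod_beta')
  then show ?thesis by (intro lborel.borel_measurable_lebesgue_integral) auto
 qed
 then show "(\<lambda>w. integral TI (\<lambda>t. Y t w)) \<in> borel_measurable M"
  by (rule measurable_cong[THEN iffD1, rotated]) (simp add: Vi)
 assume int: "\<And>t. t \<in> TI \<Longrightarrow> integrable M (Y t)" and e: "continuous_on TI e"
  and le: "\<And>t. t \<in> TI \<Longrightarrow> expectation (\<lambda>w. \<bar>Y t w\<bar>) <= e t"
 have Vint: "integrable (lborel \<Otimes>\<^sub>M M) V"
 proof (rule L.Fubini_integrable[OF Vm])
  show "integrable lborel (\<lambda>x. \<integral>y. norm (V (x, y)) \<partial>M)"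
  proof (rule Bochner_Integration.integrable_bound[OF integral_TI_lborel(2)[OF e]])
   show "(\<lambda>x. \<integral>y. norm (V (x, y)) \<partial>M) \<in> borel_measurable lborel"
    by (rule borel_measurable_lebesgue_integral) (use Vm in measurable)
   show "AE x in lborel. norm (\<integral>y. norm (V (x, y)) \<partial>M) <= norm (indicator TI x * e (clampI x))"
   proof (rule AE_I2)
    fix x
    have nn: "0 <= expectation (\<lambda>y. \<bar>Y (clampI x) y\<bar>)" by simp
    show "norm (\<integral>y. norm (V (x, y)) \<partial>M) <= norm (indicator TI x * e (clampI x))"
     using le[OF clampI_mem, of x] nn by (auto simp: V_def indicator_def abs_mult)
   qed
  qed
  show "AE x in lborel. integrable M (\<lambda>y. V (x, y))"
   using int[OF clampI_mem] by (auto simp: V_def)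
 qed
 have "integrable M (\<lambda>w. \<integral>t. V (t, w) \<partial>lborel)"
  using L.integrable_snd[of "\<lambda>t w. V (t, w)"] Vint by simp
 moreover have "(\<integral>w. (\<integral>t. V (t, w) \<partial>lborel) \<partial>M) = (\<integral>t. (\<integral>w. V (t, w) \<partial>M) \<partial>lborel)"
  using L.Fubini_integral[of "\<lambda>t w. V (t, w)"] Vint by simp
 moreover have "(\<integral>w. V (t, w) \<partial>M) = indicator TI t * expectation (Y (clampI t))" for t
  by (simp add: V_def)
 moreover have "integrable M (\<lambda>w. \<integral>t. V (t, w) \<partial>lborel) = integrable M (\<lambda>w. integral TI (\<lambda>t. Y t w))"
  by (rule Bochner_Integration.integrable_cong) (simp_all add: Vi)
 moreover have "(\<integral>w. (\<integral>t. V (t, w) \<partial>lborel) \<partial>M) = expectation (\<lambda>w. integral TI (\<lambda>t. Y t w))"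
  by (rule Bochner_Integration.integral_cong) (simp_all add: Vi)
 ultimately show "integrable M (\<lambda>w. integral TI (\<lambda>t. Y t w)) \<and>
     expectation (\<lambda>w. integral TI (\<lambda>t. Y t w)) = (\<integral>t. indicator TI t * expectation (Y (clampI t)) \<partial>lborel)"
  by simp
qed

lemma path_integral_zero:
 fixes Y :: "real \<Rightarrow> 'a \<Rightarrow> real"
 assumes "\<And>t. t \<in> TI \<Longrightarrow> integrable M (Y t)"
  and "\<And>w. w \<in> space M \<Longrightarrow> continuous_on TI (\<lambda>t. Y t w)"
  and "continuous_on TI e" "\<And>t. t \<in> TI \<Longrightarrow> expectation (\<lambda>w. \<bar>Y t w\<bar>) <= e t"
  and zero: "\<And>t. t \<in> TI \<Longrightarrow> expectation (Y t) = 0"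
 shows "expectation (\<lambda>w. integral TI (\<lambda>t. Y t w)) = 0"
 using path_integral_expectation[of Y e] assms by (simp add: zero[OF clampI_mem])

lemma path_integral_nonneg:
 fixes Y :: "real \<Rightarrow> 'a \<Rightarrow> real"
 assumes int: "\<And>t. t \<in> TI \<Longrightarrow> integrable M (Y t)"
  and cont: "\<And>w. w \<in> space M \<Longrightarrow> continuous_on TI (\<lambda>t. Y t w)"
  and nn: "\<And>t w. t \<in> TI \<Longrightarrow> w \<in> space M \<Longrightarrow> 0 <= Y t w"
  and e: "continuous_on TI e" "\<And>t. t \<in> TI \<Longrightarrow> expectation (Y t) <= e t"
 shows "integrable M (\<lambda>w. integral TI (\<lambda>t. Y t w))"
  and "expectation (\<lambda>w. integral TI (\<lambda>t. Y t w)) <= integral TI e"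
proof -
 have ab: "expectation (\<lambda>w. \<bar>Y t w\<bar>) = expectation (Y t)" if "t \<in> TI" for t
  by (rule Bochner_Integration.integral_cong) (use nn that in auto)
 have *: "integrable M (\<lambda>w. integral TI (\<lambda>t. Y t w)) \<and>
     expectation (\<lambda>w. integral TI (\<lambda>t. Y t w)) = (\<integral>t. indicator TI t * expectation (Y (clampI t)) \<partial>lborel)"
  by (rule path_integral_expectation[of Y e]) (use int cont e ab in auto)
 then show "integrable M (\<lambda>w. integral TI (\<lambda>t. Y t w))" by simp
 have "(\<integral>t. indicator TI t * expectation (Y (clampI t)) \<partial>lborel) <= (\<integral>t. indicator TI t * e (clampI t) \<partial>lborel)"
 proof (rule integral_mono')
  show "integrable lborel (\<lambda>t. indicator TI t * e (clampI t))" by (rule integral_TI_lborel(2)[OF e(1)])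
  show "indicator TI t * expectation (Y (clampI t)) <= indicator TI t * e (clampI t)" for t
   by (intro mult_left_mono e(2) clampI_mem) auto
  have "0 <= expectation (Y (clampI t))" for t
   by (rule Bochner_Integration.integral_nonneg_AE) (use nn[OF clampI_mem] in auto)
  then show "0 <= indicator TI t * e (clampI t)" for t
   using e(2)[OF clampI_mem, of t] by (meson order_trans indicator_pos_le mult_nonneg_nonneg)
 qed
 then show "expectation (\<lambda>w. integral TI (\<lambda>t. Y t w)) <= integral TI e"
  using * integral_TI_lborel(1)[OF e(1)] by simp
qed

end

context linear_well
begin

text \<open>The solution of \<open>z = (\<integral> a z) / e + w\<close>, written without differentiating \<open>w\<close>.\<close>

definition lin :: "(real \<Rightarrow> real) \<Rightarrow> real \<Rightarrow> real" where
 "lin w t = w t + exp (\<alpha> t) * integral {- (1/2)..t} (\<lambda>s. a s / e * exp (- \<alpha> s) * w s)"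

lemma lin_start [simp]: "lin w (- (1/2)) = w (- (1/2))"
 by (simp add: lin_def)

context
 fixes w :: "real \<Rightarrow> real"
 assumes w: "continuous_on TI w"
begin

lemma lin_kernel_cont: "continuous_on TI (\<lambda>s. a s / e * exp (- \<alpha> s) * w s)"
 by (intro continuous_intros a_cont alpha_cont w) simp

lemma lin_deriv:
 assumes t: "t \<in> TI"
 shows "((\<lambda>t. lin w t - w t) has_real_derivative a t / e * lin w t) (at t within TI)"
proof -
 have "((\<lambda>t. exp (\<alpha> t) * integral {- (1/2)..t} (\<lambda>s. a s / e * exp (- \<alpha> s) * w s)) has_real_derivative
   exp (\<alpha> t) * (a t / e) * integral {- (1/2)..t} (\<lambda>s. a s / e * exp (- \<alpha> s) * w s)
   + exp (\<alpha> t) * (a t / e * exp (- \<alpha> t) * w t)) (at t within TI)"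
  by (rule derivative_eq_intros alpha_deriv[OF t] integral_has_derivative_within[OF lin_kernel_cont t] refl)+ simp
 moreover have "exp (\<alpha> t) * (a t / e) * integral {- (1/2)..t} (\<lambda>s. a s / e * exp (- \<alpha> s) * w s)
   + exp (\<alpha> t) * (a t / e * exp (- \<alpha> t) * w t) = a t / e * lin w t"
  by (simp add: lin_def exp_minus field_simps)
 ultimately show ?thesis by (simp add: lin_def)
qed

lemma lin_cont: "continuous_on TI (lin w)"
 unfolding lin_def[abs_def]
 by (intro continuous_intros w alpha_cont DERIV_continuous_on[OF integral_has_derivative_within[OF lin_kernel_cont]])

lemma lin_wint:
 assumes t: "t \<in> TI" and w0: "w (- (1/2)) = 0"
 shows "lin w t = wint (\<lambda>s. exp (\<alpha> t - \<alpha> s)) (\<lambda>s. - (a s / e) * exp (\<alpha> t - \<alpha> s)) (- (1/2)) t w"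
proof -
 have "(\<lambda>s. - (a s / e) * exp (\<alpha> t - \<alpha> s) * w s) = (\<lambda>s. - exp (\<alpha> t) * (a s / e * exp (- \<alpha> s) * w s))"
  by (auto simp: fun_eq_iff exp_diff exp_minus field_simps)
 then have "integral {- (1/2)..t} (\<lambda>s. - (a s / e) * exp (\<alpha> t - \<alpha> s) * w s)
   = - exp (\<alpha> t) * integral {- (1/2)..t} (\<lambda>s. a s / e * exp (- \<alpha> s) * w s)"
  by (simp only: integral_mult_right)
 then show ?thesis by (simp add: lin_def wint_def w0)
qed

text \<open>Over a time of length \<open>e / (2 * N)\<close> the drift changes \<open>lin\<close> by
  at most half of its maximum, which is absorbed on the left; the rest is the value at the start and
  the oscillation of the noise.\<close>

lemma lin_local_sup:
 assumes N: "0 < N" and st: "- (1/2) <= \<tau>" "\<tau>' <= 1/2" and len: "\<tau>' - \<tau> <= e / (2 * N)"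
  and osc: "\<And>t. t \<in> {\<tau>..\<tau>'} \<Longrightarrow> \<bar>w t - w \<tau>\<bar> <= r" and t: "t \<in> {\<tau>..\<tau>'}"
 shows "\<bar>lin w t\<bar> <= 2 * (\<bar>lin w \<tau>\<bar> + r)"
proof -
 have sub: "{\<tau>..\<tau>'} \<subseteq> TI" using st by auto
 have "continuous_on {\<tau>..\<tau>'} (\<lambda>t. \<bar>lin w t\<bar>)"
  by (intro continuous_intros continuous_on_subset[OF lin_cont sub])
 then obtain m where m: "m \<in> {\<tau>..\<tau>'}" "\<And>s. s \<in> {\<tau>..\<tau>'} \<Longrightarrow> \<bar>lin w s\<bar> <= \<bar>lin w m\<bar>"
  using continuous_attains_sup[of "{\<tau>..\<tau>'}" "\<lambda>t. \<bar>lin w t\<bar>"] t by auto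
 let ?S = "\<bar>lin w m\<bar>"
 have "norm ((lin w m - w m) - (lin w \<tau> - w \<tau>)) <= (N / e * ?S) * norm (m - \<tau>)"
 proof (rule field_differentiable_bound[where S = "{\<tau>..\<tau>'}"])
  fix s assume s: "s \<in> {\<tau>..\<tau>'}"
  show "((\<lambda>t. lin w t - w t) has_field_derivative a s / e * lin w s) (at s within {\<tau>..\<tau>'})"
   by (rule DERIV_subset[OF lin_deriv sub]) (use s sub in auto)
  have "\<bar>a s\<bar> / e * \<bar>lin w s\<bar> <= N / e * ?S"
   by (intro mult_mono divide_right_mono a_bound m(2) s) (use s sub eps_pos N in auto)
  then show "norm (a s / e * lin w s) <= N / e * ?S" using eps_pos by (simp add: abs_mult)
 qed (use m t in auto)
 also have "(N / e * ?S) * norm (m - \<tau>) <= (N / e * ?S) * (e / (2 * N))"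
  by (intro mult_left_mono) (use m len N eps_pos in auto)
 also have "... = ?S / 2" using N by simp
 finally have "?S <= 2 * (\<bar>lin w \<tau>\<bar> + r)" using osc[OF m(1)] by (auto simp: abs_if split: if_splits)
 then show ?thesis using m(2)[OF t] by linarith
qed

end

text \<open>Isometry: this is the variance of \<open>lin\<close> at time \<open>t\<close> when it is
  driven by a Brownian path.\<close>

lemma exp_alpha_sq_integral: "t \<in> TI \<Longrightarrow> integral {- (1/2)..t} (\<lambda>s. (exp (\<alpha> t - \<alpha> s))\<^sup>2) = e * vt t"
proof -
 assume t: "t \<in> TI"
 have "(\<lambda>s. (exp (\<alpha> t - \<alpha> s))\<^sup>2) = (\<lambda>s. (e * exp (2 * \<alpha> t)) * (exp (- 2 * \<alpha> s) / e))"
  by (auto simp: fun_eq_iff exp_diff power_divide exp_double[symmetric] exp_minus field_simps)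
 then show ?thesis unfolding vt_def by (simp only: integral_mult_right mult.assoc)
qed

lemma vt_pos: assumes "- (1/2) < t" "t <= 1/2" shows "0 < vt t"
proof -
 have sub: "{- (1/2)..t} \<subseteq> TI" using assms by auto
 have "((\<lambda>s. exp (- 2 * \<alpha> s) / e) has_integral integral {- (1/2)..t} (\<lambda>s. exp (- 2 * \<alpha> s) / e)) (cbox (- (1/2)) t)"
  unfolding cbox_interval
  by (intro integrable_integral integrable_continuous_real continuous_intros continuous_on_subset[OF alpha_cont sub]) simp
 note hi = this
 have "integral {- (1/2)..t} (\<lambda>s. exp (- 2 * \<alpha> s) / e) \<noteq> 0"
 proof
  assume z: "integral {- (1/2)..t} (\<lambda>s. exp (- 2 * \<alpha> s) / e) = 0"
  have "exp (- 2 * \<alpha> t) / e = 0"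
  proof (rule has_integral_0_cbox_imp_0[OF _ _ hi[unfolded z]])
   show "continuous_on (cbox (- (1/2)) t) (\<lambda>s. exp (- 2 * \<alpha> s) / e)"
    unfolding cbox_interval
    by (intro continuous_intros continuous_on_subset[OF alpha_cont sub]) simp
  qed (use assms eps_pos in auto)
  then show False by simp
 qed
 moreover have "0 <= integral {- (1/2)..t} (\<lambda>s. exp (- 2 * \<alpha> s) / e)"
  by (intro hk_nonneg integrable_continuous_real continuous_intros continuous_on_subset[OF alpha_cont sub])
    (use eps_pos in auto)
 ultimately have "0 < integral {- (1/2)..t} (\<lambda>s. exp (- 2 * \<alpha> s) / e)" by linarith
 then show ?thesis unfolding vt_def by (intro mult_pos_pos) auto
qed

end

section \<open>The linear process\<close>

locale noisy_well = linear_well + standard_brownian_motion M "- (1/2)" W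
 for M :: "'w measure" and W +
 fixes \<sigma> :: real
 assumes sigma_ne: "\<sigma> \<noteq> 0"
begin

definition \<zeta> :: "real \<Rightarrow> 'w \<Rightarrow> real" where
 "\<zeta> t w = \<sigma> / sqrt e * lin (\<lambda>t. W t w) t"

lemma W_cont: "w \<in> space M \<Longrightarrow> continuous_on TI (\<lambda>t. W t w)"
 by (rule path_cont) auto

lemma W_start: "w \<in> space M \<Longrightarrow> W (- (1/2)) w = 0"
 by (rule BM_start)

lemma zeta_start: "w \<in> space M \<Longrightarrow> \<zeta> (- (1/2)) w = 0"
 using W_start by (simp add: \<zeta>_def)

lemma zeta_cont: "w \<in> space M \<Longrightarrow> continuous_on TI (\<lambda>t. \<zeta> t w)"
 unfolding \<zeta>_def by (intro continuous_intros lin_cont W_cont)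

lemma lin_normal:
 assumes t: "- (1/2) < t" "t <= 1/2"
 shows "distributed M lborel (\<lambda>w. lin (\<lambda>t. W t w) t) (normal_density 0 (sqrt (e * vt t)))"
proof -
 have tI: "t \<in> TI" and sub: "{- (1/2)..t} \<subseteq> TI" using t by auto
 let ?g = "\<lambda>s. exp (\<alpha> t - \<alpha> s)" and ?g' = "\<lambda>s. - (a s / e) * exp (\<alpha> t - \<alpha> s)"
 have I: "integral {- (1/2)..t} (\<lambda>s. (?g s)\<^sup>2) = e * vt t" by (rule exp_alpha_sq_integral[OF tI])
 have d: "(?g has_real_derivative ?g' s) (at s within {- (1/2)..t})" if "s \<in> {- (1/2)..t}" for s
 proof (rule DERIV_subset[OF _ sub])
  have "s \<in> TI" using that sub by auto
  from DERIV_chain2[OF DERIV_exp DERIV_diff[OF DERIV_const alpha_deriv[OF this]], of "\<alpha> t"]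
  show "(?g has_real_derivative ?g' s) (at s within TI)" by (simp add: ac_simps)
 qed
 have c: "continuous_on {- (1/2)..t} ?g'"
  by (intro continuous_intros continuous_on_subset[OF a_cont sub] continuous_on_subset[OF alpha_cont sub]) simp
 have "distributed M lborel (\<lambda>w. wint ?g ?g' (- (1/2)) t (\<lambda>t. W t w)) (normal_density 0 (sqrt (e * vt t)))"
  using wint_normal[OF order_refl _ d c] vt_pos[OF t] eps_pos t unfolding I by simp
 moreover have "distr M lborel (\<lambda>w. lin (\<lambda>t. W t w) t) = distr M lborel (\<lambda>w. wint ?g ?g' (- (1/2)) t (\<lambda>t. W t w))"
  by (rule distr_cong) (auto simp: lin_wint[OF W_cont tI W_start])
 moreover have "(\<lambda>w. lin (\<lambda>t. W t w) t) \<in> borel_measurable M"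
  using distributed_measurable[OF calculation(1)] lin_wint[OF W_cont tI W_start]
  by (subst measurable_cong[where g = "\<lambda>w. wint ?g ?g' (- (1/2)) t (\<lambda>t. W t w)"]) auto
 ultimately show ?thesis unfolding distributed_def by simp
qed

lemma lin_measurable: assumes "t \<in> TI" shows "(\<lambda>w. lin (\<lambda>t. W t w) t) \<in> borel_measurable M"
proof (cases "t = - (1/2)")
 case True
 then show ?thesis using BM_measurable[of "- (1/2)"] by simp
next
 case False
 then show ?thesis using distributed_measurable[OF lin_normal[of t]] assms by auto
qed

lemma zeta_measurable [measurable]: "t \<in> TI \<Longrightarrow> \<zeta> t \<in> borel_measurable M"
 unfolding \<zeta>_def[abs_def] using lin_measurable by measurable

lemma zeta_moment:
 assumes t: "t \<in> TI"
 shows "integrable M (\<lambda>w. \<zeta> t w ^ j)"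
  and "0 < k \<Longrightarrow> expectation (\<lambda>w. \<zeta> t w ^ (2 * k)) <= fact (2 * k) / (2 ^ k * fact k) * (\<sigma>^2 * vt t) ^ k"
proof -
 have "integrable M (\<lambda>w. \<zeta> t w ^ j) \<and>
   (0 < k \<longrightarrow> expectation (\<lambda>w. \<zeta> t w ^ (2 * k)) <= fact (2 * k) / (2 ^ k * fact k) * (\<sigma>^2 * vt t) ^ k)"
 \<comment> \<open>At the initial time the process vanishes and has no normal density, so the
   Gaussian formulas do not apply.\<close>
 proof (cases "t = - (1/2)")
  case True
  have i: "integrable M (\<lambda>w. \<zeta> t w ^ j)"
   by (rule Bochner_Integration.integrable_cong[THEN iffD1, of _ _ "\<lambda>_. 0 ^ j"]) (auto simp: True zeta_start)
  have "expectation (\<lambda>w. \<zeta> t w ^ (2 * k)) = expectation (\<lambda>_. 0 ^ (2 * k))"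
   by (rule Bochner_Integration.integral_cong) (auto simp: True zeta_start)
  then show ?thesis using i by (auto simp: vt_def True power_0_left)
 next
  case False
  then have t': "- (1/2) < t" "t <= 1/2" using t by auto
  have v: "0 < e * vt t" using vt_pos[OF t'] eps_pos by simp
  note n = normal_moment[OF lin_normal[OF t'] v]
  have i: "integrable M (\<lambda>w. \<zeta> t w ^ j)"
   unfolding \<zeta>_def power_mult_distrib by (intro integrable_mult_right n)
  have "expectation (\<lambda>w. \<zeta> t w ^ (2 * k)) = (\<sigma> / sqrt e) ^ (2 * k) * (fact (2 * k) / (2 ^ k * fact k) * (e * vt t) ^ k)"
   unfolding \<zeta>_def power_mult_distrib by (simp only: integral_mult_right_zero n(1) power_mult_distrib)
  also have "(\<sigma> / sqrt e) ^ (2 * k) = (\<sigma>^2 / e) ^ k"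
   using eps_pos by (simp add: power_mult power_divide)
  also have "(\<sigma>^2 / e) ^ k * (fact (2 * k) / (2 ^ k * fact k) * (e * vt t) ^ k)
    = fact (2 * k) / (2 ^ k * fact k) * ((\<sigma>^2 / e) * (e * vt t)) ^ k"
   by (simp only: power_mult_distrib mult_ac)
  also have "(\<sigma>^2 / e) * (e * vt t) = \<sigma>^2 * vt t" by simp
  finally show ?thesis using i by simp
 qed
 then show "integrable M (\<lambda>w. \<zeta> t w ^ j)"
  "0 < k \<Longrightarrow> expectation (\<lambda>w. \<zeta> t w ^ (2 * k)) <= fact (2 * k) / (2 ^ k * fact k) * (\<sigma>^2 * vt t) ^ k" by auto
qed

lemma zeta_tail:
 assumes t: "t \<in> TI" and y: "0 < y" and x: "\<sigma>^2 * vt t * x <= y^2"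
 shows "prob {w\<in>space M. y < \<bar>\<zeta> t w\<bar>} <= 2 * exp (- (x / 4))"
proof (cases "t = - (1/2)")
 case True
 then have "{w\<in>space M. y < \<bar>\<zeta> t w\<bar>} = {}" using y by (auto simp: zeta_start)
 then show ?thesis by (simp only: measure_empty) simp
next
 case False
 then have t': "- (1/2) < t" "t <= 1/2" using t by auto
 have v: "0 < vt t" using vt_pos[OF t'] .
 define r where "r = y * sqrt e / \<bar>\<sigma>\<bar>"
 have r: "0 <= r" using y eps_pos by (simp add: r_def)
 have "prob {w\<in>space M. y < \<bar>\<zeta> t w\<bar>} <= prob {w\<in>space M. r <= \<bar>lin (\<lambda>t. W t w) t\<bar>}"
 proof (rule finite_measure_mono)
  show "{w\<in>space M. y < \<bar>\<zeta> t w\<bar>} \<subseteq> {w\<in>space M. r <= \<bar>lin (\<lambda>t. W t w) t\<bar>}"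
   using sigma_ne eps_pos by (auto simp: \<zeta>_def r_def abs_mult field_simps)
  show "{w\<in>space M. r <= \<bar>lin (\<lambda>t. W t w) t\<bar>} \<in> sets M"
   using lin_measurable[OF t] by measurable
 qed
 also have "... <= 2 * exp (- (r^2 / (4 * (e * vt t))))"
  by (rule normal_tail[OF lin_normal[OF t'] _ r]) (use v eps_pos in simp)
 also have "r^2 / (4 * (e * vt t)) = y^2 / (\<sigma>^2 * vt t) / 4"
  using eps_pos v sigma_ne by (simp add: r_def power_divide power_mult_distrib field_simps)
 also have "2 * exp (- (y^2 / (\<sigma>^2 * vt t) / 4)) <= 2 * exp (- (x / 4))"
 proof -
  have "0 < \<sigma>^2 * vt t" using sigma_ne v by simp
  then have "x <= y^2 / (\<sigma>^2 * vt t)" using x by (simp add: pos_le_divide_eq mult.commute)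
  then show ?thesis by simp
 qed
 finally show ?thesis .
qed

text \<open>The period is cut into about \<open>2 * N / e\<close> cells, which is where the
  prefactor of order \<open>1 / e\<close> in the probabilities comes from. On each cell the left
  endpoint value and the oscillation of the noise are each allowed \<open>1/8\<close> of
  \<open>\<psi>\<close>; \<open>lin_local_sup\<close> doubles their sum and \<open>ratio\<close>
  covers the change of \<open>\<psi>\<close>. The oscillation has the worse exponent, with
  \<open>2048 = 64 * 64 / 2\<close>.\<close>

lemma zeta_sup:
 assumes N: "0 < N" "e <= N" and psi: "\<And>t. t \<in> TI \<Longrightarrow> 0 < \<psi> t"
  and ratio: "\<And>s t. s \<in> TI \<Longrightarrow> t \<in> TI \<Longrightarrow> \<bar>s - t\<bar> <= e / (2 * N) \<Longrightarrow> \<psi> s <= 2 * \<psi> t"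
  and var: "\<And>t. t \<in> TI \<Longrightarrow> \<sigma>\<^sup>2 * vt t * x <= (\<psi> t)^2"
  and noise: "\<And>t. t \<in> TI \<Longrightarrow> \<sigma>\<^sup>2 * x <= N * (\<psi> t)^2" and x: "0 <= x"
 obtains B where "B \<in> sets M" "prob B <= 3 * (exp 16 + 6) * (N / e) * exp (- (x / 2048))"
  "\<And>w t. w \<in> space M - B \<Longrightarrow> t \<in> TI \<Longrightarrow> \<bar>\<zeta> t w\<bar> <= \<psi> t"
proof -
 define n where "n = nat \<lceil>2 * N / e\<rceil>"
 have q: "0 < 2 * N / e" using N eps_pos by simp
 have n_ge: "2 * N / e <= real n" unfolding n_def using q by linarith
 have n_pos: "0 < n" using n_ge q by (cases n) auto
 have n_le: "real n <= 3 * (N / e)"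
 proof -
  have "real n <= 2 * N / e + 1" unfolding n_def using q by linarith
  moreover have "1 <= N / e" using N eps_pos by (simp add: field_simps)
  ultimately show ?thesis by simp
 qed
 define \<tau> where "\<tau> = grid (- (1/2)) (1/2) n"
 have tau_mem: "\<tau> i \<in> TI" if "i <= n" for i
  using grid_mem[of "- (1/2)" "1/2" i n] n_pos that by (simp add: \<tau>_def)
 have tau_step: "\<tau> (Suc i) - \<tau> i = 1 / n" for i by (simp add: \<tau>_def grid_Suc)
 have inv_n: "1 / real n <= e / (2 * N)"
  using n_ge n_pos N eps_pos by (simp add: field_simps)
 define r where "r i = \<psi> (\<tau> i) * sqrt e / (8 * \<bar>\<sigma>\<bar>)" for i
 have r_pos: "0 < r i" if "i < n" for i
  using psi[OF tau_mem, of i] that eps_pos sigma_ne by (simp add: r_def)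
 have "\<exists>B. B \<in> sets M \<and> prob B <= (exp 16 + 4) * exp (- ((r i)^2 / (64 * (\<tau> (Suc i) - \<tau> i)))) \<and>
   (\<forall>w u. w \<in> space M - B \<longrightarrow> u \<in> {\<tau> i..\<tau> (Suc i)} \<longrightarrow> \<bar>W u w - W (\<tau> i) w\<bar> <= r i)" if i: "i < n" for i
 proof -
  have "- (1/2) <= \<tau> i" using tau_mem[of i] i by auto
  moreover have "0 < \<tau> (Suc i) - \<tau> i" unfolding tau_step using n_pos by simp
  then have "\<tau> i < \<tau> (Suc i)" by simp
  ultimately show ?thesis using oscillation_bound[of "\<tau> i" "\<tau> (Suc i)" "r i"] r_pos[OF i] by metis
 qed
 then obtain Os where Os: "\<And>i. i < n \<Longrightarrow> Os i \<in> sets M"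
  "\<And>i. i < n \<Longrightarrow> prob (Os i) <= (exp 16 + 4) * exp (- ((r i)^2 / (64 * (\<tau> (Suc i) - \<tau> i))))"
  "\<And>i w u. i < n \<Longrightarrow> w \<in> space M - Os i \<Longrightarrow> u \<in> {\<tau> i..\<tau> (Suc i)} \<Longrightarrow> \<bar>W u w - W (\<tau> i) w\<bar> <= r i"
  by metis
 define P where "P i = {w\<in>space M. \<psi> (\<tau> i) / 8 < \<bar>\<zeta> (\<tau> i) w\<bar>}" for i
 have Pm: "P i \<in> sets M" if "i < n" for i
 proof -
  have [measurable]: "\<zeta> (\<tau> i) \<in> borel_measurable M" using zeta_measurable[OF tau_mem] that by simp
  show ?thesis unfolding P_def by measurable
 qed
 have pP: "prob (P i) <= 2 * exp (- (x / 2048))" if i: "i < n" for i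
 proof -
  have "prob (P i) <= 2 * exp (- (x / 64 / 4))"
   unfolding P_def
   by (rule zeta_tail) (use var[OF tau_mem, of i] psi[OF tau_mem, of i] tau_mem[of i] i in \<open>auto simp: power_divide\<close>)
  also have "... <= 2 * exp (- (x / 2048))" using x by simp
  finally show ?thesis .
 qed
 have pO: "prob (Os i) <= (exp 16 + 4) * exp (- (x / 2048))" if i: "i < n" for i
 proof -
  have "x / 2048 <= (r i)^2 / (64 * (\<tau> (Suc i) - \<tau> i))"
  proof -
   have "(r i)^2 / (64 * (\<tau> (Suc i) - \<tau> i)) = (\<psi> (\<tau> i))^2 * e * n / (4096 * \<sigma>^2)"
    unfolding tau_step r_def using eps_pos n_pos by (simp add: power_divide power_mult_distrib field_simps)
   also have "... \<ge> (\<psi> (\<tau> i))^2 * e * (2 * N / e) / (4096 * \<sigma>^2)"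
    by (intro divide_right_mono mult_left_mono n_ge) (use eps_pos in auto)
   also have "(\<psi> (\<tau> i))^2 * e * (2 * N / e) / (4096 * \<sigma>^2) = (N * (\<psi> (\<tau> i))^2) / (2048 * \<sigma>^2)"
    using eps_pos by (simp add: field_simps)
   also have "... \<ge> (\<sigma>^2 * x) / (2048 * \<sigma>^2)"
    by (intro divide_right_mono noise tau_mem) (use i in auto)
   also have "(\<sigma>^2 * x) / (2048 * \<sigma>^2) = x / 2048" using sigma_ne by simp
   finally show ?thesis by simp
  qed
  then have "exp (- ((r i)^2 / (64 * (\<tau> (Suc i) - \<tau> i)))) <= exp (- (x / 2048))" by simp
  then have "(exp 16 + 4) * exp (- ((r i)^2 / (64 * (\<tau> (Suc i) - \<tau> i)))) <= (exp 16 + 4) * exp (- (x / 2048))"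
   by (intro mult_left_mono) auto
  then show ?thesis using Os(2)[OF i] by linarith
 qed
 define B where "B = (\<Union>i<n. P i \<union> Os i)"
 show ?thesis
 proof (rule that[of B])
  show "B \<in> sets M" unfolding B_def using Pm Os(1) by (intro sets.finite_UN sets.Un) auto
  have "prob B <= (\<Sum>i<n. prob (P i \<union> Os i))"
   unfolding B_def by (rule finite_measure_subadditive_finite) (use Pm Os(1) in auto)
  also have "... <= (\<Sum>i<n. (exp 16 + 6) * exp (- (x / 2048)))"
  proof (rule sum_mono)
   fix i assume "i \<in> {..<n}"
   then have i: "i < n" by simp
   have "prob (P i \<union> Os i) <= prob (P i) + prob (Os i)" by (rule measure_Un_le[OF Pm[OF i] Os(1)[OF i]])
   also have "... <= (exp 16 + 6) * exp (- (x / 2048))" using pP[OF i] pO[OF i] by (simp add: algebra_simps)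
   finally show "prob (P i \<union> Os i) <= (exp 16 + 6) * exp (- (x / 2048))" .
  qed
  also have "... = real n * ((exp 16 + 6) * exp (- (x / 2048)))" by simp
  also have "... <= 3 * (N / e) * ((exp 16 + 6) * exp (- (x / 2048)))"
   by (intro mult_right_mono n_le) (auto intro: add_nonneg_nonneg)
  finally show "prob B <= 3 * (exp 16 + 6) * (N / e) * exp (- (x / 2048))" by (simp add: algebra_simps)
  fix w t assume w: "w \<in> space M - B" and t: "t \<in> TI"
  \<comment> \<open>The minimum with \<open>n - 1\<close> assigns the right end of the period to the
    last cell.\<close>
  define i where "i = min (nat \<lfloor>(t + 1/2) * n\<rfloor>) (n - 1)"
  have i: "i < n" using n_pos by (auto simp: i_def)
  have tau_eq: "\<tau> j = - (1/2) + j / n" for j by (simp add: \<tau>_def grid_def)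
  have t_in: "t \<in> {\<tau> i..\<tau> (Suc i)}"
  proof (cases "nat \<lfloor>(t + 1/2) * n\<rfloor> <= n - 1")
   case True
   then have ii: "real i = of_int \<lfloor>(t + 1/2) * n\<rfloor>" using t by (simp add: i_def)
   have "real i <= (t + 1/2) * n" "(t + 1/2) * n <= real i + 1" unfolding ii by linarith+
   then show ?thesis using n_pos by (auto simp: tau_eq field_simps)
  next
   case False
   then have ii: "i = n - 1" by (simp add: i_def)
   have "real n - 1 <= (t + 1/2) * n"
   proof -
    have "int (n - 1) < \<lfloor>(t + 1/2) * n\<rfloor>" using False by linarith
    then have "real_of_int (int (n - 1)) <= (t + 1/2) * n" by linarith
    then show ?thesis using n_pos by (simp add: of_nat_diff)
   qed
   moreover have "(t + 1/2) * n <= 1 * real n" by (intro mult_right_mono) (use t in auto)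
   ultimately show ?thesis using n_pos ii by (auto simp: tau_eq field_simps of_nat_diff)
  qed
  have sp: "w \<in> space M" and nP: "w \<notin> P i" and nO: "w \<in> space M - Os i" using w i by (auto simp: B_def)
  have "\<bar>lin (\<lambda>t. W t w) t\<bar> <= 2 * (\<bar>lin (\<lambda>t. W t w) (\<tau> i)\<bar> + r i)"
  proof (rule lin_local_sup[OF W_cont[OF sp] N(1) _ _ _ _ t_in])
   show "- (1/2) <= \<tau> i" "\<tau> (Suc i) <= 1/2" using tau_mem[of i] tau_mem[of "Suc i"] i by auto
   show "\<tau> (Suc i) - \<tau> i <= e / (2 * N)" unfolding tau_step by (rule inv_n)
  qed (use Os(3)[OF i nO] in auto)
  then have "\<bar>\<sigma>\<bar> / sqrt e * \<bar>lin (\<lambda>t. W t w) t\<bar> <= \<bar>\<sigma>\<bar> / sqrt e * (2 * (\<bar>lin (\<lambda>t. W t w) (\<tau> i)\<bar> + r i))"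
   by (intro mult_left_mono) (use eps_pos in auto)
  moreover have "\<bar>\<sigma>\<bar> / sqrt e * r i = \<psi> (\<tau> i) / 8" using eps_pos sigma_ne by (simp add: r_def)
  moreover have "\<bar>\<sigma>\<bar> / sqrt e * (2 * (\<bar>lin (\<lambda>t. W t w) (\<tau> i)\<bar> + r i))
    = 2 * (\<bar>\<sigma>\<bar> / sqrt e * \<bar>lin (\<lambda>t. W t w) (\<tau> i)\<bar> + \<bar>\<sigma>\<bar> / sqrt e * r i)"
   by (simp only: distrib_left mult.left_commute)
  moreover have "\<bar>\<zeta> s w\<bar> = \<bar>\<sigma>\<bar> / sqrt e * \<bar>lin (\<lambda>t. W t w) s\<bar>" for s
   using eps_pos by (simp add: \<zeta>_def abs_mult)
  ultimately have "\<bar>\<zeta> t w\<bar> <= 2 * (\<bar>\<zeta> (\<tau> i) w\<bar> + \<psi> (\<tau> i) / 8)" by metis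
  also have "... <= \<psi> (\<tau> i) / 2" using nP sp by (simp add: P_def)
  also have "... <= \<psi> t"
  proof -
   have "\<bar>\<tau> i - t\<bar> <= e / (2 * N)" using t_in tau_step[of i] inv_n by (auto simp: abs_le_iff)
   then show ?thesis using ratio[OF tau_mem[of i] t] i by simp
  qed
  finally show "\<bar>\<zeta> t w\<bar> <= \<psi> t" .
 qed
qed

end

section \<open>Nonlinear paths\<close>

lemma Cauchy_Schwarz_integral:
 fixes f g :: "real \<Rightarrow> real"
 assumes f: "continuous_on TI f" and g: "continuous_on TI g" and pos: "0 < integral TI (\<lambda>t. (g t)\<^sup>2)"
 shows "(integral TI (\<lambda>t. f t * g t))^2 <= integral TI (\<lambda>t. (f t)\<^sup>2) * integral TI (\<lambda>t. (g t)\<^sup>2)"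
proof -
 define A B S where "A = integral TI (\<lambda>t. (f t)\<^sup>2)" "B = integral TI (\<lambda>t. (g t)\<^sup>2)" "S = integral TI (\<lambda>t. f t * g t)"
 have i: "(\<lambda>t. (f t)\<^sup>2) integrable_on TI" "(\<lambda>t. (g t)\<^sup>2) integrable_on TI" "(\<lambda>t. f t * g t) integrable_on TI"
  by (rule integrable_continuous_real, intro continuous_intros f g)+
 have "((\<lambda>t. B\<^sup>2 * (f t)^2 - 2 * B * S * (f t * g t) + S^2 * (g t)^2) has_integral (B^2 * A - 2 * B * S * S + S^2 * B)) TI"
  unfolding A_B_S_def by (intro has_integral_add has_integral_diff has_integral_mult_right integrable_integral i)
 moreover have "B^2 * (f t)^2 - 2 * B * S * (f t * g t) + S^2 * (g t)^2 = (B * f t - S * g t)^2" for t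
  by (simp add: power2_eq_square algebra_simps)
 ultimately have "((\<lambda>t. (B * f t - S * g t)\<^sup>2) has_integral (B^2 * A - 2 * B * S * S + S^2 * B)) TI" by simp
 then have "0 <= B^2 * A - 2 * B * S * S + S^2 * B"
  by (rule has_integral_nonneg) simp
 also have "... = B * (A * B - S^2)" by (simp add: power2_eq_square algebra_simps)
 finally show ?thesis using pos unfolding A_B_S_def[symmetric] by (simp add: zero_le_mult_iff)
qed

lemma F_diff: "F (z + y) l - F z l = (1 - 3 * z^2) * y - 3 * z * y^2 - y ^ 3"
 by (simp add: F_def power2_eq_square power3_eq_cube algebra_simps)

lemma cubic_remainder_le:
 fixes z y :: real
 assumes z: "0 <= z" "z <= 3/2" and y: "\<bar>y\<bar> <= 1"
 shows "\<bar>3 * z * y^2 + y ^ 3\<bar> <= 6 * y^2"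
proof -
 have "3 * z * y^2 + y ^ 3 = (3 * z + y) * y^2"
  by (simp add: power2_eq_square power3_eq_cube algebra_simps)
 then have "\<bar>3 * z * y^2 + y ^ 3\<bar> = \<bar>3 * z + y\<bar> * y^2" by (simp add: abs_mult)
 also have "... <= 6 * y^2" by (intro mult_right_mono) (use assms in auto)
 finally show ?thesis .
qed

context linear_well
begin

text \<open>The order of integration is exchanged, so a weighted time integral of the process
  becomes a single Wiener integral; its kernel is the solution of the adjoint equation with final
  value 0.\<close>

lemma lin_area:
 assumes w: "continuous_on TI w" "w (- (1/2)) = 0" and h: "continuous_on TI h"
 shows "integral TI (\<lambda>t. h t * lin w t)
  = wint (\<lambda>s. exp (- \<alpha> s) * integral {s..1/2} (\<lambda>t. h t * exp (\<alpha> t)))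
    (\<lambda>s. - (a s / e) * (exp (- \<alpha> s) * integral {s..1/2} (\<lambda>t. h t * exp (\<alpha> t))) - h s) (- (1/2)) (1/2) w"
proof -
 let ?P = "\<lambda>s. integral {s..1/2} (\<lambda>t. h t * exp (\<alpha> t))"
 have hc: "continuous_on TI (\<lambda>t. h t * exp (\<alpha> t))" by (intro continuous_intros h alpha_cont)
 note kc = lin_kernel_cont[OF w(1)]
 have Pc: "continuous_on TI ?P"
  by (rule DERIV_continuous_on[OF integral_has_derivative_within'[OF hc]])
 have Jc: "continuous_on TI (\<lambda>t. integral {- (1/2)..t} (\<lambda>s. a s / e * exp (- \<alpha> s) * w s))"
  by (rule DERIV_continuous_on[OF integral_has_derivative_within[OF kc]])
 have "integral TI (\<lambda>t. h t * lin w t)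
   = integral TI (\<lambda>t. h t * w t) + integral TI (\<lambda>t. (h t * exp (\<alpha> t)) * integral {- (1/2)..t} (\<lambda>s. a s / e * exp (- \<alpha> s) * w s))"
  unfolding lin_def distrib_left mult.assoc[symmetric]
  by (intro hk_add integrable_continuous_real continuous_intros h w alpha_cont Jc[unfolded mult.assoc[symmetric]])
 also have "integral TI (\<lambda>t. (h t * exp (\<alpha> t)) * integral {- (1/2)..t} (\<lambda>s. a s / e * exp (- \<alpha> s) * w s))
  = integral TI (\<lambda>t. ?P t * (a t / e * exp (- \<alpha> t) * w t))"
  by (rule integral_by_parts_primitive[OF _ hc kc]) simp
 also have "integral TI (\<lambda>t. h t * w t) + ... = integral TI (\<lambda>t. h t * w t + ?P t * (a t / e * exp (- \<alpha> t) * w t))"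
  by (intro hk_add[symmetric] integrable_continuous_real continuous_on_mult Pc kc h w)
 also have "... = integral TI (\<lambda>s. - ((- (a s / e) * (exp (- \<alpha> s) * ?P s) - h s) * w s))"
  by (rule Henstock_Kurzweil_Integration.integral_cong) (simp add: algebra_simps)
 finally show ?thesis by (simp add: wint_def w(2))
qed

text \<open>Squared norm of the adjoint kernel, that is, the variance of the integral of
  \<open>h * lin\<close> under Brownian forcing.\<close>

definition D0var :: "(real \<Rightarrow> real) \<Rightarrow> real" where
 "D0var h = integral TI (\<lambda>s. (exp (- \<alpha> s) * integral {s..1/2} (\<lambda>t. h t * exp (\<alpha> t)))\<^sup>2)"

lemma adjoint_bound:
 assumes h: "continuous_on TI h" and hb: "\<And>t. t \<in> TI \<Longrightarrow> \<bar>h t\<bar> <= K * \<rho> t" and s: "s \<in> TI" and K: "0 <= K"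
 shows "\<bar>exp (- \<alpha> s) * integral {s..1/2} (\<lambda>t. h t * exp (\<alpha> t))\<bar> <= K * (exp C1 * e / c1)"
proof -
 have sub: "{s..1/2} \<subseteq> TI" using s by auto
 have "norm (integral {s..1/2} (\<lambda>t. h t * exp (\<alpha> t))) <= integral {s..1/2} (\<lambda>t. K * (\<rho> t * exp (\<alpha> t)))"
  by (rule Henstock_Kurzweil_Integration.integral_norm_bound_integral)
    (use hb sub in \<open>auto intro!: integrable_continuous_real continuous_intros continuous_on_subset[OF h sub]
     continuous_on_subset[OF alpha_cont sub] continuous_on_subset[OF rho_cont sub] simp: abs_mult mult.assoc[symmetric]\<close>)
 also have "... <= K * (exp C1 * e / c1 * exp (\<alpha> s))"
  unfolding integral_mult_right by (intro mult_left_mono adjoint_le s K)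
 finally have "exp (- \<alpha> s) * norm (integral {s..1/2} (\<lambda>t. h t * exp (\<alpha> t))) <= exp (- \<alpha> s) * (K * (exp C1 * e / c1 * exp (\<alpha> s)))"
  by (intro mult_left_mono) auto
 also have "... = K * (exp C1 * e / c1) * (exp (- \<alpha> s) * exp (\<alpha> s))" by simp
 also have "exp (- \<alpha> s) * exp (\<alpha> s) = 1" by (simp flip: exp_add)
 finally show ?thesis by (simp add: abs_mult)
qed

lemma D0var_le:
 assumes h: "continuous_on TI h" and hb: "\<And>t. t \<in> TI \<Longrightarrow> \<bar>h t\<bar> <= K * \<rho> t" and K: "0 <= K"
 shows "D0var h <= (K * (exp C1 * e / c1))^2"
proof -
 have hc: "continuous_on TI (\<lambda>t. h t * exp (\<alpha> t))" by (intro continuous_intros h alpha_cont)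
 have Pc: "continuous_on TI (\<lambda>s. integral {s..1/2} (\<lambda>t. h t * exp (\<alpha> t)))"
  by (rule DERIV_continuous_on[OF integral_has_derivative_within'[OF hc]])
 have "D0var h <= integral TI (\<lambda>s. (K * (exp C1 * e / c1))\<^sup>2)"
  unfolding D0var_def
 proof (rule hk_le)
  show "(\<lambda>s. (exp (- \<alpha> s) * integral {s..1/2} (\<lambda>t. h t * exp (\<alpha> t)))\<^sup>2) integrable_on TI"
   by (intro integrable_continuous_real continuous_intros alpha_cont Pc)
  show "(exp (- \<alpha> s) * integral {s..1/2} (\<lambda>t. h t * exp (\<alpha> t)))^2 <= (K * (exp C1 * e / c1))^2" if "s \<in> TI" for s
   using power_mono[OF adjoint_bound[OF h hb that K], of 2] by simp
 qed auto
 then show ?thesis by simp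
qed

text \<open>For impulses at times in \<open>{1/8..1/4}\<close> only the response during the
  following time \<open>e\<close> is kept: it stays inside the window where \<open>h >= b\<close>,
  and \<open>\<alpha>\<close> loses at most \<open>N\<close> there.\<close>

lemma D0var_ge:
 assumes h: "continuous_on TI h" and hpos: "\<And>t. t \<in> {1/8..1/2} \<Longrightarrow> 0 <= h t"
  and hlow: "\<And>t. t \<in> {1/8..3/8} \<Longrightarrow> b <= h t" and b: "0 <= b" and N: "0 < N" and eps: "e <= 1/8"
 shows "(b * e * exp (- N))^2 / 8 <= D0var h"
proof -
 have hc: "continuous_on TI (\<lambda>t. h t * exp (\<alpha> t))" by (intro continuous_intros h alpha_cont)
 let ?g = "\<lambda>s. exp (- \<alpha> s) * integral {s..1/2} (\<lambda>t. h t * exp (\<alpha> t))"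
 have Pc: "continuous_on TI (\<lambda>s. integral {s..1/2} (\<lambda>t. h t * exp (\<alpha> t)))"
  by (rule DERIV_continuous_on[OF integral_has_derivative_within'[OF hc]])
 have gc: "continuous_on TI (\<lambda>s. (?g s)\<^sup>2)" by (intro continuous_intros alpha_cont Pc)
 have low: "b * e * exp (- N) <= ?g s" if s: "s \<in> {1/8..1/4}" for s
 proof -
  have sub: "{s..s + e} \<subseteq> {s..1/2}" "{s..1/2} \<subseteq> TI" using s eps eps_pos by auto
  have al: "\<alpha> s - N <= \<alpha> t" if t: "t \<in> {s..s + e}" for t
  proof -
   have "norm (\<alpha> t - \<alpha> s) <= (N / e) * norm (t - s)"
    by (rule field_differentiable_bound[where S = TI and f' = "\<lambda>t. a t / e"])
      (use alpha_deriv a_bound eps_pos t s sub in \<open>auto simp: divide_right_mono abs_divide\<close>)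
   also have "... <= (N / e) * e" by (intro mult_left_mono) (use t N eps_pos in auto)
   finally show ?thesis by simp
  qed
  have "integral {s..s + e} (\<lambda>t. b * exp (\<alpha> s - N)) <= integral {s..s + e} (\<lambda>t. h t * exp (\<alpha> t))"
   by (intro hk_le integrable_continuous_real mult_mono hlow
     continuous_on_subset[OF hc])
     (use s eps sub al b in \<open>auto intro!: hpos\<close>)
  also have "... <= integral {s..1/2} (\<lambda>t. h t * exp (\<alpha> t))"
   by (intro integral_subset_le integrable_continuous_real continuous_on_subset[OF hc] sub)
     (use sub s hpos in auto)
  finally have "e * (b * exp (\<alpha> s - N)) <= integral {s..1/2} (\<lambda>t. h t * exp (\<alpha> t))"
   using eps_pos by (simp add: ac_simps)
  then have "exp (- \<alpha> s) * (e * (b * exp (\<alpha> s - N))) <= ?g s" by (intro mult_left_mono) auto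
  moreover have "exp (- \<alpha> s) * exp (\<alpha> s - N) = exp (- N)" by (simp flip: exp_add)
  ultimately show ?thesis by (simp add: algebra_simps)
 qed
 have "integral {1/8..1/4} (\<lambda>s::real. (b * e * exp (- N))\<^sup>2) <= integral {1/8..1/4} (\<lambda>s. (?g s)\<^sup>2)"
  by (intro hk_le integrable_continuous_real power_mono low continuous_on_subset[OF gc])
    (use b eps_pos in auto)
 also have "... <= D0var h" unfolding D0var_def
  by (intro integral_subset_le integrable_continuous_real continuous_on_subset[OF gc] gc) auto
 finally show ?thesis by simp
qed

end

text \<open>\<open>z\<close> is a reference curve with linearisation \<open>a\<close>, not yet tied
  to the equation: lower bounds on the path will ask for a subsolution, two-sided bounds for a
  solution. \<open>w\<close> is a frozen noise path of strength \<open>k\<close>.\<close>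

locale nonlinear_path = linear_well +
 fixes z z' l w X :: "real \<Rightarrow> real" and k x0 :: real
 assumes a_eq: "\<And>t. t \<in> TI \<Longrightarrow> a t = 1 - 3 * (z t)^2"
  and z_range: "\<And>t. t \<in> TI \<Longrightarrow> 0 <= z t \<and> z t <= 3/2"
  and z_deriv: "\<And>t. t \<in> TI \<Longrightarrow> (z has_real_derivative z' t) (at t within TI)"
  and l_cont: "continuous_on TI l" and w_cont: "continuous_on TI w"
  and X_cont: "continuous_on TI X"
  and X_eq: "\<And>t. t \<in> TI \<Longrightarrow> X t = x0 + 1 / e * integral {- (1/2)..t} (\<lambda>s. F (X s) (l s)) + k * w t"
  and w_start: "w (- (1/2)) = 0"
begin

text \<open>The noise cancels in this difference, which is therefore differentiable although the
  noise itself is not.\<close>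

definition u :: "real \<Rightarrow> real" where "u t = X t - z t - k * lin w t"

lemma z_cont: "continuous_on TI z" by (rule DERIV_continuous_on[OF z_deriv])

lemma FX_cont: "continuous_on TI (\<lambda>s. F (X s) (l s))"
 unfolding F_def by (intro continuous_intros X_cont l_cont)

lemma u_deriv:
 assumes t: "t \<in> TI"
 shows "(u has_real_derivative F (X t) (l t) / e - z' t - k * (a t / e * lin w t)) (at t within TI)"
proof -
 have "((\<lambda>t. x0 + 1 / e * integral {- (1/2)..t} (\<lambda>s. F (X s) (l s)) - z t - k * (lin w t - w t))
   has_real_derivative 0 + 1 / e * F (X t) (l t) - z' t - k * (a t / e * lin w t)) (at t within TI)"
  by (intro DERIV_diff DERIV_add DERIV_cmult DERIV_const z_deriv t lin_deriv w_cont
    integral_has_derivative_within[OF FX_cont])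
 then have "((\<lambda>t. x0 + 1 / e * integral {- (1/2)..t} (\<lambda>s. F (X s) (l s)) - z t - k * (lin w t - w t))
   has_real_derivative F (X t) (l t) / e - z' t - k * (a t / e * lin w t)) (at t within TI)" by simp
 then show ?thesis
  by (rule has_field_derivative_transform_within[OF _ zero_less_one t]) (simp add: u_def X_eq algebra_simps)
qed

lemma u_start: "u (- (1/2)) = x0 - z (- (1/2))"
 using X_eq[of "- (1/2)"] by (simp add: u_def w_start)

lemma eps_u':
 assumes t: "t \<in> TI"
 shows "e * (F (X t) (l t) / e - z' t - k * (a t / e * lin w t))
  = a t * u t - (3 * z t * (u t + k * lin w t)^2 + (u t + k * lin w t) ^ 3) + (F (z t) (l t) - e * z' t)"
proof -
 have "F (X t) (l t) - F (z t) (l t) = (1 - 3 * (z t)^2) * (u t + k * lin w t) - 3 * z t * (u t + k * lin w t)^2 - (u t + k * lin w t) ^ 3"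
  using F_diff[of "z t" "u t + k * lin w t" "l t"] by (simp add: u_def)
 then show ?thesis unfolding a_eq[OF t, symmetric] by (simp add: algebra_simps)
qed

lemma u_lower:
 assumes sub: "\<And>t. t \<in> TI \<Longrightarrow> e * z' t <= F (z t) (l t)"
  and zeta: "\<And>t. t \<in> TI \<Longrightarrow> \<bar>k * lin w t\<bar> <= \<eta>2 * \<rho> t"
  and start: "z (- (1/2)) - \<eta>1 * \<rho> (- (1/2)) < x0"
  and eta: "0 < \<eta>1" "12 * (exp (2 * C1) * \<eta>1^2 + \<eta>2^2) < \<eta>1 * c1 / 2"
  and small: "\<And>t. t \<in> TI \<Longrightarrow> (\<eta>1 * exp C1 + \<eta>2) * \<rho> t <= 1" and t: "t \<in> TI"
 shows "- (\<eta>1 * exp C1 * \<rho> t) < u t"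
proof (rule barrier_below[OF u_deriv _ zeta _ eta small t])
 fix t assume t: "t \<in> TI" and y: "\<bar>u t + k * lin w t\<bar> <= 1"
 show "a t * u t - 6 * (u t + k * lin w t)^2 <= e * (F (X t) (l t) / e - z' t - k * (a t / e * lin w t))"
  unfolding eps_u'[OF t] using cubic_remainder_le[of "z t" "u t + k * lin w t"] z_range[OF t] y sub[OF t] by linarith
qed (use start u_start in auto)

end

locale exact_path = nonlinear_path +
 assumes z_exact: "\<And>t. t \<in> TI \<Longrightarrow> e * z' t = F (z t) (l t)"
begin

definition rem :: "real \<Rightarrow> real" where
 "rem t = - (3 * z t * (u t + k * lin w t)^2 + (u t + k * lin w t) ^ 3)"

lemma u_ode: assumes t: "t \<in> TI" shows "(u has_real_derivative (a t * u t + rem t) / e) (at t within TI)"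
proof -
 have "F (X t) (l t) / e - z' t - k * (a t / e * lin w t) = (a t * u t + rem t) / e"
  using eps_u'[OF t] z_exact[OF t] eps_pos unfolding rem_def by (simp add: field_simps)
 then show ?thesis using u_deriv[OF t] by simp
qed

lemma u_cont: "continuous_on TI u" by (rule DERIV_continuous_on[OF u_ode])

lemma rem_cont: "continuous_on TI rem"
 unfolding rem_def by (intro continuous_intros z_cont u_cont lin_cont w_cont)

text \<open>The upper bound is the lower barrier applied to \<open>- u\<close> with noise
  \<open>- k * lin w\<close>: the estimate of the cubic remainder by a square does not depend on
  signs.\<close>

lemma u_bound:
 assumes zeta: "\<And>t. t \<in> TI \<Longrightarrow> \<bar>k * lin w t\<bar> <= \<eta>2 * \<rho> t"
  and start: "\<bar>x0 - z (- (1/2))\<bar> < \<eta>1 * \<rho> (- (1/2))"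
  and eta: "0 < \<eta>1" "12 * (exp (2 * C1) * \<eta>1^2 + \<eta>2^2) < \<eta>1 * c1 / 2"
  and small: "\<And>t. t \<in> TI \<Longrightarrow> (\<eta>1 * exp C1 + \<eta>2) * \<rho> t <= 1" and t: "t \<in> TI"
 shows "\<bar>u t\<bar> < \<eta>1 * exp C1 * \<rho> t"
proof -
 have "- (\<eta>1 * exp C1 * \<rho> t) < u t"
 proof (rule u_lower[OF _ zeta _ eta small t])
  show "z (- (1/2)) - \<eta>1 * \<rho> (- (1/2)) < x0" using start by linarith
 qed (use z_exact in auto)
 moreover have "- (\<eta>1 * exp C1 * \<rho> t) < - u t"
 proof (rule barrier_below[where u = "\<lambda>t. - u t" and u' = "\<lambda>t. - ((a t * u t + rem t) / e)"
    and \<zeta> = "\<lambda>t. - (k * lin w t)"])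
  show "((\<lambda>t. - u t) has_real_derivative - ((a t * u t + rem t) / e)) (at t within TI)" if "t \<in> TI" for t
   by (rule DERIV_minus[OF u_ode[OF that]])
  fix t assume t: "t \<in> TI" and y: "\<bar>- u t + - (k * lin w t)\<bar> <= 1"
  then have y: "\<bar>u t + k * lin w t\<bar> <= 1" by linarith
  have sq: "(- u t + - (k * lin w t))^2 = (u t + k * lin w t)^2" by (simp add: power2_eq_square algebra_simps)
  have "e * - ((a t * u t + rem t) / e) = - (a t * u t) - rem t" using eps_pos by simp
  then show "a t * - u t - 6 * (- u t + - (k * lin w t))^2 <= e * - ((a t * u t + rem t) / e)"
   unfolding sq rem_def using cubic_remainder_le[of "z t" "u t + k * lin w t"] z_range[OF t] y by linarith
 next
  show "- \<eta>1 * \<rho> (- (1/2)) < - u (- (1/2))" unfolding u_start using start by (simp add: abs_less_iff)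
  show "\<bar>- (k * lin w t)\<bar> <= \<eta>2 * \<rho> t" if "t \<in> TI" for t
   using zeta[OF that] by simp
 qed (fact eta small t)+
 ultimately show ?thesis by linarith
qed

end

section \<open>Remainder terms of second and third order in the noise\<close>

lemma mult_le_weighted_squares:
 fixes x y c :: real
 assumes "0 < c" shows "\<bar>x\<bar> * \<bar>y\<bar> <= (c * x^2 + y^2 / c) / 2"
proof -
 have "0 <= (c * \<bar>x\<bar> - \<bar>y\<bar>)^2 / c" using assms by simp
 also have "... = c * x^2 + y^2 / c - 2 * (\<bar>x\<bar> * \<bar>y\<bar>)"
  using assms by (simp add: power2_diff field_simps power2_eq_square)
 finally show ?thesis by simp
qed

lemma abs_cube_add_le:
 fixes x y :: real shows "\<bar>(x + y) ^ 3\<bar> <= 4 * (\<bar>x\<bar> ^ 3 + \<bar>y\<bar> ^ 3)"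
proof -
 have "\<bar>(x + y) ^ 3\<bar> <= (\<bar>x\<bar> + \<bar>y\<bar>) ^ 3"
  unfolding power_abs by (intro power_mono abs_triangle_ineq) auto
 also have "... <= 4 * (\<bar>x\<bar> ^ 3 + \<bar>y\<bar> ^ 3)"
 proof -
  have "0 <= 3 * ((\<bar>x\<bar> + \<bar>y\<bar>) * (\<bar>x\<bar> - \<bar>y\<bar>)^2)" by simp
  then show ?thesis unfolding power2_eq_square power3_eq_cube by (simp only: algebra_simps)
 qed
 finally show ?thesis .
qed

lemma abs_integral_mult_le:
 fixes f g h :: "real \<Rightarrow> real"
 assumes "continuous_on TI f" "continuous_on TI g" "continuous_on TI h"
  and "\<And>t. t \<in> TI \<Longrightarrow> \<bar>h t\<bar> <= K * g t"
 shows "\<bar>integral TI (\<lambda>t. h t * f t)\<bar> <= K * integral TI (\<lambda>t. g t * \<bar>f t\<bar>)"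
proof -
 have "norm (integral TI (\<lambda>t. h t * f t)) <= integral TI (\<lambda>t. K * (g t * \<bar>f t\<bar>))"
  by (rule Henstock_Kurzweil_Integration.integral_norm_bound_integral)
    (use assms in \<open>auto intro!: integrable_continuous_real continuous_intros mult_right_mono simp: abs_mult mult.assoc[symmetric]\<close>)
 then show ?thesis by simp
qed

text \<open>Remainder of the drift after its leading part \<open>- 3 * z * y^2\<close> has been
  removed, with \<open>x\<close> the nonlinear correction and \<open>y\<close> the noise. Mixed and
  cubic terms are split by Young's inequality with weight \<open>c * r\<close>, so only even powers
  of \<open>y\<close> remain, whose time integrals have computable moments. The parameter
  \<open>c\<close> is left free to balance the quartic against the quadratic term.\<close>

lemma cubic_remainder_diff_le:
 fixes x y z r c R :: real
 assumes z: "0 <= z \<and> z <= 3/2" and x1: "\<bar>x\<bar> <= 1/2"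
  and r0: "0 < r" and c: "0 < c" and cr: "1 <= c * r" and R: "r <= R"
 defines "e \<equiv> - (3 * z * (x + y)^2 + (x + y) ^ 3) + 3 * z * y^2"
 shows "\<bar>e\<bar> <= 14 * c * (r * x^2) + (7 / c * (y^2 / r) + 2 * c * R^2 * (y ^ 4 / r))"
proof -
  have r: "0 < r" "0 < c * r" using r0 c by auto
  have "e = - (3 * z * (x^2 + 2 * (x * y))) - (x + y) ^ 3"
   by (simp add: e_def power2_eq_square algebra_simps)
  then have "\<bar>e\<bar> <= \<bar>3 * z * (x^2 + 2 * (x * y))\<bar> + \<bar>(x + y) ^ 3\<bar>" by linarith
  moreover have "\<bar>3 * z * (x^2 + 2 * (x * y))\<bar> <= 9/2 * (x^2 + 2 * (\<bar>x\<bar> * \<bar>y\<bar>))"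
  proof -
   have "\<bar>3 * z * (x^2 + 2 * (x * y))\<bar> = 3 * z * \<bar>x^2 + 2 * (x * y)\<bar>"
    using z by (simp add: abs_mult)
   also have "... <= 9/2 * (x^2 + 2 * (\<bar>x\<bar> * \<bar>y\<bar>))"
   proof (rule mult_mono)
    have "\<bar>x^2 + 2 * (x * y)\<bar> <= \<bar>x^2\<bar> + \<bar>2 * (x * y)\<bar>" by (rule abs_triangle_ineq)
    then show "\<bar>x^2 + 2 * (x * y)\<bar> <= x^2 + 2 * (\<bar>x\<bar> * \<bar>y\<bar>)" by (simp add: abs_mult)
   qed (use z in auto)
   finally show ?thesis .
  qed
  moreover have "\<bar>(x + y) ^ 3\<bar> <= 2 * x^2 + 4 * (\<bar>y\<bar> * y^2)"
  proof -
   have "\<bar>(x + y) ^ 3\<bar> <= 4 * (\<bar>x\<bar> ^ 3 + \<bar>y\<bar> ^ 3)" by (rule abs_cube_add_le)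
   also have "\<bar>x\<bar> ^ 3 <= 1/2 * x^2"
   proof -
    have "\<bar>x\<bar> ^ 3 = \<bar>x\<bar> * x^2" by (simp add: power3_eq_cube power2_eq_square)
    also have "... <= 1/2 * x^2" by (intro mult_right_mono x1) auto
    finally show ?thesis .
   qed
   also have "\<bar>y\<bar> ^ 3 = \<bar>y\<bar> * y^2" by (simp add: power3_eq_cube power2_eq_square)
   finally show ?thesis by simp
  qed
  moreover have "x^2 <= c * r * x^2" using mult_right_mono[OF cr, of "x^2"] by simp
  moreover have "\<bar>x\<bar> * \<bar>y\<bar> <= (c * r * x^2 + y^2 / (c * r)) / 2"
   by (rule mult_le_weighted_squares[OF r(2)])
  moreover have "\<bar>y\<bar> * y^2 <= (c * R^2 * (y ^ 4 / r) + y^2 / (c * r)) / 2"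
  proof -
   have 2: "c * r * (y^2)^2 <= c * R^2 * (y ^ 4 / r)"
   proof -
    have "(r)^2 <= R^2" using R r by (intro power_mono) auto
    then have "c * (y ^ 4 / r) * (r)^2 <= c * (y ^ 4 / r) * R^2"
     by (intro mult_left_mono) (use c r in auto)
    moreover have "c * r * (y^2)^2 = c * (y ^ 4 / r) * (r)^2"
     using r by (simp add: power2_eq_square power4_eq_xxxx)
    moreover have "c * (y ^ 4 / r) * R^2 = c * R^2 * (y ^ 4 / r)" by simp
    ultimately show ?thesis by linarith
   qed
   have "\<bar>y\<bar> * y^2 = \<bar>y^2\<bar> * \<bar>y\<bar>" by simp
   also have "... <= (c * r * (y^2)^2 + y^2 / (c * r)) / 2" by (rule mult_le_weighted_squares[OF r(2)])
   also have "... <= (c * R^2 * (y ^ 4 / r) + y^2 / (c * r)) / 2"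
    by (intro divide_right_mono add_right_mono 2) simp
   finally show ?thesis .
  qed
  moreover have "0 <= c * r * x^2" and "0 <= y^2 / (c * r)" using r by auto
  moreover have comb: "e' <= 14 * P + 7 * S + 2 * T"
   if "e' <= A + B" "A <= 9/2 * (Q + 2 * G)" "B <= 2 * Q + 4 * H" "Q <= P" "G <= (P + S) / 2" "H <= (T + S) / 2" "0 <= P" "0 <= S"
   for e' A B Q G H P S T :: real using that by argo
  ultimately have "\<bar>e\<bar> <= 14 * (c * r * x^2) + 7 * (y^2 / (c * r)) + 2 * (c * R^2 * (y ^ 4 / r))"
   by (intro comb)
  then show ?thesis by (simp add: ac_simps)
qed

context exact_path
begin

lemma zeta_cont: "continuous_on TI (\<lambda>t. k * lin w t)"
 by (intro continuous_intros lin_cont w_cont)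

context
 fixes \<eta> :: real
 assumes ub: "\<And>t. t \<in> TI \<Longrightarrow> \<bar>u t\<bar> <= \<eta> * \<rho> t"
  and zb: "\<And>t. t \<in> TI \<Longrightarrow> \<bar>k * lin w t\<bar> <= \<eta> * \<rho> t"
  and small: "\<And>t. t \<in> TI \<Longrightarrow> \<eta> * \<rho> t <= 1/2"
  and eta: "24 * \<eta> * exp C1 <= c1" and eta_nonneg: "0 <= \<eta>"
  and x0: "x0 = z (- (1/2))"
begin

lemma u0: "u (- (1/2)) = 0" using u_start x0 by simp

lemma y_le_1: "t \<in> TI \<Longrightarrow> \<bar>u t + k * lin w t\<bar> <= 1"
 using ub[of t] zb[of t] small[of t] by linarith

lemma rem_le: assumes t: "t \<in> TI" shows "\<bar>rem t\<bar> <= 12 * (u t)^2 + 12 * (k * lin w t)^2"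
proof -
 have "\<bar>rem t\<bar> <= 6 * (u t + k * lin w t)^2"
  unfolding rem_def abs_minus_cancel using cubic_remainder_le z_range[OF t] y_le_1[OF t] by blast
 also have "... <= 6 * (2 * (u t)^2 + 2 * (k * lin w t)^2)"
  using sum_squares_bound[of "u t" "k * lin w t"] by (simp add: power2_sum)
 finally show ?thesis by simp
qed

lemma u_sq_le: assumes t: "t \<in> TI" shows "(u t)^2 <= \<eta> * (\<rho> t * \<bar>u t\<bar>)"
 using mult_right_mono[OF ub[OF t], of "\<bar>u t\<bar>"] by (simp add: power2_eq_square abs_mult[symmetric] mult.assoc)

text \<open>\<open>linear_L1\<close> applied to the equation of \<open>u\<close>. Its source
  contains \<open>u^2 <= \<eta> * \<rho> * \<bar>u\<bar>\<close>, and
  \<open>24 * \<eta> * exp C1 <= c1\<close> lets half of the left-hand side absorb this term, so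
  \<open>u\<close> is quadratic in the noise.\<close>

lemma rho_u_integral:
 "integral TI (\<lambda>t. \<rho> t * \<bar>u t\<bar>) <= (24 * exp C1 / c1) * integral TI (\<lambda>t. (k * lin w t)\<^sup>2)"
proof -
 note c = u_cont rho_cont lin_cont[OF w_cont] rem_cont
 let ?I = "integral TI (\<lambda>t. \<rho> t * \<bar>u t\<bar>)" and ?Z = "integral TI (\<lambda>t. (k * lin w t)\<^sup>2)"
 have "0 <= ?I"
  by (intro hk_nonneg integrable_continuous_real continuous_intros c)
    (use rho_pos in \<open>auto simp: less_imp_le\<close>)
 have "c1 * exp (- C1) * ?I <= integral TI (\<lambda>t. \<bar>rem t\<bar>)"
  by (rule linear_L1[OF u_ode rem_cont u0])
 also have "... <= integral TI (\<lambda>t. 12 * \<eta> * (\<rho> t * \<bar>u t\<bar>) + 12 * (k * lin w t)^2)"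
 proof (intro hk_le integrable_continuous_real continuous_intros c)
  fix t assume t: "t \<in> TI"
  show "\<bar>rem t\<bar> <= 12 * \<eta> * (\<rho> t * \<bar>u t\<bar>) + 12 * (k * lin w t)^2"
   using rem_le[OF t] u_sq_le[OF t] by (simp add: mult.assoc)
 qed
 also have "... = 12 * \<eta> * ?I + 12 * ?Z"
  by (subst hk_add) (auto intro!: integrable_continuous_real continuous_intros c)
 finally have 1: "c1 * exp (- C1) * ?I <= 12 * \<eta> * ?I + 12 * ?Z" .
 have "24 * \<eta> <= c1 * exp (- C1)" using eta by (simp add: exp_minus field_simps)
 then have "24 * \<eta> * ?I <= c1 * exp (- C1) * ?I" using \<open>0 <= ?I\<close> by (rule mult_right_mono)
 with 1 have "c1 * exp (- C1) * ?I <= 24 * ?Z" by linarith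
 then show ?thesis using c1_pos by (simp add: exp_minus field_simps)
qed

text \<open>Absorption as in \<open>rho_u_integral\<close>, but in the quadratic norm of
  \<open>linear_L2\<close>; \<open>576\<close> is \<open>24^2\<close>.\<close>

lemma rho_u_sq_integral:
 "integral TI (\<lambda>t. \<rho> t * (u t)^2) <= (576 * exp (2 * C1) / c1^2) * integral TI (\<lambda>t. (k * lin w t) ^ 4 / \<rho> t)"
proof -
 have rne: "\<rho> t \<noteq> 0" if "t \<in> TI" for t using rho_pos[OF that] by simp
 note c = u_cont rho_cont lin_cont[OF w_cont] rem_cont
 let ?I = "integral TI (\<lambda>t. \<rho> t * (u t)^2)" and ?Z = "integral TI (\<lambda>t. (k * lin w t) ^ 4 / \<rho> t)"
 have I0: "0 <= ?I"
  by (intro hk_nonneg integrable_continuous_real continuous_intros c)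
    (use rho_pos in \<open>auto simp: less_imp_le\<close>)
 have "c1^2 * exp (- 2 * C1) * ?I <= integral TI (\<lambda>t. (rem t)\<^sup>2 / \<rho> t)"
  by (rule linear_L2[OF u_ode rem_cont u0])
 also have "... <= integral TI (\<lambda>t. 288 * \<eta>^2 * (\<rho> t * (u t)^2) + 288 * ((k * lin w t) ^ 4 / \<rho> t))"
 proof (intro hk_le integrable_continuous_real continuous_intros c ballI rne)
  fix t assume t: "t \<in> TI"
  have r: "0 < \<rho> t" by (rule rho_pos[OF t])
  have "(rem t)^2 <= (12 * (u t)^2 + 12 * (k * lin w t)^2)^2"
   using rem_le[OF t] by (intro power2_le_iff_abs_le[THEN iffD2]) auto
  also have "... <= 288 * ((u t)^2)^2 + 288 * ((k * lin w t)^2)^2"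
   using sum_squares_bound[of "12 * (u t)^2" "12 * (k * lin w t)^2"] by (simp add: power2_sum power_mult_distrib)
  also have "((u t)^2)^2 <= (\<eta> * \<rho> t)^2 * (u t)^2"
   unfolding power2_eq_square[of "(u t)^2"]
   by (intro mult_right_mono) (use ub[OF t] in \<open>auto intro!: power2_le_iff_abs_le[THEN iffD2] simp: eta_nonneg r less_imp_le\<close>)
  finally have "(rem t)^2 <= 288 * ((\<eta> * \<rho> t)^2 * (u t)^2) + 288 * ((k * lin w t)^2)^2" by simp
  then have "(rem t)^2 / \<rho> t <= (288 * ((\<eta> * \<rho> t)^2 * (u t)^2) + 288 * ((k * lin w t)^2)^2) / \<rho> t"
   using r by (intro divide_right_mono) auto
  also have "... = 288 * \<eta>^2 * (\<rho> t * (u t)^2) + 288 * ((k * lin w t) ^ 4 / \<rho> t)"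
   using r by (simp add: add_divide_distrib power_mult_distrib power2_eq_square) (simp add: power4_eq_xxxx ac_simps)
  finally show "(rem t)^2 / \<rho> t <= 288 * \<eta>^2 * (\<rho> t * (u t)^2) + 288 * ((k * lin w t) ^ 4 / \<rho> t)" .
 qed
 also have "... = 288 * \<eta>^2 * ?I + 288 * ?Z"
  unfolding integral_mult_right[symmetric]
  by (intro hk_add integrable_continuous_real continuous_intros c ballI rne)
 finally have 1: "c1^2 * exp (- 2 * C1) * ?I <= 288 * \<eta>^2 * ?I + 288 * ?Z" .
 have "24 * \<eta> <= c1 * exp (- C1)" using eta by (simp add: exp_minus field_simps)
 then have "(24 * \<eta>)^2 <= (c1 * exp (- C1))^2" using eta_nonneg by (intro power_mono) auto
 then have "576 * \<eta>^2 <= c1^2 * exp (- 2 * C1)" using exp_double[of "- C1"] by (simp add: power_mult_distrib)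
 then have "576 * \<eta>^2 * ?I <= c1^2 * exp (- 2 * C1) * ?I" using I0 by (rule mult_right_mono)
 with 1 have "c1^2 * exp (- 2 * C1) * ?I <= 576 * ?Z" by linarith
 then show ?thesis using c1_pos by (simp add: exp_minus field_simps)
qed

end

text \<open>The second-order part of the path: the response to the quadratic term of the drift alone.\<close>

definition u2 :: "real \<Rightarrow> real" where
 "u2 t = exp (\<alpha> t) * integral {- (1/2)..t} (\<lambda>s. exp (- \<alpha> s) * (- (3 * z s * (k * lin w s)^2) / e))"

lemma u2_kernel_cont: "continuous_on TI (\<lambda>s. exp (- \<alpha> s) * (- (3 * z s * (k * lin w s)^2) / e))"
 by (intro continuous_intros alpha_cont z_cont lin_cont w_cont) simp

lemma u2_ode:
 assumes t: "t \<in> TI"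
 shows "(u2 has_real_derivative (a t * u2 t + - (3 * z t * (k * lin w t)^2)) / e) (at t within TI)"
proof -
 have "((\<lambda>t. exp (\<alpha> t) * integral {- (1/2)..t} (\<lambda>s. exp (- \<alpha> s) * (- (3 * z s * (k * lin w s)^2) / e))) has_real_derivative
   exp (\<alpha> t) * (a t / e) * integral {- (1/2)..t} (\<lambda>s. exp (- \<alpha> s) * (- (3 * z s * (k * lin w s)^2) / e))
   + exp (\<alpha> t) * (exp (- \<alpha> t) * (- (3 * z t * (k * lin w t)^2) / e))) (at t within TI)"
  by (rule derivative_eq_intros alpha_deriv[OF t] integral_has_derivative_within[OF u2_kernel_cont t] refl)+ simp
 moreover have "exp (\<alpha> t) * (exp (- \<alpha> t) * (- (3 * z t * (k * lin w t)^2) / e)) = - (3 * z t * (k * lin w t)^2) / e"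
  unfolding mult.assoc[of "exp (\<alpha> t)", symmetric] exp_add[symmetric] by simp
 ultimately show ?thesis
  unfolding u2_def[abs_def] add_divide_distrib by (simp only: times_divide_eq_left times_divide_eq_right mult_ac)
qed

lemma u2_cont: "continuous_on TI u2" by (rule DERIV_continuous_on[OF u2_ode])

lemma u2_area:
 assumes h: "continuous_on TI h"
 shows "integral TI (\<lambda>t. h t * u2 t)
  = integral TI (\<lambda>s. (- (3 * z s) / e * (exp (- \<alpha> s) * integral {s..1/2} (\<lambda>t. h t * exp (\<alpha> t)))) * (k * lin w s)^2)"
proof -
 have hc: "continuous_on TI (\<lambda>t. h t * exp (\<alpha> t))" by (intro continuous_intros h alpha_cont)
 have "integral TI (\<lambda>t. h t * u2 t)
  = integral TI (\<lambda>t. (h t * exp (\<alpha> t)) * integral {- (1/2)..t} (\<lambda>s. exp (- \<alpha> s) * (- (3 * z s * (k * lin w s)^2) / e)))"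
  by (simp add: u2_def mult.assoc)
 also have "... = integral TI (\<lambda>s. integral {s..1/2} (\<lambda>t. h t * exp (\<alpha> t)) * (exp (- \<alpha> s) * (- (3 * z s * (k * lin w s)^2) / e)))"
  by (rule integral_by_parts_primitive[OF _ hc u2_kernel_cont]) simp
 finally show ?thesis by (simp add: ac_simps)
qed

text \<open>\<open>u - u2\<close> solves the linearised equation with a source of third order in the
  noise, so \<open>linear_L1\<close> applies; the part of the source quadratic in \<open>u\<close>
  is estimated by \<open>rho_u_sq_integral\<close>.\<close>

lemma u3_integral:
 assumes ub: "\<And>t. t \<in> TI \<Longrightarrow> \<bar>u t\<bar> <= \<eta> * \<rho> t"
  and zb: "\<And>t. t \<in> TI \<Longrightarrow> \<bar>k * lin w t\<bar> <= \<eta> * \<rho> t"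
  and small: "\<And>t. t \<in> TI \<Longrightarrow> \<eta> * \<rho> t <= 1/2"
  and eta: "24 * \<eta> * exp C1 <= c1" "0 <= \<eta>" and x0: "x0 = z (- (1/2))"
  and R: "\<And>t. t \<in> TI \<Longrightarrow> \<rho> t <= R" and c: "0 < c" "\<And>t. t \<in> TI \<Longrightarrow> 1 <= c * \<rho> t"
 shows "c1 * exp (- C1) * integral TI (\<lambda>t. \<rho> t * \<bar>u t - u2 t\<bar>)
  <= c * ((14 * 576 * exp (2 * C1) / c1^2 + 2 * R^2) * integral TI (\<lambda>t. (k * lin w t) ^ 4 / \<rho> t))
   + 7 * integral TI (\<lambda>t. (k * lin w t)\<^sup>2 / \<rho> t) / c"
proof -
 have rne: "\<rho> t \<noteq> 0" if "t \<in> TI" for t using rho_pos[OF that] by simp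
 note cc = u_cont rho_cont lin_cont[OF w_cont] rem_cont u2_cont z_cont
 let ?U = "integral TI (\<lambda>t. \<rho> t * (u t)^2)" and ?Q4 = "integral TI (\<lambda>t. (k * lin w t) ^ 4 / \<rho> t)"
  and ?Q2 = "integral TI (\<lambda>t. (k * lin w t)\<^sup>2 / \<rho> t)"
 define r3 where "r3 t = rem t + 3 * z t * (k * lin w t)^2" for t
 have "c1 * exp (- C1) * integral TI (\<lambda>t. \<rho> t * \<bar>u t - u2 t\<bar>) <= integral TI (\<lambda>t. \<bar>r3 t\<bar>)"
 proof (rule linear_L1)
  fix t assume t: "t \<in> TI"
  have "(a t * u t + rem t) / e - (a t * u2 t + - (3 * z t * (k * lin w t)^2)) / e = (a t * (u t - u2 t) + r3 t) / e"
   by (simp add: r3_def algebra_simps flip: diff_divide_distrib)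
  then show "((\<lambda>t. u t - u2 t) has_real_derivative (a t * (u t - u2 t) + r3 t) / e) (at t within TI)"
   using DERIV_diff[OF u_ode[OF t] u2_ode[OF t]] by simp
 qed (use u_start x0 in \<open>auto simp: r3_def u2_def intro!: continuous_intros cc\<close>)
 also have "... <= integral TI (\<lambda>t. 14 * c * (\<rho> t * (u t)^2) + (7 / c * ((k * lin w t)^2 / \<rho> t) + 2 * c * R^2 * ((k * lin w t) ^ 4 / \<rho> t)))"
 proof (intro hk_le integrable_continuous_real continuous_intros cc ballI rne)
  show "continuous_on TI r3" unfolding r3_def by (intro continuous_intros cc)
 next
  fix t assume t: "t \<in> TI"
  have x1: "\<bar>u t\<bar> <= 1/2" using ub[OF t] small[OF t] by linarith
  show "\<bar>r3 t\<bar> <= 14 * c * (\<rho> t * (u t)^2) + (7 / c * ((k * lin w t)^2 / \<rho> t) + 2 * c * R^2 * ((k * lin w t) ^ 4 / \<rho> t))"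
   unfolding r3_def rem_def
   by (rule cubic_remainder_diff_le[OF z_range[OF t] x1 rho_pos[OF t] c(1) c(2)[OF t] R[OF t]])
 qed
 also have "... = 14 * c * ?U + (7 / c * ?Q2 + 2 * c * R^2 * ?Q4)"
 proof -
  have "integral TI (\<lambda>t. 7 / c * ((k * lin w t)^2 / \<rho> t) + 2 * c * R^2 * ((k * lin w t) ^ 4 / \<rho> t))
    = integral TI (\<lambda>t. 7 / c * ((k * lin w t)^2 / \<rho> t)) + integral TI (\<lambda>t. 2 * c * R^2 * ((k * lin w t) ^ 4 / \<rho> t))"
   by (intro hk_add integrable_continuous_real continuous_intros cc ballI rne)
  moreover have "integral TI (\<lambda>t. 14 * c * (\<rho> t * (u t)^2) + (7 / c * ((k * lin w t)^2 / \<rho> t) + 2 * c * R^2 * ((k * lin w t) ^ 4 / \<rho> t)))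
    = integral TI (\<lambda>t. 14 * c * (\<rho> t * (u t)^2)) + integral TI (\<lambda>t. 7 / c * ((k * lin w t)^2 / \<rho> t) + 2 * c * R^2 * ((k * lin w t) ^ 4 / \<rho> t))"
   by (intro hk_add integrable_continuous_real continuous_intros cc ballI rne)
  ultimately show ?thesis by (simp only: integral_mult_right)
 qed
 also have "14 * c * ?U <= 14 * c * ((576 * exp (2 * C1) / c1^2) * ?Q4)"
  by (intro mult_left_mono rho_u_sq_integral[where \<eta> = \<eta>]) (use assms in auto)
 finally show ?thesis by (simp add: algebra_simps)
qed

end

section \<open>Moments of time integrals of the linear process\<close>

context noisy_well
begin

definition V :: real where "V = exp (2 * C1) / c1"

lemma V_pos: "0 < V" using c1_pos by (simp add: V_def)

lemma vt_le_V: "t \<in> TI \<Longrightarrow> vt t <= V / \<rho> t"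
 using vt_le[of t] by (simp add: V_def)

lemma vt_nonneg: assumes "t \<in> TI" shows "0 <= vt t"
proof (cases "t = - (1/2)")
 case True then show ?thesis by (simp add: vt_def)
next
 case False then show ?thesis using vt_pos[of t] assms by auto
qed

lemma zeta_even_moment:
 assumes t: "t \<in> TI" and k: "0 < k"
 shows "expectation (\<lambda>w. \<zeta> t w ^ (2 * k)) <= fact (2 * k) / (2 ^ k * fact k) * (\<sigma>^2 * V) ^ k / \<rho> t ^ k"
proof -
 have "expectation (\<lambda>w. \<zeta> t w ^ (2 * k)) <= fact (2 * k) / (2 ^ k * fact k) * (\<sigma>^2 * vt t) ^ k"
  by (rule zeta_moment(2)[OF t k])
 also have "... <= fact (2 * k) / (2 ^ k * fact k) * (\<sigma>^2 * (V / \<rho> t)) ^ k"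
  by (intro mult_left_mono power_mono vt_le_V t) (use vt_nonneg[OF t] in auto)
 finally show ?thesis by (simp add: power_divide)
qed

lemma zeta_integral_moment:
 assumes f: "continuous_on TI f" "\<And>t. t \<in> TI \<Longrightarrow> 0 <= f t" and j: "0 < j"
 shows "integrable M (\<lambda>w. integral TI (\<lambda>t. f t * \<zeta> t w ^ (2 * j)))"
  and "expectation (\<lambda>w. integral TI (\<lambda>t. f t * \<zeta> t w ^ (2 * j)))
    <= fact (2 * j) / (2 ^ j * fact j) * (\<sigma>^2 * V) ^ j * integral TI (\<lambda>t. f t / \<rho> t ^ j)"
proof -
 let ?c = "fact (2 * j) / (2 ^ j * fact j) * (\<sigma>^2 * V) ^ j"
 have rne: "\<rho> t \<noteq> 0" if "t \<in> TI" for t using rho_pos[OF that] by simp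
 note * = path_integral_nonneg[where Y = "\<lambda>t w. f t * \<zeta> t w ^ (2 * j)" and e = "\<lambda>t. ?c * (f t / \<rho> t ^ j)"]
 have 1: "integrable M (\<lambda>w. f t * \<zeta> t w ^ (2 * j))" if "t \<in> TI" for t
  by (intro integrable_mult_right zeta_moment that)
 have 2: "continuous_on TI (\<lambda>t. f t * \<zeta> t w ^ (2 * j))" if "w \<in> space M" for w
  by (intro continuous_intros f zeta_cont that)
 have 3: "0 <= f t * \<zeta> t w ^ (2 * j)" if "t \<in> TI" for t w
  using f(2)[OF that] by (simp add: zero_le_even_power)
 have 4: "continuous_on TI (\<lambda>t. ?c * (f t / \<rho> t ^ j))"
  by (intro continuous_intros f rho_cont) (use rne in auto)
 have 5: "expectation (\<lambda>w. f t * \<zeta> t w ^ (2 * j)) <= ?c * (f t / \<rho> t ^ j)" if t: "t \<in> TI" for t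
  using mult_left_mono[OF zeta_even_moment[OF t j] f(2)[OF t]] by (simp add: ac_simps)
 show "integrable M (\<lambda>w. integral TI (\<lambda>t. f t * \<zeta> t w ^ (2 * j)))"
  by (rule *(1)[OF 1 2 3 4 5])
 show "expectation (\<lambda>w. integral TI (\<lambda>t. f t * \<zeta> t w ^ (2 * j))) <= ?c * integral TI (\<lambda>t. f t / \<rho> t ^ j)"
  using *(2)[OF 1 2 3 4 5] by (simp only: integral_mult_right)
qed

text \<open>Cauchy-Schwarz with the weight \<open>f / \<rho> ^ j\<close>, the order of the
  expectation of the integrand. In this way the bound on the second moment is a multiple of the
  square of the bound on the first, without loss of powers of \<open>\<rho>\<close> near the
  fold.\<close>

lemma zeta_integral_sq_moment:
 assumes f: "continuous_on TI f" "\<And>t. t \<in> TI \<Longrightarrow> 0 < f t" and j: "0 < j"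
 shows "integrable M (\<lambda>w. (integral TI (\<lambda>t. f t * \<zeta> t w ^ (2 * j)))\<^sup>2)"
  and "expectation (\<lambda>w. (integral TI (\<lambda>t. f t * \<zeta> t w ^ (2 * j)))\<^sup>2)
    <= fact (4 * j) / (2 ^ (2 * j) * fact (2 * j)) * (\<sigma>^2 * V) ^ (2 * j) * (integral TI (\<lambda>t. f t / \<rho> t ^ j))^2"
proof -
 let ?c = "fact (4 * j) / (2 ^ (2 * j) * fact (2 * j)) * (\<sigma>^2 * V) ^ (2 * j)"
 let ?L = "integral TI (\<lambda>t. f t / \<rho> t ^ j)"
 let ?G = "\<lambda>w. integral TI (\<lambda>t. (f t * \<rho> t ^ j) * \<zeta> t w ^ (2 * (2 * j)))"
 have rne: "\<rho> t \<noteq> 0" if "t \<in> TI" for t using rho_pos[OF that] by simp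
 have pc: "continuous_on TI (\<lambda>t. f t / \<rho> t ^ j)" by (intro continuous_intros f rho_cont) (use rne in auto)
 have pp: "0 < f t / \<rho> t ^ j" if "t \<in> TI" for t using f(2)[OF that] rho_pos[OF that] by simp
 have L: "0 < ?L"
 proof -
  have "0 <= ?L"
   by (intro hk_nonneg integrable_continuous_real pc) (use pp in \<open>auto simp: less_imp_le\<close>)
  moreover have "?L \<noteq> 0"
  proof
   assume z: "?L = 0"
   have "((\<lambda>t. f t / \<rho> t ^ j) has_integral 0) (cbox (- (1/2)) (1/2))"
    using integrable_integral[OF integrable_continuous_real[OF pc]] z by simp
   then have "f 0 / \<rho> 0 ^ j = 0"
    by (rule has_integral_0_cbox_imp_0[rotated 2]) (use pc pp in \<open>auto simp: less_imp_le\<close>)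
   moreover have "0 < f 0 / \<rho> 0 ^ j" by (rule pp) simp
   ultimately show False by linarith
  qed
  ultimately show ?thesis by simp
 qed
 have le: "(integral TI (\<lambda>t. f t * \<zeta> t w ^ (2 * j)))^2 <= ?G w * ?L" if w: "w \<in> space M" for w
 proof -
  let ?g = "\<lambda>t. sqrt (f t / \<rho> t ^ j)" and ?h = "\<lambda>t. sqrt (f t * \<rho> t ^ j) * \<zeta> t w ^ (2 * j)"
  have "integral TI (\<lambda>t. ?h t * ?g t) = integral TI (\<lambda>t. f t * \<zeta> t w ^ (2 * j))"
  proof (rule Henstock_Kurzweil_Integration.integral_cong)
   fix t assume t: "t \<in> TI"
   have "sqrt (f t * \<rho> t ^ j) * sqrt (f t / \<rho> t ^ j) = sqrt ((f t)^2)"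
    using rne[OF t] by (simp flip: real_sqrt_mult add: power2_eq_square)
   also have "... = f t" using f(2)[OF t] by simp
   finally show "?h t * ?g t = f t * \<zeta> t w ^ (2 * j)" by (simp add: mult.commute mult.left_commute)
  qed
  moreover have "integral TI (\<lambda>t. (?g t)\<^sup>2) = ?L"
   by (rule Henstock_Kurzweil_Integration.integral_cong) (use pp in \<open>auto simp: less_imp_le\<close>)
  moreover have "integral TI (\<lambda>t. (?h t)\<^sup>2) = ?G w"
  proof (rule Henstock_Kurzweil_Integration.integral_cong)
   fix t assume t: "t \<in> TI"
   have "0 <= f t * \<rho> t ^ j" using f(2)[OF t] rho_pos[OF t] by simp
   then show "(?h t)^2 = (f t * \<rho> t ^ j) * \<zeta> t w ^ (2 * (2 * j))"
    by (simp add: power_mult_distrib power_mult[symmetric] mult.commute)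
  qed
  moreover have "(integral TI (\<lambda>t. ?h t * ?g t))^2 <= integral TI (\<lambda>t. (?h t)\<^sup>2) * integral TI (\<lambda>t. (?g t)\<^sup>2)"
   by (rule Cauchy_Schwarz_integral)
     (use L calculation(2) in \<open>auto intro!: continuous_intros f rho_cont pc zeta_cont w\<close>)
  ultimately show ?thesis by simp
 qed
 have Gc: "continuous_on TI (\<lambda>t. f t * \<rho> t ^ j)" and Gp: "\<And>t. t \<in> TI \<Longrightarrow> 0 <= f t * \<rho> t ^ j"
  using f rho_pos by (auto intro!: continuous_intros rho_cont simp: less_imp_le)
 have Gint: "integrable M ?G" and GE: "expectation ?G <= ?c * ?L"
 proof -
  show "integrable M ?G" by (rule zeta_integral_moment(1)[OF Gc Gp]) (use j in auto)
  have "expectation ?G <= fact (2 * (2 * j)) / (2 ^ (2 * j) * fact (2 * j)) * (\<sigma>^2 * V) ^ (2 * j) * integral TI (\<lambda>t. f t * \<rho> t ^ j / \<rho> t ^ (2 * j))"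
   by (rule zeta_integral_moment(2)[OF Gc Gp]) (use j in auto)
  also have "integral TI (\<lambda>t. f t * \<rho> t ^ j / \<rho> t ^ (2 * j)) = ?L"
   by (rule Henstock_Kurzweil_Integration.integral_cong) (use rne in \<open>auto simp: mult_2 power_add\<close>)
  also have "fact (2 * (2 * j)) = (fact (4 * j) :: real)" by simp
  finally show "expectation ?G <= ?c * ?L" .
 qed
 have meas: "(\<lambda>w. integral TI (\<lambda>t. f t * \<zeta> t w ^ (2 * j))) \<in> borel_measurable M"
  by (rule borel_measurable_integrable[OF zeta_integral_moment(1)[OF f(1) less_imp_le[OF f(2)] j]])
 show int: "integrable M (\<lambda>w. (integral TI (\<lambda>t. f t * \<zeta> t w ^ (2 * j)))\<^sup>2)"
 proof (rule Bochner_Integration.integrable_bound)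
  show "integrable M (\<lambda>w. ?G w * ?L)" using Gint by simp
  show "AE w in M. norm ((integral TI (\<lambda>t. f t * \<zeta> t w ^ (2 * j)))^2) <= norm (?G w * ?L)"
  proof (rule AE_I2)
   fix w assume "w \<in> space M"
   from le[OF this] have "(integral TI (\<lambda>t. f t * \<zeta> t w ^ (2 * j)))^2 <= \<bar>?G w * ?L\<bar>" by linarith
   then show "norm ((integral TI (\<lambda>t. f t * \<zeta> t w ^ (2 * j)))^2) <= norm (?G w * ?L)" by simp
  qed
 qed (use meas in measurable)
 have "expectation (\<lambda>w. (integral TI (\<lambda>t. f t * \<zeta> t w ^ (2 * j)))\<^sup>2) <= expectation (\<lambda>w. ?G w * ?L)"
  by (rule Bochner_Integration.integral_mono[OF int]) (use Gint le in auto)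
 also have "... = expectation ?G * ?L" by simp
 also have "... <= (?c * ?L) * ?L" by (rule mult_right_mono[OF GE]) (use L in simp)
 finally show "expectation (\<lambda>w. (integral TI (\<lambda>t. f t * \<zeta> t w ^ (2 * j)))\<^sup>2) <= ?c * ?L\<^sup>2"
  by (simp add: power2_eq_square mult.assoc)
qed

end

section \<open>Leaving the well and tails of the area\<close>

locale noisy_bounded = noisy_well e c1 C1 N a \<rho> \<rho>' M W \<sigma>
 for e c1 C1 N a \<rho> \<rho>' and M :: "'w measure" and W \<sigma> +
 fixes R m :: real
 assumes rho_le: "\<And>t. t \<in> TI \<Longrightarrow> \<rho> t <= R"
  and m_pos: "0 < m" and rho_ge: "\<And>t. t \<in> TI \<Longrightarrow> sqrt m <= \<rho> t"
  and eps_rho: "\<And>t. t \<in> TI \<Longrightarrow> 2 * e <= \<rho> t" and N_ge: "1 <= N" and eps_le: "e <= 1"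
begin

lemma R_pos: "0 < R" using rho_pos[of 0] rho_le[of 0] by auto

text \<open>Admissible sizes relative to the width \<open>\<rho>\<close>: \<open>etaB\<close> for
  the initial deviation, \<open>etaC\<close> for the noise and \<open>etaA\<close> for the resulting
  deviation. Together they meet what the barrier, the absorption in the remainder estimates and the
  restriction to deviations below 1 demand.\<close>

definition etaA :: real where "etaA = min (c1 / (24 * exp C1)) (1 / (8 * R))"
definition etaB :: real where "etaB = min (etaA * exp (- C1)) (c1 / (96 * exp (2 * C1)))"
definition etaC :: real where "etaC = min etaB (c1 / 96)"
definition kg :: real where "kg = min (c1 / exp (2 * C1)) (N / R) / 2048"
definition Cg :: real where "Cg = 3 * (exp 16 + 6) * N"

lemma eta_pos: "0 < etaA" "0 < etaB" "0 < etaC" and kg_pos: "0 < kg" and Cg_pos: "0 < Cg"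
 using c1_pos R_pos N_ge by (auto simp: etaA_def etaB_def etaC_def kg_def Cg_def intro!: mult_pos_pos add_pos_pos)

lemma etaA_lin: "24 * etaA * exp C1 <= c1"
proof -
 have "24 * etaA * exp C1 <= 24 * (c1 / (24 * exp C1)) * exp C1"
  by (intro mult_right_mono mult_left_mono) (auto simp: etaA_def)
 then show ?thesis by simp
qed

lemma etaA_rho: assumes "t \<in> TI" shows "etaA * \<rho> t <= 1/8"
proof -
 have "etaA * \<rho> t <= 1 / (8 * R) * R"
  by (intro mult_mono rho_le assms) (use rho_pos[OF assms] R_pos in \<open>auto simp: etaA_def less_imp_le\<close>)
 then show ?thesis using R_pos by simp
qed

lemma etaB_le: "etaB * exp C1 <= etaA"
proof -
 have "etaB * exp C1 <= etaA * exp (- C1) * exp C1"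
  by (intro mult_right_mono) (auto simp: etaB_def)
 also have "... = etaA" by (simp add: mult.assoc flip: exp_add)
 finally show ?thesis .
qed

lemma etaC_le: "etaC <= etaA"
proof -
 have "etaC <= etaB * 1" by (simp add: etaC_def)
 also have "... <= etaB * exp C1" using eta_pos C1_nonneg by (intro mult_left_mono) auto
 finally show ?thesis using etaB_le by simp
qed

lemma eta_barrier: "12 * (exp (2 * C1) * etaB^2 + etaC^2) < etaB * c1 / 2"
proof -
 have "exp (2 * C1) * etaB^2 <= exp (2 * C1) * (etaB * (c1 / (96 * exp (2 * C1))))"
  unfolding power2_eq_square by (intro mult_left_mono) (use eta_pos in \<open>auto simp: etaB_def\<close>)
 then have "exp (2 * C1) * etaB^2 <= etaB * c1 / 96" by simp
 moreover have "etaC^2 <= etaB * (c1 / 96)"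
  unfolding power2_eq_square by (intro mult_mono) (use eta_pos c1_pos in \<open>auto simp: etaC_def\<close>)
 moreover have "0 < etaB * c1" using eta_pos c1_pos by simp
 ultimately show ?thesis by simp
qed

lemma eta_small: assumes t: "t \<in> TI" shows "(etaB * exp C1 + etaC) * \<rho> t <= 1/4"
proof -
 have "(etaB * exp C1 + etaC) * \<rho> t <= (etaA + etaA) * \<rho> t"
  by (intro mult_right_mono add_mono etaB_le etaC_le) (use rho_pos[OF t] in auto)
 then show ?thesis using etaA_rho[OF t] by simp
qed

text \<open>Noise of size \<open>h / sqrt \<rho>\<close> stays below \<open>etaC * \<rho>\<close> if
  \<open>h <= etaC * \<rho> powr (3/2)\<close>; with \<open>\<rho> >= sqrt m\<close> this gives the
  power \<open>3/4\<close>, whose square gives the exponent \<open>3/2\<close> of the crossing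
  probability.\<close>

definition hmax :: real where "hmax = etaC * m powr (3/4)"

lemma hmax_pos: "0 < hmax" using eta_pos m_pos by (simp add: hmax_def)

lemma m_powr_le: assumes t: "t \<in> TI" shows "m powr (3/4) <= \<rho> t * sqrt (\<rho> t)"
proof -
 have "m powr (3/4) = sqrt m * sqrt (sqrt m)"
  using m_pos by (simp add: powr_half_sqrt[symmetric] powr_powr powr_add[symmetric])
 also have "... <= \<rho> t * sqrt (\<rho> t)"
  by (intro mult_mono real_sqrt_le_mono rho_ge t) (use m_pos rho_pos[OF t] in auto)
 finally show ?thesis .
qed

lemma h_rho_le: assumes t: "t \<in> TI" and h: "h <= hmax" shows "h / sqrt (\<rho> t) <= etaC * \<rho> t"
proof -
 have "h <= etaC * (\<rho> t * sqrt (\<rho> t))"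
  using h mult_left_mono[OF m_powr_le[OF t] less_imp_le[OF eta_pos(3)]] by (simp add: hmax_def)
 then show ?thesis using rho_pos[OF t] by (simp add: field_simps)
qed

text \<open>The threshold has the shape of the bound on the standard deviation of the process. It
  varies by at most a factor 2 over one cell, because \<open>\<rho>\<close> has bounded slope and
  \<open>2 * e <= \<rho>\<close>.\<close>

lemma good_event:
 assumes h: "0 < h"
 obtains B where "B \<in> sets M" "prob B <= Cg / e * exp (- (kg * h^2 / \<sigma>^2))"
  "\<And>w t. w \<in> space M - B \<Longrightarrow> t \<in> TI \<Longrightarrow> \<bar>\<zeta> t w\<bar> <= h / sqrt (\<rho> t)"
proof -
 define x where "x = 2048 * kg * h^2 / \<sigma>^2"
 have k2048: "2048 * kg = min (c1 / exp (2 * C1)) (N / R)" by (simp add: kg_def)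
 have x0: "0 <= x" using kg_pos by (simp add: x_def)
 have sx: "\<sigma>^2 * x = 2048 * kg * h^2" using sigma_ne by (simp add: x_def)
 have psi2: "(h / sqrt (\<rho> t))^2 = h^2 / \<rho> t" if "t \<in> TI" for t
  using rho_pos[OF that] by (simp add: power_divide)
 obtain B where B: "B \<in> sets M" "prob B <= 3 * (exp 16 + 6) * (N / e) * exp (- (x / 2048))"
  "\<And>w t. w \<in> space M - B \<Longrightarrow> t \<in> TI \<Longrightarrow> \<bar>\<zeta> t w\<bar> <= h / sqrt (\<rho> t)"
 proof (rule zeta_sup[where \<psi> = "\<lambda>t. h / sqrt (\<rho> t)" and x = x])
  show "0 < N" "e <= N" using N_ge eps_le by auto
  show "0 < h / sqrt (\<rho> t)" if "t \<in> TI" for t using h rho_pos[OF that] by simp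
  show "h / sqrt (\<rho> s) <= 2 * (h / sqrt (\<rho> t))" if s: "s \<in> TI" and t: "t \<in> TI" and st: "\<bar>s - t\<bar> <= e / (2 * N)" for s t
  proof -
   have "norm (\<rho> t - \<rho> s) <= 4 * norm (t - s)"
    by (rule field_differentiable_bound[where S = TI and f' = \<rho>']) (use rho_deriv rho'_bound s t in auto)
   also have "... <= 4 * (e / (2 * N))" using st by (intro mult_left_mono) (auto simp: abs_minus_commute)
   also have "... <= 4 * (e / 2)" using N_ge eps_pos by (intro mult_left_mono divide_left_mono) auto
   finally have "\<rho> t <= 4 * \<rho> s" using eps_rho[OF s] rho_pos[OF s] by auto
   then have "sqrt (\<rho> t) <= 2 * sqrt (\<rho> s)" using real_sqrt_le_mono[of "\<rho> t" "4 * \<rho> s"] by (simp add: real_sqrt_mult)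
   then show ?thesis using h rho_pos[OF s] rho_pos[OF t] by (simp add: field_simps)
  qed
  show "\<sigma>^2 * vt t * x <= (h / sqrt (\<rho> t))^2" if t: "t \<in> TI" for t
  proof -
   have "\<sigma>^2 * vt t * x = vt t * (2048 * kg * h^2)" using sx by (simp add: ac_simps)
   also have "... <= (V / \<rho> t) * (1 / V * h^2)"
   proof (intro mult_mono vt_le_V t mult_right_mono)
    show "2048 * kg <= 1 / V" by (simp add: k2048 V_def)
   qed (use V_pos rho_pos[OF t] kg_pos in auto)
   also have "... = h^2 / \<rho> t" using V_pos by simp
   finally show ?thesis by (simp add: psi2[OF t])
  qed
  show "\<sigma>^2 * x <= N * (h / sqrt (\<rho> t))^2" if t: "t \<in> TI" for t
  proof -
   have "2048 * kg * h^2 <= N / R * h^2" by (intro mult_right_mono) (auto simp: k2048)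
   also have "... <= N / \<rho> t * h^2"
    by (intro mult_right_mono divide_left_mono rho_le t) (use N_ge rho_pos[OF t] R_pos in auto)
   finally show ?thesis by (simp add: psi2[OF t] sx)
  qed
 qed (rule x0, blast)
 show ?thesis
 proof (rule that[OF B(1) _ B(3)])
  have "x / 2048 = kg * h^2 / \<sigma>^2" by (simp add: x_def)
  then show "prob B <= Cg / e * exp (- (kg * h^2 / \<sigma>^2))" using B(2) by (simp add: Cg_def)
 qed
qed

lemma hmax_sq: "hmax^2 = etaC^2 * m powr (3/2)"
 using m_pos by (simp add: hmax_def power_mult_distrib powr_power)

text \<open>On the good event the path stays less than \<open>1/4\<close> below \<open>z\<close>,
  which itself is at least \<open>1/4\<close>.\<close>

lemma hitting_prob:
 assumes path: "AE w in M. nonlinear_path e c1 C1 N a \<rho> \<rho>' z z' l (\<lambda>t. W t w) (\<lambda>t. X t w) (\<sigma> / sqrt e) x0"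
  and sub: "\<And>t. t \<in> TI \<Longrightarrow> e * z' t <= F (z t) (l t)" and z: "\<And>t. t \<in> TI \<Longrightarrow> 1/4 <= z t"
  and start: "z (- (1/2)) - etaB * \<rho> (- (1/2)) < x0"
 shows "prob {w\<in>space M. \<exists>t\<in>TI. X t w = 0} <= Cg / e * exp (- (kg * etaC^2 * m powr (3/2) / \<sigma>^2))"
proof -
 obtain B where B: "B \<in> sets M" "prob B <= Cg / e * exp (- (kg * hmax^2 / \<sigma>^2))"
  "\<And>w t. w \<in> space M - B \<Longrightarrow> t \<in> TI \<Longrightarrow> \<bar>\<zeta> t w\<bar> <= hmax / sqrt (\<rho> t)"
  using good_event[OF hmax_pos] by blast
 have "AE w in M. w \<in> {w\<in>space M. \<exists>t\<in>TI. X t w = 0} \<longrightarrow> w \<in> B"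
  using path
 proof eventually_elim
  case (elim w)
  interpret P: nonlinear_path e c1 C1 N a \<rho> \<rho>' z z' l "\<lambda>t. W t w" "\<lambda>t. X t w" "\<sigma> / sqrt e" x0
   by (rule elim)
  show ?case
  proof (intro impI, rule ccontr)
   assume "w \<in> {w\<in>space M. \<exists>t\<in>TI. X t w = 0}" and nB: "w \<notin> B"
   then obtain t where w: "w \<in> space M - B" and t: "t \<in> TI" and X0: "X t w = 0" by auto
   have zb: "\<bar>\<sigma> / sqrt e * lin (\<lambda>t. W t w) t\<bar> <= etaC * \<rho> t" if "t \<in> TI" for t
    using B(3)[OF w that] h_rho_le[OF that order_refl] by (simp add: \<zeta>_def)
   have "- (etaB * exp C1 * \<rho> t) < P.u t"
    by (rule P.u_lower[OF sub zb start eta_pos(2) eta_barrier order_trans[OF eta_small] t]) auto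
   then have "0 < X t w"
    using zb[OF t] eta_small[OF t] z[OF t] unfolding P.u_def distrib_right abs_le_iff by linarith
   then show False using X0 by simp
  qed
 qed
 then have "prob {w\<in>space M. \<exists>t\<in>TI. X t w = 0} <= prob B"
  by (rule finite_measure_mono_AE[OF _ B(1)])
 then show ?thesis using B(2) by (simp add: hmax_sq mult.assoc)
qed

end

locale area_well = noisy_bounded e c1 C1 N a \<rho> \<rho>' M W \<sigma> R m
 for e c1 C1 N a \<rho> \<rho>' and M :: "'w measure" and W \<sigma> R m +
 fixes z z' l h :: "real \<Rightarrow> real" and X :: "real \<Rightarrow> 'w \<Rightarrow> real" and K :: real
 assumes path: "AE w in M. exact_path e c1 C1 N a \<rho> \<rho>' z z' l (\<lambda>t. W t w) (\<lambda>t. X t w) (\<sigma> / sqrt e) (z (- (1/2)))"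
  and X_meas: "\<And>t. t \<in> TI \<Longrightarrow> X t \<in> borel_measurable M"
  and X_cont: "\<And>w. w \<in> space M \<Longrightarrow> continuous_on TI (\<lambda>t. X t w)"
  and z_cont: "continuous_on TI z" and z_range: "\<And>t. t \<in> TI \<Longrightarrow> 0 <= z t \<and> z t <= 3/2"
  and l_bound: "\<And>t. t \<in> TI \<Longrightarrow> \<bar>l t\<bar> <= 1"
  and h_cont: "continuous_on TI h" and h_le: "\<And>t. t \<in> TI \<Longrightarrow> \<bar>h t\<bar> <= K * \<rho> t" and K_pos: "0 < K"
  and h_var: "0 < D0var h"
begin

definition G :: "'w \<Rightarrow> real" where "G w = integral TI (\<lambda>t. h t * (X t w - z t))"
definition D0 :: "'w \<Rightarrow> real" where "D0 w = integral TI (\<lambda>t. h t * \<zeta> t w)"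
definition Q :: "'w \<Rightarrow> real" where "Q w = integral TI (\<lambda>t. (\<zeta> t w)\<^sup>2)"
definition \<Lambda> :: real where "\<Lambda> = integral TI (\<lambda>t. 1 / \<rho> t)"
definition CQ :: real where "CQ = K * (24 * exp C1 / c1)"

lemma rho_ne: "t \<in> TI \<Longrightarrow> \<rho> t \<noteq> 0" using rho_pos[of t] by simp

lemma G_meas: "G \<in> borel_measurable M"
 unfolding G_def[abs_def]
proof (rule path_integral_measurable)
 show "(\<lambda>w. h t * (X t w - z t)) \<in> borel_measurable M" if "t \<in> TI" for t
  using X_meas[OF that] by measurable
qed (intro continuous_intros h_cont X_cont z_cont)

lemma D0_lin: "D0 w = \<sigma> / sqrt e * integral TI (\<lambda>t. h t * lin (\<lambda>t. W t w) t)"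
proof -
 have "D0 w = integral TI (\<lambda>t. \<sigma> / sqrt e * (h t * lin (\<lambda>t. W t w) t))"
  unfolding D0_def \<zeta>_def by (rule Henstock_Kurzweil_Integration.integral_cong) simp
 then show ?thesis by (simp only: integral_mult_right)
qed

abbreviation gk :: "real \<Rightarrow> real" where
 "gk s \<equiv> exp (- \<alpha> s) * integral {s..1/2} (\<lambda>t. h t * exp (\<alpha> t))"
abbreviation gk' :: "real \<Rightarrow> real" where
 "gk' s \<equiv> - (a s / e) * gk s - h s"

lemma gk_kernel_cont: "continuous_on TI (\<lambda>t. h t * exp (\<alpha> t))"
 by (intro continuous_intros h_cont alpha_cont)

lemma gk_deriv: assumes s: "s \<in> TI" shows "(gk has_real_derivative gk' s) (at s within TI)"
proof -
 have 1: "((\<lambda>s. exp (- \<alpha> s)) has_real_derivative exp (- \<alpha> s) * - (a s / e)) (at s within TI)"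
  by (rule DERIV_chain2[OF DERIV_exp DERIV_minus[OF alpha_deriv[OF s]]])
 have "(gk has_real_derivative exp (- \<alpha> s) * - (a s / e) * integral {s..1/2} (\<lambda>t. h t * exp (\<alpha> t))
   + - (h s * exp (\<alpha> s)) * exp (- \<alpha> s)) (at s within TI)"
  by (rule DERIV_mult[OF 1 integral_has_derivative_within'[OF gk_kernel_cont s]])
 moreover have "- (h s * exp (\<alpha> s)) * exp (- \<alpha> s) = - h s * (exp (\<alpha> s) * exp (- \<alpha> s))" by simp
 moreover have "exp (\<alpha> s) * exp (- \<alpha> s) = 1" by (simp flip: exp_add)
 moreover have "exp (- \<alpha> s) * - (a s / e) * integral {s..1/2} (\<lambda>t. h t * exp (\<alpha> t)) + - h s * 1 = gk' s" by simp
 ultimately show ?thesis by (simp only:)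
qed

lemma gk_cont: "continuous_on TI gk" by (rule DERIV_continuous_on[OF gk_deriv])

lemma gk'_cont: "continuous_on TI gk'" by (intro continuous_intros a_cont gk_cont h_cont) simp

lemma D0_wint: "w \<in> space M \<Longrightarrow> D0 w = \<sigma> / sqrt e * wint gk gk' (- (1/2)) (1/2) (\<lambda>t. W t w)"
 unfolding D0_lin by (simp only: lin_area[OF W_cont W_start h_cont])

lemma area_lin_normal:
 "distributed M lborel (\<lambda>w. wint gk gk' (- (1/2)) (1/2) (\<lambda>t. W t w)) (normal_density 0 (sqrt (D0var h)))"
 using wint_normal[OF order_refl _ gk_deriv gk'_cont] h_var by (simp add: D0var_def)

lemma D0_meas: "D0 \<in> borel_measurable M"
 using distributed_measurable[OF area_lin_normal]
 by (subst measurable_cong[OF D0_wint]) auto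

lemma D0_moments:
 shows "integrable M (\<lambda>w. D0 w ^ j)" "expectation D0 = 0"
  "expectation (\<lambda>w. D0 w ^ (2 * k)) = fact (2 * k) / (2 ^ k * fact k) * (\<sigma>^2 / e * D0var h) ^ k"
proof -
 note n = normal_moment[OF area_lin_normal h_var]
 show "integrable M (\<lambda>w. D0 w ^ j)"
  by (rule Bochner_Integration.integrable_cong[THEN iffD2, OF refl _ integrable_mult_right[OF n(2)[of j], of "(\<sigma> / sqrt e) ^ j"]])
    (simp only: D0_wint power_mult_distrib)
 have "expectation D0 = expectation (\<lambda>w. \<sigma> / sqrt e * wint gk gk' (- (1/2)) (1/2) (\<lambda>t. W t w))"
  by (rule Bochner_Integration.integral_cong) (simp_all only: D0_wint)
 then show "expectation D0 = 0" by (simp only: integral_mult_right_zero n(3) mult_zero_right)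
 have "expectation (\<lambda>w. D0 w ^ (2 * k)) = expectation (\<lambda>w. (\<sigma> / sqrt e) ^ (2 * k) * wint gk gk' (- (1/2)) (1/2) (\<lambda>t. W t w) ^ (2 * k))"
  by (rule Bochner_Integration.integral_cong) (simp_all only: D0_wint power_mult_distrib)
 also have "... = (\<sigma> / sqrt e) ^ (2 * k) * (fact (2 * k) / (2 ^ k * fact k) * D0var h ^ k)"
  by (simp only: integral_mult_right_zero n(1))
 also have "(\<sigma> / sqrt e) ^ (2 * k) = (\<sigma>^2 / e) ^ k" using eps_pos by (simp add: power_mult power_divide)
 finally show "expectation (\<lambda>w. D0 w ^ (2 * k)) = fact (2 * k) / (2 ^ k * fact k) * (\<sigma>^2 / e * D0var h) ^ k"
  by (simp only: power_mult_distrib mult_ac)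
qed

definition v0 :: real where "v0 = \<sigma>^2 / e * D0var h"
definition KV :: real where "KV = K * exp C1 / c1"

lemma v0_pos: "0 < v0" using h_var eps_pos sigma_ne by (simp add: v0_def)

lemma v0_le: "v0 <= KV^2 * (\<sigma>^2 * e)"
proof -
 have "v0 <= \<sigma>^2 / e * (K * (exp C1 * e / c1))^2"
  unfolding v0_def by (intro mult_left_mono D0var_le h_cont h_le) (use K_pos eps_pos in auto)
 also have "... = KV^2 * (\<sigma>^2 * e)" using eps_pos by (simp add: KV_def power2_eq_square field_simps)
 finally show ?thesis .
qed

lemma D0_tail:
 assumes H: "0 <= H"
 shows "prob {w\<in>space M. H <= \<bar>D0 w\<bar>} <= 2 * exp (- (H^2 / (4 * KV^2 * (\<sigma>^2 * e))))"
proof -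
 define r where "r = H * sqrt e / \<bar>\<sigma>\<bar>"
 have r: "0 <= r" using H eps_pos by (simp add: r_def)
 have "{w\<in>space M. H <= \<bar>D0 w\<bar>} = {w\<in>space M. r <= \<bar>wint gk gk' (- (1/2)) (1/2) (\<lambda>t. W t w)\<bar>}"
  using sigma_ne eps_pos by (auto simp: D0_wint r_def abs_mult field_simps)
 then have "prob {w\<in>space M. H <= \<bar>D0 w\<bar>} <= 2 * exp (- (r^2 / (4 * D0var h)))"
  using normal_tail[OF area_lin_normal h_var r] by simp
 also have "r^2 / (4 * D0var h) = H^2 / (4 * v0)"
  using sigma_ne eps_pos h_var by (simp add: r_def v0_def power_mult_distrib power_divide field_simps)
 also have "2 * exp (- (H^2 / (4 * v0))) <= 2 * exp (- (H^2 / (4 * (KV^2 * (\<sigma>^2 * e)))))"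
 proof -
  have "H^2 / (4 * (KV^2 * (\<sigma>^2 * e))) <= H^2 / (4 * v0)"
   by (intro divide_left_mono mult_left_mono v0_le mult_pos_pos)
     (use v0_pos order_less_le_trans[OF v0_pos v0_le] eps_pos in auto)
  then show ?thesis by simp
 qed
 finally show ?thesis by (simp add: mult.assoc)
qed

definition good :: "real \<Rightarrow> 'w \<Rightarrow> bool" where
 "good c w \<longleftrightarrow> (\<forall>t\<in>TI. \<bar>\<zeta> t w\<bar> <= c / sqrt (\<rho> t))"

lemma good_path:
 assumes P: "exact_path e c1 C1 N a \<rho> \<rho>' z z' l (\<lambda>t. W t w) (\<lambda>t. X t w) (\<sigma> / sqrt e) (z (- (1/2)))"
  and g: "good c w" and c: "c <= hmax" and t: "t \<in> TI"
 shows "\<bar>nonlinear_path.u e a z (\<lambda>t. W t w) (\<lambda>t. X t w) (\<sigma> / sqrt e) t\<bar> <= etaA * \<rho> t"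
  and "\<bar>\<sigma> / sqrt e * lin (\<lambda>t. W t w) t\<bar> <= etaA * \<rho> t"
proof -
 interpret P: exact_path e c1 C1 N a \<rho> \<rho>' z z' l "\<lambda>t. W t w" "\<lambda>t. X t w" "\<sigma> / sqrt e" "z (- (1/2))"
  by (rule P)
 have zb: "\<bar>\<sigma> / sqrt e * lin (\<lambda>t. W t w) t\<bar> <= etaC * \<rho> t" if "t \<in> TI" for t
  using g that h_rho_le[OF that c] by (auto simp: good_def \<zeta>_def intro: order_trans)
 have "etaC * \<rho> t <= etaA * \<rho> t" using rho_pos[OF t] etaC_le by (intro mult_right_mono) auto
 then show "\<bar>\<sigma> / sqrt e * lin (\<lambda>t. W t w) t\<bar> <= etaA * \<rho> t" using zb[OF t] by linarith
 have s: "\<bar>z (- (1/2)) - z (- (1/2))\<bar> < etaB * \<rho> (- (1/2))" using eta_pos(2) rho_pos[of "- (1/2)"] by simp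
 have sm: "(etaB * exp C1 + etaC) * \<rho> t <= 1" if "t \<in> TI" for t using eta_small[OF that] by linarith
 have "\<bar>P.u t\<bar> < etaB * exp C1 * \<rho> t"
  by (rule P.u_bound[OF zb s eta_pos(2) eta_barrier sm t])
 also have "... <= etaA * \<rho> t" using rho_pos[OF t] etaB_le by (intro mult_right_mono) auto
 finally show "\<bar>P.u t\<bar> <= etaA * \<rho> t" by simp
qed

lemma G_decomp:
 assumes P: "exact_path e c1 C1 N a \<rho> \<rho>' z z' l (\<lambda>t. W t w) (\<lambda>t. X t w) (\<sigma> / sqrt e) (z (- (1/2)))"
 shows "G w - D0 w = integral TI (\<lambda>t. h t * nonlinear_path.u e a z (\<lambda>t. W t w) (\<lambda>t. X t w) (\<sigma> / sqrt e) t)"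
proof -
 interpret P: exact_path e c1 C1 N a \<rho> \<rho>' z z' l "\<lambda>t. W t w" "\<lambda>t. X t w" "\<sigma> / sqrt e" "z (- (1/2))"
  by (rule P)
 have "G w - D0 w = integral TI (\<lambda>t. h t * (X t w - z t) - h t * \<zeta> t w)"
  unfolding G_def D0_def \<zeta>_def
  by (intro hk_diff[symmetric] integrable_continuous_real continuous_intros h_cont P.X_cont z_cont lin_cont P.w_cont)
 then show ?thesis by (simp add: P.u_def \<zeta>_def algebra_simps)
qed

text \<open>The weight \<open>h\<close> of the area is bounded by \<open>K * \<rho>\<close>, which
  is exactly the weight in which \<open>u\<close> is known to be of second order.\<close>

lemma G_D0_good:
 assumes P: "exact_path e c1 C1 N a \<rho> \<rho>' z z' l (\<lambda>t. W t w) (\<lambda>t. X t w) (\<sigma> / sqrt e) (z (- (1/2)))"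
  and g: "good c w" and c: "c <= hmax"
 shows "\<bar>G w - D0 w\<bar> <= CQ * Q w"
proof -
 interpret P: exact_path e c1 C1 N a \<rho> \<rho>' z z' l "\<lambda>t. W t w" "\<lambda>t. X t w" "\<sigma> / sqrt e" "z (- (1/2))"
  by (rule P)
 have "\<bar>G w - D0 w\<bar> <= K * integral TI (\<lambda>t. \<rho> t * \<bar>P.u t\<bar>)"
  unfolding G_decomp[OF P] by (intro abs_integral_mult_le P.u_cont rho_cont h_cont h_le)
 also have "... <= K * ((24 * exp C1 / c1) * integral TI (\<lambda>t. (\<sigma> / sqrt e * lin (\<lambda>t. W t w) t)\<^sup>2))"
 proof (intro mult_left_mono P.rho_u_integral[where \<eta> = etaA] good_path[OF P g c] etaA_lin)
  show "etaA * \<rho> t <= 1/2" if "t \<in> TI" for t using etaA_rho[OF that] by linarith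
 qed (use K_pos eta_pos in auto)
 finally show ?thesis by (simp add: CQ_def Q_def \<zeta>_def)
qed

lemma Q_good: assumes g: "good c w" and w: "w \<in> space M" shows "Q w <= c^2 * \<Lambda>"
proof -
 have "Q w <= integral TI (\<lambda>t. c\<^sup>2 * (1 / \<rho> t))"
  unfolding Q_def
 proof (intro hk_le integrable_continuous_real continuous_intros zeta_cont w rho_cont ballI rho_ne)
  fix t assume t: "t \<in> TI"
  have "\<bar>\<zeta> t w\<bar> <= c / sqrt (\<rho> t)" using g t by (auto simp: good_def)
  then have "(\<zeta> t w)^2 <= (c / sqrt (\<rho> t))^2" by (intro power2_le_iff_abs_le[THEN iffD2]) auto
  then show "(\<zeta> t w)^2 <= c^2 * (1 / \<rho> t)" using rho_pos[OF t] by (simp add: power_divide)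
 qed
 also have "... = c^2 * integral TI (\<lambda>t. 1 / \<rho> t)" by (rule integral_mult_right)
 finally show ?thesis by (simp add: \<Lambda>_def)
qed

lemma CQ_pos: "0 < CQ" using K_pos c1_pos by (simp add: CQ_def)

text \<open>Half of \<open>H\<close> is left to the Gaussian part; the other half covers the
  remainder, at most \<open>CQ * \<Lambda> * c^2\<close> on the good event of level
  \<open>c\<close>. The level is chosen later according to the range of \<open>H\<close>.\<close>

lemma area_tail:
 assumes c: "0 < c" "c <= hmax" and H: "2 * CQ * \<Lambda> * c^2 <= H" "0 <= H"
 shows "prob {w\<in>space M. H <= \<bar>G w\<bar>} <= 2 * exp (- (H^2 / (16 * KV^2 * (\<sigma>^2 * e)))) + Cg / e * exp (- (kg * c^2 / \<sigma>^2))"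
proof -
 obtain B where B: "B \<in> sets M" "prob B <= Cg / e * exp (- (kg * c^2 / \<sigma>^2))"
  "\<And>w t. w \<in> space M - B \<Longrightarrow> t \<in> TI \<Longrightarrow> \<bar>\<zeta> t w\<bar> <= c / sqrt (\<rho> t)"
  using good_event[OF c(1)] by blast
 let ?D = "{w\<in>space M. H / 2 <= \<bar>D0 w\<bar>}"
 have Dm: "?D \<in> sets M" using D0_meas by measurable
 have "AE w in M. w \<in> {w\<in>space M. H <= \<bar>G w\<bar>} \<longrightarrow> w \<in> ?D \<union> B"
  using path
 proof eventually_elim
  case (elim w)
  show ?case
  proof (intro impI, rule ccontr)
   assume "w \<in> {w\<in>space M. H <= \<bar>G w\<bar>}" and n: "w \<notin> ?D \<union> B"
   then have w: "w \<in> space M" "H <= \<bar>G w\<bar>" "\<bar>D0 w\<bar> < H / 2" by auto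
   have g: "good c w" unfolding good_def using B(3)[of w] n w by auto
   have "\<bar>G w - D0 w\<bar> <= CQ * (c^2 * \<Lambda>)"
    using G_D0_good[OF elim g c(2)] mult_left_mono[OF Q_good[OF g w(1)], of CQ] CQ_pos by linarith
   then have "\<bar>G w - D0 w\<bar> <= H / 2" using H by (simp add: mult.commute mult.left_commute)
   then show False using w by linarith
  qed
 qed
 then have "prob {w\<in>space M. H <= \<bar>G w\<bar>} <= prob (?D \<union> B)"
  by (rule finite_measure_mono_AE) (use Dm B(1) in auto)
 also have "... <= prob ?D + prob B" by (rule measure_Un_le[OF Dm B(1)])
 also have "prob ?D <= 2 * exp (- ((H/2)^2 / (4 * KV^2 * (\<sigma>^2 * e))))" by (rule D0_tail) (use H in simp)
 also have "(H/2)^2 / (4 * KV^2 * (\<sigma>^2 * e)) = H^2 / (16 * KV^2 * (\<sigma>^2 * e))" by (simp add: power_divide)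
 finally show ?thesis using B(2) by linarith
qed

end

section \<open>Moments of the area\<close>

lemma integral_sq_le:
 fixes f :: "real \<Rightarrow> real"
 assumes "continuous_on TI f"
 shows "(integral TI f)^2 <= integral TI (\<lambda>t. (f t)\<^sup>2)"
 using Cauchy_Schwarz_integral[OF assms, of "\<lambda>_. 1"] by simp

lemma two_sq_le: "2 * x^2 <= 1 + (x::real) ^ 4"
proof -
 have "0 <= (x^2 - 1)^2" by simp
 moreover have "(x^2 - 1)^2 = x ^ 4 - 2 * x^2 + 1"
  by (simp add: power2_eq_square power4_eq_xxxx algebra_simps)
 ultimately show ?thesis by linarith
qed

text \<open>Testing with \<open>x - w\<close> because this will be the differentiable part of the
  path. Of the term \<open>- x ^ 4\<close>, three quarters pay for \<open>w * x ^ 3\<close> and one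
  quarter for the quadratic terms in \<open>x\<close>.\<close>

lemma dissipation_le:
 fixes x w l :: real
 assumes "\<bar>l\<bar> <= 1"
 shows "(x - w) * F x l <= 6 + w ^ 4"
proof -
 have 1: "x^2 <= x ^ 4 / 8 + 2"
 proof -
  have "0 <= (x^2 - 4)^2" by simp
  moreover have "(x^2 - 4)^2 = x ^ 4 - 8 * x^2 + 16"
   by (simp add: power2_eq_square power4_eq_xxxx algebra_simps)
  ultimately show ?thesis by linarith
 qed
 have 2: "l * x <= 1/2 + x^2 / 2" "- (w * l) <= 1/2 + w^2 / 2"
 proof -
  have l2: "l^2 <= 1" using assms by (simp add: abs_square_le_1)
  have "0 <= (l - x)^2" "0 <= (l + w)^2" by simp_all
  moreover have "(l - x)^2 = l^2 - 2 * (l * x) + x^2" "(l + w)^2 = l^2 + 2 * (w * l) + w^2"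
   by (simp_all add: power2_eq_square algebra_simps)
  ultimately show "l * x <= 1/2 + x^2 / 2" "- (w * l) <= 1/2 + w^2 / 2"
   using l2 by linarith+
 qed
 have 3: "- (w * x) <= w^2 / 2 + x^2 / 2"
 proof -
  have "0 <= (w + x)^2" by simp
  then show ?thesis by (simp add: power2_sum)
 qed
 have 4: "w * x ^ 3 <= 3/4 * x ^ 4 + w ^ 4 / 4"
 proof -
  have "0 <= (x^2 - x * w)^2 / 2 + (x^2 - w^2)^2 / 4" by simp
  moreover have "(x^2 - x * w)^2 / 2 + (x^2 - w^2)^2 / 4 = 3/4 * x ^ 4 + w ^ 4 / 4 - w * x ^ 3"
   by (simp add: power2_diff power_mult_distrib power4_eq_xxxx power3_eq_cube power2_eq_square field_simps)
  ultimately show ?thesis by simp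
 qed
 have 5: "w^2 <= 1/2 + w ^ 4 / 2" using two_sq_le[of w] by linarith
 have "(x - w) * F x l = x^2 - x ^ 4 + l * x - w * x + w * x ^ 3 - w * l"
  by (simp add: F_def power4_eq_xxxx power3_eq_cube power2_eq_square algebra_simps)
 moreover have "0 <= w ^ 4" by simp
 ultimately show ?thesis using 1 2 3 4 5 by linarith
qed

context nonlinear_path
begin

text \<open>A priori bound for every path, without any confinement: energy estimate for
  \<open>v = X - k * w\<close>. It serves on the exceptional event, where the stability estimates
  fail.\<close>

lemma X_sq_integral:
 assumes l: "\<And>t. t \<in> TI \<Longrightarrow> \<bar>l t\<bar> <= 1" and x0: "\<bar>x0\<bar> <= 3/2" and eps: "e <= 1"
 shows "integral TI (\<lambda>t. (X t)\<^sup>2) <= 30 / e * (1 + integral TI (\<lambda>t. (k * w t) ^ 4))"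
proof -
 let ?I = "integral TI (\<lambda>t. (k * w t) ^ 4)"
 have wc: "continuous_on TI (\<lambda>t. (k * w t) ^ 4)" by (intro continuous_intros w_cont)
 have I0: "0 <= ?I"
  by (intro hk_nonneg integrable_continuous_real wc) (auto simp: zero_le_even_power)
 define v where "v t = x0 + 1 / e * integral {- (1/2)..t} (\<lambda>s. F (X s) (l s))" for t
 have vd: "(v has_real_derivative F (X t) (l t) / e) (at t within TI)" if "t \<in> TI" for t
 proof -
  have "(v has_real_derivative 0 + 1 / e * F (X t) (l t)) (at t within TI)"
   unfolding v_def by (intro DERIV_add DERIV_cmult DERIV_const integral_has_derivative_within[OF FX_cont that])
  then show ?thesis by simp
 qed
 have Xv: "X t = v t + k * w t" if "t \<in> TI" for t using X_eq[OF that] by (simp add: v_def)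
 define C where "C = x0^2 + 2 / e * (6 + ?I)"
 have v_le: "(v t)^2 <= C" if t: "t \<in> TI" for t
 proof -
  have sub: "{- (1/2)..t} \<subseteq> TI" using t by auto
  have "(v t)^2 + integral {- (1/2)..t} (\<lambda>s. 0) <= (v (- (1/2)))^2 + integral {- (1/2)..t} (\<lambda>s. 2 / e * (6 + (k * w s) ^ 4))"
  proof (rule integral_le_of_derivative_le[where f' = "\<lambda>s. 2 * v s * (F (X s) (l s) / e)"])
   fix s assume s: "s \<in> {- (1/2)..t}"
   then have sI: "s \<in> TI" using sub by blast
   have "((\<lambda>s. (v s)\<^sup>2) has_real_derivative 2 * v s * (F (X s) (l s) / e)) (at s within TI)"
    using DERIV_power[OF vd[OF sI], of 2] by (simp add: ac_simps)
   then show "((\<lambda>s. (v s)\<^sup>2) has_real_derivative 2 * v s * (F (X s) (l s) / e)) (at s within {- (1/2)..t})"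
    by (rule DERIV_subset[OF _ sub])
   have "(X s - k * w s) * F (X s) (l s) <= 6 + (k * w s) ^ 4" by (rule dissipation_le[OF l[OF sI]])
   then have "2 / e * (v s * F (X s) (l s)) <= 2 / e * (6 + (k * w s) ^ 4)"
    using eps_pos Xv[OF sI] by (intro mult_left_mono) auto
   then show "2 * v s * (F (X s) (l s) / e) <= 2 / e * (6 + (k * w s) ^ 4) - 0" by simp
  qed (use t in \<open>auto intro!: continuous_intros continuous_on_subset[OF w_cont sub]\<close>)
  moreover have "integral {- (1/2)..t} (\<lambda>s. 2 / e * (6 + (k * w s) ^ 4)) <= integral TI (\<lambda>s. 2 / e * (6 + (k * w s) ^ 4))"
   by (intro integral_subset_le integrable_continuous_real continuous_intros w_cont continuous_on_subset[OF w_cont sub] sub)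
     (use eps_pos in \<open>auto intro!: divide_nonneg_pos add_nonneg_nonneg simp: zero_le_even_power\<close>)
  moreover have "integral TI (\<lambda>s. 2 / e * (6 + (k * w s) ^ 4)) = 2 / e * (6 + ?I)"
  proof -
   have "integral TI (\<lambda>s. 6 + (k * w s) ^ 4) = integral TI (\<lambda>s. 6) + ?I"
    by (intro hk_add integrable_continuous_real wc continuous_intros)
   then show ?thesis unfolding integral_mult_right by simp
  qed
  moreover have "v (- (1/2)) = x0" by (simp add: v_def)
  ultimately show ?thesis by (simp add: C_def)
 qed
 have "integral TI (\<lambda>t. (X t)\<^sup>2) <= integral TI (\<lambda>t. (2 * C + 1) + (k * w t) ^ 4)"
 proof (intro hk_le integrable_continuous_real continuous_intros X_cont w_cont)
  fix t assume t: "t \<in> TI"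
  have "(X t)^2 <= 2 * (v t)^2 + 2 * (k * w t)^2"
   using sum_squares_bound[of "v t" "k * w t"] unfolding Xv[OF t] by (simp add: power2_sum)
  moreover note two_sq_le[of "k * w t"]
  ultimately show "(X t)^2 <= (2 * C + 1) + (k * w t) ^ 4" using v_le[OF t] by linarith
 qed
 also have "... = (2 * C + 1) + ?I"
  by (subst hk_add) (auto intro!: integrable_continuous_real wc)
 also have "... <= 11/2 + (24 + 4 * ?I) / e + ?I"
 proof -
  have "x0^2 <= (3/2)^2" using x0 by (intro power2_le_iff_abs_le[THEN iffD2]) auto
  moreover have "2 * (2 / e * (6 + ?I)) = (24 + 4 * ?I) / e" by (simp add: field_simps)
  ultimately show ?thesis unfolding C_def distrib_left by (simp add: power2_eq_square)
 qed
 also have "... <= 30 / e * (1 + ?I)"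
 proof -
  have "1 <= 1 / e" using eps eps_pos by simp
  then have "11/2 * 1 <= 11/2 * (1 / e)" "?I * 1 <= ?I * (1 / e)" "0 <= ?I * (1 / e)"
   using I0 eps_pos by (intro mult_left_mono; simp)+ (use I0 eps_pos in simp)
  moreover have "(24 + 4 * ?I) / e = 24 * (1 / e) + 4 * (?I * (1 / e))" by (simp add: add_divide_distrib)
  moreover have "30 / e * (1 + ?I) = 30 * (1 / e) + 30 * (?I * (1 / e))" by (simp add: algebra_simps)
  ultimately show ?thesis using \<open>1 <= 1 / e\<close> by linarith
 qed
 finally show ?thesis .
qed

end

context prob_space
begin

text \<open>On the exceptional event \<open>y^2 <= \<delta> * y ^ 4 + 1 / \<delta>\<close>; since
  its probability is at most \<open>\<delta>^2\<close>, both terms contribute a multiple of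
  \<open>\<delta>\<close>. A crude fourth moment is enough if \<open>\<delta>\<close> is small
  against it.\<close>

lemma rare_event_moments:
 fixes Y Z :: "'a \<Rightarrow> real"
 assumes Y: "Y \<in> borel_measurable M" and Y4: "integrable M (\<lambda>w. Y w ^ 4)" "expectation (\<lambda>w. Y w ^ 4) <= m4"
  and B: "B \<in> sets M" "prob B <= \<delta>^2" and \<delta>: "0 < \<delta>" "\<delta> <= 1"
  and le: "AE w in M. w \<notin> B \<longrightarrow> \<bar>Y w\<bar> <= Z w"
  and Z: "\<And>w. w \<in> space M \<Longrightarrow> 0 <= Z w" "integrable M Z" "integrable M (\<lambda>w. (Z w)\<^sup>2)"
 shows "integrable M Y" "integrable M (\<lambda>w. (Y w)\<^sup>2)"
  "expectation (\<lambda>w. \<bar>Y w\<bar>) <= expectation Z + \<delta> * (2 + m4)"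
  "expectation (\<lambda>w. (Y w)\<^sup>2) <= expectation (\<lambda>w. (Z w)\<^sup>2) + \<delta> * (2 + m4)"
proof -
 have sq: "x^2 <= 1 + x ^ 4" and ab: "\<bar>x\<bar> <= 1 + x ^ 4" for x :: real
 proof -
  have "0 <= (\<bar>x\<bar> - 1)^2" by simp
  then have b: "2 * \<bar>x\<bar> <= x^2 + 1" by (simp add: power2_diff)
  note a = two_sq_le[of x]
  then show "x^2 <= 1 + x ^ 4" using zero_le_power2[of x] by linarith
  moreover have "0 <= x ^ 4" by simp
  ultimately show "\<bar>x\<bar> <= 1 + x ^ 4" using a b by linarith
 qed
 have i1: "integrable M (\<lambda>w. 1 + Y w ^ 4)" using Y4 by simp
 have p4: "0 <= x ^ 4" for x :: real by simp
 show YI: "integrable M Y"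
  by (rule Bochner_Integration.integrable_bound[OF i1 Y]) (use ab in \<open>auto intro: order_trans[OF _ abs_ge_self]\<close>)
 show Y2: "integrable M (\<lambda>w. (Y w)\<^sup>2)"
  by (rule Bochner_Integration.integrable_bound[OF i1]) (use Y sq in \<open>auto intro: order_trans[OF _ abs_ge_self]\<close>)
 have bi: "integrable M (indicator B :: 'a \<Rightarrow> real)" using B(1) by (simp add: integrable_indicator_iff less_top[symmetric])
 have Eb: "expectation (indicator B :: 'a \<Rightarrow> real) = prob B" using B(1) by simp
 have bad: "y^2 <= \<delta> * y ^ 4 + 1 / \<delta>" for y :: real
 proof -
  have "\<bar>y^2\<bar> * \<bar>1\<bar> <= (\<delta> * (y^2)^2 + 1^2 / \<delta>) / 2" by (rule mult_le_weighted_squares[OF \<delta>(1)])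
  moreover have "(y^2)^2 = y ^ 4" by (simp add: power2_eq_square power4_eq_xxxx)
  moreover have "0 <= \<delta> * y ^ 4" "0 <= 1 / \<delta>" using \<delta> by auto
  ultimately show ?thesis by (simp only: abs_1 mult_1_right power_one abs_power2) argo
 qed
 have pB: "1 / \<delta> * prob B <= \<delta>"
 proof -
  have "1 / \<delta> * prob B <= 1 / \<delta> * \<delta>^2" using B(2) \<delta> by (intro mult_left_mono) auto
  then show ?thesis using \<delta> by (simp add: power2_eq_square)
 qed
 have pB2: "prob B <= \<delta>"
 proof -
  have "\<delta> * \<delta> <= \<delta> * 1" using \<delta> by (intro mult_left_mono) auto
  then show ?thesis using B(2) by (simp add: power2_eq_square)
 qed
 have d4: "\<delta> * expectation (\<lambda>w. Y w ^ 4) <= \<delta> * m4" using Y4(2) \<delta> by (intro mult_left_mono) auto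
 have "expectation (\<lambda>w. (Y w)\<^sup>2) <= expectation (\<lambda>w. (Z w)\<^sup>2 + (\<delta> * Y w ^ 4 + 1 / \<delta> * indicator B w))"
 proof (rule integral_mono_AE[OF Y2])
  show "integrable M (\<lambda>w. (Z w)\<^sup>2 + (\<delta> * Y w ^ 4 + 1 / \<delta> * indicator B w))"
   by (intro Bochner_Integration.integrable_add integrable_mult_right Z Y4 bi)
  show "AE w in M. (Y w)\<^sup>2 <= (Z w)^2 + (\<delta> * Y w ^ 4 + 1 / \<delta> * indicator B w)"
   using le AE_space
  proof eventually_elim
   case (elim w)
   show ?case
   proof (cases "w \<in> B")
    case True
    then show ?thesis using bad[of "Y w"] by (simp add: add_increasing)
   next
    case False
    then have "(Y w)^2 <= (Z w)^2" using elim Z(1)[of w] by (intro power2_le_iff_abs_le[THEN iffD2]) auto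
    moreover have "0 <= \<delta> * Y w ^ 4" using \<delta> by simp
    ultimately show ?thesis using False by simp
   qed
  qed
 qed
 also have "... = expectation (\<lambda>w. (Z w)\<^sup>2) + (\<delta> * expectation (\<lambda>w. Y w ^ 4) + 1 / \<delta> * prob B)"
  using Z Y4 bi Eb by (simp add: integrable_mult_right)
 finally show "expectation (\<lambda>w. (Y w)\<^sup>2) <= expectation (\<lambda>w. (Z w)\<^sup>2) + \<delta> * (2 + m4)"
  using pB d4 \<delta> unfolding distrib_left by linarith
 have "expectation (\<lambda>w. \<bar>Y w\<bar>) <= expectation (\<lambda>w. Z w + (\<delta> * Y w ^ 4 + (1 / \<delta> + 1) * indicator B w))"
 proof (rule integral_mono_AE)
  show "integrable M (\<lambda>w. \<bar>Y w\<bar>)" using YI by simp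
  show "integrable M (\<lambda>w. Z w + (\<delta> * Y w ^ 4 + (1 / \<delta> + 1) * indicator B w))"
   by (intro Bochner_Integration.integrable_add integrable_mult_right Z Y4 bi)
  show "AE w in M. \<bar>Y w\<bar> <= Z w + (\<delta> * Y w ^ 4 + (1 / \<delta> + 1) * indicator B w)"
   using le AE_space
  proof eventually_elim
   case (elim w)
   show ?case
   proof (cases "w \<in> B")
    case True
    have "0 <= (\<bar>Y w\<bar> - 1)^2" by simp
    then have "2 * \<bar>Y w\<bar> <= (Y w)^2 + 1" by (simp add: power2_diff)
    then have "\<bar>Y w\<bar> <= \<delta> * Y w ^ 4 + 1 / \<delta> + 1" using bad[of "Y w"] by linarith
    then show ?thesis using True Z(1)[of w] elim by simp
   next
    case False
    moreover have "0 <= \<delta> * Y w ^ 4" using \<delta> by simp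
    ultimately show ?thesis using elim by simp
   qed
  qed
 qed
 also have "... = expectation Z + (\<delta> * expectation (\<lambda>w. Y w ^ 4) + (1 / \<delta> + 1) * prob B)"
  using Z Y4 bi Eb by (simp add: integrable_mult_right)
 finally show "expectation (\<lambda>w. \<bar>Y w\<bar>) <= expectation Z + \<delta> * (2 + m4)"
  using pB pB2 d4 \<delta> unfolding distrib_left distrib_right by linarith
qed

end

context area_well
begin

text \<open>The eighth moment enters because \<open>G ^ 4\<close> is bounded through the square of
  the time integral of the fourth power of the noise. The constant is
  \<open>105 = 7 * 5 * 3\<close>.\<close>

lemma W_moment8:
 assumes t: "t \<in> TI"
 shows "integrable M (\<lambda>w. (\<sigma> / sqrt e * W t w) ^ 8)" "expectation (\<lambda>w. (\<sigma> / sqrt e * W t w) ^ 8) <= 105 * (\<sigma>^2 / e) ^ 4"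
proof -
 have "integrable M (\<lambda>w. (\<sigma> / sqrt e * W t w) ^ 8) \<and> expectation (\<lambda>w. (\<sigma> / sqrt e * W t w) ^ 8) <= 105 * (\<sigma>^2 / e) ^ 4"
 proof (cases "t = - (1/2)")
  case True
  have "integrable M (\<lambda>w. (\<sigma> / sqrt e * W t w) ^ 8)"
   by (rule Bochner_Integration.integrable_cong[THEN iffD2, of _ _ _ "\<lambda>_. 0"]) (auto simp: True W_start)
  moreover have "expectation (\<lambda>w. (\<sigma> / sqrt e * W t w) ^ 8) = expectation (\<lambda>_. 0)"
   by (rule Bochner_Integration.integral_cong) (auto simp: True W_start)
  ultimately show ?thesis using eps_pos by simp
 next
  case False
  then have v: "0 < t + 1/2" "t + 1/2 <= 1" using t by auto
  have d: "distributed M lborel (\<lambda>w. W t w - W (- (1/2)) w) (normal_density 0 (sqrt (t + 1/2)))"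
   using BM_increment[of "- (1/2)" t] v by simp
  note n = normal_moment[OF d v(1)]
  have eq: "(\<sigma> / sqrt e * W t w) ^ 8 = (\<sigma>^2 / e) ^ 4 * (W t w - W (- (1/2)) w) ^ (2 * 4)" if "w \<in> space M" for w
  proof -
   have "(\<sigma> / sqrt e) ^ 8 = ((\<sigma> / sqrt e)^2) ^ 4" by (simp flip: power_mult)
   also have "(\<sigma> / sqrt e)^2 = \<sigma>^2 / e" using eps_pos by (simp add: power_divide)
   finally show ?thesis unfolding power_mult_distrib[of "\<sigma> / sqrt e"] using W_start[OF that] by simp
  qed
  have i: "integrable M (\<lambda>w. (\<sigma> / sqrt e * W t w) ^ 8)"
   by (rule Bochner_Integration.integrable_cong[THEN iffD2, OF refl eq integrable_mult_right[OF n(2)]])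
  have "expectation (\<lambda>w. (\<sigma> / sqrt e * W t w) ^ 8) = expectation (\<lambda>w. (\<sigma>^2 / e) ^ 4 * (W t w - W (- (1/2)) w) ^ (2 * 4))"
   by (rule Bochner_Integration.integral_cong) (simp_all only: eq)
  also have "... = (\<sigma>^2 / e) ^ 4 * (105 * (t + 1/2) ^ 4)"
   by (simp only: integral_mult_right_zero n(1)) (simp add: fact_numeral)
  also have "... <= (\<sigma>^2 / e) ^ 4 * (105 * 1)"
   by (intro mult_left_mono power_le_one) (use v eps_pos in auto)
  finally show ?thesis using i by (simp only: mult.commute) simp
 qed
 then show "integrable M (\<lambda>w. (\<sigma> / sqrt e * W t w) ^ 8)" "expectation (\<lambda>w. (\<sigma> / sqrt e * W t w) ^ 8) <= 105 * (\<sigma>^2 / e) ^ 4"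
  by auto
qed

definition I8 :: "'w \<Rightarrow> real" where "I8 w = integral TI (\<lambda>t. (\<sigma> / sqrt e * W t w) ^ 8)"

lemma I8_moment: "integrable M I8" "expectation I8 <= 105 * (\<sigma>^2 / e) ^ 4"
proof -
 have c: "continuous_on TI (\<lambda>t. (\<sigma> / sqrt e * W t w) ^ 8)" if "w \<in> space M" for w
  by (intro continuous_intros W_cont that)
 have c2: "continuous_on TI (\<lambda>t::real. 105 * (\<sigma>^2 / e) ^ 4)" by simp
 note * = path_integral_nonneg[where Y = "\<lambda>t w. (\<sigma> / sqrt e * W t w) ^ 8", OF W_moment8(1) c _ c2 W_moment8(2)]
 show "integrable M I8" unfolding I8_def[abs_def] by (rule *(1)) (auto simp: zero_le_even_power)
 show "expectation I8 <= 105 * (\<sigma>^2 / e) ^ 4" using *(2) by (simp add: I8_def[abs_def] zero_le_even_power)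
qed

lemma K_R_pos: "0 < K * R" using K_pos R_pos by simp

lemma G_fourth_le:
 assumes P: "exact_path e c1 C1 N a \<rho> \<rho>' z z' l (\<lambda>t. W t w) (\<lambda>t. X t w) (\<sigma> / sqrt e) (z (- (1/2)))"
 shows "G w ^ 4 <= (K * R) ^ 4 * (65 / e)^2 * (2 + 2 * I8 w)"
proof -
 interpret P: exact_path e c1 C1 N a \<rho> \<rho>' z z' l "\<lambda>t. W t w" "\<lambda>t. X t w" "\<sigma> / sqrt e" "z (- (1/2))"
  by (rule P)
 let ?I = "integral TI (\<lambda>t. (\<sigma> / sqrt e * W t w) ^ 4)"
 have hR: "(h t)^2 <= (K * R)^2" if t: "t \<in> TI" for t
 proof -
  have "\<bar>h t\<bar> <= K * R" using h_le[OF t] mult_left_mono[OF rho_le[OF t], of K] K_pos by linarith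
  then show ?thesis using K_R_pos by (intro power2_le_iff_abs_le[THEN iffD2]) auto
 qed
 have I0: "0 <= ?I"
  by (intro hk_nonneg integrable_continuous_real continuous_intros P.w_cont) (auto simp: zero_le_even_power)
 have "(G w)^2 <= integral TI (\<lambda>t. (h t * (X t w - z t))\<^sup>2)"
  unfolding G_def by (intro integral_sq_le continuous_intros h_cont P.X_cont z_cont)
 also have "... <= integral TI (\<lambda>t. (K * R)\<^sup>2 * (2 * (X t w)^2 + 9/2))"
 proof (intro hk_le integrable_continuous_real continuous_intros h_cont P.X_cont z_cont)
  fix t assume t: "t \<in> TI"
  have "(X t w - z t)^2 <= 2 * (X t w)^2 + 2 * (z t)^2"
  proof -
   have "0 <= (X t w + z t)^2" by simp
   then show ?thesis by (simp add: power2_sum power2_diff)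
  qed
  moreover have "(z t)^2 <= (3/2)^2" using z_range[OF t] by (intro power_mono) auto
  ultimately have "(X t w - z t)^2 <= 2 * (X t w)^2 + 9/2" by (simp add: power2_eq_square)
  then show "(h t * (X t w - z t))^2 <= (K * R)^2 * (2 * (X t w)^2 + 9/2)"
   unfolding power_mult_distrib[of "h t"] by (intro mult_mono hR t) auto
 qed
 also have "... = (K * R)^2 * (2 * integral TI (\<lambda>t. (X t w)\<^sup>2) + 9/2)"
 proof -
  have "integral TI (\<lambda>t. 2 * (X t w)^2 + 9/2) = integral TI (\<lambda>t. 2 * (X t w)^2) + integral TI (\<lambda>t. 9/2)"
   by (intro hk_add integrable_continuous_real continuous_intros P.X_cont)
  then show ?thesis unfolding integral_mult_right by simp
 qed
 also have "... <= (K * R)^2 * (65 / e * (1 + ?I))"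
 proof (intro mult_left_mono)
  have "integral TI (\<lambda>t. (X t w)\<^sup>2) <= 30 / e * (1 + ?I)"
   by (rule P.X_sq_integral[OF l_bound]) (use z_range[of "- (1/2)"] eps_le in auto)
  moreover have "9/2 <= 5 / e * (1 + ?I)"
  proof -
   have "5 <= 5 / e" using eps_pos eps_le by (simp add: field_simps)
   then have "5 * 1 <= 5 / e * (1 + ?I)" using I0 eps_pos by (intro mult_mono) auto
   then show ?thesis by linarith
  qed
  moreover have "65 / e * (1 + ?I) = 2 * (30 / e * (1 + ?I)) + 5 / e * (1 + ?I)" by (simp add: field_simps)
  ultimately show "2 * integral TI (\<lambda>t. (X t w)\<^sup>2) + 9/2 <= 65 / e * (1 + ?I)" by linarith
 qed simp
 finally have "((G w)^2)^2 <= ((K * R)^2 * (65 / e * (1 + ?I)))^2" by (intro power_mono) auto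
 also have "... = (K * R) ^ 4 * (65 / e)^2 * (1 + ?I)^2"
  unfolding power_mult_distrib[of "(K * R)^2"] power_mult_distrib[of "65 / e"] mult.assoc
  by (simp only: power_mult[symmetric]) simp
 also have "(1 + ?I)^2 <= 2 + 2 * I8 w"
 proof -
  have "?I\<^sup>2 <= integral TI (\<lambda>t. ((\<sigma> / sqrt e * W t w) ^ 4)\<^sup>2)"
   by (intro integral_sq_le continuous_intros P.w_cont)
  also have "... = I8 w" by (simp add: I8_def flip: power_mult)
  finally have "?I\<^sup>2 <= I8 w" .
  moreover have "0 <= (1 - ?I)^2" by simp
  ultimately show ?thesis by (simp add: power2_sum power2_diff)
 qed
 finally show ?thesis using eps_pos K_R_pos by (simp add: mult_left_mono)
qed

lemma G_moment4:
 assumes s: "\<sigma>^2 <= 1"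
 shows "integrable M (\<lambda>w. G w ^ 4)" "expectation (\<lambda>w. G w ^ 4) <= (K * R) ^ 4 * 900000 / e ^ 6"
proof -
 let ?H = "\<lambda>w. (K * R) ^ 4 * (65 / e)^2 * (2 + 2 * I8 w)"
 have le: "AE w in M. G w ^ 4 <= ?H w" using path by eventually_elim (rule G_fourth_le)
 have Hi: "integrable M ?H" using I8_moment(1) by simp
 have Gm: "(\<lambda>w. G w ^ 4) \<in> borel_measurable M" using G_meas by measurable
 show i: "integrable M (\<lambda>w. G w ^ 4)"
 proof (rule Bochner_Integration.integrable_bound[OF Hi Gm])
  show "AE w in M. norm (G w ^ 4) <= norm (?H w)"
   using le
  proof eventually_elim
   case (elim w)
   have "norm (G w ^ 4) = G w ^ 4" by simp
   also have "... <= norm (?H w)" using elim by (simp only: real_norm_def)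
   finally show ?case .
  qed
 qed
 have "expectation (\<lambda>w. G w ^ 4) <= expectation ?H" by (rule integral_mono_AE[OF i Hi le])
 also have "... = (K * R) ^ 4 * (65 / e)^2 * (2 + 2 * expectation I8)"
  using I8_moment(1) by (simp add: prob_space)
 also have "... <= (K * R) ^ 4 * (65 / e)^2 * (212 / e ^ 4)"
 proof (intro mult_left_mono)
  have "(\<sigma>^2 / e) ^ 4 <= (1 / e) ^ 4" using s eps_pos by (intro power_mono divide_right_mono) auto
  moreover have "1 <= 1 / e ^ 4" using eps_pos eps_le by (simp add: power_le_one)
  moreover have "(1 / e) ^ 4 = 1 / e ^ 4" by (simp add: power_divide)
  moreover have "212 / e ^ 4 = 212 * (1 / e ^ 4)" by simp
  ultimately show "2 + 2 * expectation I8 <= 212 / e ^ 4" using I8_moment(2) by linarith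
 qed (use K_R_pos in auto)
 also have "... = (K * R) ^ 4 * (895700 / e ^ 6)"
  using eps_pos by (simp add: power_divide field_simps power_numeral_reduce)
 also have "... <= (K * R) ^ 4 * (900000 / e ^ 6)"
  by (intro mult_left_mono divide_right_mono) (use K_R_pos eps_pos in auto)
 finally show "expectation (\<lambda>w. G w ^ 4) <= (K * R) ^ 4 * 900000 / e ^ 6" by simp
qed

end

lemma fourth_power_add_le: "(x + y) ^ 4 <= 8 * (x ^ 4 + (y::real) ^ 4)"
proof -
 have "(x + y) ^ 4 = ((x + y)^2)^2" by (simp flip: power_mult)
 also have "... <= (2 * (x^2 + y^2))^2"
 proof (rule power_mono)
  show "(x + y)^2 <= 2 * (x^2 + y^2)" using sum_squares_bound[of x y] by (simp add: power2_sum)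
 qed simp
 also have "... = 4 * (x^2 + y^2)^2" unfolding power_mult_distrib by simp
 also have "(x^2 + y^2)^2 <= 2 * ((x^2)^2 + (y^2)^2)"
  using sum_squares_bound[of "x^2" "y^2"] by (simp add: power2_sum)
 also have "4 * (2 * ((x^2)^2 + (y^2)^2)) = 8 * (x ^ 4 + y ^ 4)" by (simp flip: power_mult)
 finally show ?thesis by simp
qed

lemma mult_le_sq_quarter: "x * y <= x^2 + (y::real)^2 / 4"
proof -
 have "0 <= (x - y / 2)^2" by simp
 also have "... = x^2 + y^2 / 4 - x * y" by (simp add: power2_eq_square algebra_simps)
 finally show ?thesis by simp
qed

context prob_space
begin

lemma integrable_mult_of_squares:
 fixes X Y :: "'a \<Rightarrow> real"
 assumes "X \<in> borel_measurable M" "Y \<in> borel_measurable M"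
  "integrable M (\<lambda>w. (X w)\<^sup>2)" "integrable M (\<lambda>w. (Y w)\<^sup>2)"
 shows "integrable M (\<lambda>w. X w * Y w)"
proof (rule Bochner_Integration.integrable_bound)
 show "integrable M (\<lambda>w. (X w)\<^sup>2 + (Y w)^2)" using assms by simp
 show "AE w in M. norm (X w * Y w) <= norm ((X w)^2 + (Y w)^2)"
 proof (rule AE_I2)
  fix w
  have "2 * (\<bar>X w\<bar> * \<bar>Y w\<bar>) <= (X w)^2 + (Y w)^2"
   using sum_squares_bound[of "\<bar>X w\<bar>" "\<bar>Y w\<bar>"] by simp
  moreover have "0 <= \<bar>X w\<bar> * \<bar>Y w\<bar>" by simp
  ultimately show "norm (X w * Y w) <= norm ((X w)^2 + (Y w)^2)"
   unfolding real_norm_def abs_mult by linarith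
 qed
qed (use assms in measurable)

lemma fourth_moment_add:
 fixes X Y :: "'a \<Rightarrow> real"
 assumes m: "X \<in> borel_measurable M" "Y \<in> borel_measurable M"
  and i: "integrable M (\<lambda>w. X w ^ 4)" "integrable M (\<lambda>w. Y w ^ 4)"
 shows "integrable M (\<lambda>w. (X w - Y w) ^ 4)"
  "expectation (\<lambda>w. (X w - Y w) ^ 4) <= 8 * (expectation (\<lambda>w. X w ^ 4) + expectation (\<lambda>w. Y w ^ 4))"
proof -
 have le: "(X w - Y w) ^ 4 <= 8 * (X w ^ 4 + Y w ^ 4)" for w
  using fourth_power_add_le[of "X w" "- Y w"] by simp
 have i2: "integrable M (\<lambda>w. 8 * (X w ^ 4 + Y w ^ 4))" using i by simp
 show i3: "integrable M (\<lambda>w. (X w - Y w) ^ 4)"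
 proof (rule Bochner_Integration.integrable_bound[OF i2])
  show "AE w in M. norm ((X w - Y w) ^ 4) <= norm (8 * (X w ^ 4 + Y w ^ 4))"
  proof (rule AE_I2)
   fix w
   have "norm ((X w - Y w) ^ 4) = (X w - Y w) ^ 4" by simp
   also note le
   also have "8 * (X w ^ 4 + Y w ^ 4) = norm (8 * (X w ^ 4 + Y w ^ 4))" by simp
   finally show "norm ((X w - Y w) ^ 4) <= norm (8 * (X w ^ 4 + Y w ^ 4))" .
  qed
 qed (use m in measurable)
 have "expectation (\<lambda>w. (X w - Y w) ^ 4) <= expectation (\<lambda>w. 8 * (X w ^ 4 + Y w ^ 4))"
  by (rule Bochner_Integration.integral_mono[OF i3 i2 le])
 then show "expectation (\<lambda>w. (X w - Y w) ^ 4) <= 8 * (expectation (\<lambda>w. X w ^ 4) + expectation (\<lambda>w. Y w ^ 4))"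
  using i by simp
qed

end

context area_well
begin

lemma Q_moments:
 shows "Q \<in> borel_measurable M" "integrable M Q" "integrable M (\<lambda>w. (Q w)\<^sup>2)" "w \<in> space M \<Longrightarrow> 0 <= Q w"
  "expectation Q <= \<sigma>^2 * V * \<Lambda>" "expectation (\<lambda>w. (Q w)\<^sup>2) <= 3 * (\<sigma>^2 * V * \<Lambda>)^2"
proof -
 have o: "continuous_on TI (\<lambda>t::real. 1::real)" by simp
 show i: "integrable M Q"
  using zeta_integral_moment(1)[OF o _ zero_less_one] by (simp add: Q_def[abs_def])
 show "Q \<in> borel_measurable M" using i by (rule borel_measurable_integrable)
 show "integrable M (\<lambda>w. (Q w)\<^sup>2)"
  using zeta_integral_sq_moment(1)[OF o _ zero_less_one] by (simp add: Q_def)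
 show "w \<in> space M \<Longrightarrow> 0 <= Q w"
  unfolding Q_def by (intro hk_nonneg integrable_continuous_real continuous_intros zeta_cont) auto
 show "expectation Q <= \<sigma>^2 * V * \<Lambda>"
  using zeta_integral_moment(2)[OF o _ zero_less_one] by (simp add: Q_def[abs_def] \<Lambda>_def)
 show "expectation (\<lambda>w. (Q w)\<^sup>2) <= 3 * (\<sigma>^2 * V * \<Lambda>)^2"
  using zeta_integral_sq_moment(2)[OF o _ zero_less_one]
  by (simp add: Q_def \<Lambda>_def fact_numeral power_mult_distrib)
qed

text \<open>Square root of the bound for the exceptional event, the form in which
  \<open>rare_event_moments\<close> takes it.\<close>

definition \<delta>B :: real where "\<delta>B = sqrt (Cg / e * exp (- (kg * hmax^2 / \<sigma>^2)))"

lemma deltaB_pos: "0 < \<delta>B" using Cg_pos eps_pos by (simp add: \<delta>B_def)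

lemma good_event_max:
 obtains B where "B \<in> sets M" "prob B <= \<delta>B^2" "\<And>w. w \<in> space M - B \<Longrightarrow> good hmax w"
proof -
 obtain B where B: "B \<in> sets M" "prob B <= Cg / e * exp (- (kg * hmax^2 / \<sigma>^2))"
  "\<And>w t. w \<in> space M - B \<Longrightarrow> t \<in> TI \<Longrightarrow> \<bar>\<zeta> t w\<bar> <= hmax / sqrt (\<rho> t)"
  using good_event[OF hmax_pos] by blast
 have "\<delta>B^2 = Cg / e * exp (- (kg * hmax^2 / \<sigma>^2))" using Cg_pos eps_pos by (simp add: \<delta>B_def)
 then show ?thesis using B by (intro that[of B]) (auto simp: good_def)
qed

definition M4 :: real where "M4 = 8 * ((K * R) ^ 4 * 900000 / e ^ 6 + 3 * v0^2)"

lemma G_D0_fourth: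
 assumes s: "\<sigma>^2 <= 1"
 shows "integrable M (\<lambda>w. (G w - D0 w) ^ 4)" "expectation (\<lambda>w. (G w - D0 w) ^ 4) <= M4"
proof -
 have e: "expectation (\<lambda>w. D0 w ^ 4) = 3 * v0^2"
  using D0_moments(3)[of 2] by (simp add: v0_def fact_numeral)
 note f = fourth_moment_add[OF G_meas D0_meas G_moment4(1)[OF s] D0_moments(1)]
 show "integrable M (\<lambda>w. (G w - D0 w) ^ 4)" by (rule f(1))
 show "expectation (\<lambda>w. (G w - D0 w) ^ 4) <= M4"
  unfolding M4_def by (rule order_trans[OF f(2)], unfold e, intro mult_left_mono add_right_mono G_moment4(2)[OF s]) simp
qed

text \<open>\<open>D0\<close> is centred, so the mean of \<open>G\<close> comes from
  \<open>G - D0\<close>, which is of second order on the good event.\<close>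

lemma area_moments:
 assumes s: "\<sigma>^2 <= 1" and d: "\<delta>B <= 1"
 shows "integrable M G" "integrable M (\<lambda>w. (G w)\<^sup>2)"
  "\<bar>expectation G\<bar> <= CQ * (\<sigma>^2 * V * \<Lambda>) + \<delta>B * (2 + M4)"
  "expectation (\<lambda>w. (G w)\<^sup>2) <= 2 * v0 + 2 * (CQ^2 * (3 * (\<sigma>^2 * V * \<Lambda>)^2) + \<delta>B * (2 + M4))"
proof -
 obtain B where B: "B \<in> sets M" "prob B <= \<delta>B^2" "\<And>w. w \<in> space M - B \<Longrightarrow> good hmax w"
  using good_event_max by blast
 have le: "AE w in M. w \<notin> B \<longrightarrow> \<bar>G w - D0 w\<bar> <= CQ * Q w"
  using path AE_space by eventually_elim (use B(3) G_D0_good in auto)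
 have Ym: "(\<lambda>w. G w - D0 w) \<in> borel_measurable M" using G_meas D0_meas by measurable
 have Z: "\<And>w. w \<in> space M \<Longrightarrow> 0 <= CQ * Q w" "integrable M (\<lambda>w. CQ * Q w)" "integrable M (\<lambda>w. (CQ * Q w)\<^sup>2)"
  using Q_moments CQ_pos by (auto simp: power_mult_distrib)
 note r = rare_event_moments[OF Ym G_D0_fourth[OF s] B(1,2) deltaB_pos d le Z]
 have D0i: "integrable M D0" "integrable M (\<lambda>w. (D0 w)\<^sup>2)" using D0_moments(1)[of 1] D0_moments(1)[of 2] by auto
 have D0v: "expectation (\<lambda>w. (D0 w)\<^sup>2) = v0" using D0_moments(3)[of 1] by (simp add: v0_def)
 have "integrable M (\<lambda>w. (G w - D0 w) + D0 w)" by (intro Bochner_Integration.integrable_add r(1) D0i)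
 then show GI: "integrable M G" by simp
 have EQ1: "expectation (\<lambda>w. CQ * Q w) <= CQ * (\<sigma>^2 * V * \<Lambda>)"
  using mult_left_mono[OF Q_moments(5), of CQ] CQ_pos by simp
 have EQ2: "expectation (\<lambda>w. (CQ * Q w)\<^sup>2) <= CQ^2 * (3 * (\<sigma>^2 * V * \<Lambda>)^2)"
  unfolding power_mult_distrib[of CQ] integral_mult_right_zero by (intro mult_left_mono Q_moments) auto
 have EG: "expectation G = expectation (\<lambda>w. G w - D0 w)" using GI D0i D0_moments(2) by simp
 have "\<bar>expectation G\<bar> <= expectation (\<lambda>w. \<bar>G w - D0 w\<bar>)" unfolding EG by (rule integral_abs_bound)
 then show "\<bar>expectation G\<bar> <= CQ * (\<sigma>^2 * V * \<Lambda>) + \<delta>B * (2 + M4)" using r(3) EQ1 by linarith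
 have G2: "(G w)^2 <= 2 * (D0 w)^2 + 2 * (G w - D0 w)^2" for w
 proof -
  have "0 <= (G w - 2 * D0 w)^2" by simp
  moreover have "(G w - 2 * D0 w)^2 = 2 * (D0 w)^2 + 2 * (G w - D0 w)^2 - (G w)^2"
   by (simp add: power2_eq_square algebra_simps)
  ultimately show ?thesis by linarith
 qed
 have i2: "integrable M (\<lambda>w. 2 * (D0 w)^2 + 2 * (G w - D0 w)^2)"
  by (intro Bochner_Integration.integrable_add integrable_mult_right r D0i)
 show G2I: "integrable M (\<lambda>w. (G w)\<^sup>2)"
 proof (rule Bochner_Integration.integrable_bound[OF i2])
  show "AE w in M. norm ((G w)^2) <= norm (2 * (D0 w)^2 + 2 * (G w - D0 w)^2)"
  proof (rule AE_I2)
   fix w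
   have "norm ((G w)^2) = (G w)^2" by simp
   also have "... <= norm (2 * (D0 w)^2 + 2 * (G w - D0 w)^2)"
    using G2[of w] unfolding real_norm_def by linarith
   finally show "norm ((G w)^2) <= norm (2 * (D0 w)^2 + 2 * (G w - D0 w)^2)" .
  qed
 qed (use G_meas in measurable)
 have "expectation (\<lambda>w. (G w)\<^sup>2) <= expectation (\<lambda>w. 2 * (D0 w)^2 + 2 * (G w - D0 w)^2)"
  by (rule Bochner_Integration.integral_mono[OF G2I i2 G2])
 also have "... = 2 * v0 + 2 * expectation (\<lambda>w. (G w - D0 w)\<^sup>2)"
  using r(2) D0i D0v by simp
 finally have fin: "expectation (\<lambda>w. (G w)\<^sup>2) <= 2 * v0 + 2 * expectation (\<lambda>w. (G w - D0 w)\<^sup>2)" .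
 have r4: "expectation (\<lambda>w. (G w - D0 w)\<^sup>2) <= expectation (\<lambda>w. (CQ * Q w)\<^sup>2) + \<delta>B * (2 + M4)" by (rule r(4))
 show "expectation (\<lambda>w. (G w)\<^sup>2) <= 2 * v0 + 2 * (CQ^2 * (3 * (\<sigma>^2 * V * \<Lambda>)^2) + \<delta>B * (2 + M4))"
  by (rule order_trans[OF fin], intro add_left_mono mult_left_mono order_trans[OF r4] add_right_mono EQ2) simp
qed

section \<open>Quadratic part of the area and lower bound on its variance\<close>

definition qf :: "real \<Rightarrow> real" where "qf s = - (3 * z s) / e * gk s"
text \<open>Contribution of \<open>u2\<close> to the area, rewritten with the adjoint kernel as a
  weighted integral of \<open>\<zeta>^2\<close>. In this form its covariance with \<open>D0\<close>
  can be computed time by time. The weight \<open>qf\<close> is bounded because the kernel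
  \<open>gk\<close> is of order \<open>e\<close>.\<close>

definition R2 :: "'w \<Rightarrow> real" where "R2 w = integral TI (\<lambda>s. qf s * (\<zeta> s w)^2)"

lemma qf_cont: "continuous_on TI qf"
 unfolding qf_def[abs_def] by (intro continuous_intros z_cont gk_cont) simp

lemma KV_pos: "0 < KV" using K_pos c1_pos by (simp add: KV_def)

lemma qf_le: assumes s: "s \<in> TI" shows "\<bar>qf s\<bar> <= 9/2 * KV"
proof -
 have "\<bar>gk s\<bar> <= K * (exp C1 * e / c1)" by (rule adjoint_bound[OF h_cont h_le s]) (use K_pos in auto)
 then have "3 * z s / e * \<bar>gk s\<bar> <= 9/2 / e * (K * (exp C1 * e / c1))"
  by (intro mult_mono divide_right_mono) (use z_range[OF s] eps_pos in auto)
 moreover have "\<bar>qf s\<bar> = 3 * z s / e * \<bar>gk s\<bar>"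
  unfolding qf_def abs_mult using z_range[OF s] eps_pos by simp
 moreover have "9/2 / e * (K * (exp C1 * e / c1)) = 9/2 * KV" using eps_pos by (simp add: KV_def)
 ultimately show ?thesis by linarith
qed

lemma R2_meas: "R2 \<in> borel_measurable M"
 unfolding R2_def[abs_def]
proof (rule path_integral_measurable)
 show "(\<lambda>w. qf t * (\<zeta> t w)^2) \<in> borel_measurable M" if "t \<in> TI" for t
  using zeta_measurable[OF that] by measurable
qed (intro continuous_intros qf_cont zeta_cont)

lemma R2_le: assumes w: "w \<in> space M" shows "\<bar>R2 w\<bar> <= 9/2 * KV * Q w"
proof -
 have "\<bar>R2 w\<bar> <= 9/2 * KV * integral TI (\<lambda>t. 1 * \<bar>(\<zeta> t w)\<^sup>2\<bar>)"
  unfolding R2_def by (rule abs_integral_mult_le) (use qf_le in \<open>auto intro!: continuous_intros zeta_cont w qf_cont\<close>)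
 then show ?thesis by (simp add: Q_def)
qed

definition \<Lambda>2 :: real where "\<Lambda>2 = integral TI (\<lambda>t. 1 / (\<rho> t)^2)"
definition \<Lambda>3 :: real where "\<Lambda>3 = integral TI (\<lambda>t. 1 / (\<rho> t) ^ 3)"

lemma R2_fourth:
 shows "integrable M (\<lambda>w. R2 w ^ 4)" "expectation (\<lambda>w. R2 w ^ 4) <= (9/2 * KV) ^ 4 * (105 * (\<sigma>^2 * V) ^ 4 * \<Lambda>2^2)"
proof -
 have o: "continuous_on TI (\<lambda>t::real. 1::real)" by simp
 let ?S = "\<lambda>w. integral TI (\<lambda>t. 1 * \<zeta> t w ^ (2 * 2))"
 note s = zeta_integral_sq_moment[OF o, of 2]
 have Si: "integrable M (\<lambda>w. (?S w)\<^sup>2)" by (rule s(1)) auto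
 have Se: "expectation (\<lambda>w. (?S w)\<^sup>2) <= 105 * (\<sigma>^2 * V) ^ 4 * \<Lambda>2^2"
  using s(2) by (simp add: \<Lambda>2_def fact_numeral)
 have le: "R2 w ^ 4 <= (9/2 * KV) ^ 4 * (?S w)^2" if w: "w \<in> space M" for w
 proof -
  have "(Q w)^2 <= integral TI (\<lambda>t. ((\<zeta> t w)^2)\<^sup>2)"
   unfolding Q_def by (intro integral_sq_le continuous_intros zeta_cont w)
  also have "... = ?S w" by (simp flip: power_mult)
  finally have "((Q w)^2)^2 <= (?S w)^2" by (intro power_mono) auto
  then have q4: "Q w ^ 4 <= (?S w)^2" by (simp flip: power_mult)
  have "\<bar>R2 w\<bar> ^ 4 <= (9/2 * KV * Q w) ^ 4" by (intro power_mono R2_le w) auto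
  also have "... = (9/2 * KV) ^ 4 * Q w ^ 4" by (simp only: power_mult_distrib)
  also have "... <= (9/2 * KV) ^ 4 * (?S w)^2" using q4 by (intro mult_left_mono) auto
  finally show ?thesis by simp
 qed
 have i2: "integrable M (\<lambda>w. (9/2 * KV) ^ 4 * (?S w)^2)" using Si by (intro integrable_mult_right)
 show i: "integrable M (\<lambda>w. R2 w ^ 4)"
 proof (rule Bochner_Integration.integrable_bound[OF i2])
  show "AE w in M. norm (R2 w ^ 4) <= norm ((9/2 * KV) ^ 4 * (?S w)^2)"
  proof (rule AE_I2)
   fix w assume w: "w \<in> space M"
   have "norm (R2 w ^ 4) = R2 w ^ 4" by simp
   also have "... <= norm ((9/2 * KV) ^ 4 * (?S w)^2)" using le[OF w] unfolding real_norm_def by linarith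
   finally show "norm (R2 w ^ 4) <= norm ((9/2 * KV) ^ 4 * (?S w)^2)" .
  qed
 qed (use R2_meas in measurable)
 have "expectation (\<lambda>w. R2 w ^ 4) <= expectation (\<lambda>w. (9/2 * KV) ^ 4 * (?S w)^2)"
  by (rule Bochner_Integration.integral_mono[OF i i2 le])
 also have "... = (9/2 * KV) ^ 4 * expectation (\<lambda>w. (?S w)\<^sup>2)" by (rule integral_mult_right_zero)
 also have "... <= (9/2 * KV) ^ 4 * (105 * (\<sigma>^2 * V) ^ 4 * \<Lambda>2^2)" by (intro mult_left_mono Se) simp
 finally show "expectation (\<lambda>w. R2 w ^ 4) <= (9/2 * KV) ^ 4 * (105 * (\<sigma>^2 * V) ^ 4 * \<Lambda>2^2)" .
qed

text \<open>Third moments of all combinations \<open>x * \<zeta> s + y * D0\<close> vanish by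
  \<open>wint_odd_moment\<close>; the values at \<open>(1, 1)\<close>, \<open>(1, -1)\<close> and
  \<open>(0, 1)\<close> isolate the mixed moment.\<close>

lemma zeta_sq_D0:
 assumes s: "s \<in> TI"
 shows "integrable M (\<lambda>w. (\<zeta> s w)\<^sup>2 * D0 w)" "expectation (\<lambda>w. (\<zeta> s w)\<^sup>2 * D0 w) = 0"
proof -
 let ?f = "\<lambda>r. exp (\<alpha> s - \<alpha> r)" and ?f' = "\<lambda>r. - (a r / e) * exp (\<alpha> s - \<alpha> r)"
 let ?A = "\<lambda>w. wint ?f ?f' (- (1/2)) s (\<lambda>t. W t w)" and ?B = "\<lambda>w. wint gk gk' (- (1/2)) (1/2) (\<lambda>t. W t w)"
 have sub: "{- (1/2)..s} \<subseteq> TI" using s by auto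
 have d: "(?f has_real_derivative ?f' r) (at r within {- (1/2)..s})" if "r \<in> {- (1/2)..s}" for r
 proof (rule DERIV_subset[OF _ sub])
  have "r \<in> TI" using that sub by auto
  from DERIV_chain2[OF DERIV_exp DERIV_diff[OF DERIV_const alpha_deriv[OF this]], of "\<alpha> s"]
  show "(?f has_real_derivative ?f' r) (at r within TI)" by (simp add: ac_simps)
 qed
 have c: "continuous_on {- (1/2)..s} ?f'"
  by (intro continuous_intros continuous_on_subset[OF a_cont sub] continuous_on_subset[OF alpha_cont sub]) simp
 have o3: "odd (3::nat)" by simp
 have odd: "expectation (\<lambda>w. (x * ?A w + y * ?B w) ^ 3) = 0" for x y
  by (rule wint_odd_moment[OF order_refl _ _ d c gk_deriv gk'_cont o3]) (use s in auto)
 let ?k = "\<sigma> / sqrt e"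
 have zA: "\<zeta> s w = ?k * ?A w" if "w \<in> space M" for w
  unfolding \<zeta>_def using lin_wint[OF W_cont[OF that] s W_start[OF that]] by simp
 have zB: "D0 w = ?k * ?B w" if "w \<in> space M" for w using D0_wint[OF that] .
 have lin: "expectation (\<lambda>w. (x * \<zeta> s w + y * D0 w) ^ 3) = 0" for x y
 proof -
  have "expectation (\<lambda>w. (x * \<zeta> s w + y * D0 w) ^ 3) = expectation (\<lambda>w. ((x * ?k) * ?A w + (y * ?k) * ?B w) ^ 3)"
   by (rule Bochner_Integration.integral_cong) (simp_all only: zA zB mult.assoc)
  then show ?thesis by (simp only: odd)
 qed
 have mz: "\<zeta> s \<in> borel_measurable M" by (rule zeta_measurable[OF s])
 have iz2: "integrable M (\<lambda>w. ((\<zeta> s w)^2)\<^sup>2)" and id2: "integrable M (\<lambda>w. ((D0 w)^2)\<^sup>2)"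
  using zeta_moment(1)[OF s, of 4] D0_moments(1)[of 4] by (simp_all flip: power_mult)
 have iz1: "integrable M (\<lambda>w. (\<zeta> s w)\<^sup>2)" and id1: "integrable M (\<lambda>w. (D0 w)\<^sup>2)"
  using zeta_moment(1)[OF s, of 2] D0_moments(1)[of 2] by simp_all
 show i1: "integrable M (\<lambda>w. (\<zeta> s w)\<^sup>2 * D0 w)"
  by (rule integrable_mult_of_squares[OF _ D0_meas iz2 id1]) (use mz in measurable)
 have i2: "integrable M (\<lambda>w. \<zeta> s w * (D0 w)^2)"
  by (rule integrable_mult_of_squares[OF mz _ iz1 id2]) (use D0_meas in measurable)
 have i3: "integrable M (\<lambda>w. \<zeta> s w ^ 3)" "integrable M (\<lambda>w. D0 w ^ 3)"
  using zeta_moment(1)[OF s, of 3] D0_moments(1)[of 3] by simp_all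
 have e: "(x * \<zeta> s w + y * D0 w) ^ 3 = x ^ 3 * \<zeta> s w ^ 3 + 3 * x^2 * y * ((\<zeta> s w)^2 * D0 w) + 3 * x * y^2 * (\<zeta> s w * (D0 w)^2) + y ^ 3 * D0 w ^ 3"
  for x y :: real and w by (simp add: power2_eq_square power3_eq_cube algebra_simps)
 have E: "x ^ 3 * expectation (\<lambda>w. \<zeta> s w ^ 3) + 3 * x^2 * y * expectation (\<lambda>w. (\<zeta> s w)\<^sup>2 * D0 w)
   + 3 * x * y^2 * expectation (\<lambda>w. \<zeta> s w * (D0 w)^2) + y ^ 3 * expectation (\<lambda>w. D0 w ^ 3) = 0" for x y
  using lin[of x y] i1 i2 i3 unfolding e by (simp add: integrable_mult_right)
 show "expectation (\<lambda>w. (\<zeta> s w)\<^sup>2 * D0 w) = 0"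
  using E[of 1 1] E[of 1 "-1"] E[of 0 1] by simp
qed

lemma R2_D0: "integrable M (\<lambda>w. R2 w * D0 w)" "expectation (\<lambda>w. R2 w * D0 w) = 0"
proof -
 have "integrable M (\<lambda>w. (R2 w)\<^sup>2)"
 proof (rule Bochner_Integration.integrable_bound)
  show "integrable M (\<lambda>w. 1 + R2 w ^ 4)" using R2_fourth(1) by simp
  show "AE w in M. norm ((R2 w)^2) <= norm (1 + R2 w ^ 4)"
  proof (rule AE_I2)
   fix w
   have "norm ((R2 w)^2) <= 2 * (R2 w)^2" by simp
   also note two_sq_le
   also have "1 + R2 w ^ 4 = norm (1 + R2 w ^ 4)" by (simp add: add_nonneg_nonneg)
   finally show "norm ((R2 w)^2) <= norm (1 + R2 w ^ 4)" .
  qed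
 qed (use R2_meas in measurable)
 then show "integrable M (\<lambda>w. R2 w * D0 w)"
  using integrable_mult_of_squares[OF R2_meas D0_meas] D0_moments(1)[of 2] by simp
 have id2: "integrable M (\<lambda>w. (D0 w)\<^sup>2)" using D0_moments(1)[of 2] by simp
 have v: "expectation (\<lambda>w. (D0 w)\<^sup>2) = v0" using D0_moments(3)[of 1] by (simp add: v0_def)
 have "expectation (\<lambda>w. R2 w * D0 w) = expectation (\<lambda>w. integral TI (\<lambda>s. qf s * ((\<zeta> s w)^2 * D0 w)))"
  unfolding R2_def by (simp only: integral_mult_left[symmetric] mult.assoc)
 also have "... = 0"
 proof (rule path_integral_zero[where e = "\<lambda>s. 9/2 * KV * (3 * (\<sigma>^2 * V)^2 / (\<rho> s)^2 + v0)"])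
  fix s assume s: "s \<in> TI"
  show "integrable M (\<lambda>w. qf s * ((\<zeta> s w)^2 * D0 w))" by (intro integrable_mult_right zeta_sq_D0 s)
  show "expectation (\<lambda>w. qf s * ((\<zeta> s w)^2 * D0 w)) = 0" by (simp only: integral_mult_right_zero zeta_sq_D0(2)[OF s] mult_zero_right)
  have iz4: "integrable M (\<lambda>w. \<zeta> s w ^ 4)" by (rule zeta_moment(1)[OF s])
  have "expectation (\<lambda>w. \<bar>qf s * ((\<zeta> s w)^2 * D0 w)\<bar>) <= expectation (\<lambda>w. 9/2 * KV * (\<zeta> s w ^ 4 + (D0 w)^2))"
  proof (rule Bochner_Integration.integral_mono)
   show "integrable M (\<lambda>w. \<bar>qf s * ((\<zeta> s w)^2 * D0 w)\<bar>)"
    by (intro integrable_abs integrable_mult_right zeta_sq_D0 s)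
   show "integrable M (\<lambda>w. 9/2 * KV * (\<zeta> s w ^ 4 + (D0 w)^2))"
    by (intro integrable_mult_right Bochner_Integration.integrable_add iz4 id2)
   fix w
   have "2 * (\<bar>(\<zeta> s w)\<^sup>2\<bar> * \<bar>D0 w\<bar>) <= \<bar>(\<zeta> s w)\<^sup>2\<bar>\<^sup>2 + \<bar>D0 w\<bar>\<^sup>2"
    using sum_squares_bound[of "\<bar>(\<zeta> s w)\<^sup>2\<bar>" "\<bar>D0 w\<bar>"] by simp
   moreover have "0 <= \<bar>(\<zeta> s w)\<^sup>2\<bar> * \<bar>D0 w\<bar>" by simp
   moreover have "\<bar>(\<zeta> s w)\<^sup>2\<bar>\<^sup>2 = \<zeta> s w ^ 4" "\<bar>D0 w\<bar>\<^sup>2 = (D0 w)^2" by (simp_all flip: power_mult)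
   ultimately have "\<bar>(\<zeta> s w)\<^sup>2\<bar> * \<bar>D0 w\<bar> <= \<zeta> s w ^ 4 + (D0 w)^2" by linarith
   then show "\<bar>qf s * ((\<zeta> s w)^2 * D0 w)\<bar> <= 9/2 * KV * (\<zeta> s w ^ 4 + (D0 w)^2)"
    unfolding abs_mult by (intro mult_mono qf_le s) (use KV_pos in auto)
  qed
  also have "... = 9/2 * KV * (expectation (\<lambda>w. \<zeta> s w ^ 4) + v0)"
   using iz4 id2 v by simp
  also have "... <= 9/2 * KV * (3 * (\<sigma>^2 * V)^2 / (\<rho> s)^2 + v0)"
   using zeta_even_moment[OF s, of 2] KV_pos by (intro mult_left_mono add_right_mono) (auto simp: fact_numeral)
  finally show "expectation (\<lambda>w. \<bar>qf s * ((\<zeta> s w)^2 * D0 w)\<bar>) <= 9/2 * KV * (3 * (\<sigma>^2 * V)^2 / (\<rho> s)^2 + v0)" .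
 qed (use rho_ne in \<open>auto intro!: continuous_intros qf_cont zeta_cont rho_cont\<close>)
 finally show "expectation (\<lambda>w. R2 w * D0 w) = 0" .
qed

definition CA :: real where "CA = 14 * 576 * exp (2 * C1) / c1^2 + 2 * R^2"
definition Q4 :: "'w \<Rightarrow> real" where "Q4 w = integral TI (\<lambda>t. 1 / \<rho> t * \<zeta> t w ^ (2 * 2))"
definition Q2 :: "'w \<Rightarrow> real" where "Q2 w = integral TI (\<lambda>t. 1 / \<rho> t * \<zeta> t w ^ (2 * 1))"

lemma inv_rho: "continuous_on TI (\<lambda>t. 1 / \<rho> t)" "t \<in> TI \<Longrightarrow> 0 < 1 / \<rho> t"
 using rho_ne rho_pos by (auto intro!: continuous_intros rho_cont)

lemma Q4_moments: "integrable M Q4" "integrable M (\<lambda>w. (Q4 w)\<^sup>2)" "expectation (\<lambda>w. (Q4 w)\<^sup>2) <= 105 * (\<sigma>^2 * V) ^ 4 * \<Lambda>3^2"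
 "w \<in> space M \<Longrightarrow> 0 <= Q4 w"
proof -
 have L: "integral TI (\<lambda>t. 1 / \<rho> t / \<rho> t ^ 2) = \<Lambda>3" by (simp add: \<Lambda>3_def power2_eq_square power3_eq_cube mult.assoc)
 show "integrable M Q4" unfolding Q4_def[abs_def] by (rule zeta_integral_moment(1)[OF inv_rho(1) less_imp_le[OF inv_rho(2)]]) auto
 show "integrable M (\<lambda>w. (Q4 w)\<^sup>2)" unfolding Q4_def by (rule zeta_integral_sq_moment(1)[OF inv_rho]) auto
 have "expectation (\<lambda>w. (Q4 w)\<^sup>2) <= fact (4 * 2) / (2 ^ (2 * 2) * fact (2 * 2)) * (\<sigma>^2 * V) ^ (2 * 2) * (integral TI (\<lambda>t. 1 / \<rho> t / \<rho> t ^ 2))^2"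
  unfolding Q4_def by (rule zeta_integral_sq_moment(2)[OF inv_rho]) auto
 then show "expectation (\<lambda>w. (Q4 w)\<^sup>2) <= 105 * (\<sigma>^2 * V) ^ 4 * \<Lambda>3^2" unfolding L by (simp add: fact_numeral)
 show "w \<in> space M \<Longrightarrow> 0 <= Q4 w"
  unfolding Q4_def using inv_rho(2)
  by (intro hk_nonneg integrable_continuous_real continuous_on_mult inv_rho(1) continuous_on_power zeta_cont)
    (auto simp: less_imp_le zero_le_even_power intro!: mult_nonneg_nonneg)
qed

lemma Q2_moments: "integrable M Q2" "integrable M (\<lambda>w. (Q2 w)\<^sup>2)" "expectation (\<lambda>w. (Q2 w)\<^sup>2) <= 3 * (\<sigma>^2 * V)^2 * \<Lambda>2^2"
 "w \<in> space M \<Longrightarrow> 0 <= Q2 w"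
proof -
 have L: "integral TI (\<lambda>t. 1 / \<rho> t / \<rho> t ^ 1) = \<Lambda>2" by (simp add: \<Lambda>2_def power2_eq_square)
 show "integrable M Q2" unfolding Q2_def[abs_def] by (rule zeta_integral_moment(1)[OF inv_rho(1) less_imp_le[OF inv_rho(2)]]) auto
 show "integrable M (\<lambda>w. (Q2 w)\<^sup>2)" unfolding Q2_def by (rule zeta_integral_sq_moment(1)[OF inv_rho]) auto
 have "expectation (\<lambda>w. (Q2 w)\<^sup>2) <= fact (4 * 1) / (2 ^ (2 * 1) * fact (2 * 1)) * (\<sigma>^2 * V) ^ (2 * 1) * (integral TI (\<lambda>t. 1 / \<rho> t / \<rho> t ^ 1))^2"
  unfolding Q2_def by (rule zeta_integral_sq_moment(2)[OF inv_rho]) auto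
 then show "expectation (\<lambda>w. (Q2 w)\<^sup>2) <= 3 * (\<sigma>^2 * V)^2 * \<Lambda>2^2" unfolding L by (simp add: fact_numeral)
 show "w \<in> space M \<Longrightarrow> 0 <= Q2 w"
  unfolding Q2_def using inv_rho(2)
  by (intro hk_nonneg integrable_continuous_real continuous_on_mult inv_rho(1) continuous_on_power zeta_cont)
    (auto simp: less_imp_le zero_le_even_power intro!: mult_nonneg_nonneg)
qed

lemma R3_good:
 assumes P: "exact_path e c1 C1 N a \<rho> \<rho>' z z' l (\<lambda>t. W t w) (\<lambda>t. X t w) (\<sigma> / sqrt e) (z (- (1/2)))"
  and g: "good hmax w" and c: "0 < c" "\<And>t. t \<in> TI \<Longrightarrow> 1 <= c * \<rho> t"
 shows "\<bar>G w - D0 w - R2 w\<bar> <= KV * (c * (CA * Q4 w) + 7 * Q2 w / c)"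
proof -
 interpret P: exact_path e c1 C1 N a \<rho> \<rho>' z z' l "\<lambda>t. W t w" "\<lambda>t. X t w" "\<sigma> / sqrt e" "z (- (1/2))"
  by (rule P)
 have R2: "R2 w = integral TI (\<lambda>t. h t * P.u2 t)"
  unfolding P.u2_area[OF h_cont] R2_def qf_def \<zeta>_def ..
 have "G w - D0 w - R2 w = integral TI (\<lambda>t. h t * P.u t - h t * P.u2 t)"
  unfolding G_decomp[OF P] R2
  by (intro hk_diff[symmetric] integrable_continuous_real continuous_intros h_cont P.u_cont P.u2_cont)
 also have "... = integral TI (\<lambda>t. h t * (P.u t - P.u2 t))" by (simp only: right_diff_distrib)
 finally have "\<bar>G w - D0 w - R2 w\<bar> <= K * integral TI (\<lambda>t. \<rho> t * \<bar>P.u t - P.u2 t\<bar>)"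
  by (simp only:) (intro abs_integral_mult_le continuous_intros P.u_cont P.u2_cont rho_cont h_cont h_le)
 also have "integral TI (\<lambda>t. \<rho> t * \<bar>P.u t - P.u2 t\<bar>) <= exp C1 / c1 * (c * (CA * Q4 w) + 7 * Q2 w / c)"
 proof -
  have "c1 * exp (- C1) * integral TI (\<lambda>t. \<rho> t * \<bar>P.u t - P.u2 t\<bar>)
   <= c * ((14 * 576 * exp (2 * C1) / c1^2 + 2 * R^2) * integral TI (\<lambda>t. (\<sigma> / sqrt e * lin (\<lambda>t. W t w) t) ^ 4 / \<rho> t))
    + 7 * integral TI (\<lambda>t. (\<sigma> / sqrt e * lin (\<lambda>t. W t w) t)\<^sup>2 / \<rho> t) / c"
  proof (rule P.u3_integral[where \<eta> = etaA])
   show "etaA * \<rho> t <= 1/2" if "t \<in> TI" for t using etaA_rho[OF that] by linarith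
  qed (use good_path[OF P g order_refl] etaA_lin eta_pos rho_le c in auto)
  also have "integral TI (\<lambda>t. (\<sigma> / sqrt e * lin (\<lambda>t. W t w) t) ^ 4 / \<rho> t) = Q4 w"
   by (simp add: Q4_def \<zeta>_def)
  also have "integral TI (\<lambda>t. (\<sigma> / sqrt e * lin (\<lambda>t. W t w) t)\<^sup>2 / \<rho> t) = Q2 w"
   by (simp add: Q2_def \<zeta>_def)
  finally have "c1 * exp (- C1) * integral TI (\<lambda>t. \<rho> t * \<bar>P.u t - P.u2 t\<bar>) <= c * (CA * Q4 w) + 7 * Q2 w / c"
   by (simp only: CA_def)
  then have "exp C1 / c1 * (c1 * exp (- C1) * integral TI (\<lambda>t. \<rho> t * \<bar>P.u t - P.u2 t\<bar>)) <= exp C1 / c1 * (c * (CA * Q4 w) + 7 * Q2 w / c)"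
   using c1_pos by (intro mult_left_mono) auto
  moreover have "exp C1 / c1 * (c1 * exp (- C1) * J) = J" for J
   using c1_pos by (simp add: exp_minus)
  ultimately show ?thesis by simp
 qed
 finally show ?thesis using K_pos by (simp add: KV_def mult_left_mono ac_simps)
qed

definition M4' :: real where
 "M4' = 8 * (M4 + (9/2 * KV) ^ 4 * (105 * (\<sigma>^2 * V) ^ 4 * \<Lambda>2^2))"

text \<open>Third-order part of the area: on the good event it is bounded by a multiple of
  \<open>c * Q4 + Q2 / c\<close>, elsewhere the crude fourth moment \<open>M4'\<close> is
  used.\<close>

lemma R3_moment:
 assumes s: "\<sigma>^2 <= 1" and d: "\<delta>B <= 1" and c: "0 < c" "\<And>t. t \<in> TI \<Longrightarrow> 1 <= c * \<rho> t"
 shows "integrable M (\<lambda>w. (G w - D0 w - R2 w)\<^sup>2)"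
  "expectation (\<lambda>w. (G w - D0 w - R2 w)\<^sup>2)
   <= 2 * KV^2 * (c^2 * CA^2 * (105 * (\<sigma>^2 * V) ^ 4 * \<Lambda>3^2) + 49 / c^2 * (3 * (\<sigma>^2 * V)^2 * \<Lambda>2^2)) + \<delta>B * (2 + M4')"
proof -
 obtain B where B: "B \<in> sets M" "prob B <= \<delta>B^2" "\<And>w. w \<in> space M - B \<Longrightarrow> good hmax w"
  using good_event_max by blast
 let ?Z = "\<lambda>w. KV * (c * (CA * Q4 w) + 7 * Q2 w / c)"
 have le: "AE w in M. w \<notin> B \<longrightarrow> \<bar>G w - D0 w - R2 w\<bar> <= ?Z w"
  using path AE_space by eventually_elim (use B(3) R3_good[OF _ _ c] in auto)
 have Y0m: "(\<lambda>w. G w - D0 w) \<in> borel_measurable M" using G_meas D0_meas by measurable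
 have Ym: "(\<lambda>w. G w - D0 w - R2 w) \<in> borel_measurable M" using G_meas D0_meas R2_meas by measurable
 note f = fourth_moment_add[OF Y0m R2_meas G_D0_fourth(1)[OF s] R2_fourth(1)]
 have f2: "expectation (\<lambda>w. (G w - D0 w - R2 w) ^ 4) <= M4'"
  unfolding M4'_def by (rule order_trans[OF f(2)], intro mult_left_mono add_mono G_D0_fourth(2)[OF s] R2_fourth(2)) simp
 have CA0: "0 <= CA" using c1_pos by (simp add: CA_def)
 have Z0: "0 <= ?Z w" if "w \<in> space M" for w
  using Q4_moments(4)[OF that] Q2_moments(4)[OF that] KV_pos CA0 c by simp
 have Z1: "integrable M ?Z" using Q4_moments(1) Q2_moments(1) by simp
 let ?W = "\<lambda>w. 2 * KV^2 * (c^2 * CA^2 * (Q4 w)^2 + 49 / c^2 * (Q2 w)^2)"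
 have ZW: "(?Z w)^2 <= ?W w" for w
 proof -
  have "(?Z w)^2 = KV^2 * (c * (CA * Q4 w) + 7 * Q2 w / c)^2" by (simp only: power_mult_distrib)
  also have "... <= KV^2 * (2 * (c * (CA * Q4 w))^2 + 2 * (7 * Q2 w / c)^2)"
   using sum_squares_bound[of "c * (CA * Q4 w)" "7 * Q2 w / c"] by (intro mult_left_mono) (auto simp: power2_sum)
  also have "... = ?W w" by (simp add: power_mult_distrib power_divide algebra_simps)
  finally show ?thesis .
 qed
 have Wi: "integrable M ?W" using Q4_moments(2) Q2_moments(2) by simp
 have Z2: "integrable M (\<lambda>w. (?Z w)\<^sup>2)"
 proof (rule Bochner_Integration.integrable_bound[OF Wi])
  show "(\<lambda>w. (?Z w)\<^sup>2) \<in> borel_measurable M"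
   using borel_measurable_integrable[OF Q4_moments(1)] borel_measurable_integrable[OF Q2_moments(1)] by measurable
  show "AE w in M. norm ((?Z w)^2) <= norm (?W w)"
  proof (rule AE_I2)
   fix w
   have "norm ((?Z w)^2) = (?Z w)^2" by simp
   also have "... <= norm (?W w)" using ZW[of w] unfolding real_norm_def by linarith
   finally show "norm ((?Z w)^2) <= norm (?W w)" .
  qed
 qed
 note r = rare_event_moments[OF Ym f(1) f2 B(1,2) deltaB_pos d le Z0 Z1 Z2]
 show "integrable M (\<lambda>w. (G w - D0 w - R2 w)\<^sup>2)" by (rule r(2))
 have "expectation (\<lambda>w. (?Z w)\<^sup>2) <= expectation ?W"
  by (rule Bochner_Integration.integral_mono[OF Z2 Wi ZW])
 also have "... = 2 * KV^2 * (c^2 * CA^2 * expectation (\<lambda>w. (Q4 w)\<^sup>2) + 49 / c^2 * expectation (\<lambda>w. (Q2 w)\<^sup>2))"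
  using Q4_moments(2) Q2_moments(2) by (simp add: integrable_mult_right)
 also have "... <= 2 * KV^2 * (c^2 * CA^2 * (105 * (\<sigma>^2 * V) ^ 4 * \<Lambda>3^2) + 49 / c^2 * (3 * (\<sigma>^2 * V)^2 * \<Lambda>2^2))"
  by (intro mult_left_mono add_mono Q4_moments Q2_moments) auto
 finally show "expectation (\<lambda>w. (G w - D0 w - R2 w)\<^sup>2)
   <= 2 * KV^2 * (c^2 * CA^2 * (105 * (\<sigma>^2 * V) ^ 4 * \<Lambda>3^2) + 49 / c^2 * (3 * (\<sigma>^2 * V)^2 * \<Lambda>2^2)) + \<delta>B * (2 + M4')"
  using r(4) by linarith
qed

text \<open>The variance is tested against \<open>D0\<close>: the covariance of \<open>G\<close> and
  \<open>D0\<close> equals \<open>v0\<close> up to the third-order part, because \<open>R2\<close>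
  is uncorrelated with \<open>D0\<close>. Hence the variance of \<open>R2\<close>, which may be
  comparable with \<open>v0\<close>, does not enter.\<close>

lemma variance_lower:
 assumes s: "\<sigma>^2 <= 1" and d: "\<delta>B <= 1"
  and r3: "integrable M (\<lambda>w. (G w - D0 w - R2 w)\<^sup>2)" "expectation (\<lambda>w. (G w - D0 w - R2 w)\<^sup>2) <= v0 / 4"
 shows "v0 / 4 <= variance G"
proof -
 note am = area_moments[OF s d]
 let ?Y = "\<lambda>w. G w - D0 w - R2 w"
 have Ym: "?Y \<in> borel_measurable M" using G_meas D0_meas R2_meas by measurable
 have iD: "integrable M D0" "integrable M (\<lambda>w. (D0 w)\<^sup>2)" using D0_moments(1)[of 1] D0_moments(1)[of 2] by auto
 have v: "expectation (\<lambda>w. (D0 w)\<^sup>2) = v0" using D0_moments(3)[of 1] by (simp add: v0_def)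
 have iYD: "integrable M (\<lambda>w. ?Y w * D0 w)" by (rule integrable_mult_of_squares[OF Ym D0_meas r3(1) iD(2)])
 have iGD: "integrable M (\<lambda>w. G w * D0 w)" by (rule integrable_mult_of_squares[OF G_meas D0_meas am(2) iD(2)])
 have "expectation (\<lambda>w. G w * D0 w) = expectation (\<lambda>w. (D0 w)\<^sup>2 + R2 w * D0 w + ?Y w * D0 w)"
  by (rule Bochner_Integration.integral_cong) (simp_all add: power2_eq_square algebra_simps)
 also have "... = v0 + expectation (\<lambda>w. ?Y w * D0 w)"
  using iD R2_D0 iYD v by (simp del: left_diff_distrib')
 finally have 1: "expectation (\<lambda>w. G w * D0 w) = v0 + expectation (\<lambda>w. ?Y w * D0 w)" .
 have "expectation (\<lambda>w. - (?Y w * D0 w)) <= expectation (\<lambda>w. (?Y w)\<^sup>2 + (D0 w)^2 / 4)"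
 proof (rule Bochner_Integration.integral_mono)
  show "integrable M (\<lambda>w. - (?Y w * D0 w))" using iYD by (rule Bochner_Integration.integrable_minus)
  show "integrable M (\<lambda>w. (?Y w)\<^sup>2 + (D0 w)^2 / 4)" using r3(1) iD by simp
  fix w
  show "- (?Y w * D0 w) <= (?Y w)^2 + (D0 w)^2 / 4"
   using mult_le_sq_quarter[of "?Y w" "- D0 w"] by simp
 qed
 also have "... = expectation (\<lambda>w. (?Y w)\<^sup>2) + v0 / 4" using r3(1) iD v by simp
 finally have "- expectation (\<lambda>w. ?Y w * D0 w) <= v0 / 4 + v0 / 4" using r3(2) by simp
 then have 2: "v0 / 2 <= expectation (\<lambda>w. G w * D0 w)" using 1 by linarith
 let ?e = "expectation G"
 have cov: "expectation (\<lambda>w. (G w - ?e) * D0 w) = expectation (\<lambda>w. G w * D0 w)"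
  unfolding left_diff_distrib using iGD iD D0_moments(2) by simp
 have iv: "integrable M (\<lambda>w. (G w - ?e)\<^sup>2)" using am(1,2) by (simp add: power2_diff)
 have icov: "integrable M (\<lambda>w. (G w - ?e) * D0 w)" unfolding left_diff_distrib using iGD iD by simp
 have "expectation (\<lambda>w. (G w - ?e) * D0 w) <= expectation (\<lambda>w. (G w - ?e)\<^sup>2 + (D0 w)^2 / 4)"
 proof (rule Bochner_Integration.integral_mono[OF icov])
  show "integrable M (\<lambda>w. (G w - ?e)\<^sup>2 + (D0 w)^2 / 4)" using iv iD by simp
  fix w
  show "(G w - ?e) * D0 w <= (G w - ?e)^2 + (D0 w)^2 / 4"
   by (rule mult_le_sq_quarter)
 qed
 also have "... = variance G + v0 / 4" using iv iD v by simp
 finally show ?thesis using 2 cov by linarith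
qed

end

section \<open>Excursions at large scale\<close>

lemma confining_drift:
 fixes x M l e :: real
 assumes M: "4 <= M" and x: "9/10 * M <= x" "x <= 11/10 * M" and l: "l <= 1" and e: "e <= M ^ 3 / 64"
 shows "F x l + e < 0"
proof -
 have M3: "4^2 * M <= M^2 * M" using M by (intro mult_right_mono power_mono) auto
 have "(9/10 * M) ^ 3 <= x ^ 3" using x M by (intro power_mono) auto
 then have 1: "729/1000 * M ^ 3 <= x ^ 3" by (simp add: power_mult_distrib power_divide)
 have 2: "M <= M ^ 3 / 16" using M3 by (simp add: power2_eq_square power3_eq_cube)
 have 3: "1 <= M ^ 3 / 64"
 proof -
  have "4 ^ 3 <= M ^ 3" using M by (intro power_mono) auto
  then show ?thesis by simp
 qed
 have "0 < M ^ 3" using M by simp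
 then show ?thesis using 1 2 3 x l e unfolding F_def by linarith
qed

text \<open>\<open>1/512000\<close> is \<open>1 / (64 * 20 ^ 3)\<close>: noise below
  \<open>H / 512000\<close> times the damping \<open>H^2\<close> is at most
  \<open>(H / 20) ^ 3 / 64\<close>, which the cubic drift at height \<open>H / 20\<close> overcomes.
  The divisor is \<open>2 * 2048\<close>, half of the exponent being spent on the number of
  cells.\<close>

definition kT :: real where "kT = (1/512000)^2 / 4096"
definition CT :: real where "CT = 3 * (exp 16 + 6) / kT"

lemma kT_pos: "0 < kT" and CT_pos: "0 < CT" by (simp_all add: kT_def CT_def add_pos_pos)

context standard_brownian_motion
begin

text \<open>The linear process gets the artificial constant damping \<open>N = H^2\<close>, the
  strength of the cubic drift at heights of order \<open>H\<close>. Its variance, at most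
  \<open>\<sigma>^2 / H^2\<close>, gives an excursion of order \<open>H\<close> the exponent
  \<open>H ^ 4 / \<sigma>^2\<close>. The difference \<open>u\<close> then feels the drift
  \<open>F\<close> plus a small multiple of \<open>H ^ 3\<close>, and cannot cross the levels
  \<open>H / 20\<close> and \<open>- H / 20\<close>.\<close>

lemma large_tail:
 fixes X :: "real \<Rightarrow> 'w \<Rightarrow> real"
 assumes t0: "t0 = - (1/2)" and eps: "0 < e" "e <= 1" and sigma: "\<sigma> \<noteq> 0" "\<sigma>^2 <= 1"
  and X_cont: "\<And>w. w \<in> space M \<Longrightarrow> continuous_on TI (\<lambda>t. X t w)"
  and X_eq: "AE w in M. \<forall>t\<in>TI. X t w = x0 + 1 / e * integral {- (1/2)..t} (\<lambda>s. F (X s w) (l s)) + \<sigma> / sqrt e * W t w"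
  and l: "continuous_on TI l" "\<And>t. t \<in> TI \<Longrightarrow> \<bar>l t\<bar> <= 1" and x0: "\<bar>x0\<bar> <= 3/2"
  and z: "continuous_on TI z" "\<And>t. t \<in> TI \<Longrightarrow> \<bar>z t\<bar> <= 3/2"
  and h: "continuous_on TI h" "\<And>t. t \<in> TI \<Longrightarrow> \<bar>h t\<bar> <= 7" and H: "80 <= H"
 shows "prob {w\<in>space M. H <= \<bar>integral TI (\<lambda>t. h t * (X t w - z t))\<bar>} <= CT / e * exp (- (kT * H ^ 4 / \<sigma>^2))"
proof -
 define N where "N = H^2"
 define \<mu> where "\<mu> = H / 20"
 have mu: "4 <= \<mu>" using H by (simp add: \<mu>_def)
 have N: "1 <= N" unfolding N_def using H one_le_power[of H 2] by simp
 have NN: "1 <= N^2" using N by (rule one_le_power)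
 have N8: "8 <= N^2"
 proof -
  have "8 * 1 <= N * N"
  proof (rule mult_mono)
   have "80 * 80 <= H * H" using H by (intro mult_mono) auto
   then show "8 <= N" by (simp add: N_def power2_eq_square)
  qed (use N in auto)
  then show ?thesis by (simp add: power2_eq_square)
 qed
 interpret nw: noisy_well e 1 0 N "\<lambda>_. - N" "\<lambda>_. N" "\<lambda>_. 0" M W \<sigma>
 proof -
  have "standard_brownian_motion M (- (1/2)) W" using standard_brownian_motion_axioms by (simp add: t0)
  moreover have "linear_well e 1 0 N (\<lambda>_. - N) (\<lambda>_. N) (\<lambda>_. 0)"
   by unfold_locales (use eps N N8 in auto)
  ultimately show "noisy_well e 1 0 N (\<lambda>_. - N) (\<lambda>_. N) (\<lambda>_. 0) M W \<sigma>"
   using sigma by (simp add: noisy_well_def noisy_well_axioms_def)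
 qed
 define c where "c = (1/512000 :: real)"
 define x where "x = c^2 * H ^ 4 / \<sigma>^2"
 have H4: "H ^ 4 = H^2 * N" by (simp add: N_def power2_eq_square power4_eq_xxxx)
 have sx: "\<sigma>^2 * x = c^2 * H ^ 4" using sigma by (simp add: x_def)
 obtain B where B: "B \<in> sets M" "prob B <= 3 * (exp 16 + 6) * (N / e) * exp (- (x / 2048))"
  "\<And>w t. w \<in> space M - B \<Longrightarrow> t \<in> TI \<Longrightarrow> \<bar>nw.\<zeta> t w\<bar> <= c * H"
 proof (rule nw.zeta_sup[where \<psi> = "\<lambda>_. c * H" and x = x])
  show "\<sigma>^2 * nw.vt t * x <= (c * H)^2" if t: "t \<in> TI" for t
  proof -
   have "\<sigma>^2 * nw.vt t * x = nw.vt t * (c^2 * H ^ 4)" using sx by (simp add: ac_simps)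
   also have "... <= 1 / N * (c^2 * H ^ 4)" using nw.vt_le[OF t] by (intro mult_right_mono) auto
   also have "... = (c * H)^2" using N by (simp add: H4 power_mult_distrib)
   finally show ?thesis .
  qed
  show "\<sigma>^2 * x <= N * (c * H)^2" unfolding sx by (simp add: H4 power_mult_distrib)
 qed (use N eps H in \<open>auto simp: c_def x_def\<close>)
 have "AE w in M. w \<in> {w\<in>space M. H <= \<bar>integral TI (\<lambda>t. h t * (X t w - z t))\<bar>} \<longrightarrow> w \<in> B"
  using X_eq AE_space
 proof eventually_elim
  case (elim w)
  show ?case
  proof (intro impI, rule ccontr)
   assume big: "w \<in> {w\<in>space M. H <= \<bar>integral TI (\<lambda>t. h t * (X t w - z t))\<bar>}" and nB: "w \<notin> B"
   have w: "w \<in> space M" "w \<in> space M - B" using big nB by auto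
   let ?k = "\<sigma> / sqrt e"
   have zb: "\<bar>nw.\<zeta> t w\<bar> <= \<mu> / 10" if "t \<in> TI" for t
    using B(3)[OF w(2) that] H by (simp add: c_def \<mu>_def)
   have nz: "\<bar>N * nw.\<zeta> t w\<bar> <= \<mu> ^ 3 / 64" if "t \<in> TI" for t
   proof -
    have "N * \<bar>nw.\<zeta> t w\<bar> <= N * (c * H)" using B(3)[OF w(2) that] N by (intro mult_left_mono) auto
    also have "... = \<mu> ^ 3 / 64" by (simp add: N_def c_def \<mu>_def power_divide power2_eq_square power3_eq_cube)
    finally show ?thesis using N by (simp add: abs_mult)
   qed
   note Xc = X_cont[OF w(1)] and wc = nw.W_cont[OF w(1)]
   have Fc: "continuous_on TI (\<lambda>s. F (X s w) (l s))" unfolding F_def by (intro continuous_intros Xc l)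
   define u where "u t = X t w - nw.\<zeta> t w" for t
   have ud: "(u has_real_derivative (F (X t w) (l t) + N * nw.\<zeta> t w) / e) (at t within TI)" if t: "t \<in> TI" for t
   proof -
    let ?L = "\<lambda>t. nw.lin (\<lambda>t. W t w) t"
    have "((\<lambda>t. x0 + 1 / e * integral {- (1/2)..t} (\<lambda>s. F (X s w) (l s)) - ?k * (?L t - W t w))
     has_real_derivative 0 + 1 / e * F (X t w) (l t) - ?k * (- N / e * ?L t)) (at t within TI)"
     by (intro DERIV_diff DERIV_add DERIV_cmult DERIV_const nw.lin_deriv t wc integral_has_derivative_within[OF Fc])
    moreover have "0 + 1 / e * F (X t w) (l t) - ?k * (- N / e * ?L t) = (F (X t w) (l t) + N * nw.\<zeta> t w) / e"
     by (simp add: nw.\<zeta>_def add_divide_distrib)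
    ultimately have d: "((\<lambda>t. x0 + 1 / e * integral {- (1/2)..t} (\<lambda>s. F (X s w) (l s)) - ?k * (?L t - W t w))
     has_real_derivative (F (X t w) (l t) + N * nw.\<zeta> t w) / e) (at t within TI)" by (simp only:)
    show ?thesis
    proof (rule has_field_derivative_transform_within[OF d zero_less_one t])
     fix s assume "s \<in> TI"
     then have "X s w = x0 + 1 / e * integral {- (1/2)..s} (\<lambda>s. F (X s w) (l s)) + ?k * W s w" using elim by blast
     then show "x0 + 1 / e * integral {- (1/2)..s} (\<lambda>s. F (X s w) (l s)) - ?k * (?L s - W s w) = u s"
      unfolding u_def nw.\<zeta>_def by (simp add: right_diff_distrib)
    qed
   qed
   have uc: "continuous_on TI u" by (rule DERIV_continuous_on[OF ud])
   have Xs: "X (- (1/2)) w = x0"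
   proof -
    have "X (- (1/2)) w = x0 + 1 / e * integral {- (1/2)..- (1/2)} (\<lambda>s. F (X s w) (l s)) + ?k * W (- (1/2)) w"
     using elim by (auto simp del: integral_refl)
    then show ?thesis using nw.W_start[OF w(1)] by simp
   qed
   have us: "u (- (1/2)) = x0" using Xs nw.zeta_start[OF w(1)] by (simp add: u_def)
   have up: "u t < \<mu>" if t: "t \<in> TI" for t
   proof -
    have "0 < \<mu> - u t"
    proof (rule barrier_pos[where g = "\<lambda>t. \<mu> - u t" and p = "- (1/2)" and q = "1/2"])
     fix t :: real assume "- (1/2) < t" "t <= 1/2" "\<mu> - u t = 0"
     then have t: "t \<in> TI" and X: "X t w = \<mu> + nw.\<zeta> t w" by (auto simp: u_def)
     have "F (X t w) (l t) + N * nw.\<zeta> t w < 0"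
      by (rule confining_drift[OF mu]) (use zb[OF t] nz[OF t] l(2)[OF t] X in auto)
     then have "0 < - ((F (X t w) (l t) + N * nw.\<zeta> t w) / e)" using eps by (simp add: divide_neg_pos)
     moreover have "((\<lambda>t. \<mu> - u t) has_real_derivative - ((F (X t w) (l t) + N * nw.\<zeta> t w) / e)) (at t within TI)"
      using DERIV_diff[OF DERIV_const ud[OF t], of \<mu>] by simp
     ultimately show "\<exists>d>0. ((\<lambda>t. \<mu> - u t) has_real_derivative d) (at t within TI)" by blast
    qed (use t us x0 mu uc in \<open>auto intro!: continuous_intros\<close>)
    then show ?thesis by simp
   qed
   have down: "- \<mu> < u t" if t: "t \<in> TI" for t
   proof -
    have "0 < \<mu> + u t"
    proof (rule barrier_pos[where g = "\<lambda>t. \<mu> + u t" and p = "- (1/2)" and q = "1/2"])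
     fix t :: real assume "- (1/2) < t" "t <= 1/2" "\<mu> + u t = 0"
     then have t: "t \<in> TI" and X: "- X t w = \<mu> - nw.\<zeta> t w" by (auto simp: u_def)
     have "F (- X t w) (- l t) + - (N * nw.\<zeta> t w) < 0"
      by (rule confining_drift[OF mu]) (use zb[OF t] nz[OF t] l(2)[OF t] X in auto)
     then have "0 < (F (X t w) (l t) + N * nw.\<zeta> t w) / e" using eps by (simp add: F_def)
     moreover have "((\<lambda>t. \<mu> + u t) has_real_derivative (F (X t w) (l t) + N * nw.\<zeta> t w) / e) (at t within TI)"
      using DERIV_add[OF DERIV_const ud[OF t], of \<mu>] by simp
     ultimately show "\<exists>d>0. ((\<lambda>t. \<mu> + u t) has_real_derivative d) (at t within TI)" by blast
    qed (use t us x0 mu uc in \<open>auto intro!: continuous_intros\<close>)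
    then show ?thesis by simp
   qed
   have Xb: "\<bar>X t w\<bar> <= 11/10 * \<mu>" if t: "t \<in> TI" for t
    using up[OF t] down[OF t] zb[OF t] unfolding u_def by (simp add: abs_le_iff)
   have "norm (integral TI (\<lambda>t. h t * (X t w - z t))) <= 7 * (11/10 * \<mu> + 3/2) * (1/2 - - (1/2))"
   proof (rule integral_bound)
    fix t assume t: "t \<in> TI"
    have "\<bar>X t w - z t\<bar> <= 11/10 * \<mu> + 3/2" using Xb[OF t] z(2)[OF t] by linarith
    then show "norm (h t * (X t w - z t)) <= 7 * (11/10 * \<mu> + 3/2)"
     unfolding real_norm_def abs_mult by (intro mult_mono h(2) t) auto
   qed (auto intro!: continuous_intros h z Xc)
   also have "... < H" using H by (simp add: \<mu>_def)
   finally show False using big by simp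
  qed
 qed
 then have "prob {w\<in>space M. H <= \<bar>integral TI (\<lambda>t. h t * (X t w - z t))\<bar>} <= prob B"
  by (rule finite_measure_mono_AE[OF _ B(1)])
 also have "... <= 3 * (exp 16 + 6) * (N / e) * exp (- (x / 2048))" by (rule B(2))
 also have "... <= CT / e * exp (- (kT * H ^ 4 / \<sigma>^2))"
 proof -
  \<comment> \<open>Half of the exponent absorbs the prefactor \<open>N / e\<close>, which grows
    with \<open>H\<close>.\<close>
  define y where "y = kT * H ^ 4 / \<sigma>^2"
  have x2: "x / 2048 = 2 * y" by (simp add: x_def y_def kT_def c_def mult.commute)
  have "kT * N <= y"
  proof -
   have "H^2 * 1 <= H^2 * N" using N by (intro mult_left_mono) auto
   then have "N <= H ^ 4" unfolding H4 N_def[symmetric] by simp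
   also have "... = H ^ 4 / 1" by simp
   also have "... <= H ^ 4 / \<sigma>^2" using sigma by (intro divide_left_mono) auto
   finally have "kT * N <= kT * (H ^ 4 / \<sigma>^2)" using kT_pos by (intro mult_left_mono) auto
   then show ?thesis by (simp add: y_def)
  qed
  also have "y <= exp y" using exp_ge_add_one_self[of y] by linarith
  finally have "N <= exp y / kT" using kT_pos by (simp add: field_simps)
  then have "3 * (exp 16 + 6) * (N / e) * exp (- (x / 2048)) <= 3 * (exp 16 + 6) * ((exp y / kT) / e) * exp (- (2 * y))"
   unfolding x2 using eps by (intro mult_right_mono mult_left_mono divide_right_mono) (auto simp: add_nonneg_nonneg)
  also have "... = CT / e * (exp y * exp (- (2 * y)))" by (simp add: CT_def)
  also have "exp y * exp (- (2 * y)) = exp (- y)" by (simp flip: exp_add)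
  finally show ?thesis by (simp add: y_def)
 qed
 finally show ?thesis .
qed

end

section \<open>The fold\<close>

lemma sin_pi_ge: assumes "\<bar>u\<bar> <= 1/2" shows "\<bar>u\<bar> <= \<bar>sin (pi * u)\<bar>"
proof -
 have pos: "x <= sin (pi * x)" if x: "0 <= x" "x <= 1/2" for x :: real
 proof (cases "x <= 1/3")
  case True
  show ?thesis
  proof (cases "x = 0")
   case False
   then have "0 < pi * x" using x by simp
   then obtain \<xi> where xi: "0 < \<xi>" "\<xi> < pi * x" "sin (pi * x) - sin 0 = (pi * x - 0) * cos \<xi>"
    using MVT2[of 0 "pi * x" sin cos] DERIV_sin by blast
   have "pi * x <= pi * (1/3)" using True by (intro mult_left_mono) auto
   then have "\<xi> <= pi / 3" using xi by linarith
   then have "cos (pi / 3) <= cos \<xi>" by (rule cos_monotone_0_pi_le[rotated]) (use xi in auto)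
   then have "pi * x * (1/2) <= pi * x * cos \<xi>" using x by (intro mult_left_mono) (auto simp: cos_60)
   moreover have "2 * x <= pi * x" using x pi_ge_two by (intro mult_right_mono) auto
   moreover have "sin (pi * x) = pi * x * cos \<xi>" using xi(3) by simp
   ultimately show ?thesis by linarith
  qed simp
 next
  case False
  have "sin (pi / 3) <= sin (pi * x)" using False x pi_gt_zero by (intro sin_monotone_2pi_le) (auto simp del: pi_gt_zero)
  moreover have "1 <= sqrt (3::real)" by simp
  ultimately show ?thesis using x sin_60 by linarith
 qed
 show ?thesis
 proof (cases "0 <= u")
  case True then show ?thesis using pos[of u] assms by simp
 next
  case False then show ?thesis using pos[of "- u"] assms by simp
 qed
qed

lemma sin_pi_sq_ge: assumes "\<bar>u\<bar> <= 1/2" shows "u^2 <= (sin (pi * u))^2"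
 using sin_pi_ge[OF assms] by (simp add: abs_le_square_iff)

lemma integral_inverse_square:
 fixes m c :: real assumes m: "0 < m"
 shows "integral TI (\<lambda>t. 1 / (m + (t + c)^2)) <= pi / sqrt m"
proof -
 have s: "0 < sqrt m" using m by simp
 have pos: "0 < m + x^2" for x using m by (simp add: add_pos_nonneg)
 have d: "((\<lambda>t. arctan ((t + c) / sqrt m) / sqrt m) has_real_derivative 1 / (m + (t + c)^2)) (at t within TI)" for t
 proof -
  have d1: "((\<lambda>t. (t + c) / sqrt m) has_real_derivative 1 / sqrt m) (at t within TI)"
   by (rule DERIV_cdivide) (auto intro!: derivative_eq_intros)
  have "((\<lambda>t. arctan ((t + c) / sqrt m) / sqrt m) has_real_derivative inverse (1 + ((t + c) / sqrt m)^2) * (1 / sqrt m) / sqrt m) (at t within TI)"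
   by (intro DERIV_cdivide DERIV_chain2[OF DERIV_arctan d1])
  moreover have "inverse (1 + ((t + c) / sqrt m)^2) * (1 / sqrt m) / sqrt m = 1 / (m + (t + c)^2)"
  proof -
   have "inverse (1 + ((t + c) / sqrt m)^2) * (1 / sqrt m) / sqrt m = inverse (1 + (t + c)^2 / m) * (1 / (sqrt m * sqrt m))"
    using m by (simp add: power_divide)
   also have "... = 1 / (m + (t + c)^2)" using m pos[of "t + c"] by (simp add: field_simps)
   finally show ?thesis .
  qed
  ultimately show ?thesis by simp
 qed
 have "((\<lambda>t. 1 / (m + (t + c)^2)) has_integral (arctan ((1/2 + c) / sqrt m) / sqrt m - arctan ((- (1/2) + c) / sqrt m) / sqrt m)) TI"
  by (rule fundamental_theorem_of_calculus) (use d in \<open>auto simp: has_real_derivative_iff_has_vector_derivative[symmetric]\<close>)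
 then have "integral TI (\<lambda>t. 1 / (m + (t + c)^2)) = (arctan ((1/2 + c) / sqrt m) - arctan ((- (1/2) + c) / sqrt m)) / sqrt m"
  by (simp add: integral_unique diff_divide_distrib)
 also have "... <= pi / sqrt m"
 proof (rule divide_right_mono)
  show "arctan ((1/2 + c) / sqrt m) - arctan ((- (1/2) + c) / sqrt m) <= pi"
   using arctan_bounded[of "(1/2 + c) / sqrt m"] arctan_bounded[of "(- (1/2) + c) / sqrt m"] by linarith
 qed (use s in simp)
 finally show ?thesis .
qed

text \<open>Up to constants, the squared distance in time from the fold: for
  \<open>\<phi> = 0\<close> it vanishes at time 0, where the upper well is shallowest, for
  \<open>\<phi> = 1/2\<close> at the ends of the period, where the lower well is.\<close>

definition Sfun :: "real \<Rightarrow> real \<Rightarrow> real" where "Sfun \<phi> t = (sin (pi * (t + \<phi>)))^2"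

lemma Sfun_bounds: "0 <= Sfun \<phi> t" "Sfun \<phi> t <= 1"
 by (simp_all add: Sfun_def abs_square_le_1)

lemma Sfun_cont: "continuous_on T (Sfun \<phi>)"
 unfolding Sfun_def[abs_def] by (intro continuous_intros)

text \<open>The squared sine lies above a parabola centred at its nearest zero. Adding the terms for
  the three possible zeros 0, \<open>1/2\<close> and \<open>- (1/2)\<close> treats both phases with
  one bound that can be integrated.\<close>

lemma Sfun_lower:
 assumes \<phi>: "\<phi> = 0 \<or> \<phi> = 1/2" and t: "t \<in> TI" and m: "0 < m"
 shows "1 / (m + Sfun \<phi> t) <= 1 / (m + (t + 0)^2) + (1 / (m + (t + 1/2)^2) + 1 / (m + (t + - (1/2))^2))"
proof -
 have nn: "0 <= 1 / (m + x^2)" for x using m by (simp add: add_nonneg_nonneg)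
 have le: "1 / (m + Sfun \<phi> t) <= 1 / (m + x^2)" if "x^2 <= Sfun \<phi> t" for x
  using m that by (intro divide_left_mono) (auto intro!: mult_pos_pos add_pos_nonneg simp: Sfun_bounds)
 consider "\<phi> = 0" | "\<phi> = 1/2" "t <= 0" | "\<phi> = 1/2" "0 <= t" using \<phi> by linarith
 then show ?thesis
 proof cases
  case 1
  have "(t + 0)^2 <= Sfun \<phi> t" using sin_pi_sq_ge[of t] t 1 by (auto simp: Sfun_def abs_le_iff)
  from le[OF this] show ?thesis using nn[of "t + 1/2"] nn[of "t + - (1/2)"] by linarith
 next
  case 2
  have "(t + 1/2)^2 <= Sfun \<phi> t" unfolding Sfun_def 2(1) by (rule sin_pi_sq_ge) (use t 2 in auto)
  from le[OF this] show ?thesis using nn[of "t + 0"] nn[of "t + - (1/2)"] by linarith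
 next
  case 3
  have "sin (pi * (t + 1/2)) = - sin (pi * (t - 1/2))"
  proof -
   have "pi * (t + 1/2) = pi * (t - 1/2) + pi" by (simp add: algebra_simps)
   then show ?thesis by (simp only: sin_periodic_pi)
  qed
  then have "Sfun \<phi> t = (sin (pi * (t - 1/2)))^2" unfolding Sfun_def 3(1) by simp
  moreover have "(t - 1/2)^2 <= (sin (pi * (t - 1/2)))^2" by (rule sin_pi_sq_ge) (use t 3 in auto)
  ultimately have "(t + - (1/2))^2 <= Sfun \<phi> t" by simp
  from le[OF this] show ?thesis using nn[of "t + 0"] nn[of "t + 1/2"] by linarith
 qed
qed

lemma integral_inverse_Sfun:
 assumes \<phi>: "\<phi> = 0 \<or> \<phi> = 1/2" and m: "0 < m"
 shows "integral TI (\<lambda>t. 1 / (m + Sfun \<phi> t)) <= 12 / sqrt m"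
proof -
 have ne: "m + x^2 \<noteq> 0" for x using m by (simp add: add_pos_nonneg less_imp_neq[symmetric])
 have neS: "m + Sfun \<phi> t \<noteq> 0" for t using m Sfun_bounds(1)[of \<phi> t] by linarith
 have i: "(\<lambda>t. 1 / (m + (t + c)^2)) integrable_on TI" for c
  by (intro integrable_continuous_real continuous_intros) (simp add: ne)
 have "integral TI (\<lambda>t. 1 / (m + Sfun \<phi> t))
   <= integral TI (\<lambda>t. 1 / (m + (t + 0)^2) + (1 / (m + (t + 1/2)^2) + 1 / (m + (t + - (1/2))^2)))"
  by (intro hk_le Henstock_Kurzweil_Integration.integrable_add i Sfun_lower \<phi> m)
    (intro integrable_continuous_real continuous_intros Sfun_cont, simp add: neS)
 also have "... = integral TI (\<lambda>t. 1 / (m + (t + 0)^2)) + (integral TI (\<lambda>t. 1 / (m + (t + 1/2)^2)) + integral TI (\<lambda>t. 1 / (m + (t + - (1/2))^2)))"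
  by (simp only: hk_add Henstock_Kurzweil_Integration.integrable_add i)
 also have "... <= pi / sqrt m + (pi / sqrt m + pi / sqrt m)"
  by (intro add_mono integral_inverse_square m)
 also have "... = 3 * pi / sqrt m" by simp
 also have "... <= 12 / sqrt m" using pi_less_4 m by (intro divide_right_mono) auto
 finally show ?thesis .
qed

text \<open>\<open>sqrt (m + t^2)\<close> is comparable with \<open>sqrt m + \<bar>t\<bar>\<close>,
  whose reciprocal has a logarithmic primitive; the factor \<open>\<bar>ln m\<bar>\<close> of the
  area estimates originates here. The bound \<open>m <= 1/2\<close> keeps
  \<open>\<bar>ln m\<bar>\<close> away from 0, so additive constants can be absorbed.\<close>

lemma integral_log_bound:
 assumes m: "0 < m" "m <= 1/2"
 shows "integral TI (\<lambda>t. 1 / sqrt (m + t^2)) <= 3 * \<bar>ln m\<bar>"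
proof -
 define s where "s = sqrt m"
 have s: "0 < s" "s^2 = m" using m by (auto simp: s_def)
 have pos: "0 < m + t^2" for t using m by (simp add: add_pos_nonneg)
 have le: "1 / sqrt (m + t^2) <= sqrt 2 / (s + \<bar>t\<bar>)" for t
 proof -
  have "(s + \<bar>t\<bar>)^2 <= 2 * (m + t^2)"
   using sum_squares_bound[of s "\<bar>t\<bar>"] s by (simp add: power2_sum)
  then have "s + \<bar>t\<bar> <= sqrt (2 * (m + t^2))" using s by (intro real_le_rsqrt)
  then have "s + \<bar>t\<bar> <= sqrt 2 * sqrt (m + t^2)" by (simp only: real_sqrt_mult)
  then show ?thesis using s pos[of t] by (simp add: field_simps)
 qed
 have c: "continuous_on T (\<lambda>t. 1 / sqrt (m + t^2))" for T
  using pos by (intro continuous_intros) (auto simp: less_imp_neq[symmetric])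
 have val: "((\<lambda>t. sqrt 2 / (s + t)) has_integral sqrt 2 * (ln (s + 1/2) - ln s)) {0..1/2}"
 proof -
  have "((\<lambda>t. sqrt 2 / (s + t)) has_integral (sqrt 2 * ln (s + 1/2) - sqrt 2 * ln (s + 0))) {0..1/2}"
  proof (rule fundamental_theorem_of_calculus)
   fix t :: real assume "t \<in> {0..1/2}"
   then have "0 < s + t" using s by auto
   then show "((\<lambda>t. sqrt 2 * ln (s + t)) has_vector_derivative sqrt 2 / (s + t)) (at t within {0..1/2})"
    unfolding has_real_derivative_iff_has_vector_derivative[symmetric]
    by (auto intro!: derivative_eq_intros simp: field_simps)
  qed simp
  then show ?thesis by (simp add: right_diff_distrib)
 qed
 have val': "((\<lambda>t. sqrt 2 / (s - t)) has_integral sqrt 2 * (ln (s + 1/2) - ln s)) {- (1/2)..0}"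
 proof -
  have "((\<lambda>t. sqrt 2 / (s - t)) has_integral (- sqrt 2 * ln (s - 0) - (- sqrt 2 * ln (s - - (1/2))))) {- (1/2)..0}"
  proof (rule fundamental_theorem_of_calculus)
   fix t :: real assume "t \<in> {- (1/2)..0}"
   then have "0 < s - t" using s by auto
   then show "((\<lambda>t. - sqrt 2 * ln (s - t)) has_vector_derivative sqrt 2 / (s - t)) (at t within {- (1/2)..0})"
    unfolding has_real_derivative_iff_has_vector_derivative[symmetric]
    by (auto intro!: derivative_eq_intros simp: field_simps)
  qed simp
  then show ?thesis by (simp add: right_diff_distrib)
 qed
 have "integral TI (\<lambda>t. 1 / sqrt (m + t^2)) = integral {- (1/2)..0} (\<lambda>t. 1 / sqrt (m + t^2)) + integral {0..1/2} (\<lambda>t. 1 / sqrt (m + t^2))"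
  by (rule hk_combine[symmetric]) (auto intro: integrable_continuous_real c)
 also have "... <= sqrt 2 * (ln (s + 1/2) - ln s) + sqrt 2 * (ln (s + 1/2) - ln s)"
 proof (rule add_mono)
  have "integral {- (1/2)..0} (\<lambda>t. 1 / sqrt (m + t^2)) <= integral {- (1/2)..0} (\<lambda>t. sqrt 2 / (s - t))"
  proof (rule hk_le[OF integrable_continuous_real[OF c] has_integral_integrable[OF val']])
   show "1 / sqrt (m + t^2) <= sqrt 2 / (s - t)" if "t \<in> {- (1/2)..0}" for t using le[of t] that by simp
  qed
  then show "integral {- (1/2)..0} (\<lambda>t. 1 / sqrt (m + t^2)) <= sqrt 2 * (ln (s + 1/2) - ln s)"
   using integral_unique[OF val'] by simp
  have "integral {0..1/2} (\<lambda>t. 1 / sqrt (m + t^2)) <= integral {0..1/2} (\<lambda>t. sqrt 2 / (s + t))"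
  proof (rule hk_le[OF integrable_continuous_real[OF c] has_integral_integrable[OF val]])
   show "1 / sqrt (m + t^2) <= sqrt 2 / (s + t)" if "t \<in> {0..1/2}" for t using le[of t] that by simp
  qed
  then show "integral {0..1/2} (\<lambda>t. 1 / sqrt (m + t^2)) <= sqrt 2 * (ln (s + 1/2) - ln s)"
   using integral_unique[OF val] by simp
 qed
 also have "... = 2 * sqrt 2 * (ln (s + 1/2) - ln s)" by simp
 also have "... <= 2 * sqrt 2 * (\<bar>ln m\<bar> * (5/6))"
 proof (intro mult_left_mono)
  have l2: "2/3 <= ln (2::real)" by (rule ln2_ge_two_thirds)
  have "ln m <= ln (1/2)" using m by (simp add: ln_mono)
  then have lm: "\<bar>ln m\<bar> = - ln m" "2/3 <= - ln m" using l2 by (auto simp: ln_div)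
  have "ln (s + 1/2) <= s + 1/2 - 1" using s by (intro ln_le_minus_one) simp
  moreover have "s <= 7/10 + 1/100"
  proof -
   have "sqrt m <= sqrt ((71/100)^2)" using m by (intro real_sqrt_le_mono) (simp add: power2_eq_square)
   then show ?thesis by (simp add: s_def)
  qed
  moreover have "ln s = ln m / 2" using m by (simp add: s_def ln_sqrt)
  ultimately show "ln (s + 1/2) - ln s <= \<bar>ln m\<bar> * (5/6)" using lm by simp
 qed simp
 also have "... <= 3 * \<bar>ln m\<bar>"
 proof -
  have "sqrt 2 <= sqrt ((3/2)^2)" by (intro real_sqrt_le_mono) (simp add: power2_eq_square)
  then have "2 * sqrt 2 * (5/6) <= (3::real)" by simp
  then have "2 * sqrt 2 * (5/6) * \<bar>ln m\<bar> <= 3 * \<bar>ln m\<bar>" by (intro mult_right_mono) auto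
  then show ?thesis by (simp add: ac_simps)
 qed
 finally show ?thesis .
qed

section \<open>Roots of the drift and the fold point\<close>

lemma F_roots_finite: "finite {x. F x l = 0}"
proof -
 have "{x. F x l = 0} = {x. poly [:l, 1, 0, -1:] x = 0}"
  by (auto simp: F_def power3_eq_cube algebra_simps)
 then show ?thesis using poly_roots_finite[of "[:l, 1, 0, -1:]"] by simp
qed

lemma F_root_above:
 assumes "0 <= F y l" shows "\<exists>x\<ge>y. F x l = 0"
proof -
 define b where "b = max y (2 + \<bar>l\<bar>)"
 have b: "2 + \<bar>l\<bar> <= b" "y <= b" by (auto simp: b_def)
 have "F b l <= 0"
 proof -
  have "4 * b <= b^2 * b"
  proof (rule mult_right_mono)
   have "2^2 <= b^2" using b by (intro power_mono) auto
   then show "4 <= b^2" by simp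
  qed (use b in linarith)
  then have "b - b ^ 3 <= - 3 * b" by (simp add: power2_eq_square power3_eq_cube)
  then show ?thesis using b by (simp add: F_def abs_le_iff)
 qed
 then have "\<exists>x\<ge>y. x <= b \<and> F x l = 0"
  by (intro IVT2') (use assms b in \<open>auto simp: F_def intro!: continuous_intros\<close>)
 then show ?thesis by blast
qed

text \<open>A nonnegative drift at \<open>y\<close> forces a root above \<open>y\<close>, since the
  cubic term makes the drift negative far to the right; lower bounds on \<open>X_plus\<close> thus
  reduce to a sign check.\<close>

lemma X_plus_ge: assumes "0 <= F y l" shows "y <= X_plus l"
proof -
 obtain x where "y <= x" "F x l = 0" using F_root_above[OF assms] by blast
 then show ?thesis using Max_ge[OF F_roots_finite, of x l] by (simp add: X_plus_def)
qed

lemma F_root_exists: "\<exists>x. F x l = 0"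
proof -
 have "0 <= F (- (2 + \<bar>l\<bar>)) l"
 proof -
  define b where "b = 2 + \<bar>l\<bar>"
  have b: "2 <= b" "\<bar>l\<bar> <= b" by (auto simp: b_def)
  have "4 * b <= b^2 * b"
  proof (rule mult_right_mono)
   have "2^2 <= b^2" using b by (intro power_mono) auto
   then show "4 <= b^2" by simp
  qed (use b in linarith)
  moreover have "b^2 * b = b ^ 3" by (simp add: power2_eq_square power3_eq_cube)
  moreover have "F (- b) l = b ^ 3 - b + l" by (simp add: F_def)
  ultimately show ?thesis unfolding b_def[symmetric] using b by linarith
 qed
 from F_root_above[OF this] show ?thesis by blast
qed

lemma X_plus_le: assumes "\<And>x. b < x \<Longrightarrow> F x l \<noteq> 0" shows "X_plus l <= b"
proof -
 have "X_plus l \<in> {x. F x l = 0}" unfolding X_plus_def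
  by (rule Max_in[OF F_roots_finite]) (use F_root_exists in auto)
 then show ?thesis using assms[of "X_plus l"] by force
qed

lemma X_minus_eq: "X_minus l = - X_plus (- l)"
proof -
 have e: "{x. F x l = 0} = uminus ` {x. F x (- l) = 0}"
 proof (rule set_eqI)
  fix x
  have "F x l = - F (- x) (- l)" by (simp add: F_def)
  then have "F x l = 0 \<longleftrightarrow> F (- x) (- l) = 0" by simp
  then show "x \<in> {x. F x l = 0} \<longleftrightarrow> x \<in> uminus ` {x. F x (- l) = 0}"
   by (auto simp: image_iff intro: exI[of _ "- x"])
 qed
 show ?thesis unfolding X_minus_def X_plus_def e
  by (rule minus_Max_eq_Min[symmetric]) (use F_roots_finite F_root_exists in auto)
qed

lemma sqrt3: "(sqrt 3)^2 = (3::real)" "17/10 <= sqrt 3" "sqrt 3 <= 18/10"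
proof -
 have "sqrt ((17/10)^2) <= sqrt 3" "sqrt 3 <= sqrt ((18/10)^2)"
  by (intro real_sqrt_le_mono; simp add: power2_eq_square)+
 then show "17/10 <= sqrt 3" "sqrt 3 <= 18/10" by simp_all
qed simp

text \<open>Abscissa of the fold: a double root of the drift at
  \<open>l = - lambda_c\<close>.\<close>

definition xc :: real where "xc = 1 / sqrt 3"

lemma xc: "xc^2 = 1/3" "5/9 <= xc" "xc <= 10/17" "xc - xc ^ 3 = lambda_c"
proof -
 show 1: "xc^2 = 1/3" by (simp add: xc_def power_divide)
 show "5/9 <= xc" "xc <= 10/17" using sqrt3 by (auto simp: xc_def field_simps)
 have "xc ^ 3 = xc^2 * xc" by (simp add: power2_eq_square power3_eq_cube)
 then show "xc - xc ^ 3 = lambda_c" unfolding 1 by (simp add: lambda_c_def xc_def)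
qed

lemma F_xc: "F (xc + y) l = (l + lambda_c) - 3 * xc * y^2 - y ^ 3"
proof -
 have "F (xc + y) l = (xc - xc ^ 3) + (1 - 3 * xc^2) * y - 3 * xc * y^2 - y ^ 3 + l"
  by (simp add: F_def power2_eq_square power3_eq_cube algebra_simps)
 then show ?thesis by (simp add: xc)
qed

lemma lambda_c_bounds: "37/100 <= lambda_c" "lambda_c <= 393/1000"
proof -
 have "lambda_c = 2/3 * xc" by (simp add: lambda_c_def xc_def)
 then show "37/100 <= lambda_c" "lambda_c <= 393/1000" using xc(2,3) by auto
qed

text \<open>The branch leaves the fold like a square root of the gap \<open>l + lambda_c\<close>. At
  half of that root the quadratic term of the drift takes less than half of the gap and the cubic
  term at most an eighth, so the drift is still nonnegative.\<close>

lemma X_plus_lower: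
 assumes e: "0 <= l + lambda_c" "l + lambda_c <= 1"
 shows "xc + sqrt (l + lambda_c) / 2 <= X_plus l"
proof (rule X_plus_ge)
 define r where "r = sqrt (l + lambda_c)"
 have r: "0 <= r" "r <= 1" "r^2 = l + lambda_c" using e by (auto simp: r_def)
 have "(r/2)^2 = r^2 / 4" by (simp add: power_divide)
 moreover have "(r/2) ^ 3 <= r^2 / 8"
 proof -
  have "(r/2) ^ 3 = r^2 / 8 * r" by (simp add: power_divide power2_eq_square power3_eq_cube)
  also have "... <= r^2 / 8 * 1" using r(1,2) by (intro mult_left_mono) auto
  finally show ?thesis by simp
 qed
 moreover have "3 * xc * (r^2 / 4) <= 3 * (10/17) * (r^2 / 4)" using xc by (intro mult_right_mono) auto
 moreover have "0 <= r^2" by simp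
 moreover have "3 * xc * (r/2)^2 = 3 * xc * (r^2 / 4)" by (simp add: power_divide)
 ultimately have "0 <= F (xc + r / 2) l" unfolding F_xc using r(3) by linarith
 then show "0 <= F (xc + sqrt (l + lambda_c) / 2) l" unfolding r_def .
qed

lemma F_neg_above:
 assumes l: "l <= 9/20" and x: "13/10 <= x" shows "F x l < 0"
proof -
 have "(13/10)^2 * x <= x^2 * x" using x by (intro mult_right_mono power_mono) auto
 then have "169/100 * x <= x ^ 3" by (simp add: power2_eq_square power3_eq_cube power_divide)
 then show ?thesis using l x by (simp add: F_def)
qed

section \<open>Tracked branches\<close>

text \<open>The factor 40000 yields \<open>8 * e <= c * (width m \<phi> t)^2\<close> for the rates \<open>c = 1/1000\<close> and
 \<open>c = 1/2000\<close> below.\<close>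

definition width :: "real \<Rightarrow> real \<Rightarrow> real \<Rightarrow> real" where
 "width m \<phi> t = sqrt (40000 * m + Sfun \<phi> t)"

definition width' :: "real \<Rightarrow> real \<Rightarrow> real \<Rightarrow> real" where
 "width' m \<phi> t = pi * (sin (pi * (t + \<phi>)) * cos (pi * (t + \<phi>))) / width m \<phi> t"

lemma width_basic:
 assumes m: "0 < m"
 shows "0 < width m \<phi> t" "200 * sqrt m <= width m \<phi> t" "sqrt m <= width m \<phi> t"
  "\<bar>sin (pi * (t + \<phi>))\<bar> <= width m \<phi> t" "width m \<phi> t <= 200 * sqrt (m + Sfun \<phi> t)"
  "(width m \<phi> t)^2 = 40000 * m + Sfun \<phi> t"
  "m <= 1 \<Longrightarrow> width m \<phi> t <= 201"
proof -
 have S: "0 <= Sfun \<phi> t" "Sfun \<phi> t <= 1" by (rule Sfun_bounds)+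
 have r4: "sqrt 40000 = (200::real)" by (rule real_sqrt_unique) auto
 show 1: "0 < width m \<phi> t" using m S by (simp add: width_def add_pos_nonneg)
 have "sqrt (40000 * m) <= width m \<phi> t" unfolding width_def using S by simp
 then show 2: "200 * sqrt m <= width m \<phi> t" by (simp add: real_sqrt_mult r4)
 then show "sqrt m <= width m \<phi> t" using real_sqrt_ge_zero[of m] m by linarith
 have "sqrt (Sfun \<phi> t) <= width m \<phi> t" unfolding width_def using m by simp
 then show "\<bar>sin (pi * (t + \<phi>))\<bar> <= width m \<phi> t" by (simp add: Sfun_def)
 have "width m \<phi> t <= sqrt (40000 * (m + Sfun \<phi> t))" unfolding width_def using S by simp
 then show "width m \<phi> t <= 200 * sqrt (m + Sfun \<phi> t)" by (simp only: real_sqrt_mult r4)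
 show "(width m \<phi> t)^2 = 40000 * m + Sfun \<phi> t" using m S by (simp add: width_def)
 show "width m \<phi> t <= 201" if "m <= 1"
 proof -
  have "width m \<phi> t <= sqrt (201^2)" unfolding width_def using that S by (intro real_sqrt_le_mono) auto
  then show ?thesis by simp
 qed
qed

lemma width_deriv:
 assumes m: "0 < m"
 shows "(width m \<phi> has_real_derivative width' m \<phi> t) (at t within T)"
proof -
 have p: "0 < 40000 * m + (sin (pi * (t + \<phi>)))^2" using m by (simp add: add_pos_nonneg)
 have d: "((\<lambda>t. 40000 * m + (sin (pi * (t + \<phi>)))^2) has_real_derivative 2 * (pi * (sin (pi * (t + \<phi>)) * cos (pi * (t + \<phi>))))) (at t within T)"
  by (auto intro!: derivative_eq_intros)
 have eq: "inverse (sqrt x) / 2 * (2 * y) = y / sqrt x" for x y :: real by (cases "sqrt x = 0") (auto simp: field_simps)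
 show ?thesis using DERIV_chain2[OF DERIV_real_sqrt[OF p] d]
  unfolding width_def[abs_def] width'_def Sfun_def[abs_def] eq .
qed

lemma width'_bound: assumes m: "0 < m" shows "\<bar>width' m \<phi> t\<bar> <= 4"
proof -
 have "\<bar>sin (pi * (t + \<phi>)) * cos (pi * (t + \<phi>))\<bar> <= width m \<phi> t * 1"
  unfolding abs_mult by (intro mult_mono width_basic m) (use width_basic(1)[OF m, of \<phi> t] in auto)
 then have "pi * \<bar>sin (pi * (t + \<phi>)) * cos (pi * (t + \<phi>))\<bar> <= pi * width m \<phi> t" by simp
 also have "... <= 4 * width m \<phi> t" using pi_less_4 width_basic(1)[OF m, of \<phi> t] by (intro mult_right_mono) auto
 finally show ?thesis using width_basic(1)[OF m, of \<phi> t] unfolding width'_def by (simp add: abs_mult field_simps)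
qed

lemma linear_well_width:
 assumes eps: "0 < e" "e <= m" and c1: "0 < c1" "8 <= c1 * 40000" and C1: "0 <= C1"
  and z: "continuous_on TI z" "\<And>t. t \<in> TI \<Longrightarrow> 0 <= z t \<and> z t <= 3/2"
  and ex: "integral TI (\<lambda>t. max 0 (1 - 3 * (z t)^2 + c1 * width m \<phi> t)) <= C1 * e"
 shows "linear_well e c1 C1 7 (\<lambda>t. 1 - 3 * (z t)^2) (width m \<phi>) (width' m \<phi>)"
proof unfold_locales
 have m: "0 < m" using eps by simp
 show "0 < e" "0 < c1" "0 <= C1" by fact+
 show "continuous_on TI (\<lambda>t. 1 - 3 * (z t)^2)" by (intro continuous_intros z)
 fix t assume t: "t \<in> TI"
 have "(z t)^2 <= (3/2)^2" using z(2)[OF t] by (intro power_mono) auto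
 moreover have "0 <= (z t)^2" "(3/2)^2 = (9/4::real)" by (simp_all add: power_divide)
 ultimately show "\<bar>1 - 3 * (z t)^2\<bar> <= 7" by linarith
 show "(width m \<phi> has_real_derivative width' m \<phi> t) (at t within TI)" by (rule width_deriv[OF m])
 show "\<bar>width' m \<phi> t\<bar> <= 4" by (rule width'_bound[OF m])
 show "0 < width m \<phi> t" by (rule width_basic[OF m])
 have "8 * e <= (c1 * 40000) * m" using eps c1 by (intro mult_mono) auto
 also have "... <= c1 * (40000 * m + Sfun \<phi> t)" using c1 Sfun_bounds(1)[of \<phi> t] by (simp add: algebra_simps)
 finally show "8 * e <= c1 * (width m \<phi> t)^2" unfolding width_basic(6)[OF m] .
next
 show "integral TI (\<lambda>t. max 0 (1 - 3 * (z t)^2 + c1 * width m \<phi> t)) <= C1 * e" by (rule ex)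
qed

text \<open>The peak \<open>e * sqrt e / (e + S)\<close> has height and width of order
  \<open>sqrt e\<close>, hence area of order \<open>e\<close>, which is what
  \<open>linear_well\<close> allows.\<close>

lemma excess_from_peak:
 assumes eps: "0 < e" and \<phi>: "\<phi> = 0 \<or> \<phi> = 1/2" and B: "0 <= B" and m: "0 < m"
  and z: "continuous_on TI z"
  and le: "\<And>t. t \<in> TI \<Longrightarrow> 1 - 3 * (z t)^2 + c1 * width m \<phi> t <= B * (e * sqrt e) * (1 / (e + Sfun \<phi> t))"
 shows "integral TI (\<lambda>t. max 0 (1 - 3 * (z t)^2 + c1 * width m \<phi> t)) <= 12 * B * e"
proof -
 have ne: "e + Sfun \<phi> t \<noteq> 0" for t using eps Sfun_bounds(1)[of \<phi> t] by linarith
 have c: "continuous_on TI (\<lambda>t. 1 / (e + Sfun \<phi> t))" by (intro continuous_intros Sfun_cont) (simp add: ne)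
 have cw: "continuous_on TI (width m \<phi>)" by (rule DERIV_continuous_on[OF width_deriv[OF m]])
 have "integral TI (\<lambda>t. max 0 (1 - 3 * (z t)^2 + c1 * width m \<phi> t)) <= integral TI (\<lambda>t. B * (e * sqrt e) * (1 / (e + Sfun \<phi> t)))"
 proof (rule hk_le)
  show "(\<lambda>t. max 0 (1 - 3 * (z t)^2 + c1 * width m \<phi> t)) integrable_on TI"
   by (intro integrable_continuous_real continuous_intros z cw)
  show "(\<lambda>t. B * (e * sqrt e) * (1 / (e + Sfun \<phi> t))) integrable_on TI"
   by (intro integrable_continuous_real continuous_on_mult continuous_on_const c)
  show "max 0 (1 - 3 * (z t)^2 + c1 * width m \<phi> t) <= B * (e * sqrt e) * (1 / (e + Sfun \<phi> t))" if "t \<in> TI" for t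
   using le[OF that] B eps Sfun_bounds(1)[of \<phi> t] by (intro max.boundedI) auto
 qed
 also have "... = B * (e * sqrt e) * integral TI (\<lambda>t. 1 / (e + Sfun \<phi> t))" by (rule integral_mult_right)
 also have "... <= B * (e * sqrt e) * (12 / sqrt e)"
  using B eps by (intro mult_left_mono integral_inverse_Sfun \<phi>) auto
 also have "... = 12 * B * e" using eps by simp
 finally show ?thesis .
qed

lemma lam_shift: "lam (lambda_c + a0) t + lambda_c = - a0 + 2 * (lambda_c + a0) * Sfun 0 t"
proof -
 have "cos (2 * pi * t) = 1 - 2 * (sin (pi * t))^2"
  using cos_double_sin[of "pi * t"] by (simp add: ac_simps)
 then have "lam (lambda_c + a0) t = - (lambda_c + a0) * (1 - 2 * (sin (pi * t))^2)" unfolding lam_def by simp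
 then show ?thesis by (simp add: Sfun_def algebra_simps)
qed

text \<open>Both wells in one locale: \<open>\<phi> = 0\<close> is used with the upper orbit,
  \<open>\<phi> = 1/2\<close> with the negative of the lower orbit, the symmetry being a reflection
  combined with a shift by half a period. \<open>small\<close> collects the requirements on
  \<open>e\<close> in terms of \<open>K\<close> and \<open>\<gamma>\<close>.\<close>

locale tracked_branch =
 fixes e a0 A m \<gamma> K \<phi> :: real and z :: "real \<Rightarrow> real"
 assumes A_eq: "A = lambda_c + a0" and m_eq: "m = max \<bar>a0\<bar> e" and eps: "0 < e" and gamma: "0 < \<gamma>" and K: "0 < K" and a0: "- lambda_c < a0" "a0 <= \<gamma> * e"
  and phi: "\<phi> = 0 \<or> \<phi> = 1/2"
  and small: "15000 * (1 + 3 * \<gamma> + 200 * K^2)^2 * sqrt e <= 1"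
  and ode: "\<And>t. (z has_real_derivative F (z t) (lam A (t + \<phi>)) / e) (at t)"
  and track: "\<And>t. - lambda_c < lam A (t + \<phi>) \<Longrightarrow>
   \<bar>z t - X_plus (lam A (t + \<phi>))\<bar> <= K * (e / sqrt m)"
begin

abbreviation S :: "real \<Rightarrow> real" where "S \<equiv> Sfun \<phi>"
abbreviation l :: "real \<Rightarrow> real" where "l t \<equiv> lam A (t + \<phi>)"

definition K2 :: real where "K2 = 1 + 3 * \<gamma> + 200 * K^2"
definition gap :: "real \<Rightarrow> real" where "gap t = l t + lambda_c"

lemma K2: "1 <= K2" "3 * \<gamma> <= K2" "200 * K^2 <= K2"
 using gamma by (simp_all add: K2_def)

lemma small': "15000 * K2^2 * sqrt e <= 1" "K2 * sqrt e <= 1/15000" "K2 * e <= 1/15000" "e <= 1/15000"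
  "\<gamma> * e <= 1/15000"
proof -
 show 1: "15000 * K2^2 * sqrt e <= 1" using small by (simp add: K2_def)
 have "K2 * sqrt e <= K2^2 * sqrt e" using K2(1) eps by (intro mult_right_mono) (auto simp: power2_eq_square)
 then show 2: "K2 * sqrt e <= 1/15000" using 1 by simp
 have s: "sqrt e <= K2 * sqrt e" using K2(1) eps by simp
 have "sqrt e * sqrt e <= sqrt e * 1" using s 2 eps by (intro mult_left_mono) (linarith, simp)
 then have es: "e <= sqrt e" using eps by simp
 have "K2 * e <= K2 * sqrt e" using K2(1) by (intro mult_left_mono es) auto
 then show 3: "K2 * e <= 1/15000" using 2 by simp
 have "1 * e <= K2 * e" using K2(1) eps by (intro mult_right_mono) auto
 then show "e <= 1/15000" using 3 by simp
 have "\<gamma> * e <= K2 * e" using K2(2) gamma eps by (intro mult_right_mono) auto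
 then show "\<gamma> * e <= 1/15000" using 3 by simp
qed

lemma A_bounds: "0 < A" "A <= 9/20" "m <= lambda_c" "e <= m" "0 < m"
 using a0 small' lambda_c_bounds eps by (auto simp: A_eq m_eq)

lemma m_a0: "\<bar>a0\<bar> <= m" "- e < a0 \<Longrightarrow> a0 <= 0 \<Longrightarrow> m = e" "a0 <= - e \<Longrightarrow> m = - a0" "0 <= a0 \<Longrightarrow> m = max a0 e"
 using eps by (auto simp: m_eq)

lemma gap_eq: "gap t = - a0 + 2 * A * S t"
 using lam_shift[of a0 "t + \<phi>"] unfolding gap_def Sfun_def A_eq[symmetric] by simp

lemma gap_le: "gap t <= 1"
proof -
 have "2 * A * S t <= 2 * A * 1" using A_bounds Sfun_bounds[of \<phi> t] by (intro mult_left_mono) auto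
 moreover have "- a0 = lambda_c - A" by (simp add: A_eq)
 ultimately show ?thesis using lambda_c_bounds A_bounds unfolding gap_eq by linarith
qed

text \<open>Four regimes: for \<open>a0\<close> below \<open>- (lambda_c / 2)\<close> the amplitude
  may degenerate but \<open>- a0\<close> alone suffices; for \<open>a0 <= - e\<close> both terms of
  the gap help; for \<open>a0\<close> between \<open>- e\<close> and 0, and for positive
  \<open>a0\<close>, the hypothesis forces \<open>S t >= K2 * e\<close>, and \<open>S t\<close>
  dominates \<open>m\<close>.\<close>

lemma gap_ge:
 assumes o: "K2 * e <= S t \<or> a0 <= - K2 * e"
 shows "37/400 * (m + S t) <= gap t"
proof -
 have S: "0 <= S t" "S t <= 1" by (rule Sfun_bounds)+
 have e1: "1 * e <= K2 * e" using K2(1) eps by (intro mult_right_mono) auto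
 consider "a0 <= - (lambda_c / 2)" | "- (lambda_c / 2) < a0" "a0 <= - e" | "- (lambda_c / 2) < a0" "- e < a0" "a0 <= 0" | "0 < a0"
  by linarith
 then show ?thesis
 proof cases
  case 1
  have "0 <= 2 * A * S t" using A_bounds S by simp
  moreover have "37/400 * (m + S t) <= 37/400 * (lambda_c + 1)" using A_bounds S by (intro mult_left_mono) auto
  ultimately show ?thesis using 1 lambda_c_bounds unfolding gap_eq by argo
 next
  case 2
  then have "lambda_c * S t <= 2 * A * S t" using S by (intro mult_right_mono) (auto simp: A_eq)
  moreover have "37/100 * S t <= lambda_c * S t" using S lambda_c_bounds by (intro mult_right_mono) auto
  moreover have "m = - a0" using 2 m_a0 by auto
  ultimately show ?thesis using S 2 eps unfolding gap_eq by (simp add: field_simps)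
 next
  case 3
  then have "lambda_c * S t <= 2 * A * S t" using S by (intro mult_right_mono) (auto simp: A_eq)
  moreover have "37/100 * S t <= lambda_c * S t" using S lambda_c_bounds by (intro mult_right_mono) auto
  moreover have "m <= S t" using 3 o e1 m_a0(2) by linarith
  ultimately show ?thesis using S 3 unfolding gap_eq by argo
 next
  case 4
  then have "2 * lambda_c * S t <= 2 * A * S t" using S by (intro mult_right_mono) (auto simp: A_eq)
  moreover have "37/100 * S t <= lambda_c * S t" using S lambda_c_bounds by (intro mult_right_mono) auto
  moreover have Ke: "K2 * e <= S t" using 4 o e1 eps by auto
  moreover have "3 * \<gamma> * e <= K2 * e" using K2 eps by (intro mult_right_mono) auto
  moreover have "m <= S t" 
  proof -
   have "0 < \<gamma> * e" using gamma eps by simp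
   then have "e <= S t" "a0 <= S t" using calculation(3,4) a0(2) e1 by linarith+
   then show ?thesis using m_a0(4) 4 by simp
  qed
  ultimately show ?thesis using S 4 a0 unfolding gap_eq by argo
 qed
qed

text \<open>The tracking error \<open>K * (e / sqrt m)\<close> is at most a quarter of the square
  root of the gap, since \<open>(4 * K * e)^2 <= gap t * m\<close>; so half of the bound from
  \<open>X_plus_lower\<close> survives.\<close>

lemma outer:
 assumes o: "K2 * e <= S t \<or> a0 <= - K2 * e"
 shows "xc + sqrt (gap t) / 4 <= z t" "3/10 * sqrt (m + S t) <= sqrt (gap t)"
proof -
 have S: "0 <= S t" by (rule Sfun_bounds)
 have e1: "1 * e <= K2 * e" using K2(1) eps by (intro mult_right_mono) auto
 have eg: "37/400 * (m + S t) <= gap t" by (rule gap_ge[OF o])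
 have mp: "0 < m + S t" using A_bounds S by linarith
 then have ep: "0 < gap t" using eg by argo
 have "sqrt ((3/10)^2 * (m + S t)) <= sqrt (gap t)" using eg mp by (intro real_sqrt_le_mono) (simp add: power_divide)
 then show "3/10 * sqrt (m + S t) <= sqrt (gap t)" by (simp add: real_sqrt_mult)
 have "(4 * K * e)^2 <= gap t * m"
 proof -
  have "K2 * e <= m + S t" using o A_bounds e1 S m_a0(1) by auto
  have "16 * K^2 * (e * e) <= 37/400 * K2 * (e * e)" using K2(3) zero_le_power2[of K] eps by (intro mult_right_mono) (linarith, simp)
  also have "... = 37/400 * (K2 * e) * e" by simp
  also have "... <= 37/400 * (m + S t) * m"
   using \<open>K2 * e <= m + S t\<close> A_bounds eps K2(1) mp by (intro mult_mono) auto
  also have "... <= gap t * m" using eg A_bounds by (intro mult_right_mono) auto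
  finally have "16 * K^2 * (e * e) <= gap t * m" .
  moreover have "(4 * K * e)^2 = 16 * K^2 * (e * e)" by (simp only: power_mult_distrib) (simp add: power2_eq_square)
  ultimately show ?thesis by (simp only:)
 qed
 then have "4 * K * e <= sqrt (gap t * m)" by (rule real_le_rsqrt)
 then have "4 * K * e <= sqrt (gap t) * sqrt m" by (simp only: real_sqrt_mult)
 then have "4 * K * e / sqrt m <= sqrt (gap t)" by (subst pos_divide_le_eq) (use A_bounds(5) in simp)
 moreover have "K * (e / sqrt m) = 4 * K * e / sqrt m / 4" by simp
 ultimately have "K * (e / sqrt m) <= sqrt (gap t) / 4" by argo
 moreover have "\<bar>z t - X_plus (l t)\<bar> <= K * (e / sqrt m)" using ep by (intro track) (simp add: gap_def)
 moreover have "xc + sqrt (gap t) / 2 <= X_plus (l t)"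
  using X_plus_lower[of "l t"] ep gap_le[of t] by (simp add: gap_def)
 ultimately show "xc + sqrt (gap t) / 4 <= z t" by argo
qed

text \<open>\<open>724 = 1 + 3 * 241\<close>, in units of \<open>K2^2\<close>: an offset
  \<open>sqrt e\<close> plus a descent with slope \<open>241 * K2\<close> during a time of at most
  \<open>3 * K2 * sqrt e\<close>.\<close>

definition Cz :: real where "Cz = 724 * K2^2"

lemma Cz: "Cz * sqrt e <= 1/20" "724 <= Cz" "K2 <= Cz"
proof -
 show "Cz * sqrt e <= 1/20" using small'(1) eps by (simp add: Cz_def)
 have "1 * K2 <= K2^2" unfolding power2_eq_square using K2 by (intro mult_right_mono) auto
 then show "724 <= Cz" "K2 <= Cz" using K2 by (auto simp: Cz_def)
qed

text \<open>Close to the fold the branch may not exist, so the orbit is controlled backwards from a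
 nearby later time at which tracking applies.\<close>

lemma inner:
 assumes i: "S t < K2 * e" "- K2 * e < a0"
 shows "xc - Cz * sqrt e <= z t"
proof -
 define q where "q = sqrt (K2 * e)"
 have q: "0 < q" "q^2 = K2 * e" using K2 eps by (auto simp: q_def)
 have "sqrt (K2 * e) <= sqrt ((1/100)^2)" by (rule real_sqrt_le_mono) (use small'(3) in \<open>simp add: power2_eq_square\<close>)
 then have q_le: "q <= 1/100" by (simp add: q_def)
 define n where "n = round (t + \<phi>)"
 define v where "v = t + \<phi> - of_int n"
 have v: "\<bar>v\<bar> <= 1/2" unfolding v_def n_def using of_int_round_abs_le[of "t + \<phi>"] by (simp add: abs_minus_commute)
 have S_shift: "S r = (sin (pi * (v + (r - t))))^2" for r
 proof -
  have "pi * (r + \<phi>) = pi * (v + (r - t)) + of_int n * pi" by (simp add: v_def algebra_simps)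
  moreover have "(sin (x + of_int n * pi))^2 = (sin x)^2" for x
  proof -
   have "sin (of_int n * pi) = 0" using sin_npi_int[of n] by (simp add: ac_simps)
   then show ?thesis using sin_cos_squared_add[of "of_int n * pi"] by (simp add: sin_add power_mult_distrib)
  qed
  ultimately show ?thesis unfolding Sfun_def by simp
 qed
 have "v^2 <= q^2" using sin_pi_sq_ge[OF v] i(1) S_shift[of t] q(2) by simp
 then have v_q: "\<bar>v\<bar> <= q" using q(1) by (simp add: abs_le_square_iff[symmetric])
 \<comment> \<open>\<open>t\<close> lies within \<open>q\<close> of a fold time; a delay of
   \<open>3 * q\<close> moves it to where \<open>S\<close> has reached \<open>K2 * e\<close> and
   \<open>outer\<close> applies.\<close>
 define t1 where "t1 = t + 3 * q"
 have S1: "K2 * e <= S t1"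
 proof -
  have b: "q <= v + 3 * q" "v + 3 * q <= 1/2" using v_q q_le by auto
  have "q^2 <= (v + 3 * q)^2" using b q by (intro power_mono) auto
  also have "... <= (sin (pi * (v + 3 * q)))^2" using b q by (intro sin_pi_sq_ge) auto
  finally show ?thesis using S_shift[of t1] q(2) by (simp add: t1_def)
 qed
 have eb: "gap r <= 240 * K2 * e" if r: "r \<in> {t..t1}" for r
 proof -
  have "\<bar>sin (pi * (v + (r - t)))\<bar> <= \<bar>pi * (v + (r - t))\<bar>" by (rule abs_sin_x_le_abs_x)
  also have "... <= 4 * (4 * q)" unfolding abs_mult using pi_less_4 v_q r q by (intro mult_mono) (auto simp: t1_def)
  finally have "\<bar>sin (pi * (v + (r - t)))\<bar> <= \<bar>16 * q\<bar>" using q by simp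
  then have "(sin (pi * (v + (r - t))))^2 <= (16 * q)^2" unfolding abs_le_square_iff .
  then have "S r <= 256 * (K2 * e)" using q(2) S_shift[of r] by (simp add: power_mult_distrib)
  then have "2 * A * S r <= 2 * (9/20) * (256 * (K2 * e))"
   using A_bounds Sfun_bounds(1)[of \<phi> r] by (intro mult_mono) auto
  moreover have "0 <= K2 * e" using K2 eps by simp
  ultimately show ?thesis using i(2) unfolding gap_eq by (simp add: algebra_simps)
 qed
 \<comment> \<open>On the line below, the drift is at most the gap, hence at most
   \<open>240 * K2 * e\<close>; a slope exceeding this bound divided by \<open>e\<close> cannot be
   undercut when the orbit is followed backwards.\<close>
 define B where "B = 241 * K2"
 define g where "g r = z r - (xc - sqrt e - B * (t1 - r))" for r
 have BK: "240 * K2 * e < B * e" using K2 eps by (auto simp: B_def)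
 have range: "sqrt e + B * (3 * q) <= Cz * sqrt e"
 proof -
  have "sqrt K2 <= sqrt (K2^2)" using K2 by (intro real_sqrt_le_mono) (auto simp: power2_eq_square)
  then have sK: "sqrt K2 <= K2" using K2 by simp
  have "q <= K2 * sqrt e" unfolding q_def real_sqrt_mult using sK eps by (intro mult_right_mono) auto
  then have "B * (3 * q) <= B * (3 * (K2 * sqrt e))" using K2 by (intro mult_left_mono) (auto simp: B_def)
  moreover have "1 * sqrt e <= K2^2 * sqrt e" using K2 eps by (intro mult_right_mono) auto
  ultimately show ?thesis by (simp add: B_def Cz_def power2_eq_square)
 qed
 have "0 < g t"
 proof (rule barrier_pos_backward[of t t1 g])
  have gd: "(g has_real_derivative F (z r) (l r) / e - B) (at r)" for r
   unfolding g_def[abs_def] by (rule derivative_eq_intros ode refl | simp)+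
  show "continuous_on {t..t1} g" by (rule DERIV_continuous_on[OF has_field_derivative_at_within[OF gd]])
  have e1: "0 <= sqrt (gap t1)" using gap_ge[of t1] S1 A_bounds Sfun_bounds(1)[of \<phi> t1] by simp
  have "g t1 = z t1 - xc + sqrt e" by (simp add: g_def)
  moreover have "0 < sqrt e" "xc + sqrt (gap t1) / 4 <= z t1" using outer(1)[of t1] S1 eps by auto
  ultimately show "0 < g t1" using e1 by argo
  show "\<exists>d<0. (g has_real_derivative d) (at r)" if r: "t <= r" "r < t1" and g0: "g r = 0" for r
  proof (intro exI conjI)
   define y where "y = sqrt e + B * (t1 - r)"
   have "B * (t1 - r) <= B * (3 * q)" using r K2 by (intro mult_left_mono) (auto simp: t1_def B_def)
   moreover have "0 <= B * (t1 - r)" using r K2 by (simp add: B_def)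
   ultimately have y: "0 <= y" "y <= 1/20" using range Cz(1) eps by (auto simp: y_def)
   have zr: "z r = xc + (- y)" using g0 by (simp add: g_def y_def)
   have "y ^ 3 = y * y^2" by (simp add: power2_eq_square power3_eq_cube)
   also have "... <= 3 * xc * y^2" using y xc by (intro mult_right_mono) auto
   finally have "F (z r) (l r) <= gap r" unfolding zr F_xc gap_def by simp
   also have "... <= 240 * K2 * e" using r by (intro eb) auto
   also note BK
   finally have "F (z r) (l r) / e < B" using eps by (simp only: pos_divide_less_eq)
   then show "F (z r) (l r) / e - B < 0" by simp
   show "(g has_real_derivative F (z r) (l r) / e - B) (at r)" by (rule gd)
  qed
  show "t \<in> {t..t1}" using q by (simp add: t1_def)
 qed
 then show ?thesis using range by (simp add: g_def t1_def)
qed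

lemma z_lower: "1/2 <= z t"
proof -
 have "xc - 1/20 <= z t"
 proof (cases "K2 * e <= S t \<or> a0 <= - K2 * e")
  case True
  have "0 <= sqrt (gap t)" using gap_ge[OF True] A_bounds Sfun_bounds(1)[of \<phi> t] by simp
  then show ?thesis using outer(1)[OF True] by linarith
 next
  case False then show ?thesis using inner[of t] Cz by linarith
 qed
 then show ?thesis using xc by linarith
qed

lemma z_cont: "continuous_on T z"
 by (rule DERIV_continuous_on[OF has_field_derivative_at_within[OF ode]])

lemma z_upper: assumes t: "t \<in> TI" shows "z t <= 7/5"
proof -
 have "0 < 7/5 - z t"
 \<comment> \<open>The barrier starts at the phase where \<open>l\<close> equals \<open>A\<close>
   and tracking is available; for \<open>\<phi> = 1/2\<close> the period itself begins at the
   fold.\<close>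
 proof (rule barrier_pos[of "- (1/2) - \<phi>" "1/2" "\<lambda>t. 7/5 - z t"])
  show "continuous_on {- (1/2) - \<phi>..1/2} (\<lambda>t. 7/5 - z t)" by (intro continuous_intros z_cont)
  have l0: "l (- (1/2) - \<phi>) = A" by (simp add: lam_def)
  have "K * (e / sqrt m) <= K * (e / sqrt e)" using K eps A_bounds by (intro mult_left_mono divide_left_mono) auto
  also have "... = K * sqrt e" using eps by (simp add: real_div_sqrt)
  also have "... < 1/10"
  proof -
   have "K <= 200 * K^2 + 1"
   proof -
    have "0 <= (K - 1)^2" "0 <= K^2" by simp_all
    moreover have "(K - 1)^2 = K^2 - 2 * K + 1" by (simp add: power2_diff)
    ultimately show ?thesis using K by linarith
   qed
   then have "K <= 2 * K2" using K2 by linarith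
   then have "K * sqrt e <= 2 * K2 * sqrt e" using eps by (intro mult_right_mono) auto
   then show ?thesis using small'(2) by simp
  qed
  finally have "K * (e / sqrt m) < 1/10" .
  moreover have "\<bar>z (- (1/2) - \<phi>) - X_plus (l (- (1/2) - \<phi>))\<bar> <= K * (e / sqrt m)"
   by (rule track) (use l0 A_bounds lambda_c_bounds in simp)
  moreover have "X_plus A <= 13/10" using F_neg_above[OF A_bounds(2)] by (intro X_plus_le) (auto simp: less_imp_neq)
  ultimately show "0 < 7/5 - z (- (1/2) - \<phi>)" unfolding l0 by linarith
  show "\<exists>d>0. ((\<lambda>t. 7/5 - z t) has_real_derivative d) (at r within {- (1/2) - \<phi>..1/2})" if "7/5 - z r = 0" for r
  proof (intro exI conjI)
   have "l r <= A" using cos_ge_minus_one[of "2 * pi * (r + \<phi>)"] mult_left_mono[of "-1" "cos (2 * pi * (r + \<phi>))" A] A_bounds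
    by (simp add: lam_def)
   then have "F (z r) (l r) < 0" using that A_bounds by (intro F_neg_above) auto
   then show "0 < - (F (z r) (l r) / e)" using eps by (simp add: divide_neg_pos)
   show "((\<lambda>t. 7/5 - z t) has_real_derivative - (F (z r) (l r) / e)) (at r within {- (1/2) - \<phi>..1/2})"
    by (rule derivative_eq_intros has_field_derivative_at_within[OF ode] refl | simp)+
  qed
  show "t \<in> {- (1/2) - \<phi>..1/2}" using t phi by auto
 qed
 then show ?thesis by simp
qed

text \<open>Away from the fold the branch contributes at most \<open>- 1/4 * sqrt (m + S t)\<close>,
  which beats \<open>1/5 * sqrt (m + S t)\<close> from the width. Close to it all terms are of order
  \<open>sqrt e\<close>, and \<open>e + S t <= 2 * K2 * e\<close> turns this into the peak.\<close>

lemma excess_peak: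
 "1 - 3 * (z t)^2 + 1/1000 * width m \<phi> t <= 10 * Cz * K2 * (e * sqrt e) * (1 / (e + S t))"
proof (cases "K2 * e <= S t \<or> a0 <= - K2 * e")
 case True
 have S: "0 <= S t" by (rule Sfun_bounds)
 define r where "r = sqrt (gap t)"
 have r: "0 <= r" unfolding r_def using gap_ge[OF True] A_bounds S by simp
 have "(xc + r / 4)^2 <= (z t)^2" using outer(1)[OF True] r xc by (intro power_mono) (auto simp: r_def)
 moreover have "(xc + r / 4)^2 = xc^2 + xc * r / 2 + (r/4)^2" by (simp add: power2_sum)
 moreover have "5/9 * r <= xc * r" using xc r by (intro mult_right_mono) auto
 moreover have "0 <= (r/4)^2" by simp
 ultimately have "1/3 + 5/18 * r <= (z t)^2" using xc(1) by linarith
 moreover have "3/10 * sqrt (m + S t) <= r" using outer(2)[OF True] by (simp add: r_def)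
 moreover have "width m \<phi> t <= 200 * sqrt (m + S t)" by (rule width_basic[OF A_bounds(5)])
 moreover have "0 <= sqrt (m + S t)" using A_bounds S by simp
 ultimately have "1 - 3 * (z t)^2 + 1/1000 * width m \<phi> t <= 0" by linarith
 also have "0 <= 10 * Cz * K2 * (e * sqrt e) * (1 / (e + S t))" using Cz K2 eps S by simp
 finally show ?thesis .
next
 case False
 have S: "0 <= S t" by (rule Sfun_bounds)
 have e1: "1 * e <= K2 * e" using K2(1) eps by (intro mult_right_mono) auto
 have g1: "\<gamma> * e <= K2 * e" using K2 gamma eps by (intro mult_right_mono) auto
 have y: "0 <= Cz * sqrt e" "Cz * sqrt e <= 1/20" using Cz eps by auto
 have "(xc - Cz * sqrt e)^2 <= (z t)^2" using inner[of t] False y xc by (intro power_mono) auto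
 moreover have "(xc - Cz * sqrt e)^2 = xc^2 - 2 * (xc * (Cz * sqrt e)) + (Cz * sqrt e)^2" by (simp add: power2_diff)
 moreover have "xc * (Cz * sqrt e) <= 10/17 * (Cz * sqrt e)" using xc y by (intro mult_right_mono) auto
 moreover have "0 <= (Cz * sqrt e)^2" by simp
 ultimately have 1: "1 - 3 * (z t)^2 <= 4 * (Cz * sqrt e)" using xc(1) y by linarith
 have 2: "width m \<phi> t <= 400 * (K2 * sqrt e)"
 proof -
  have "m + S t <= K2 * e + K2 * e" using False a0(2) e1 g1 unfolding m_eq by linarith
  also have "... <= (2 * (K2 * sqrt e))^2" using K2 eps mult_right_mono[of 1 K2 "K2 * e"]
   by (simp add: power_mult_distrib power2_eq_square[of K2])
  finally have "sqrt (m + S t) <= 2 * (K2 * sqrt e)" using K2 eps by (intro real_le_lsqrt) auto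
  then show ?thesis using width_basic(5)[OF A_bounds(5), of \<phi> t] by linarith
 qed
 have "K2 * sqrt e <= Cz * sqrt e" using Cz eps by (intro mult_right_mono) auto
 then have "1 - 3 * (z t)^2 + 1/1000 * width m \<phi> t <= 5 * (Cz * sqrt e) * 1" using 1 2 y by linarith
 also have "... <= 5 * (Cz * sqrt e) * (2 * K2 * e * (1 / (e + S t)))"
 proof (intro mult_left_mono)
  have "e + S t <= 2 * K2 * e" using False e1 by auto
  then show "1 <= 2 * K2 * e * (1 / (e + S t))" using eps S by (simp add: field_simps)
 qed (use y in simp)
 also have "... = 10 * Cz * K2 * (e * sqrt e) * (1 / (e + S t))" by simp
 finally show ?thesis .
qed

definition C1 :: real where "C1 = 120 * Cz * K2"

lemma C1_nonneg: "0 <= C1" using Cz K2 by (simp add: C1_def)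

lemma linear_well: "linear_well e (1/1000) C1 7 (\<lambda>t. 1 - 3 * (z t)^2) (width m \<phi>) (width' m \<phi>)"
proof (rule linear_well_width)
 show "integral TI (\<lambda>t. max 0 (1 - 3 * (z t)^2 + 1/1000 * width m \<phi> t)) <= C1 * e"
  using excess_from_peak[OF eps phi _ A_bounds(5) z_cont excess_peak, of ] Cz K2 by (simp add: C1_def)
 show "0 <= z t \<and> z t <= 3/2" if "t \<in> TI" for t using z_lower[of t] z_upper[OF that] by linarith
qed (use eps A_bounds C1_nonneg z_cont in auto)

end

lemma nonlinear_pathI:
 assumes "linear_well e c1 C1 N (\<lambda>t. 1 - 3 * (z t)^2) \<rho> \<rho>'"
  and "\<And>t. t \<in> TI \<Longrightarrow> 0 <= z t \<and> z t <= 3/2"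
  and "\<And>t. t \<in> TI \<Longrightarrow> (z has_real_derivative z' t) (at t within TI)"
  and "continuous_on TI l" "continuous_on TI w" "continuous_on TI X" "w (- (1/2)) = 0"
  and "\<And>t. t \<in> TI \<Longrightarrow> X t = x0 + 1 / e * integral {- (1/2)..t} (\<lambda>s. F (X s) (l s)) + k * w t"
 shows "nonlinear_path e c1 C1 N (\<lambda>t. 1 - 3 * (z t)^2) \<rho> \<rho>' z z' l w X k x0"
 by (rule nonlinear_path.intro[OF assms(1)], unfold_locales) (use assms in auto)

lemma exact_pathI:
 assumes "nonlinear_path e c1 C1 N a \<rho> \<rho>' z (\<lambda>t. F (z t) (l t) / e) l w X k x0"
 shows "exact_path e c1 C1 N a \<rho> \<rho>' z (\<lambda>t. F (z t) (l t) / e) l w X k x0"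
proof -
 interpret nonlinear_path e c1 C1 N a \<rho> \<rho>' z "\<lambda>t. F (z t) (l t) / e" l w X k x0 by fact
 show ?thesis by unfold_locales simp
qed

lemma ode_integral_equation:
 assumes d: "\<And>t. t \<in> TI \<Longrightarrow> (x has_real_derivative f t) (at t within TI)" and t: "t \<in> TI"
 shows "x t = x (- (1/2)) + integral {- (1/2)..t} f"
proof -
 have "(f has_integral (x t - x (- (1/2)))) {- (1/2)..t}"
 proof (rule fundamental_theorem_of_calculus)
  show "(x has_vector_derivative f s) (at s within {- (1/2)..t})" if "s \<in> {- (1/2)..t}" for s
   using DERIV_subset[OF d, of s "{- (1/2)..t}"] that t
   by (auto simp: has_real_derivative_iff_has_vector_derivative)
 qed (use t in simp)
 then show ?thesis by (simp add: integral_unique)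
qed

context tracked_branch
begin

text \<open>Admissible initial distance in units of the width. The factor \<open>25000\<close>
  ensures that passing to a neighbouring solution changes the linearisation by at most
  \<open>9/25000\<close> of the width, less than the half of the rate \<open>1/1000\<close> that is
  given up.\<close>

definition \<eta> :: real where "\<eta> = exp (- (2 * C1)) / 25000"

lemma eta_pos: "0 < \<eta>" by (simp add: \<eta>_def)

lemma eta_bounds: "12 * (exp (2 * C1) * \<eta>^2 + 0^2) < \<eta> * (1/1000) / 2" "\<eta> * exp C1 <= 1/25000"
proof -
 have "exp (2 * C1) * \<eta>^2 = \<eta> * (exp (2 * C1) * exp (- (2 * C1))) / 25000" by (simp add: \<eta>_def power2_eq_square)
 also have "... = \<eta> / 25000" unfolding exp_add[symmetric] by simp
 finally show "12 * (exp (2 * C1) * \<eta>^2 + 0^2) < \<eta> * (1/1000) / 2" using eta_pos by simp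
 have "exp (- (2 * C1)) * exp C1 = exp (- C1)" unfolding exp_add[symmetric] by simp
 then have "\<eta> * exp C1 = exp (- C1) / 25000" by (simp add: \<eta>_def)
 then show "\<eta> * exp C1 <= 1/25000" using C1_nonneg by simp
qed

lemma l_cont: "continuous_on T l" unfolding lam_def by (intro continuous_intros)

lemma z_range: "t \<in> TI \<Longrightarrow> 0 <= z t \<and> z t <= 3/2"
 using z_lower[of t] z_upper[of t] by auto

lemma z_TI: "(z has_real_derivative F (z t) (l t) / e) (at t within TI)"
 by (rule has_field_derivative_at_within[OF ode])

lemma m_le_1: "m <= 1" using A_bounds lambda_c_bounds by linarith

text \<open>Every solution starting close to the tracked one stays close to it, so it inherits the
 stability bounds with half the rate.\<close>

lemma nearby_solution:
 assumes x: "\<And>t. t \<in> TI \<Longrightarrow> (x has_real_derivative F (x t) (l t) / e) (at t within TI)"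
  and start: "\<bar>x (- (1/2)) - z (- (1/2))\<bar> < \<eta> * width m \<phi> (- (1/2))"
 shows "linear_well e (1/2000) C1 7 (\<lambda>t. 1 - 3 * (x t)^2) (width m \<phi>) (width' m \<phi>)"
  "\<And>t. t \<in> TI \<Longrightarrow> 0 <= x t \<and> x t <= 3/2"
proof -
 have xc: "continuous_on TI x" by (rule DERIV_continuous_on[OF x])
 \<comment> \<open>The neighbouring solution is regarded as a path without noise, so the barriers
   for paths apply to it.\<close>
 interpret P: nonlinear_path e "1/1000" C1 7 "\<lambda>t. 1 - 3 * (z t)^2" "width m \<phi>" "width' m \<phi>" z "\<lambda>t. F (z t) (l t) / e" l "\<lambda>_. 0" x 0 "x (- (1/2))"
 proof (rule nonlinear_pathI[OF linear_well z_range z_TI l_cont continuous_on_const xc])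
  show "x t = x (- (1/2)) + 1 / e * integral {- (1/2)..t} (\<lambda>s. F (x s) (l s)) + 0 * 0" if "t \<in> TI" for t
   using ode_integral_equation[OF x that] by simp
 qed auto
 interpret P: exact_path e "1/1000" C1 7 "\<lambda>t. 1 - 3 * (z t)^2" "width m \<phi>" "width' m \<phi>" z "\<lambda>t. F (z t) (l t) / e" l "\<lambda>_. 0" x 0 "x (- (1/2))"
  by (rule exact_pathI) (rule P.nonlinear_path_axioms)
 have u: "P.u t = x t - z t" for t by (simp add: P.u_def)
 have close: "\<bar>x t - z t\<bar> <= 1/25000 * width m \<phi> t" if t: "t \<in> TI" for t
 proof -
  have "\<bar>P.u t\<bar> < \<eta> * exp C1 * width m \<phi> t"
  proof (rule P.u_bound[OF _ start eta_pos eta_bounds(1) _ t])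
   show "(\<eta> * exp C1 + 0) * width m \<phi> r <= 1" if "r \<in> TI" for r
   proof -
    have "\<eta> * exp C1 * width m \<phi> r <= 1/25000 * 201"
     using eta_bounds(2) width_basic[OF A_bounds(5), of \<phi> r] m_le_1 by (intro mult_mono) auto
    then show ?thesis by simp
   qed
  qed simp
  also have "... <= 1/25000 * width m \<phi> t" using eta_bounds(2) width_basic[OF A_bounds(5), of \<phi> t] by (intro mult_right_mono) auto
  finally show ?thesis unfolding u by simp
 qed
 have w: "0 < width m \<phi> t" "width m \<phi> t <= 201" for t using width_basic[OF A_bounds(5), of \<phi> t] m_le_1 by auto
 show range: "0 <= x t \<and> x t <= 3/2" if "t \<in> TI" for t
  using close[OF that] z_lower[of t] z_upper[OF that] w[of t] by linarith
 have le: "1 - 3 * (x t)^2 + 1/2000 * width m \<phi> t <= 10 * Cz * K2 * (e * sqrt e) * (1 / (e + S t))" if t: "t \<in> TI" for t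
 proof -
  have "(z t)^2 - (x t)^2 = (z t - x t) * (z t + x t)" by (simp add: power2_eq_square algebra_simps)
  also have "... <= \<bar>x t - z t\<bar> * 3"
   using z_range[OF t] range[OF t] by (intro mult_mono) auto
  finally have "3 * (z t)^2 - 3 * (x t)^2 <= 9/25000 * width m \<phi> t" using close[OF t] by argo
  then show ?thesis using excess_peak[of t] w[of t] by argo
 qed
 show "linear_well e (1/2000) C1 7 (\<lambda>t. 1 - 3 * (x t)^2) (width m \<phi>) (width' m \<phi>)"
 proof (rule linear_well_width)
  show "integral TI (\<lambda>t. max 0 (1 - 3 * (x t)^2 + 1/2000 * width m \<phi> t)) <= C1 * e"
   using excess_from_peak[OF eps phi _ A_bounds(5) xc le] Cz K2 by (simp add: C1_def)
 qed (use eps A_bounds C1_nonneg xc range in auto)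
qed

end

text \<open>When the fold of the left well is at distance of order \<open>e\<close>, tracking does not locate
 the branch with the precision of the allowed starting interval. The following explicit
 subsolution starts below that interval and still crosses the fold with bounded excess.\<close>

definition fold_sub :: "real \<Rightarrow> real \<Rightarrow> real" where
 "fold_sub e t = - (sqrt e / 20) + sin (pi * t) * cos (pi * t) / 200 + (cos (pi * t)) ^ 3 / (e + (cos (pi * t))^2) / 50"

definition fold_sub' :: "real \<Rightarrow> real \<Rightarrow> real" where
 "fold_sub' e t = pi * (2 * (cos (pi * t))^2 - 1) / 200
   - pi * sin (pi * t) * ((cos (pi * t))^2 * (3 * e + (cos (pi * t))^2) / (e + (cos (pi * t))^2)^2) / 50"

lemma fold_sub_deriv:
 assumes e: "0 < e"
 shows "(fold_sub e has_real_derivative fold_sub' e t) (at t within T)"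
proof -
 define s n where "s = cos (pi * t)" and "n = sin (pi * t)"
 have p: "0 < e + s^2" using e by (simp add: add_pos_nonneg)
 have d1: "((\<lambda>t. sin (pi * t) * cos (pi * t) / 200) has_real_derivative pi * (2 * s^2 - 1) / 200) (at t within T)"
 proof -
  have "((\<lambda>t. sin (pi * t) * cos (pi * t)) has_real_derivative (cos (pi * t) * pi * cos (pi * t) + (- sin (pi * t) * pi) * sin (pi * t))) (at t within T)"
   by (auto intro!: derivative_eq_intros)
  moreover have "cos (pi * t) * pi * cos (pi * t) + (- sin (pi * t) * pi) * sin (pi * t) = pi * (s^2 - n^2)"
   by (simp add: s_def n_def power2_eq_square algebra_simps)
  moreover have "n^2 = 1 - s^2" using sin_cos_squared_add[of "pi * t"] unfolding s_def n_def by linarith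
  ultimately have "((\<lambda>t. sin (pi * t) * cos (pi * t)) has_real_derivative pi * (2 * s^2 - 1)) (at t within T)" by simp
  then show ?thesis by (rule DERIV_cdivide)
 qed
 have d2: "((\<lambda>t. (cos (pi * t)) ^ 3 / (e + (cos (pi * t))^2) / 50) has_real_derivative - (pi * n * (s^2 * (3 * e + s^2) / (e + s^2)^2) / 50)) (at t within T)"
 proof -
  have c: "((\<lambda>t. cos (pi * t)) has_real_derivative - (n * pi)) (at t within T)"
   by (auto intro!: derivative_eq_intros simp: n_def)
  have "((\<lambda>y. y ^ 3 / (e + y^2)) has_real_derivative ((3 * s^2) * (e + s^2) - s ^ 3 * (2 * s)) / ((e + s^2) * (e + s^2))) (at s)"
  proof (rule DERIV_divide)
   show "((\<lambda>y. y ^ 3) has_real_derivative 3 * s^2) (at s)"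
    by (auto intro!: derivative_eq_intros)
   show "((\<lambda>y. e + y^2) has_real_derivative 2 * s) (at s)"
    by (auto intro!: derivative_eq_intros)
  qed (use p in simp)
  moreover have "(3 * s^2) * (e + s^2) - s ^ 3 * (2 * s) = s^2 * (3 * e + s^2)"
   by (simp add: power2_eq_square power3_eq_cube algebra_simps)
  ultimately have "((\<lambda>y. y ^ 3 / (e + y^2)) has_real_derivative s\<^sup>2 * (3 * e + s^2) / (e + s^2)^2) (at s)"
   by (simp only: power2_eq_square[of "e + s^2"])
  from DERIV_cdivide[OF DERIV_chain2[OF this[unfolded s_def] c], of 50]
  show ?thesis by (rule DERIV_cong) (simp add: s_def)
 qed
 show ?thesis unfolding fold_sub_def[abs_def] fold_sub'_def
  by (rule DERIV_cong[OF DERIV_add[OF DERIV_add[OF DERIV_const d1] d2]]) (simp add: s_def n_def)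
qed

text \<open>Smoothing lowers \<open>s\<close> by at most \<open>sqrt e / 2\<close>, by
  \<open>2 * s * sqrt e <= s^2 + e\<close>.\<close>

lemma fold_ratio:
 fixes s e :: real
 assumes e: "0 < e" and s: "0 <= s"
 shows "s - sqrt e / 2 <= s ^ 3 / (e + s^2)" "s ^ 3 / (e + s^2) <= s" "0 <= s ^ 3 / (e + s^2)"
proof -
 define r where "r = sqrt e"
 have r: "0 < r" "e = r^2" using e by (auto simp: r_def)
 have p: "0 < e + s^2" using e by (simp add: add_pos_nonneg)
 have "2 * (s * r) <= s^2 + r^2" using sum_squares_bound[of s r] by (simp add: ac_simps)
 then have "r * (2 * (s * r)) <= r * (s^2 + r^2)" using r by (intro mult_left_mono) auto
 then have "(s - r / 2) * (r^2 + s^2) <= s ^ 3" by (simp add: power2_eq_square power3_eq_cube algebra_simps)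
 then have "s - r / 2 <= s ^ 3 / (e + s^2)" using p r by (simp only: pos_le_divide_eq)
 then show "s - sqrt e / 2 <= s ^ 3 / (e + s^2)" by (simp add: r_def)
 have "s ^ 3 <= s * (e + s^2)" using e s by (simp add: power2_eq_square power3_eq_cube algebra_simps)
 then show "s ^ 3 / (e + s^2) <= s" using p by (simp only: pos_divide_le_eq)
 show "0 <= s ^ 3 / (e + s^2)" using p s by simp
qed

lemma fold_sub_bounds:
 assumes e: "0 < e" "e <= 1" and s: "0 <= cos (pi * t)"
 shows "15/1000 * cos (pi * t) - 6/100 * sqrt e <= fold_sub e t" "\<bar>fold_sub e t\<bar> <= 8/100"
  "(fold_sub e t)^2 <= 75/10000 * e + 13/10000 * (cos (pi * t))^2"
proof -
 define s n q where "s = cos (pi * t)" and "n = sin (pi * t)" and "q = s ^ 3 / (e + s^2)"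
 have s0: "0 <= s" "s <= 1" using s by (auto simp: s_def)
 have q: "s - sqrt e / 2 <= q" "q <= s" "0 <= q" unfolding q_def using fold_ratio[OF e(1) s0(1)] by auto
 have "\<bar>n * s\<bar> <= 1 * s" unfolding abs_mult using s0 by (intro mult_mono) (auto simp: n_def)
 then have ns: "\<bar>n * s\<bar> <= s" by simp
 have Y: "fold_sub e t = - (sqrt e / 20) + n * s / 200 + q / 50" by (simp add: fold_sub_def s_def n_def q_def)
 have r: "0 <= sqrt e" "sqrt e <= 1" using e by auto
 show "15/1000 * cos (pi * t) - 6/100 * sqrt e <= fold_sub e t"
  using ns q unfolding Y s_def[symmetric] by linarith
 show "\<bar>fold_sub e t\<bar> <= 8/100" using ns q r s0 unfolding Y by linarith
 have sq3: "(x + y + z)^2 <= 3 * (x^2 + y^2 + z^2)" for x y z :: real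
  using zero_le_power2[of "x - y"] zero_le_power2[of "y - z"] zero_le_power2[of "x - z"]
  by (simp add: power2_eq_square algebra_simps)
 have "(n * s)^2 <= s^2" "q^2 <= s^2"
  using ns q s0 by (auto simp: abs_le_square_iff[symmetric])
 moreover have "(sqrt e)^2 = e" using e by simp
 ultimately have "(- (sqrt e / 20))^2 + (n * s / 200)^2 + (q / 50)^2 <= e / 400 + s^2 / 40000 + s^2 / 2500"
  by (simp add: power_divide)
 then show "(fold_sub e t)^2 <= 75/10000 * e + 13/10000 * (cos (pi * t))^2"
  unfolding Y s_def[symmetric] using sq3[of "- (sqrt e / 20)" "n * s / 200" "q / 50"] zero_le_power2[of s] by argo
qed

lemma Sfun_half: "Sfun (1/2) t = (cos (pi * t))^2"
proof -
 have "pi * (t + 1/2) = pi * t + pi / 2" by (simp add: algebra_simps)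
 then have "sin (pi * (t + 1/2)) = cos (pi * t)" by (simp add: sin_add)
 then show ?thesis by (simp add: Sfun_def)
qed

lemma cos_pi_nonneg: "t \<in> TI \<Longrightarrow> 0 <= cos (pi * t)"
 using mult_left_mono[of t "1/2" pi] mult_left_mono[of "- (1/2)" t pi] by (intro cos_ge_zero) auto

text \<open>Everything is compared with \<open>s^2\<close> and \<open>e\<close>, where
  \<open>s\<close> is the cosine. The drift is at least \<open>36/100 * s^2 - 15/1000 * e\<close>;
  the loss in \<open>e\<close> comes from the offset \<open>- (sqrt e / 20)\<close>, and the
  derivative of the sine term supplies the matching \<open>- 15/1000 * e\<close>. The last summand
  of \<open>fold_sub\<close> is a smoothed cosine because \<open>e\<close> times its derivative
  stays below a multiple of \<open>s^2\<close>, whereas a plain cosine would leave a positive term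
  of order \<open>e\<close> at the initial time.\<close>

lemma fold_sub_subsolution:
 assumes e: "0 < e" "e <= 1" and a0: "- (18/100) <= a0" "a0 <= 0" and t: "t \<in> TI"
 shows "e * fold_sub' e t <= F (xc + fold_sub e t) (lam (lambda_c + a0) (t + 1/2))"
proof -
 define s n Y where "s = cos (pi * t)" and "n = sin (pi * t)" and "Y = fold_sub e t"
 have s0: "0 <= s" "s <= 1" using cos_pi_nonneg[OF t] by (auto simp: s_def)
 have p: "0 < e + s^2" using e by (simp add: add_pos_nonneg)
 have Yb: "\<bar>Y\<bar> <= 8/100" "Y^2 <= 75/10000 * e + 13/10000 * s^2"
  using fold_sub_bounds[OF e cos_pi_nonneg[OF t]] by (auto simp: Y_def s_def)
 have "37/100 * s^2 <= 2 * (lambda_c + a0) * s^2" using a0 lambda_c_bounds by (intro mult_right_mono) auto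
 moreover have "lam (lambda_c + a0) (t + 1/2) + lambda_c = - a0 + 2 * (lambda_c + a0) * s^2"
  using lam_shift[of a0 "t + 1/2"] Sfun_half[of t] by (simp add: Sfun_def s_def)
 ultimately have l: "37/100 * s^2 <= lam (lambda_c + a0) (t + 1/2) + lambda_c" using a0 by linarith
 have "3 * xc * Y^2 + Y ^ 3 = (3 * xc + Y) * Y^2" by (simp add: power2_eq_square power3_eq_cube algebra_simps)
 also have "... <= 2 * Y^2" using Yb(1) xc by (intro mult_right_mono) auto
 finally have "3 * xc * Y^2 + Y ^ 3 <= 2 * Y^2" .
 then have lower: "36/100 * s^2 - 15/1000 * e <= F (xc + Y) (lam (lambda_c + a0) (t + 1/2))"
  using l Yb(2) zero_le_power2[of s] unfolding F_xc by linarith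
 define k where "k = s^2 * (3 * e + s^2) / (e + s^2)^2"
 have k0: "0 <= k" using e by (simp add: k_def)
 have "e * k <= 3 * s^2"
 proof -
  have "e * (s^2 * (3 * e + s^2)) = s^2 * (e * (3 * e + s^2))" by simp
  also have "... <= s^2 * ((e + s^2) * (3 * (e + s^2)))" using e by (intro mult_left_mono mult_mono) auto
  also have "... = 3 * s^2 * (e + s^2)^2" by (simp add: power2_eq_square)
  finally have "e * (s^2 * (3 * e + s^2)) / (e + s^2)^2 <= 3 * s^2" using p by (subst pos_divide_le_eq) auto
  then show ?thesis by (simp add: k_def)
 qed
 moreover have "- n <= 1" by (simp add: n_def)
 then have "pi * (- n) * (e * k) <= 4 * 1 * (e * k)"
  using pi_less_4 pi_gt_zero k0 e mult_left_mono[of "- n" 1 pi] by (intro mult_right_mono) auto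
 ultimately have B: "pi * (- n) * (e * k) / 50 <= 24/100 * s^2" by linarith
 have A: "e * (pi * (2 * s^2 - 1) / 200) <= 4/100 * s^2 - 15/1000 * e"
 proof -
  have "e * s^2 <= 1 * s^2" using e by (intro mult_right_mono) auto
  then have "pi * (e * s^2) <= 4 * s^2" using pi_less_4 e by (intro mult_mono) auto
  moreover have "3 * e <= pi * e" using pi_gt3 e by (intro mult_right_mono) auto
  moreover have "e * (pi * (2 * s^2 - 1) / 200) = pi * (e * s^2) / 100 - pi * e / 200" by (simp add: field_simps)
  ultimately show ?thesis by linarith
 qed
 have "e * fold_sub' e t = e * (pi * (2 * s^2 - 1) / 200) + pi * (- n) * (e * k) / 50"
  by (simp add: fold_sub'_def s_def n_def k_def right_diff_distrib)
 then have "e * fold_sub' e t <= 28/100 * s^2 - 15/1000 * e" using A B by linarith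
 then show ?thesis using lower zero_le_power2[of s] unfolding Y_def by linarith
qed

text \<open>\<open>Kq\<close> bounds the ratio of \<open>m\<close> to \<open>e\<close>, so the width
  is at most of order \<open>Kq * sqrt e\<close> plus the cosine. The excess can be positive only
  while the cosine is below \<open>25 * Kq * sqrt e\<close>; there it is at most
  \<open>Kq * sqrt e\<close>, which fits under the peak with constant
  \<open>626 * Kq ^ 3\<close>.\<close>

lemma fold_sub_well:
 assumes e: "0 < e" "e <= 1" and Kq: "1 <= Kq" and m: "e <= m" "m <= Kq * e"
 shows "linear_well e (1/1000) (7600 * Kq ^ 3) 7 (\<lambda>t. 1 - 3 * (xc + fold_sub e t)^2) (width m (1/2)) (width' m (1/2))"
  "\<And>t. t \<in> TI \<Longrightarrow> 1/4 <= xc + fold_sub e t \<and> xc + fold_sub e t <= 3/2"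
proof -
 have m0: "0 < m" using e m by simp
 have zc: "continuous_on TI (\<lambda>t. xc + fold_sub e t)"
  by (intro continuous_intros DERIV_continuous_on[OF fold_sub_deriv[OF e(1)]])
 show range: "1/4 <= xc + fold_sub e t \<and> xc + fold_sub e t <= 3/2" if "t \<in> TI" for t
  using fold_sub_bounds(2)[OF e cos_pi_nonneg[OF that]] xc by linarith
 have le: "1 - 3 * (xc + fold_sub e t)^2 + 1/1000 * width m (1/2) t <= 626 * Kq ^ 3 * (e * sqrt e) * (1 / (e + Sfun (1/2) t))"
  if t: "t \<in> TI" for t
 proof -
  define s Y r where "s = cos (pi * t)" and "Y = fold_sub e t" and "r = sqrt e"
  have s0: "0 <= s" using cos_pi_nonneg[OF t] by (auto simp: s_def)
  have r: "0 < r" "r^2 = e" using e by (auto simp: r_def)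
  have Yl: "15/1000 * s - 6/100 * r <= Y" using fold_sub_bounds(1)[OF e cos_pi_nonneg[OF t]] by (simp add: s_def Y_def r_def)
  have "1 - 3 * (xc + Y)^2 = - 6 * (xc * Y) - 3 * Y^2" using xc(1) by (simp add: power2_sum)
  also have "... <= - 6 * (xc * (15/1000 * s - 6/100 * r))" using mult_left_mono[OF Yl, of xc] xc zero_le_power2[of Y] by linarith
  also have "... <= 22/100 * r - 5/100 * s"
  proof -
   have "- 6 * (xc * (15/1000 * s - 6/100 * r)) = 36/100 * (xc * r) - 9/100 * (xc * s)" by (simp add: algebra_simps)
   then show ?thesis using mult_right_mono[OF xc(2) s0] mult_right_mono[OF xc(3), of r] r by linarith
  qed
  finally have a: "1 - 3 * (xc + Y)^2 <= 22/100 * r - 5/100 * s" .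
  have "width m (1/2) t <= 200 * (Kq * r) + s"
  proof (rule power2_le_imp_le)
   have "40000 * m <= 40000 * (Kq * e)" using m by simp
   also have "Kq * e <= Kq^2 * e" using Kq e by (intro mult_right_mono) (auto simp: power2_eq_square)
   finally have "40000 * m <= (200 * (Kq * r))^2" using r by (simp add: power_mult_distrib)
   moreover have "0 <= 200 * (Kq * r) * s" using Kq r s0 by simp
   ultimately show "(width m (1/2) t)^2 <= (200 * (Kq * r) + s)^2"
    unfolding width_basic(6)[OF m0] Sfun_half s_def[symmetric] power2_sum by linarith
  qed (use Kq r s0 in simp)
  moreover have "r <= Kq * r" using Kq r by simp
  ultimately have up: "1 - 3 * (xc + Y)^2 + 1/1000 * width m (1/2) t <= Kq * r - 49/1000 * s" using a r by linarith
  have p: "0 < e + s^2" using e by (simp add: add_pos_nonneg)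
  show ?thesis
  proof (cases "s <= 25 * (Kq * r)")
   case True
   have "s^2 <= (25 * (Kq * r))^2" using True s0 by (intro power_mono) auto
   moreover have "e <= Kq^2 * e" using Kq e by (simp add: one_le_power)
   ultimately have "e + s^2 <= 626 * Kq^2 * e" using r by (simp add: power_mult_distrib)
   then have "1 <= 626 * Kq^2 * e * (1 / (e + s^2))" using p by simp
   then have "Kq * r * 1 <= Kq * r * (626 * Kq^2 * e * (1 / (e + s^2)))" using Kq r by (intro mult_left_mono) auto
   also have "... = 626 * Kq ^ 3 * (e * r) * (1 / (e + s^2))" by (simp add: power2_eq_square power3_eq_cube)
   finally show ?thesis using up s0 unfolding Sfun_half s_def[symmetric] Y_def[symmetric] r_def[symmetric] by linarith
  next
   case False
   then have "Kq * r - 49/1000 * s <= 0" using s0 by linarith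
   also have "0 <= 626 * Kq ^ 3 * (e * r) * (1 / (e + s^2))" using Kq e r p by simp
   finally show ?thesis using up unfolding Sfun_half s_def[symmetric] Y_def[symmetric] r_def[symmetric] by linarith
  qed
 qed
 show "linear_well e (1/1000) (7600 * Kq ^ 3) 7 (\<lambda>t. 1 - 3 * (xc + fold_sub e t)^2) (width m (1/2)) (width' m (1/2))"
 proof (rule linear_well_width)
  have "integral TI (\<lambda>t. max 0 (1 - 3 * (xc + fold_sub e t)^2 + 1/1000 * width m (1/2) t)) <= 12 * (626 * Kq ^ 3) * e"
   by (rule excess_from_peak[OF e(1) _ _ m0 zc le]) (use Kq in auto)
  also have "... <= 7600 * Kq ^ 3 * e" using Kq e by (intro mult_right_mono) auto
  finally show "integral TI (\<lambda>t. max 0 (1 - 3 * (xc + fold_sub e t)^2 + 1/1000 * width m (1/2) t)) <= 7600 * Kq ^ 3 * e" .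
  show "0 <= xc + fold_sub e t \<and> xc + fold_sub e t <= 3/2" if "t \<in> TI" for t using range[OF that] by linarith
 qed (use e m Kq zc in auto)
qed

section \<open>Crossing probabilities\<close>

text \<open>With \<open>noise_size\<close>, \<open>tail_rate\<close> and \<open>tail_const\<close>,
  these are the locale constants \<open>etaB\<close>, \<open>etaC\<close>, \<open>kg\<close> and
  \<open>Cg\<close> written out for \<open>N = 7\<close> and \<open>R = 201\<close>. As closed
  formulas in the rate \<open>c\<close> and the excess constant \<open>C\<close> they can be chosen
  before \<open>e\<close>, \<open>a0\<close>, \<open>\<sigma>\<close> and the probability
  space.\<close>

definition start_size :: "real \<Rightarrow> real \<Rightarrow> real" where
 "start_size c C = min (min (c / (24 * exp C)) (1 / (8 * 201)) * exp (- C)) (c / (96 * exp (2 * C)))"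

definition noise_size :: "real \<Rightarrow> real \<Rightarrow> real" where "noise_size c C = min (start_size c C) (c / 96)"

definition tail_rate :: "real \<Rightarrow> real \<Rightarrow> real" where "tail_rate c C = min (c / exp (2 * C)) (7 / 201) / 2048"

definition tail_const :: real where "tail_const = 3 * (exp 16 + 6) * 7"

lemma const_pos: "0 < c \<Longrightarrow> 0 < start_size c C" "0 < c \<Longrightarrow> 0 < noise_size c C" "0 < c \<Longrightarrow> 0 < tail_rate c C" "0 < tail_const"
 by (simp_all add: start_size_def noise_size_def tail_rate_def tail_const_def add_pos_pos)

lemma lam_half: "lam A (t + 1/2) = - lam A t"
proof -
 have "cos (2 * pi * (t + 1/2)) = cos (2 * pi * t + pi)" by (simp add: algebra_simps)
 then show ?thesis by (simp add: lam_def)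
qed

lemma lam_le: "0 <= A \<Longrightarrow> \<bar>lam A t\<bar> <= A"
 using mult_left_mono[OF abs_cos_le_one, of A "2 * pi * t"] by (simp add: lam_def abs_mult)

lemma F_uminus: "F (- x) (- l) = - F x l" by (simp add: F_def)

text \<open>Since \<open>F\<close> is odd and \<open>lam\<close> changes sign after half a period,
  \<open>- xm\<close> solves the shifted equation and tracks \<open>X_plus\<close> there.\<close>

lemma periodic_orbits_tracked:
 assumes "periodic_orbits \<gamma> xp xm xz" and \<gamma>: "0 < \<gamma>"
 obtains K e0 where "0 < K" "0 < e0"
  "\<And>e a0 A m. 0 < e \<Longrightarrow> e < e0 \<Longrightarrow> - lambda_c < a0 \<Longrightarrow> a0 <= \<gamma> * e \<Longrightarrow> A = lambda_c + a0 \<Longrightarrow> m = max \<bar>a0\<bar> e \<Longrightarrow>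
   tracked_branch e a0 A m \<gamma> K 0 (xp e a0) \<and> tracked_branch e a0 A m \<gamma> K (1/2) (\<lambda>t. - xm e a0 t)"
proof -
 let ?P = "\<lambda>K e0. \<forall>e a0. 0 < e \<and> e < e0 \<and> - lambda_c < a0 \<and> a0 <= \<gamma> * e \<longrightarrow>
   {x. periodic_solution e (lambda_c + a0) x \<and> stable_solution e (lambda_c + a0) x} = {xp e a0, xm e a0}
   \<and> (\<forall>t. lam (lambda_c + a0) t > - lambda_c \<longrightarrow> \<bar>xp e a0 t - X_plus (lam (lambda_c + a0) t)\<bar> <= K * (e / sqrt (max \<bar>a0\<bar> e)))
   \<and> (\<forall>t. lam (lambda_c + a0) t < lambda_c \<longrightarrow> \<bar>xm e a0 t - X_minus (lam (lambda_c + a0) t)\<bar> <= K * (e / sqrt (max \<bar>a0\<bar> e)))"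
 have "\<exists>K>0. \<exists>e0>0. ?P K e0"
  using assms(1) unfolding periodic_orbits_def Let_def
  apply -
  apply (erule ex_forward, erule conj_forward, assumption, erule ex_forward, erule conj_forward, assumption)
  apply (intro allI impI, drule spec, drule spec, drule mp, assumption, elim conjE, intro conjI; assumption)
  done
 then obtain K e0 where K: "0 < K" and e0: "0 < e0" and P: "?P K e0"
  by (elim exE conjE)
 define q where "q = 15000 * (1 + 3 * \<gamma> + 200 * K^2)^2"
 have q: "0 < q" using \<gamma> unfolding q_def by (intro mult_pos_pos zero_less_power add_pos_nonneg) auto
 show thesis
 proof (rule that[of K "min e0 (1 / q^2)"])
  fix e a0 A m assume h: "0 < e" "e < min e0 (1 / q^2)" "- lambda_c < a0" "a0 <= \<gamma> * e" "A = lambda_c + a0" "m = max \<bar>a0\<bar> e"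
  have "sqrt e <= sqrt (1 / q^2)" using h by (intro real_sqrt_le_mono) auto
  also have "... = 1 / q" using q by (simp add: real_sqrt_divide)
  finally have small: "q * sqrt e <= 1" using q by (simp add: field_simps)
  have PP: "{x. periodic_solution e A x \<and> stable_solution e A x} = {xp e a0, xm e a0}"
   "\<And>t. lam A t > - lambda_c \<Longrightarrow> \<bar>xp e a0 t - X_plus (lam A t)\<bar> <= K * (e / sqrt m)"
   "\<And>t. lam A t < lambda_c \<Longrightarrow> \<bar>xm e a0 t - X_minus (lam A t)\<bar> <= K * (e / sqrt m)"
   using P[rule_format, of e a0] h by auto
  have "periodic_solution e A (xp e a0)" "periodic_solution e A (xm e a0)" using PP(1) by auto
  then have d: "(xp e a0 has_real_derivative F (xp e a0 t) (lam A t) / e) (at t)"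
   "(xm e a0 has_real_derivative F (xm e a0 t) (lam A t) / e) (at t)" for t
   by (simp_all add: periodic_solution_def ode_solution_def)
  have "tracked_branch e a0 A m \<gamma> K 0 (xp e a0)"
   by unfold_locales (use h K \<gamma> small d PP in \<open>simp_all add: q_def\<close>)
  moreover have "tracked_branch e a0 A m \<gamma> K (1/2) (\<lambda>t. - xm e a0 t)"
  proof unfold_locales
   show "((\<lambda>t. - xm e a0 t) has_real_derivative F (- xm e a0 t) (lam A (t + 1/2)) / e) (at t)" for t
    unfolding lam_half F_uminus using DERIV_minus[OF d(2)[of t]] by simp
   show "\<bar>- xm e a0 t - X_plus (lam A (t + 1/2))\<bar> <= K * (e / sqrt m)" if "- lambda_c < lam A (t + 1/2)" for t
    using PP(3)[of t] that unfolding lam_half X_minus_eq by (simp add: abs_minus_commute)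
  qed (use h K \<gamma> small in \<open>simp_all add: q_def\<close>)
  ultimately show "tracked_branch e a0 A m \<gamma> K 0 (xp e a0) \<and> tracked_branch e a0 A m \<gamma> K (1/2) (\<lambda>t. - xm e a0 t)" ..
 qed (use K e0 q in auto)
qed

context standard_brownian_motion
begin

lemma noisy_bounded_width:
 assumes t0: "t0 = - (1/2)" and L: "linear_well e c C 7 a (width m \<phi>) (width' m \<phi>)"
  and m: "e <= m" "m <= 1" and s: "\<sigma> \<noteq> 0"
 shows "noisy_bounded e c C 7 a (width m \<phi>) (width' m \<phi>) M W \<sigma> 201 m"
proof -
 interpret L: linear_well e c C 7 a "width m \<phi>" "width' m \<phi>" by (rule L)
 have m0: "0 < m" using L.eps_pos m by simp
 have eps_rho: "2 * e <= width m \<phi> t" for t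
 proof -
  have "m^2 <= m" using m m0 by (simp add: power2_eq_square mult_left_le)
  then have "m <= sqrt m" by (rule real_le_rsqrt)
  then show ?thesis using width_basic(2)[OF m0, of \<phi> t] m m0 by linarith
 qed
 show ?thesis
  by unfold_locales
   (use s m m0 L.eps_pos width_basic[OF m0] BM_measurable BM_start BM_continuous BM_increment BM_indep t0 eps_rho in auto)
qed

lemma hitting_bound:
 fixes X :: "real \<Rightarrow> 'w \<Rightarrow> real"
 assumes t0: "t0 = - (1/2)" and L: "linear_well e c C 7 (\<lambda>t. 1 - 3 * (z t)^2) (width m \<phi>) (width' m \<phi>)"
  and m: "e <= m" "m <= 1" and s: "\<sigma> \<noteq> 0"
  and z: "\<And>t. t \<in> TI \<Longrightarrow> 1/4 <= z t \<and> z t <= 3/2"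
  and zd: "\<And>t. t \<in> TI \<Longrightarrow> (z has_real_derivative z' t) (at t within TI)"
  and sub: "\<And>t. t \<in> TI \<Longrightarrow> e * z' t <= F (z t) (l t)" and l: "continuous_on TI l"
  and X_cont: "\<And>w. w \<in> space M \<Longrightarrow> continuous_on TI (\<lambda>t. X t w)"
  and X_eq: "AE w in M. \<forall>t\<in>TI. X t w = x0 + 1 / e * integral {- (1/2)..t} (\<lambda>s. F (X s w) (l s)) + \<sigma> / sqrt e * W t w"
  and start: "z (- (1/2)) - start_size c C * width m \<phi> (- (1/2)) < x0"
 shows "prob {w\<in>space M. \<exists>t\<in>TI. X t w = 0} <= tail_const / e * exp (- (tail_rate c C * (noise_size c C)^2 * m powr (3/2) / \<sigma>^2))"
proof -
 interpret N: noisy_bounded e c C 7 "\<lambda>t. 1 - 3 * (z t)^2" "width m \<phi>" "width' m \<phi>" M W \<sigma> 201 m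
  by (rule noisy_bounded_width[OF t0 L m s])
 have e: "N.etaB = start_size c C" "N.etaC = noise_size c C" "N.kg = tail_rate c C" "N.Cg = tail_const"
  by (simp_all add: N.etaA_def N.etaB_def N.etaC_def N.kg_def N.Cg_def start_size_def noise_size_def tail_rate_def tail_const_def)
 have path: "AE w in M. nonlinear_path e c C 7 (\<lambda>t. 1 - 3 * (z t)^2) (width m \<phi>) (width' m \<phi>) z z' l (\<lambda>t. W t w) (\<lambda>t. X t w) (\<sigma> / sqrt e) x0"
  using X_eq AE_space
 proof eventually_elim
  case (elim w)
  show ?case
  proof (rule nonlinear_pathI[OF L _ zd l _ X_cont[OF elim(2)]])
   show "0 <= z t \<and> z t <= 3/2" if "t \<in> TI" for t using z[OF that] by linarith
   show "continuous_on TI (\<lambda>t. W t w)"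
    by (rule continuous_on_subset[OF BM_continuous[OF elim(2)]]) (use t0 in auto)
   show "W (- (1/2)) w = 0" using BM_start[OF elim(2)] t0 by simp
  qed (use elim(1) in auto)
 qed
 show ?thesis
  using N.hitting_prob[OF path sub] z start unfolding e by blast
qed

end

context standard_brownian_motion
begin

lemma sde_TI:
 assumes "t0 = - (1/2)" and "sde_solution M W e \<sigma> A x0 X"
 shows "\<And>t. t \<in> TI \<Longrightarrow> X t \<in> borel_measurable M" "\<And>w. w \<in> space M \<Longrightarrow> continuous_on TI (\<lambda>t. X t w)"
  "AE w in M. \<forall>t\<in>TI. X t w = x0 + 1 / e * integral {- (1/2)..t} (\<lambda>s. F (X s w) (lam A s)) + \<sigma> / sqrt e * W t w"
proof -
 have *: "AE w in M. \<forall>t\<in>TI. X t w = x0 + 1 / e * integral {- (1/2)..t} (\<lambda>s. F (X s w) (lam A s)) + \<sigma> / sqrt e * (W t w - W (- (1/2)) w)"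
  using assms(2) unfolding sde_solution_def by simp
 show "AE w in M. \<forall>t\<in>TI. X t w = x0 + 1 / e * integral {- (1/2)..t} (\<lambda>s. F (X s w) (lam A s)) + \<sigma> / sqrt e * W t w"
  using * AE_space
 proof eventually_elim
  case (elim w)
  then show ?case using BM_start[OF elim(2)] assms(1) by simp
 qed
qed (use assms(2) in \<open>auto simp: sde_solution_def\<close>)

lemma hitting_right_well:
 assumes t0: "t0 = - (1/2)" and T: "tracked_branch e a0 A m \<gamma> K 0 z" and s: "\<sigma> \<noteq> 0"
  and X: "sde_solution M W e \<sigma> A x0 X"
  and start: "\<bar>x0 - z (- (1/2))\<bar> < start_size (1/1000) (tracked_branch.C1 \<gamma> K)"
 shows "prob {w\<in>space M. \<exists>t\<in>TI. X t w = 0}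
  <= tail_const / e * exp (- (tail_rate (1/1000) (tracked_branch.C1 \<gamma> K) * (noise_size (1/1000) (tracked_branch.C1 \<gamma> K))^2 * m powr (3/2) / \<sigma>^2))"
proof -
 interpret T: tracked_branch e a0 A m \<gamma> K 0 z by (rule T)
 show ?thesis
 proof (rule hitting_bound[OF t0 T.linear_well T.A_bounds(4) T.m_le_1 s _ T.z_TI _ _ sde_TI(2)[OF t0 X]])
  show "1/4 <= z t \<and> z t <= 3/2" if "t \<in> TI" for t using T.z_lower[of t] T.z_upper[OF that] by linarith
  show "e * (F (z t) (lam A (t + 0)) / e) <= F (z t) (lam A (t + 0))" for t using T.eps by simp
  show "AE w in M. \<forall>t\<in>TI. X t w = x0 + 1 / e * integral {- (1/2)..t} (\<lambda>s. F (X s w) (lam A (s + 0))) + \<sigma> / sqrt e * W t w"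
   using sde_TI(3)[OF t0 X] by simp
  \<comment> \<open>The period starts farthest from the upper fold, so the width is at least 1 and a
    start at a distance of order one is admissible.\<close>
  have "1 <= width m 0 (- (1/2))" using width_basic(4)[OF T.A_bounds(5), of "- (1/2)" 0] by simp
  then have "start_size (1/1000) T.C1 * 1 <= start_size (1/1000) T.C1 * width m 0 (- (1/2))" using const_pos(1)[of "1/1000" T.C1] by (intro mult_left_mono) auto
  then show "z (- (1/2)) - start_size (1/1000) T.C1 * width m 0 (- (1/2)) < x0" using start by linarith
 qed (rule T.l_cont)
qed

lemma sde_reflect:
 assumes t0: "t0 = - (1/2)" and X: "sde_solution M W e \<sigma> A x0 X"
 shows "AE w in M. \<forall>t\<in>TI. - X t w = - x0 + 1 / e * integral {- (1/2)..t} (\<lambda>s. F (- X s w) (lam A (s + 1/2))) + (- \<sigma>) / sqrt e * W t w"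
 using sde_TI(3)[OF t0 X]
proof eventually_elim
 case (elim w)
 then show ?case unfolding lam_half F_uminus by auto
qed

text \<open>Mirror image of the right well. The start lies at the fold, where the width is at least
  \<open>200 * sqrt m\<close>, hence the scale \<open>sqrt m\<close> of the neighbourhood.\<close>

lemma hitting_left_well:
 assumes t0: "t0 = - (1/2)" and T: "tracked_branch e a0 A m \<gamma> K (1/2) (\<lambda>t. - z t)" and s: "\<sigma> \<noteq> 0"
  and X: "sde_solution M W e \<sigma> A x0 X"
  and start: "\<bar>x0 - z (- (1/2))\<bar> < start_size (1/1000) (tracked_branch.C1 \<gamma> K) * (200 * sqrt m)"
 shows "prob {w\<in>space M. \<exists>t\<in>TI. X t w = 0}
  <= tail_const / e * exp (- (tail_rate (1/1000) (tracked_branch.C1 \<gamma> K) * (noise_size (1/1000) (tracked_branch.C1 \<gamma> K))^2 * m powr (3/2) / \<sigma>^2))"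
proof -
 interpret T: tracked_branch e a0 A m \<gamma> K "1/2" "\<lambda>t. - z t" by (rule T)
 have "prob {w\<in>space M. \<exists>t\<in>TI. - X t w = 0}
  <= tail_const / e * exp (- (tail_rate (1/1000) T.C1 * (noise_size (1/1000) T.C1)^2 * m powr (3/2) / (- \<sigma>)^2))"
 proof (rule hitting_bound[OF t0 T.linear_well T.A_bounds(4) T.m_le_1 _ _ T.z_TI _ _ _ sde_reflect[OF t0 X]])
  show "1/4 <= - z t \<and> - z t <= 3/2" if "t \<in> TI" for t using T.z_lower[of t] T.z_upper[OF that] by linarith
  show "e * (F (- z t) (lam A (t + 1/2)) / e) <= F (- z t) (lam A (t + 1/2))" for t using T.eps by simp
  show "continuous_on TI (\<lambda>t. - X t w)" if "w \<in> space M" for w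
   by (intro continuous_intros sde_TI(2)[OF t0 X that])
  have "start_size (1/1000) T.C1 * (200 * sqrt m) <= start_size (1/1000) T.C1 * width m (1/2) (- (1/2))"
   using const_pos(1)[of "1/1000" T.C1] width_basic(2)[OF T.A_bounds(5), of "1/2" "- (1/2)"] by (intro mult_left_mono) auto
  then show "- z (- (1/2)) - start_size (1/1000) T.C1 * width m (1/2) (- (1/2)) < - x0" using start by linarith
 qed (use s T.l_cont in auto)
 then show ?thesis by simp
qed

text \<open>The mirrored equilibrium \<open>X_plus (- A)\<close> is at least \<open>xc\<close>,
  while the subsolution starts \<open>sqrt e / 20\<close> below \<open>xc\<close>; the condition on
  \<open>\<delta> * sqrt Kq\<close> keeps the allowed start above it.\<close>

lemma hitting_left_fold:
 assumes t0: "t0 = - (1/2)" and s: "\<sigma> \<noteq> 0" and X: "sde_solution M W e \<sigma> A x0 X"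
  and e: "0 < e" "e <= 1" and A: "A = lambda_c + a0" and m: "m = max \<bar>a0\<bar> e"
  and a0: "a0 < 0" and Kq: "1 <= Kq" and mK: "m <= Kq * e" "Kq * e <= 18/100"
  and start: "\<bar>x0 - X_minus A\<bar> < \<delta> * sqrt m" and \<delta>: "0 < \<delta>" "\<delta> * sqrt Kq <= 1/20"
 shows "prob {w\<in>space M. \<exists>t\<in>TI. X t w = 0}
  <= tail_const / e * exp (- (tail_rate (1/1000) (7600 * Kq ^ 3) * (noise_size (1/1000) (7600 * Kq ^ 3))^2 * m powr (3/2) / \<sigma>^2))"
proof -
 have em: "e <= m" "\<bar>a0\<bar> <= m" "m <= 1" using m mK by auto
 note W = fold_sub_well[OF e Kq em(1) mK(1)]
 have "prob {w\<in>space M. \<exists>t\<in>TI. - X t w = 0}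
  <= tail_const / e * exp (- (tail_rate (1/1000) (7600 * Kq ^ 3) * (noise_size (1/1000) (7600 * Kq ^ 3))^2 * m powr (3/2) / (- \<sigma>)^2))"
 proof (rule hitting_bound[OF t0 W(1) em(1) em(3) _ W(2) _ _ _ _ sde_reflect[OF t0 X]])
  show "((\<lambda>t. xc + fold_sub e t) has_real_derivative fold_sub' e t) (at t within TI)" for t
   using DERIV_add[OF DERIV_const fold_sub_deriv[OF e(1), of t TI], of xc] by simp
  show "e * fold_sub' e t <= F (xc + fold_sub e t) (lam A (t + 1/2))" if "t \<in> TI" for t
   unfolding A by (rule fold_sub_subsolution[OF e _ _ that]) (use a0 em mK in auto)
  show "continuous_on TI (\<lambda>t. - X t w)" if "w \<in> space M" for w
   by (intro continuous_intros sde_TI(2)[OF t0 X that])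
  show "continuous_on TI (\<lambda>t. lam A (t + 1/2))" unfolding lam_def by (intro continuous_intros)
  have "xc + sqrt (- A + lambda_c) / 2 <= X_plus (- A)" using a0 em by (intro X_plus_lower) (auto simp: A)
  moreover have "0 <= sqrt (- A + lambda_c)" using a0 by (simp add: A)
  ultimately have "xc <= X_plus (- A)" by linarith
  moreover have "\<delta> * sqrt m <= sqrt e / 20"
  proof -
   have "sqrt m <= sqrt (Kq * e)" using mK(1) by simp
   then have "\<delta> * sqrt m <= \<delta> * (sqrt Kq * sqrt e)" unfolding real_sqrt_mult using \<delta> by (intro mult_left_mono) auto
   also have "... = (\<delta> * sqrt Kq) * sqrt e" by simp
   also have "... <= 1/20 * sqrt e" using \<delta>(2) e by (intro mult_right_mono) auto
   finally show ?thesis by simp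
  qed
  moreover have "- x0 > X_plus (- A) - \<delta> * sqrt m" using start unfolding X_minus_eq by linarith
  moreover have "fold_sub e (- (1/2)) = - (sqrt e / 20)" by (simp add: fold_sub_def)
  moreover have "0 < start_size (1/1000) (7600 * Kq ^ 3) * width m (1/2) (- (1/2))"
   using e em width_basic(1)[of m "1/2" "- (1/2)"] by (intro mult_pos_pos const_pos) auto
  ultimately show "xc + fold_sub e (- (1/2)) - start_size (1/1000) (7600 * Kq ^ 3) * width m (1/2) (- (1/2)) < - x0" by linarith
 qed (use s in auto)
 then show ?thesis by simp
qed

end

section \<open>Constants for the area\<close>

abbreviation forcing :: "real \<Rightarrow> real" where "forcing t \<equiv> 2 * pi * sin (2 * pi * t)"

lemma forcing_cont: "continuous_on T forcing" by (intro continuous_intros)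

text \<open>The forcing is a multiple of \<open>sin (pi * t)\<close>, so it vanishes at the fold
  along with the time-dependent part of the width. This compensates the weak damping there in the
  area estimates.\<close>

lemma forcing_le:
 assumes m: "0 < m" shows "\<bar>forcing t\<bar> <= 16 * width m 0 t"
proof -
 have "forcing t = 4 * pi * (sin (pi * t) * cos (pi * t))" using sin_double[of "pi * t"] by (simp add: ac_simps)
 moreover have "\<bar>4 * pi * (sin (pi * t) * cos (pi * t))\<bar> = 4 * pi * (\<bar>sin (pi * t)\<bar> * \<bar>cos (pi * t)\<bar>)" by (simp add: abs_mult)
 moreover have "... <= 16 * (width m 0 t * 1)"
  using pi_less_4 width_basic(1)[OF m, of 0 t] width_basic(4)[OF m, of t 0] by (intro mult_mono) auto
 ultimately show ?thesis by argo
qed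

lemma forcing_lower:
 shows "t \<in> {1/8..1/2} \<Longrightarrow> 0 <= forcing t" "t \<in> {1/8..3/8} \<Longrightarrow> 3 <= forcing t"
proof -
 assume t: "t \<in> {1/8..1/2}"
 have "2 * pi * t <= 2 * pi * (1/2)" using t by (intro mult_left_mono) auto
 then show "0 <= forcing t" using t by (intro mult_nonneg_nonneg sin_ge_zero) auto
next
 assume t: "t \<in> {1/8..3/8}"
 have s: "7/10 <= sin (pi / 4)"
 proof -
  have "sqrt ((7/5)^2) <= sqrt 2" by (intro real_sqrt_le_mono) (simp add: power2_eq_square)
  then show ?thesis by (simp add: sin_45)
 qed
 have "7/10 <= sin (2 * pi * t)"
 proof (cases "t <= 1/4")
  case True
  have "2 * pi * (1/8) <= 2 * pi * t" "2 * pi * t <= 2 * pi * (1/4)" using t True by (intro mult_left_mono; simp)+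
  then have "sin (pi / 4) <= sin (2 * pi * t)" by (intro sin_monotone_2pi_le) (use pi_gt_zero in linarith)+
  then show ?thesis using s by simp
 next
  case False
  have "2 * pi * (1/4) <= 2 * pi * t" "2 * pi * t <= 2 * pi * (3/8)" using t False by (intro mult_left_mono; simp)+
  then have "sin (pi / 4) <= sin (pi - 2 * pi * t)" by (intro sin_monotone_2pi_le) (use pi_gt_zero in linarith)+
  then show ?thesis using s by simp
 qed
 then have "2 * 3 * (7/10) <= 2 * pi * sin (2 * pi * t)" using pi_gt3 by (intro mult_mono) auto
 then show "3 <= forcing t" by simp
qed

text \<open>\<open>lin_const\<close> and \<open>quad_const\<close> are the values of
  \<open>KV\<close> and \<open>CQ\<close> for rate \<open>1/2000\<close> and \<open>K = 16\<close>.
  \<open>quad_frac\<close> reduces the noise level so that the quadratic remainder stays below half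
  of the deviation, and \<open>area_rate\<close> is the rate that remains.\<close>

definition lin_const :: "real \<Rightarrow> real" where "lin_const C = 16 * exp C / (1/2000)"
definition quad_const :: "real \<Rightarrow> real" where "quad_const C = 16 * (24 * exp C / (1/2000))"
definition quad_frac :: "real \<Rightarrow> real" where "quad_frac C = min 1 (1 / (6 * quad_const C))"
definition area_rate :: "real \<Rightarrow> real" where "area_rate C = min (1 / (16 * (lin_const C)^2)) (tail_rate (1/2000) C * quad_frac C)"

lemma area_const_pos: "0 < lin_const C" "0 < quad_const C" "0 < quad_frac C" "0 < area_rate C"
proof -
 show 1: "0 < lin_const C" "0 < quad_const C" by (simp_all add: lin_const_def quad_const_def)
 then show 2: "0 < quad_frac C" by (simp add: quad_frac_def)
 show "0 < area_rate C" unfolding area_rate_def using 1 2 const_pos(3)[of "1/2000" C] by simp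
qed

lemma noise_size_le_1: "noise_size (1/2000) C <= 1" by (simp add: noise_size_def min_le_iff_disj)

text \<open>The reference \<open>x\<close> is the deterministic solution with the same initial value
  as \<open>X\<close>, hence the rate \<open>1/2000\<close> of a neighbouring solution.\<close>

locale area_problem = area_well e "1/2000" C 7 "\<lambda>t. 1 - 3 * (x t)^2" "width m 0" "width' m 0" M W \<sigma> 201 m
  x "\<lambda>t. F (x t) (lam A t) / e" "lam A" forcing X 16
 for e C :: real and x :: "real \<Rightarrow> real" and m :: real and M :: "'w measure" and W \<sigma> A X +
 assumes m_le: "m <= 2/5" and eps_m: "e <= m" and eps_small: "e <= 1/8" and sigma_pos: "0 < \<sigma>" and sigma_le: "\<sigma> <= m powr (3/4)"
begin

lemma constants:
 "etaC = noise_size (1/2000) C" "kg = tail_rate (1/2000) C" "Cg = tail_const" "KV = lin_const C" "CQ = quad_const C"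
 by (simp_all add: etaA_def etaB_def etaC_def kg_def Cg_def KV_def CQ_def
   start_size_def noise_size_def tail_rate_def tail_const_def lin_const_def quad_const_def)

lemma ln_m: "2/3 <= \<bar>ln m\<bar>" "\<bar>ln m\<bar> = - ln m"
proof -
 have "ln m <= ln (1/2)" using m_pos m_le by (intro ln_mono) auto
 then show "2/3 <= \<bar>ln m\<bar>" "\<bar>ln m\<bar> = - ln m" using ln2_ge_two_thirds by (auto simp: ln_div)
qed

lemma width_sq: "(width m 0 t)^2 = 40000 * m + Sfun 0 t" by (rule width_basic(6)[OF m_pos])

lemma Lambda_le: "\<Lambda> <= 3 * \<bar>ln m\<bar>"
proof -
 have "\<Lambda> <= integral TI (\<lambda>t. 1 / sqrt (m + t^2))"
  unfolding \<Lambda>_def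
 proof (rule hk_le)
  show "(\<lambda>t. 1 / width m 0 t) integrable_on TI" by (intro integrable_continuous_real inv_rho)
  have "m + t^2 \<noteq> 0" for t using m_pos by (simp add: add_pos_nonneg less_imp_neq[symmetric])
  then show "(\<lambda>t. 1 / sqrt (m + t^2)) integrable_on TI"
   by (intro integrable_continuous_real continuous_intros) simp
  fix t assume t: "t \<in> TI"
  have "m + t^2 <= (width m 0 t)^2"
  proof -
   have "t^2 <= Sfun 0 t" unfolding Sfun_def using sin_pi_sq_ge[of t] abs_leI[of t "1/2"] t by simp
   then show ?thesis using m_pos unfolding width_sq by linarith
  qed
  then have "sqrt (m + t^2) <= width m 0 t" by (rule real_le_lsqrt[OF less_imp_le[OF rho_pos[OF t]]])
  then show "1 / width m 0 t <= 1 / sqrt (m + t^2)"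
   using m_pos by (intro divide_left_mono mult_pos_pos rho_pos t) (auto simp: add_pos_nonneg)
 qed
 also have "... <= 3 * \<bar>ln m\<bar>" by (rule integral_log_bound) (use m_pos m_le in auto)
 finally show ?thesis .
qed

lemma Lambda23_le: "\<Lambda>2 <= 12 / sqrt m" "\<Lambda>3 <= 12 / m"
proof -
 have ne: "m + Sfun 0 t \<noteq> 0" for t using m_pos Sfun_bounds(1)[of 0 t] by linarith
 have i: "(\<lambda>t. 1 / (m + Sfun 0 t)) integrable_on TI"
  by (intro integrable_continuous_real continuous_intros Sfun_cont) (simp add: ne)
 have le2: "1 / (width m 0 t)^2 <= 1 / (m + Sfun 0 t)" for t
  unfolding width_sq using m_pos Sfun_bounds(1)[of 0 t] by (intro divide_left_mono mult_pos_pos) auto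
 have "\<Lambda>2 <= integral TI (\<lambda>t. 1 / (m + Sfun 0 t))" unfolding \<Lambda>2_def
  by (intro hk_le i le2 integrable_continuous_real continuous_intros rho_cont)
    (use rho_ne in auto)
 then show "\<Lambda>2 <= 12 / sqrt m" using integral_inverse_Sfun[of 0 m] m_pos by simp
 have "\<Lambda>3 <= integral TI (\<lambda>t. 1 / sqrt m * (1 / (m + Sfun 0 t)))" unfolding \<Lambda>3_def
 proof (rule hk_le)
  show "(\<lambda>t. 1 / width m 0 t ^ 3) integrable_on TI"
   by (intro integrable_continuous_real continuous_intros rho_cont) (use rho_ne in auto)
  show "(\<lambda>t. 1 / sqrt m * (1 / (m + Sfun 0 t))) integrable_on TI"
   using i by (rule integrable_on_mult_right)
  fix t assume t: "t \<in> TI"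
  have "1 / width m 0 t ^ 3 = 1 / width m 0 t * (1 / (width m 0 t)^2)" by (simp add: power2_eq_square power3_eq_cube)
  also have "... <= 1 / sqrt m * (1 / (m + Sfun 0 t))"
   using m_pos rho_pos[OF t] rho_ge[OF t] by (intro mult_mono le2 divide_left_mono mult_pos_pos) auto
  finally show "1 / width m 0 t ^ 3 <= 1 / sqrt m * (1 / (m + Sfun 0 t))" .
 qed
 also have "... = 1 / sqrt m * integral TI (\<lambda>t. 1 / (m + Sfun 0 t))" by (rule integral_mult_right)
 also have "... <= 1 / sqrt m * (12 / sqrt m)" using m_pos by (intro mult_left_mono integral_inverse_Sfun) auto
 also have "... = 12 / m" using m_pos by simp
 finally show "\<Lambda>3 <= 12 / m" .
qed

text \<open>\<open>y\<close> is the exponent aimed at. The noise level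
  \<open>c^2 = quad_frac C * (\<sigma>^2 * y)\<close> gives the exceptional event an exponent
  proportional to \<open>y\<close>; the conditions say that the Gaussian part is no more likely,
  that the remainder stays below \<open>H / 2\<close>, and that \<open>c\<close> does not exceed
  \<open>hmax\<close>.\<close>

lemma area_tail_rate:
 assumes y: "0 <= y" "y <= H^2 / (\<sigma>^2 * e)" "\<sigma>^2 * y * \<bar>ln m\<bar> <= H"
  and b: "\<sigma>^2 * y <= (noise_size (1/2000) C)^2 * m powr (3/2)"
 shows "prob {w\<in>space M. H <= \<bar>G w\<bar>} <= (2 + tail_const) / e * exp (- (area_rate C * y))"
proof (cases "y = 0")
 case True
 have "1 <= (2 + tail_const) / e" using eps_pos eps_le const_pos(4) by simp
 then show ?thesis unfolding True by (simp add: order_trans[OF prob_le_1])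
next
 case False
 define c where "c = sqrt (quad_frac C * (\<sigma>^2 * y))"
 have c2: "c^2 = quad_frac C * (\<sigma>^2 * y)" using area_const_pos(3)[of C] y by (simp add: c_def)
 have c0: "0 < c" using area_const_pos(3)[of C] y(1) False sigma_pos by (simp add: c_def)
 have q1: "quad_frac C <= 1" "6 * quad_const C * quad_frac C <= 1"
 proof -
  show "quad_frac C <= 1" by (simp add: quad_frac_def)
  have "quad_frac C <= 1 / (6 * quad_const C)" by (simp add: quad_frac_def)
  then show "6 * quad_const C * quad_frac C <= 1" using area_const_pos(2)[of C] by (simp add: field_simps)
 qed
 have "c <= hmax"
 proof (rule power2_le_imp_le)
  have "quad_frac C * (\<sigma>^2 * y) <= 1 * (\<sigma>^2 * y)" using q1 y by (intro mult_right_mono) auto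
  then show "c^2 <= hmax^2" using b unfolding c2 hmax_sq constants by linarith
 qed (use hmax_pos in simp)
 have n: "0 <= \<sigma>^2 * y * \<bar>ln m\<bar>" using y by simp
 have "2 * CQ * \<Lambda> * c^2 <= 2 * CQ * (3 * \<bar>ln m\<bar>) * c^2"
  using Lambda_le CQ_pos by (intro mult_right_mono mult_left_mono) auto
 also have "... = (6 * quad_const C * quad_frac C) * (\<sigma>^2 * y * \<bar>ln m\<bar>)" unfolding c2 constants by simp
 also have "... <= 1 * (\<sigma>^2 * y * \<bar>ln m\<bar>)" using q1 n by (intro mult_right_mono) auto
 finally have "2 * CQ * \<Lambda> * c^2 <= H" using y(3) by simp
 moreover have "0 <= H" using y(3) n by simp
 ultimately have "prob {w\<in>space M. H <= \<bar>G w\<bar>} <= 2 * exp (- (H^2 / (16 * KV^2 * (\<sigma>^2 * e)))) + Cg / e * exp (- (kg * c^2 / \<sigma>^2))"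
  by (intro area_tail c0 \<open>c <= hmax\<close>)
 also have "... <= 2 / e * exp (- (area_rate C * y)) + tail_const / e * exp (- (area_rate C * y))"
  unfolding constants
 proof (intro add_mono mult_mono)
  have "area_rate C * y <= 1 / (16 * (lin_const C)^2) * (H^2 / (\<sigma>^2 * e))"
   using y by (intro mult_mono) (auto simp: area_rate_def)
  then show "exp (- (H^2 / (16 * (lin_const C)^2 * (\<sigma>^2 * e)))) <= exp (- (area_rate C * y))" by simp
  have "area_rate C * y <= tail_rate (1/2000) C * quad_frac C * y"
   using y by (intro mult_right_mono) (auto simp: area_rate_def)
  then show "exp (- (tail_rate (1/2000) C * c^2 / \<sigma>^2)) <= exp (- (area_rate C * y))"
   unfolding c2 using sigma_pos by simp
 qed (use eps_pos eps_le const_pos(4) in \<open>auto simp: pos_le_divide_eq\<close>)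
 also have "... = (2 + tail_const) / e * exp (- (area_rate C * y))" by (simp add: add_divide_distrib distrib_right)
 finally show ?thesis .
qed

text \<open>Gaussian range: with the exponent \<open>y = H^2 / (\<sigma>^2 * e)\<close>, the bound
  \<open>H <= e / \<bar>ln m\<bar>\<close> is exactly the condition
  \<open>\<sigma>^2 * y * \<bar>ln m\<bar> <= H\<close> on the quadratic remainder.\<close>

lemma small_tail:
 assumes H: "0 <= H" "H <= (noise_size (1/2000) C)^2 * sqrt e * m powr (3/4)" "H <= e / \<bar>ln m\<bar>"
 shows "prob {w\<in>space M. H <= \<bar>G w\<bar>} <= (2 + tail_const) / e * exp (- (area_rate C * (H^2 / (\<sigma>^2 * e))))"
proof (rule area_tail_rate)
 show "0 <= H^2 / (\<sigma>^2 * e)" using eps_pos by simp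
 have s: "\<sigma>^2 * (H^2 / (\<sigma>^2 * e)) = H^2 / e" using sigma_pos by simp
 have "\<bar>ln m\<bar> * H <= e" using H(3) ln_m by (simp add: field_simps)
 then have "\<bar>ln m\<bar> * H * H <= e * H" using H(1) by (rule mult_right_mono)
 then show "\<sigma>^2 * (H^2 / (\<sigma>^2 * e)) * \<bar>ln m\<bar> <= H"
  unfolding s using eps_pos by (simp add: pos_divide_le_eq power2_eq_square ac_simps)
 have n: "0 < noise_size (1/2000) C" by (rule const_pos) simp
 have "H^2 <= ((noise_size (1/2000) C)^2 * sqrt e * m powr (3/4))^2" using H by (intro power_mono)
 also have "... = e * ((noise_size (1/2000) C)^2 * ((noise_size (1/2000) C)^2 * m powr (3/2)))"
  using eps_pos m_pos by (simp add: power_mult_distrib powr_power power2_eq_square[of "(noise_size (1/2000) C)^2"])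
 also have "... <= e * (1 * ((noise_size (1/2000) C)^2 * m powr (3/2)))"
  using eps_pos n noise_size_le_1[of C] by (intro mult_left_mono mult_right_mono) (auto simp: power_le_one)
 finally show "\<sigma>^2 * (H^2 / (\<sigma>^2 * e)) <= (noise_size (1/2000) C)^2 * m powr (3/2)"
  unfolding s using eps_pos by (simp add: pos_divide_le_eq ac_simps)
qed simp

text \<open>Range dominated by the quadratic remainder: the exponent is the largest \<open>y\<close>
  with \<open>\<sigma>^2 * y * \<bar>ln m\<bar> <= H\<close>.\<close>

lemma mid_tail:
 assumes H: "e / \<bar>ln m\<bar> <= H" "H <= (noise_size (1/2000) C)^2 * m powr (3/2) * \<bar>ln m\<bar>"
 shows "prob {w\<in>space M. H <= \<bar>G w\<bar>} <= (2 + tail_const) / e * exp (- (area_rate C * (H / (\<sigma>^2 * \<bar>ln m\<bar>))))"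
proof (rule area_tail_rate)
 have k: "0 < \<bar>ln m\<bar>" using ln_m by linarith
 have H0: "0 < H" using H(1) divide_pos_pos[OF eps_pos k] by linarith
 then show "0 <= H / (\<sigma>^2 * \<bar>ln m\<bar>)" by simp
 have s: "\<sigma>^2 * (H / (\<sigma>^2 * \<bar>ln m\<bar>)) = H / \<bar>ln m\<bar>" using sigma_pos by simp
 show "\<sigma>^2 * (H / (\<sigma>^2 * \<bar>ln m\<bar>)) * \<bar>ln m\<bar> <= H" unfolding s using k by simp
 show "\<sigma>^2 * (H / (\<sigma>^2 * \<bar>ln m\<bar>)) <= (noise_size (1/2000) C)^2 * m powr (3/2)"
  unfolding s using H(2) k by (simp add: pos_divide_le_eq)
 have "e <= H * \<bar>ln m\<bar>" using H(1) k by (simp add: pos_divide_le_eq)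
 then have "H / \<sigma>^2 * (1 / \<bar>ln m\<bar>) <= H / \<sigma>^2 * (H / e)"
  using H0 k eps_pos by (intro mult_left_mono) (auto simp: field_simps)
 then show "H / (\<sigma>^2 * \<bar>ln m\<bar>) <= H^2 / (\<sigma>^2 * e)" by (simp add: power2_eq_square)
qed

end

text \<open>The logarithmic gap between \<open>\<sigma>\<close> and the critical noise intensity makes the rare event
 negligible against every power of \<open>e\<close>, even relative to \<open>\<sigma> ^ 4\<close>.\<close>

lemma rare_event_negligible:
 fixes k b D e s r :: real
 assumes k: "0 < k" and b: "0 < b" and D: "0 < D"
  and e: "0 < e" "e < 1" "e <= exp (- (48 / k))" "sqrt b * (32 / k^2) * D * e <= 1"
  and s: "0 < s" "s * \<bar>ln e\<bar> <= r" and r: "e ^ 3 <= r ^ 4"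
 shows "sqrt (b / e * exp (- (k * r^2 / s^2))) * (D / e ^ 6) <= s ^ 4 * e"
proof -
 define y where "y = k * (r^2 / s^2) / 4"
 have ln: "\<bar>ln e\<bar> = - ln e" "0 < - ln e" using e by auto
 have "0 < s * \<bar>ln e\<bar>" by (rule mult_pos_pos) (use s ln in auto)
 then have r0: "0 < r" using s by linarith
 have y0: "0 < y" using k r0 s by (simp add: y_def)
 have "\<bar>ln e\<bar> <= r / s" using s by (simp add: field_simps)
 then have "\<bar>ln e\<bar>\<^sup>2 <= (r / s)^2" by (intro power_mono) auto
 then have "k * (ln e)^2 <= k * (r^2 / s^2)" using k by (intro mult_left_mono) (auto simp: power_divide)
 then have "k * (ln e)^2 / 4 <= y" by (simp add: y_def)
 moreover have "12 * (- ln e) <= k * (ln e)^2 / 4"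
 proof -
  have "ln e <= ln (exp (- (48 / k)))" using e by (intro ln_mono) auto
  then have "48 / k <= - ln e" by simp
  then have "48 <= k * (- ln e)" using k by (simp add: field_simps)
  then have "48 * (- ln e) <= k * (- ln e) * (- ln e)" using ln by (intro mult_right_mono) auto
  then show ?thesis by (simp add: power2_eq_square)
 qed
 ultimately have "exp (- y) <= exp (12 * ln e)" by simp
 also have "... = e ^ 12" using exp_of_nat_mult[of 12 "ln e"] e by simp
 finally have e1: "exp (- y) <= e ^ 12" .
 have e2: "exp (- y) <= 32 / k^2 * (s ^ 4 / e ^ 3)"
 proof -
  have "1 + y + y^2 / 2 <= exp y" by (rule exp_lower_Taylor_quadratic) (use y0 in simp)
  then have "y^2 / 2 <= exp y" using y0 by linarith
  then have "exp (- y) <= 2 / y^2" using y0 by (simp add: exp_minus field_simps)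
  also have "... = 32 / k^2 * (s ^ 4 / r ^ 4)"
  proof -
   have "y^2 = k^2 * (r ^ 4 / s ^ 4) / 16"
    by (simp add: y_def power_divide power_mult_distrib) 
   then show ?thesis by simp
  qed
  also have "... <= 32 / k^2 * (s ^ 4 / e ^ 3)"
   using e r r0 s by (intro mult_left_mono divide_left_mono mult_pos_pos) auto
  finally show ?thesis .
 qed
 have "sqrt (b / e * exp (- (k * r^2 / s^2))) = sqrt b / sqrt e * (exp (- y) * exp (- y))"
 proof -
  have "exp (- (k * r^2 / s^2)) = (exp (- y) * exp (- y))^2"
  proof -
   have "(exp (- y) * exp (- y))^2 = exp (- y + - y + (- y + - y))"
    by (simp only: power2_eq_square exp_add)
   moreover have "- y + - y + (- y + - y) = - (k * r^2 / s^2)" by (simp add: y_def)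
   ultimately show ?thesis by (simp only:)
  qed
  then show ?thesis by (simp only: real_sqrt_mult real_sqrt_divide real_sqrt_abs abs_of_pos mult_pos_pos exp_gt_zero)
 qed
 also have "... <= sqrt b / e * (e ^ 12 * (32 / k^2 * (s ^ 4 / e ^ 3)))"
 proof (intro mult_mono divide_left_mono e1 e2)
  have "e^2 <= e" using e by (simp add: power2_eq_square mult_left_le)
  then show "e <= sqrt e" by (rule real_le_rsqrt)
 qed (use e b in auto)
 finally have "sqrt (b / e * exp (- (k * r^2 / s^2))) * (D / e ^ 6) <= sqrt b / e * (e ^ 12 * (32 / k^2 * (s ^ 4 / e ^ 3))) * (D / e ^ 6)"
  using D e by (intro mult_right_mono) auto
 also have "... = (sqrt b * (32 / k^2) * D * e) * (s ^ 4 * e)"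
 proof -
  have "e ^ 12 = e * e ^ 3 * e ^ 6 * (e * e)" by (simp add: eval_nat_numeral)
  then show ?thesis using e by simp
 qed
 also have "... <= 1 * (s ^ 4 * e)" using e s by (intro mult_right_mono) auto
 finally show ?thesis by simp
qed

section \<open>Moments of the area for the concrete forcing\<close>

definition var_const :: "real \<Rightarrow> real" where "var_const C = exp (2 * C) / (1/2000)"

definition rem_const :: "real \<Rightarrow> real" where
 "rem_const C = 14 * 576 * exp (2 * C) / (1/2000)^2 + 2 * 201^2"

text \<open>Bound for \<open>2 + M4'\<close> after removal of the factor \<open>1 / e ^ 6\<close>:
  \<open>3216 = 16 * 201\<close> is \<open>K * R\<close>, and \<open>144\<close> is the square of
  the constant in the bound on \<open>\<Lambda>2\<close>.\<close>

definition fourth_const :: "real \<Rightarrow> real" where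
 "fourth_const C = 2 + 8 * (8 * (3216 ^ 4 * 900000 + 3 * ((lin_const C)^2)^2) + (9/2 * lin_const C) ^ 4 * (105 * var_const C ^ 4 * 144))"

definition third_const :: "real \<Rightarrow> real" where
 "third_const C = 2 * (lin_const C)^2 * ((rem_const C)^2 * 105 * var_const C ^ 4 * 144 + 147 * (var_const C)^2 * 144)"

lemma moment_const_pos: "0 < var_const C" "0 < fourth_const C" "0 < third_const C"
proof -
 show 1: "0 < var_const C" by (simp add: var_const_def)
 show "0 < fourth_const C" unfolding fourth_const_def by (intro add_pos_nonneg) (use 1 in auto)
 show "0 < third_const C" unfolding third_const_def using 1 area_const_pos(1)[of C]
  by (intro mult_pos_pos add_nonneg_pos) auto
qed

context area_problem
begin

lemma m_powr: "m powr (3/4) * m powr (3/4) = sqrt m ^ 3" "m powr (3/2) = sqrt m ^ 3" "(m powr (3/4)) ^ 4 = m ^ 3"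
 "m powr (1/4) * sqrt m = m powr (3/4)" "(m powr (1/4))^2 = sqrt m" "m powr (3/4) <= 1"
proof -
 have s: "sqrt m ^ 3 = m powr (3/2)"
  using m_pos by (simp add: powr_half_sqrt[symmetric] powr_power)
 then show "m powr (3/4) * m powr (3/4) = sqrt m ^ 3" "m powr (3/2) = sqrt m ^ 3"
  by (simp_all add: powr_add[symmetric])
 show "(m powr (3/4)) ^ 4 = m ^ 3" using m_pos by (simp add: powr_power)
 show "m powr (1/4) * sqrt m = m powr (3/4)" "(m powr (1/4))^2 = sqrt m"
  using m_pos by (simp_all add: powr_half_sqrt[symmetric] powr_power powr_add[symmetric])
 show "m powr (3/4) <= 1" using m_pos m_le by (intro powr_le1) auto
qed

lemma sigma_sq: "\<sigma>^2 <= sqrt m ^ 3" "\<sigma> <= 1" "\<sigma>^2 <= 1"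
proof -
 have "\<sigma> * \<sigma> <= m powr (3/4) * m powr (3/4)" using sigma_le sigma_pos by (intro mult_mono) auto
 then show "\<sigma>^2 <= sqrt m ^ 3" unfolding m_powr by (simp add: power2_eq_square)
 show "\<sigma> <= 1" using sigma_le m_powr(6) by linarith
 then show "\<sigma>^2 <= 1" using sigma_pos by (simp add: abs_square_le_1)
qed

lemma V_const: "V = var_const C" "CA = rem_const C"
 by (simp_all add: V_def var_const_def CA_def rem_const_def)

lemma v0_le_1: "v0 <= (lin_const C)^2"
proof -
 have "\<sigma>^2 * e <= 1 * 1" using sigma_sq eps_pos eps_le by (intro mult_mono) auto
 then have "KV^2 * (\<sigma>^2 * e) <= KV^2 * 1" by (intro mult_left_mono) auto
 then show ?thesis using v0_le unfolding constants by linarith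
qed

lemma Lambda2_nonneg: "0 <= \<Lambda>2" "0 <= \<Lambda>3" "0 <= \<Lambda>"
proof -
 show "0 <= \<Lambda>2" unfolding \<Lambda>2_def using rho_ne
  by (intro hk_nonneg integrable_continuous_real continuous_intros rho_cont) auto
 show "0 <= \<Lambda>3" unfolding \<Lambda>3_def using rho_ne less_imp_le[OF rho_pos]
  by (intro hk_nonneg integrable_continuous_real continuous_intros rho_cont) auto
 show "0 <= \<Lambda>" unfolding \<Lambda>_def using inv_rho less_imp_le[OF rho_pos]
  by (intro hk_nonneg integrable_continuous_real) auto
qed

lemma M4'_le: "0 <= M4" "M4 <= M4'" "2 + M4' <= fourth_const C / e ^ 6"
proof -
 have p6: "e ^ 6 <= 1" "0 < e ^ 6" "e ^ 6 <= e"
  using eps_pos eps_le by (auto intro: power_le_one power_decreasing[of 1 6 e, simplified])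
 show M40: "0 <= M4" using eps_pos by (simp add: M4_def)
 define T where "T = (9/2 * KV) ^ 4 * (105 * (\<sigma>^2 * V) ^ 4 * \<Lambda>2^2)"
 have T0: "0 <= T" by (simp add: T_def)
 have M4': "M4' = 8 * (M4 + T)" by (simp add: M4'_def T_def)
 then show "M4 <= M4'" using M40 T0 by simp
 have big: "x <= x / e ^ 6" if "0 <= x" for x
  using mult_left_mono[OF p6(1) that] p6(2) by (simp add: pos_le_divide_eq)
 have m4: "M4 <= 8 * (3216 ^ 4 * 900000 + 3 * ((lin_const C)^2)^2) / e ^ 6"
 proof -
  have "v0^2 <= ((lin_const C)^2)^2" using v0_le_1 v0_pos by (intro power_mono) auto
  also have "... <= ((lin_const C)^2)^2 / e ^ 6" by (rule big) simp
  finally show ?thesis by (simp add: M4_def add_divide_distrib)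
 qed
 have t: "T <= (9/2 * lin_const C) ^ 4 * (105 * var_const C ^ 4 * 144) / e ^ 6"
 proof -
  have "(\<sigma>^2 * V) ^ 4 <= (1 * V) ^ 4" using sigma_sq V_pos by (intro power_mono mult_right_mono) auto
  moreover have "\<Lambda>2^2 <= 144 / e ^ 6"
  proof -
   have "\<Lambda>2^2 <= (12 / sqrt m)^2" using Lambda23_le Lambda2_nonneg by (intro power_mono) auto
   also have "... = 144 / m" using m_pos by (simp add: power_divide)
   also have "... <= 144 / e ^ 6" using p6 eps_m m_pos by (intro divide_left_mono mult_pos_pos) auto
   finally show ?thesis .
  qed
  ultimately have "T <= (9/2 * KV) ^ 4 * (105 * V ^ 4 * (144 / e ^ 6))"
   unfolding T_def by (intro mult_left_mono mult_mono) auto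
  then show ?thesis unfolding constants V_const by simp
 qed
 have "2 <= 2 / e ^ 6" by (rule big) simp
 then show "2 + M4' <= fourth_const C / e ^ 6"
  using m4 t unfolding M4' fourth_const_def by (simp add: add_divide_distrib)
qed

lemma rare_event:
 assumes e: "e <= exp (- (48 / (tail_rate (1/2000) C * (noise_size (1/2000) C)^2)))"
   "sqrt tail_const * (32 / (tail_rate (1/2000) C * (noise_size (1/2000) C)^2)^2) * fourth_const C * e <= 1" "e < 1"
  and s: "\<sigma> * \<bar>ln e\<bar> <= m powr (3/4)"
 shows "\<delta>B * (2 + M4') <= \<sigma> ^ 4 * e"
proof -
 have "\<delta>B = sqrt (tail_const / e * exp (- (tail_rate (1/2000) C * (noise_size (1/2000) C)^2 * (m powr (3/4))^2 / \<sigma>^2)))"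
  unfolding \<delta>B_def hmax_def constants by (simp add: power_mult_distrib)
 also have "... * (fourth_const C / e ^ 6) <= \<sigma> ^ 4 * e"
 proof (rule rare_event_negligible[OF _ _ moment_const_pos(2) eps_pos e(3,1,2) sigma_pos s])
  show "e ^ 3 <= (m powr (3/4)) ^ 4" unfolding m_powr using eps_pos eps_m by (intro power_mono) auto
 qed (use const_pos(2,3)[of "1/2000" C] const_pos(4) in auto)
 finally have "\<delta>B * (fourth_const C / e ^ 6) <= \<sigma> ^ 4 * e" .
 moreover have "\<delta>B * (2 + M4') <= \<delta>B * (fourth_const C / e ^ 6)"
  using M4'_le deltaB_pos by (intro mult_left_mono) auto
 ultimately show ?thesis by linarith
qed

lemma moments:
 assumes rare: "\<delta>B * (2 + M4') <= \<sigma> ^ 4 * e"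
 shows "integrable M G" "integrable M (\<lambda>w. (G w)\<^sup>2)"
  "\<bar>expectation G\<bar> <= (3 * quad_const C * var_const C + 2) * (\<sigma>^2 * \<bar>ln m\<bar>)"
  "variance G <= 2 * (lin_const C)^2 * (\<sigma>^2 * e) + 54 * (quad_const C)^2 * (var_const C)^2 * (\<sigma> ^ 4 * \<bar>ln m\<bar>\<^sup>2) + 2 * (\<sigma> ^ 4 * e)"
  "third_const C * \<sigma>^2 * \<sigma>^2 / sqrt m ^ 3 + \<sigma>^2 * e <= 9 * exp (- 14) / 32 * e \<Longrightarrow> 9 * exp (- 14) / 32 * (\<sigma>^2 * e) <= variance G"
proof -
 have s4: "\<sigma> ^ 4 * e <= 1" "\<sigma> ^ 4 * e <= \<sigma>^2"
 proof -
  have "\<sigma> ^ 4 = \<sigma>^2 * \<sigma>^2" by (simp add: eval_nat_numeral)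
  moreover have "\<sigma>^2 * (\<sigma>^2 * e) <= \<sigma>^2 * (1 * 1)" using sigma_sq eps_pos eps_le by (intro mult_left_mono mult_mono) auto
  ultimately show "\<sigma> ^ 4 * e <= \<sigma>^2" by simp
  then show "\<sigma> ^ 4 * e <= 1" using sigma_sq by linarith
 qed
 have "\<delta>B * 1 <= \<delta>B * (2 + M4')" using M4'_le deltaB_pos by (intro mult_left_mono) auto
 then have d1: "\<delta>B <= 1" using rare s4 by linarith
 have dM: "\<delta>B * (2 + M4) <= \<sigma> ^ 4 * e"
  using rare mult_left_mono[of "2 + M4" "2 + M4'" \<delta>B] M4'_le deltaB_pos by linarith
 note m = area_moments[OF sigma_sq(3) d1]
 show i: "integrable M G" "integrable M (\<lambda>w. (G w)\<^sup>2)" by (rule m)+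
 have VL: "\<sigma>^2 * V * \<Lambda> <= 3 * V * (\<sigma>^2 * \<bar>ln m\<bar>)" "0 <= \<sigma>^2 * V * \<Lambda>"
  using mult_left_mono[OF Lambda_le, of "\<sigma>^2 * V"] V_pos Lambda2_nonneg by (auto simp: ac_simps)
 have "CQ * (\<sigma>^2 * V * \<Lambda>) <= CQ * (3 * V * (\<sigma>^2 * \<bar>ln m\<bar>))" using VL CQ_pos by (intro mult_left_mono) auto
 moreover have "\<sigma>^2 * (2/3) <= \<sigma>^2 * \<bar>ln m\<bar>" using ln_m by (intro mult_left_mono) auto
 ultimately have "\<bar>expectation G\<bar> <= CQ * (3 * V * (\<sigma>^2 * \<bar>ln m\<bar>)) + 2 * (\<sigma>^2 * \<bar>ln m\<bar>)"
  using m(3) dM s4 zero_le_power2[of \<sigma>] by argo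
 then show "\<bar>expectation G\<bar> <= (3 * quad_const C * var_const C + 2) * (\<sigma>^2 * \<bar>ln m\<bar>)"
  unfolding constants V_const by (simp add: algebra_simps)
 have "variance G <= expectation (\<lambda>w. (G w)\<^sup>2)"
  using variance_eq[OF i] by simp
 also have "... <= 2 * (KV^2 * (\<sigma>^2 * e)) + 2 * (CQ^2 * (3 * (3 * V * (\<sigma>^2 * \<bar>ln m\<bar>))^2) + \<sigma> ^ 4 * e)"
 proof -
  have "(\<sigma>^2 * V * \<Lambda>)^2 <= (3 * V * (\<sigma>^2 * \<bar>ln m\<bar>))^2" using VL by (intro power_mono)
  then show ?thesis by (intro order_trans[OF m(4)] add_mono mult_left_mono v0_le dM) auto
 qed
 also have "... = 2 * (lin_const C)^2 * (\<sigma>^2 * e) + 54 * (quad_const C)^2 * (var_const C)^2 * (\<sigma> ^ 4 * \<bar>ln m\<bar>\<^sup>2) + 2 * (\<sigma> ^ 4 * e)"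
  unfolding constants V_const by (simp add: power_mult_distrib)
 finally show "variance G <= 2 * (lin_const C)^2 * (\<sigma>^2 * e) + 54 * (quad_const C)^2 * (var_const C)^2 * (\<sigma> ^ 4 * \<bar>ln m\<bar>\<^sup>2) + 2 * (\<sigma> ^ 4 * e)" .
 assume third: "third_const C * \<sigma>^2 * \<sigma>^2 / sqrt m ^ 3 + \<sigma>^2 * e <= 9 * exp (- 14) / 32 * e"
 define s where "s = sqrt m"
 have s: "0 < s" "s^2 = m" using m_pos by (auto simp: s_def)
 \<comment> \<open>This choice balances the two parts of the third-order remainder: both become
   multiples of \<open>\<sigma> ^ 6 / sqrt m ^ 3\<close>. The requirement
   \<open>1 <= c * width m 0 t\<close> holds because \<open>\<sigma> <= m powr (3/4)\<close> and the
   width is at least \<open>sqrt m\<close>.\<close>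
 define c where "c = m powr (1/4) / \<sigma>"
 have c: "0 < c" using m_pos sigma_pos by (simp add: c_def)
 have c2: "c^2 = s / \<sigma>^2" by (simp add: c_def power_divide m_powr s_def)
 have c1: "1 <= c * width m 0 t" if t: "t \<in> TI" for t
 proof -
  have "1 <= m powr (3/4) / \<sigma>" using sigma_le sigma_pos by simp
  also have "... = c * sqrt m" by (simp add: c_def m_powr)
  also have "... <= c * width m 0 t" using c rho_ge[OF t] by (intro mult_left_mono) auto
  finally show ?thesis .
 qed
 note r3 = R3_moment[OF sigma_sq(3) d1 c c1]
 have L2: "\<Lambda>2^2 <= 144 / s^2"
 proof -
  have "\<Lambda>2^2 <= (12 / s)^2" using Lambda23_le Lambda2_nonneg by (intro power_mono) (auto simp: s_def)
  then show ?thesis by (simp add: power_divide)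
 qed
 have L3: "\<Lambda>3^2 <= 144 / s ^ 4"
 proof -
  have "\<Lambda>3^2 <= (12 / m)^2" using Lambda23_le Lambda2_nonneg by (intro power_mono) auto
  then show ?thesis unfolding s(2)[symmetric] by (simp add: power_divide)
 qed
 have "c^2 * CA^2 * (105 * (\<sigma>^2 * V) ^ 4 * \<Lambda>3^2) <= c^2 * CA^2 * (105 * (\<sigma>^2 * V) ^ 4 * (144 / s ^ 4))"
  by (intro mult_left_mono L3) auto
 also have "... = (CA^2 * 105 * V ^ 4 * 144) * (\<sigma> ^ 6 / s ^ 3)"
  unfolding c2 using sigma_pos s(1) by (simp add: power_mult_distrib field_simps eval_nat_numeral)
 finally have t1: "c^2 * CA^2 * (105 * (\<sigma>^2 * V) ^ 4 * \<Lambda>3^2) <= (CA^2 * 105 * V ^ 4 * 144) * (\<sigma> ^ 6 / s ^ 3)" .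
 have "49 / c^2 * (3 * (\<sigma>^2 * V)^2 * \<Lambda>2^2) <= 49 / c^2 * (3 * (\<sigma>^2 * V)^2 * (144 / s^2))"
  by (intro mult_left_mono L2) auto
 also have "... = (147 * V^2 * 144) * (\<sigma> ^ 6 / s ^ 3)"
  unfolding c2 using sigma_pos s(1) by (simp add: power_mult_distrib field_simps eval_nat_numeral)
 finally have "c^2 * CA^2 * (105 * (\<sigma>^2 * V) ^ 4 * \<Lambda>3^2) + 49 / c^2 * (3 * (\<sigma>^2 * V)^2 * \<Lambda>2^2)
   <= (CA^2 * 105 * V ^ 4 * 144 + 147 * V^2 * 144) * (\<sigma> ^ 6 / s ^ 3)"
  using t1 by (simp only: distrib_right)
 then have "2 * KV^2 * (c^2 * CA^2 * (105 * (\<sigma>^2 * V) ^ 4 * \<Lambda>3^2) + 49 / c^2 * (3 * (\<sigma>^2 * V)^2 * \<Lambda>2^2))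
   <= 2 * KV^2 * ((CA^2 * 105 * V ^ 4 * 144 + 147 * V^2 * 144) * (\<sigma> ^ 6 / s ^ 3))"
  by (intro mult_left_mono) auto
 also have "... = third_const C * (\<sigma> ^ 6 / s ^ 3)"
  unfolding constants V_const third_const_def by simp
 finally have "expectation (\<lambda>w. (G w - D0 w - R2 w)\<^sup>2) <= third_const C * (\<sigma> ^ 6 / s ^ 3) + \<sigma> ^ 4 * e"
  using r3(2) rare by linarith
 also have "... = \<sigma>^2 * (third_const C * \<sigma>^2 * \<sigma>^2 / sqrt m ^ 3 + \<sigma>^2 * e)"
  unfolding s_def by (simp add: eval_nat_numeral algebra_simps)
 also have "... <= \<sigma>^2 * (9 * exp (- 14) / 32 * e)" by (intro mult_left_mono third) simp
 \<comment> \<open>\<open>D0var_ge\<close> with \<open>b = 3\<close> and \<open>N = 7\<close> gives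
   \<open>v0 >= 9 * exp (- 14) / 8 * (\<sigma>^2 * e)\<close>.\<close>
 also have *: "... <= v0 / 4"
 proof -
  have "(3 * e * exp (- 7))^2 / 8 <= D0var forcing"
   by (rule D0var_ge[OF forcing_cont forcing_lower]) (use eps_m m_le eps_small in auto)
  moreover have "exp (- 14 :: real) = (exp (- 7))^2" unfolding power2_eq_square exp_add[symmetric] by simp
  ultimately have "9 * exp (- 14) / 8 * e^2 <= D0var forcing" by (simp add: power_mult_distrib ac_simps)
  then have "\<sigma>^2 / e * (9 * exp (- 14) / 8 * e^2) <= \<sigma>^2 / e * D0var forcing" using eps_pos by (intro mult_left_mono) auto
  moreover have "\<sigma>^2 / e * (9 * exp (- 14) / 8 * e^2) = 4 * (\<sigma>^2 * (9 * exp (- 14) / 32 * e))"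
   using eps_pos by (simp add: power2_eq_square[of e])
  ultimately show ?thesis unfolding v0_def by argo
 qed
 finally have "v0 / 4 <= variance G" by (intro variance_lower[OF sigma_sq(3) d1 r3(1)])
 then show "9 * exp (- 14) / 32 * (\<sigma>^2 * e) <= variance G" using * by argo
qed

end

lemma deriv_lam: "deriv (lam A) t = A * forcing t"
proof -
 have "((\<lambda>t. - A * cos (2 * pi * t)) has_real_derivative A * forcing t) (at t)"
  by (auto intro!: derivative_eq_intros)
 then show ?thesis by (simp add: lam_def[abs_def] DERIV_imp_deriv)
qed

lemma sqrt_ln_sq_le: fixes m :: real assumes m: "0 < m" "m <= 1" shows "sqrt m * (ln m)^2 <= 16"
proof -
 define u where "u = sqrt (sqrt m)"
 have u: "0 < u" using m by (simp add: u_def)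
 have mu: "sqrt m = u^2" using m by (simp add: u_def)
 have ln: "ln m = 4 * ln u" using m by (simp add: u_def ln_sqrt)
 have "u <= 1" using m by (simp add: u_def)
 then have n: "0 <= - ln u" using u by simp
 have "- ln u <= 1 / u"
  using ln_le_minus_one[of "1 / u"] u by (simp add: ln_div)
 then have "u * (- ln u) <= 1" using u by (simp add: field_simps)
 moreover have "0 <= u * (- ln u)" by (rule mult_nonneg_nonneg) (use u n in auto)
 ultimately have "(u * (- ln u))^2 <= 1^2" by (rule power_mono)
 then show ?thesis unfolding mu ln by (simp add: power_mult_distrib)
qed

text \<open>One constant for both alternatives of case Ia: \<open>\<gamma>\<close> bounds
  \<open>m / e\<close> when \<open>a0 >= - e\<close> is of that order, and \<open>3\<close> covers
  the factor \<open>9/4\<close> that comes from \<open>\<bar>ln m\<bar> >= 2/3\<close>.\<close>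

definition Ia_const :: "real \<Rightarrow> real" where "Ia_const \<gamma> = max 3 \<gamma>"

context area_problem
begin

lemma area_difference:
 assumes w: "w \<in> space M"
 shows "area A (\<lambda>t. X t w) - area A x = - A * G w"
proof -
 have Xc: "continuous_on TI (\<lambda>t. X t w)" by (rule X_cont[OF w])
 have i: "(\<lambda>t. A * (forcing t * X t w)) integrable_on TI" "(\<lambda>t. A * (forcing t * x t)) integrable_on TI"
  by (intro integrable_continuous_real continuous_intros Xc z_cont)+
 have "area A (\<lambda>t. X t w) - area A x = - (integral TI (\<lambda>t. A * (forcing t * X t w)) - integral TI (\<lambda>t. A * (forcing t * x t)))"
  unfolding area_def deriv_lam by (simp add: ac_simps)
 also have "integral TI (\<lambda>t. A * (forcing t * X t w)) - integral TI (\<lambda>t. A * (forcing t * x t))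
   = integral TI (\<lambda>t. A * (forcing t * (X t w - x t)))"
  unfolding hk_diff[OF i, symmetric] by (simp add: algebra_simps)
 also have "... = A * G w" unfolding G_def by (rule integral_mult_right)
 finally show ?thesis by simp
qed

lemma area_tail_le:
 assumes A: "0 < A" "A <= 1" and D: "\<And>w. w \<in> space M \<Longrightarrow> D w = - A * G w"
 shows "prob {w\<in>space M. H <= \<bar>D w\<bar>} <= prob {w\<in>space M. H <= \<bar>G w\<bar>}"
proof (rule finite_measure_mono)
 show "{w\<in>space M. H <= \<bar>D w\<bar>} \<subseteq> {w\<in>space M. H <= \<bar>G w\<bar>}"
 proof safe
  fix w assume w: "w \<in> space M" and H: "H <= \<bar>D w\<bar>"
  have "\<bar>D w\<bar> = A * \<bar>G w\<bar>" using D[OF w] A by (simp add: abs_mult)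
  also have "... <= 1 * \<bar>G w\<bar>" using A by (intro mult_right_mono) auto
  finally show "H <= \<bar>G w\<bar>" using H by simp
 qed
 show "{w\<in>space M. H <= \<bar>G w\<bar>} \<in> events" using G_meas by measurable
qed

lemma difference_moments:
 assumes A: "0 < A" "A <= 1" and D: "\<And>w. w \<in> space M \<Longrightarrow> D w = - A * G w"
  and i: "integrable M G" "integrable M (\<lambda>w. (G w)\<^sup>2)"
 shows "integrable M D" "integrable M (\<lambda>w. (D w)\<^sup>2)" "\<bar>expectation D\<bar> <= \<bar>expectation G\<bar>"
  "variance D = A^2 * variance G" "variance D <= variance G"
proof -
 have e: "expectation D = - A * expectation G"
  using Bochner_Integration.integral_cong[OF refl D, of M] by simp
 show "integrable M D" "integrable M (\<lambda>w. (D w)\<^sup>2)"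
  using i by (auto simp: D power_mult_distrib cong: Bochner_Integration.integrable_cong)
 have "\<bar>expectation D\<bar> = A * \<bar>expectation G\<bar>" unfolding e using A by (simp add: abs_mult)
 also have "... <= 1 * \<bar>expectation G\<bar>" using A by (intro mult_right_mono) auto
 finally show "\<bar>expectation D\<bar> <= \<bar>expectation G\<bar>" by simp
 have "variance D = expectation (\<lambda>w. A\<^sup>2 * (G w - expectation G)^2)"
 proof (rule Bochner_Integration.integral_cong[OF refl])
  fix w assume "w \<in> space M"
  then have "D w - expectation D = - A * (G w - expectation G)" unfolding e by (simp add: D algebra_simps)
  then show "(D w - expectation D)^2 = A^2 * (G w - expectation G)^2" by (simp only: power_mult_distrib) simp
 qed
 then show v: "variance D = A^2 * variance G" by simp
 have "A^2 * variance G <= 1 * variance G" using A by (intro mult_right_mono) (auto simp: power_le_one)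
 then show "variance D <= variance G" unfolding v by simp
qed

text \<open>In case Ia the quadratic part of the area is at most of the order of the Gaussian part.
  If \<open>m\<close> is of order \<open>e\<close>, this follows from
  \<open>\<sigma>^2 <= m powr (3/2)\<close> because \<open>sqrt m * (ln m)^2\<close> is bounded;
  otherwise it is the assumption on \<open>\<sigma>\<close>.\<close>

lemma sigma_case_Ia:
 assumes g: "m <= Ia_const \<gamma> * e \<or> \<sigma> <= sqrt e / \<bar>ln m\<bar>"
 shows "\<sigma>^2 <= Ia_const \<gamma> * e" "\<sigma>^2 * \<bar>ln m\<bar>\<^sup>2 <= 16 * Ia_const \<gamma> * e"
proof -
 have g3: "3 <= Ia_const \<gamma>" by (simp add: Ia_const_def)
 have "\<sigma>^2 <= Ia_const \<gamma> * e \<and> \<sigma>\<^sup>2 * \<bar>ln m\<bar>\<^sup>2 <= 16 * Ia_const \<gamma> * e"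
 proof (cases "m <= Ia_const \<gamma> * e")
  case True
  have s3: "sqrt m ^ 3 = m * sqrt m" using m_pos by (simp add: power3_eq_cube)
  have "m * sqrt m <= m * 1" using m_pos m_le by (intro mult_left_mono) auto
  moreover have "\<sigma>^2 * \<bar>ln m\<bar>\<^sup>2 <= m * sqrt m * \<bar>ln m\<bar>\<^sup>2" using sigma_sq(1) unfolding s3 by (intro mult_right_mono) auto
  moreover have "m * (sqrt m * (ln m)^2) <= m * 16" using m_pos m_le by (intro mult_left_mono sqrt_ln_sq_le) auto
  ultimately show ?thesis using True sigma_sq(1) unfolding s3 by (simp add: ac_simps)
 next
  case False
  then have "\<sigma> * \<bar>ln m\<bar> <= sqrt e" using g ln_m by (simp add: field_simps)
  then have "(\<sigma> * \<bar>ln m\<bar>)^2 <= (sqrt e)^2" using sigma_pos by (intro power_mono) auto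
  then have 1: "\<sigma>^2 * \<bar>ln m\<bar>\<^sup>2 <= e" using eps_pos by (simp add: power_mult_distrib)
  have "(2/3)^2 <= \<bar>ln m\<bar>\<^sup>2" using ln_m by (intro power_mono) auto
  then have "\<sigma>^2 * (4/9) <= \<sigma>^2 * \<bar>ln m\<bar>\<^sup>2" by (intro mult_left_mono) (auto simp: power_divide)
  then have 2: "\<sigma>^2 <= 3 * e" using 1 eps_pos by linarith
  have "3 * e <= Ia_const \<gamma> * e" using g3 eps_pos by (intro mult_right_mono) auto
  then show ?thesis using 1 2 eps_pos by linarith
 qed
 then show "\<sigma>^2 <= Ia_const \<gamma> * e" "\<sigma>^2 * \<bar>ln m\<bar>\<^sup>2 <= 16 * Ia_const \<gamma> * e" by auto
qed

text \<open>Relative to \<open>\<sigma>^2 * e\<close>, the third-order variance is governed by the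
  product of \<open>\<sigma>^2 / e\<close>, bounded in case Ia, and
  \<open>\<sigma>^2 / m powr (3/2)\<close>, at most \<open>1 / (ln e)^2\<close> by the logarithmic
  gap. The threshold on \<open>e\<close> brings this below the constant from the lower bound on
  \<open>v0\<close>.\<close>

lemma third_order_small:
 assumes s: "\<sigma>^2 <= Ia_const \<gamma> * e" "\<sigma> * \<bar>ln e\<bar> <= m powr (3/4)" and e: "e < 1"
  and L: "e <= exp (- (1 + (third_const C * Ia_const \<gamma> + 1) / (9 * exp (- 14) / 32)))"
 shows "third_const C * \<sigma>^2 * \<sigma>^2 / sqrt m ^ 3 + \<sigma>^2 * e <= 9 * exp (- 14) / 32 * e"
proof -
 define y where "y = \<bar>ln e\<bar>"
 define T where "T = third_const C * Ia_const \<gamma> + 1"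
 define v :: real where "v = 9 * exp (- 14) / 32"
 have v: "0 < v" by (simp add: v_def)
 have T: "0 < T" unfolding T_def Ia_const_def using moment_const_pos(3)[of C] by (intro add_nonneg_pos mult_nonneg_nonneg) auto
 have "ln e <= ln (exp (- (1 + T / v)))" using L eps_pos unfolding T_def v_def by (intro ln_mono) auto
 then have y: "1 + T / v <= y" by (simp add: y_def)
 have "0 <= T / v" using T v by simp
 then have y1: "1 <= y" "T / v <= y" using y by auto
 have "y * 1 <= y * y" using y1 by (intro mult_left_mono) auto
 then have "T / v <= y^2" using y1(2) unfolding power2_eq_square by linarith
 then have Ty: "T / y^2 <= v" using v y1 by (simp add: field_simps)
 have "(\<sigma> * y)^2 <= (m powr (3/4))^2" using s(2) sigma_pos by (intro power_mono) (auto simp: y_def)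
 then have sy: "\<sigma>^2 * y^2 <= sqrt m ^ 3" using m_powr(1) by (simp add: power_mult_distrib power2_eq_square[of "m powr (3/4)"])
 have s3: "0 < sqrt m ^ 3" "sqrt m ^ 3 <= 1" using m_pos m_le by (auto intro!: power_le_one)
 have r1: "\<sigma>^2 / sqrt m ^ 3 <= 1 / y^2" using sy s3 y1 by (simp add: field_simps)
 have r2: "\<sigma>^2 <= 1 / y^2" using sy s3 y1 by (simp add: field_simps)
 have "third_const C * \<sigma>^2 * \<sigma>^2 / sqrt m ^ 3 = third_const C * \<sigma>^2 * (\<sigma>^2 / sqrt m ^ 3)" by simp
 also have "... <= third_const C * (Ia_const \<gamma> * e) * (1 / y^2)"
 proof (intro mult_mono r1)
  have "0 <= Ia_const \<gamma> * e" using order_trans[OF zero_le_power2 s(1)] .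
  then show "0 <= third_const C * (Ia_const \<gamma> * e)" by (rule mult_nonneg_nonneg[OF less_imp_le[OF moment_const_pos(3)]])
 qed (use moment_const_pos(3)[of C] s3 s(1) in auto)
 finally have "third_const C * \<sigma>^2 * \<sigma>^2 / sqrt m ^ 3 <= third_const C * (Ia_const \<gamma> * e) * (1 / y^2)" .
 moreover have "\<sigma>^2 * e <= 1 / y^2 * e" using r2 eps_pos by (intro mult_right_mono) auto
 ultimately have "third_const C * \<sigma>^2 * \<sigma>^2 / sqrt m ^ 3 + \<sigma>^2 * e <= third_const C * (Ia_const \<gamma> * e) * (1 / y^2) + 1 / y^2 * e"
  by (rule add_mono)
 also have "... = T / y^2 * e" by (simp add: T_def add_divide_distrib distrib_right)
 also have "... <= v * e" using Ty eps_pos by (intro mult_right_mono) auto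
 finally show ?thesis unfolding v_def .
qed

end

context standard_brownian_motion
begin

lemma area_problemI:
 assumes t0: "t0 = - (1/2)" and T: "tracked_branch e a0 A m \<gamma> K 0 z"
  and x: "ode_solution e A {-1/2..1/2} x" "x (- (1/2)) = x0"
  and start: "\<bar>x0 - z (- (1/2))\<bar> < exp (- (2 * tracked_branch.C1 \<gamma> K)) / 25000"
  and X: "sde_solution M W e \<sigma> A x0 X" and s: "0 < \<sigma>" "\<sigma> <= m powr (3/4)"
 shows "area_problem e (tracked_branch.C1 \<gamma> K) x m M W \<sigma> A X"
proof -
 interpret T: tracked_branch e a0 A m \<gamma> K 0 z by (rule T)
 have xd: "(x has_real_derivative F (x t) (lam A (t + 0)) / e) (at t within TI)" if "t \<in> TI" for t
  using x(1) that by (simp add: ode_solution_def)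
 have "1 <= width m 0 (- (1/2))" using width_basic(4)[OF T.A_bounds(5), of "- (1/2)" 0] by simp
 then have "T.\<eta> * 1 <= T.\<eta> * width m 0 (- (1/2))" using T.eta_pos by (intro mult_left_mono) auto
 then have st: "\<bar>x (- (1/2)) - z (- (1/2))\<bar> < T.\<eta> * width m 0 (- (1/2))"
  using start unfolding x(2) T.\<eta>_def by linarith
 note L = T.nearby_solution(1)[OF xd st] and xr = T.nearby_solution(2)[OF xd st]
 interpret N: noisy_bounded e "1/2000" T.C1 7 "\<lambda>t. 1 - 3 * (x t)^2" "width m 0" "width' m 0" M W \<sigma> 201 m
  by (rule noisy_bounded_width[OF t0 L T.A_bounds(4) T.m_le_1 less_imp_neq[OF s(1), symmetric]])
 have xc: "continuous_on TI x" by (rule DERIV_continuous_on[OF xd])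
 note X' = sde_TI[OF t0 X]
 have lc: "continuous_on TI (lam A)" using T.l_cont[of TI] by simp
 have path: "AE w in M. exact_path e (1/2000) T.C1 7 (\<lambda>t. 1 - 3 * (x t)^2) (width m 0) (width' m 0) x (\<lambda>t. F (x t) (lam A t) / e)
   (lam A) (\<lambda>t. W t w) (\<lambda>t. X t w) (\<sigma> / sqrt e) (x (- (1/2)))"
  using X'(3) AE_space
 proof eventually_elim
  case (elim w)
  show ?case
  proof (intro exact_pathI nonlinear_pathI[OF L xr _ lc _ X'(2)[OF elim(2)]])
   show "(x has_real_derivative F (x t) (lam A t) / e) (at t within TI)" if "t \<in> TI" for t using xd[OF that] by simp
   show "continuous_on TI (\<lambda>t. W t w)"
    by (rule continuous_on_subset[OF BM_continuous[OF elim(2)]]) (use t0 in auto)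
   show "W (- (1/2)) w = 0" using BM_start[OF elim(2)] t0 by simp
  qed (use elim(1) x(2) in auto)
 qed
 have "(3 * e * exp (- 7))^2 / 8 <= N.D0var forcing"
  by (rule N.D0var_ge[OF forcing_cont forcing_lower]) (use T.small'(4) in auto)
 moreover have "0 < (3 * e * exp (- 7))^2 / 8" using T.eps by simp
 ultimately have h_var: "0 < N.D0var forcing" by linarith
 have mA: "m <= 2/5" "A <= 1" using T.A_bounds lambda_c_bounds by auto
 show ?thesis
  by unfold_locales
   (use path X'(1,2) xc xr forcing_cont forcing_le[OF T.A_bounds(5)] h_var mA T.A_bounds T.small'(4) s
    order_trans[OF lam_le[of A]] in auto)
qed

lemma large_area_tail:
 assumes t0: "t0 = - (1/2)" and P: "area_problem e C x m M W \<sigma> A X" and A: "0 < A" "A <= 9/20"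
  and X: "sde_solution M W e \<sigma> A x0 X" and x0: "\<bar>x0\<bar> <= 3/2" and H: "80 <= H"
  and D: "\<And>w. w \<in> space M \<Longrightarrow> D w = area A (\<lambda>t. X t w) - area A x"
 shows "prob {w\<in>space M. H <= \<bar>D w\<bar>} <= CT / e * exp (- (kT * H ^ 4 / \<sigma>^2))"
proof -
 interpret P: area_problem e C x m M W \<sigma> A X by (rule P)
 have "\<bar>D w\<bar> = \<bar>integral TI (\<lambda>t. A * forcing t * (X t w - x t))\<bar>" if w: "w \<in> space M" for w
 proof -
  have "integral TI (\<lambda>t. A * (forcing t * (X t w - x t))) = A * P.G w" unfolding P.G_def by (rule integral_mult_right)
  moreover have "D w = - (A * P.G w)" using P.area_difference[OF w] D[OF w] by simp
  moreover have "(\<lambda>t. A * forcing t * (X t w - x t)) = (\<lambda>t. A * (forcing t * (X t w - x t)))" by (simp add: mult.assoc)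
  ultimately show ?thesis by (simp only: abs_minus_cancel)
 qed
 then have "{w\<in>space M. H <= \<bar>D w\<bar>} = {w\<in>space M. H <= \<bar>integral TI (\<lambda>t. A * forcing t * (X t w - x t))\<bar>}" by auto
 also have "prob ... <= CT / e * exp (- (kT * H ^ 4 / \<sigma>^2))"
 proof (rule large_tail[OF t0 P.eps_pos P.eps_le _ P.sigma_sq(3) sde_TI(2,3)[OF t0 X] _ P.l_bound x0 P.z_cont _ _ _ H])
  show "\<sigma> \<noteq> 0" using P.sigma_pos by simp
  show "continuous_on TI (lam A)" unfolding lam_def[abs_def] by (intro continuous_intros)
  show "\<bar>x t\<bar> <= 3/2" if "t \<in> TI" for t using P.z_range[OF that] by simp
  show "continuous_on TI (\<lambda>t. A * forcing t)" by (intro continuous_intros)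
  have "\<bar>A * forcing t\<bar> <= 9/20 * (2 * 4 * 1)" for t
   unfolding abs_mult using A pi_less_4 by (intro mult_mono) auto
  then show "\<bar>A * forcing t\<bar> <= 7" for t by (rule order_trans) simp
 qed
 finally show ?thesis .
qed

end

section \<open>Combination of the estimates\<close>

definition crossing_rate :: "real \<Rightarrow> real" where
 "crossing_rate C = tail_rate (1/1000) C * (noise_size (1/1000) C)^2"

lemma crossing_rate_pos: "0 < crossing_rate C"
 using const_pos(2,3)[of "1/1000" C] by (simp add: crossing_rate_def)

lemma weaken_tail:
 fixes p :: real
 assumes "p <= c / e * exp (- (r * y))" "c <= c'" "\<kappa> <= r" "0 <= y" "0 < e" "0 <= c"
 shows "p <= c' / e * exp (- (\<kappa> * y))"
proof -
 have "c / e * exp (- (r * y)) <= c' / e * exp (- (\<kappa> * y))"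
  using assms by (intro mult_mono divide_right_mono) (auto intro: mult_right_mono)
 then show ?thesis using assms(1) by linarith
qed

context standard_brownian_motion
begin

text \<open>If \<open>m > Kq * e\<close>, the tracking error of the left orbit is below \<open>\<delta> * sqrt m\<close> and a start near
 \<open>X_minus\<close> is a start near the orbit; otherwise \<open>fold_sub\<close> takes over.\<close>

lemma barrier_crossing:
 assumes t0: "t0 = - (1/2)" and Tp: "tracked_branch e a0 A m \<gamma> K 0 (xp e a0)"
  and Tm: "tracked_branch e a0 A m \<gamma> K (1/2) (\<lambda>t. - xm e a0 t)" and s: "\<sigma> \<noteq> 0"
  and \<delta>: "0 < \<delta>" "2 * \<delta> <= start_size (1/1000) (tracked_branch.C1 \<gamma> K)" "\<delta> * sqrt Kq <= 1/20"
  and Kq: "Kq = max 1 (K / \<delta>)" "Kq * e <= 18/100" "K * sqrt e <= \<delta>"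
  and near: "near_right_well xp \<delta> e a0 x0 \<or> near_left_well xm \<delta> e a0 x0"
  and X: "sde_solution M W e \<sigma> A x0 X"
  and \<kappa>: "\<kappa> <= crossing_rate (tracked_branch.C1 \<gamma> K)" "\<kappa> <= crossing_rate (7600 * Kq ^ 3)"
 shows "prob {w\<in>space M. \<exists>t\<in>TI. X t w = 0} <= tail_const / e * exp (- (\<kappa> * (m powr (3/2) / \<sigma>^2)))"
proof -
 interpret P: tracked_branch e a0 A m \<gamma> K 0 "xp e a0" by (rule Tp)
 interpret L: tracked_branch e a0 A m \<gamma> K "1/2" "\<lambda>t. - xm e a0 t" by (rule Tm)
 have e: "0 < e" "e <= 1" using P.eps P.small' by auto
 have y: "0 <= m powr (3/2) / \<sigma>^2" by simp
 have lamA: "lam A (- (1/2)) = A" by (simp add: lam_def)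
 have m: "0 < m" "e <= m" by (rule P.A_bounds)+
 have Kd: "K * (e / sqrt m) <= \<delta>"
 proof -
  have "K * (e / sqrt m) <= K * (e / sqrt e)" using P.K e m by (intro mult_left_mono divide_left_mono) auto
  also have "... = K * sqrt e" using e by (simp add: real_div_sqrt)
  finally show ?thesis using Kq(3) by linarith
 qed
 from near consider (right) "near_right_well xp \<delta> e a0 x0" | (left) "\<bar>x0 - xm e a0 (- (1/2))\<bar> < 2 * \<delta> * sqrt m"
  | (fold) "a0 < 0" "m <= Kq * e" "\<bar>x0 - X_minus A\<bar> < \<delta> * sqrt m"
 proof (elim disjE)
  assume n: "near_left_well xm \<delta> e a0 x0"
  have dm: "0 < \<delta> * sqrt m" using \<delta> m by simp
  from n consider "\<bar>x0 - xm e a0 (- (1/2))\<bar> < \<delta> * sqrt m" | "a0 < 0" "\<bar>x0 - X_minus A\<bar> < \<delta> * sqrt m"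
   using lamA P.A_eq P.m_eq unfolding near_left_well_def by fastforce
  then show thesis
  proof cases
   case 1 then show thesis using left dm by simp
  next
   case 2
   show thesis
   proof (cases "m <= Kq * e")
    case True then show thesis using fold 2 by blast
   next
    case False
    have "K * e <= \<delta> * m"
    proof -
     have "K / \<delta> * e <= Kq * e" using Kq(1) e by (intro mult_right_mono) auto
     then have "K / \<delta> * e <= m" using False by linarith
     then show ?thesis using \<delta>(1) by (simp add: field_simps)
    qed
    then have "K * e <= \<delta> * sqrt m * sqrt m" using m by (simp add: mult.assoc)
    then have "K * (e / sqrt m) <= \<delta> * sqrt m" using m by (simp add: pos_divide_le_eq)
    moreover have "\<bar>- xm e a0 (- (1/2)) - X_plus (lam A (- (1/2) + 1/2))\<bar> <= K * (e / sqrt m)"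
    proof (rule L.track)
     show "- lambda_c < lam A (- (1/2) + 1/2)" unfolding lam_half lamA using 2 P.A_eq by simp
    qed
    ultimately have "\<bar>- xm e a0 (- (1/2)) - X_plus (- A)\<bar> <= \<delta> * sqrt m"
     unfolding lam_half lamA by linarith
    then show thesis using 2(2) left unfolding X_minus_eq by linarith
   qed
  qed
 qed blast
 then show ?thesis
 proof cases
  case right
  have "\<bar>xp e a0 (- (1/2)) - X_plus (lam A (- (1/2) + 0))\<bar> <= K * (e / sqrt m)"
   by (rule P.track) (use lamA P.A_bounds lambda_c_bounds in simp)
  then have t: "\<bar>xp e a0 (- (1/2)) - X_plus A\<bar> <= \<delta>" using lamA Kd by simp
  have "\<bar>x0 - xp e a0 (- (1/2))\<bar> < \<delta> \<or> \<bar>x0 - X_plus A\<bar> < \<delta>"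
   using right lamA P.A_eq unfolding near_right_well_def by fastforce
  then have "\<bar>x0 - xp e a0 (- (1/2))\<bar> < start_size (1/1000) P.C1" using t \<delta> by linarith
  from hitting_right_well[OF t0 Tp s X this]
  show ?thesis
   by (intro weaken_tail[OF _ order_refl \<kappa>(1) y e(1)]) (use const_pos(4) in \<open>simp_all add: crossing_rate_def\<close>)
 next
  case left
  have "2 * \<delta> * sqrt m <= start_size (1/1000) P.C1 * (200 * sqrt m)"
   using \<delta> m by (intro mult_mono) auto
  then have "\<bar>x0 - xm e a0 (- (1/2))\<bar> < start_size (1/1000) P.C1 * (200 * sqrt m)" using left by linarith
  from hitting_left_well[OF t0 Tm s X this]
  show ?thesis
   by (intro weaken_tail[OF _ order_refl \<kappa>(1) y e(1)]) (use const_pos(4) in \<open>simp_all add: crossing_rate_def\<close>)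
 next
  case fold
  have "1 <= Kq" using Kq(1) by simp
  from hitting_left_fold[OF t0 s X e P.A_eq P.m_eq fold(1) this fold(2) Kq(2) fold(3) \<delta>(1,3)]
  show ?thesis
   by (intro weaken_tail[OF _ order_refl \<kappa>(2) y e(1)]) (use const_pos(4) in \<open>simp_all add: crossing_rate_def\<close>)
 qed
qed

lemma area_tails:
 assumes t0: "t0 = - (1/2)" and P: "area_problem e C x m M W \<sigma> A X" and A: "0 < A" "A <= 9/20" and m: "m = max \<bar>a0\<bar> e"
  and X: "sde_solution M W e \<sigma> A x0 X" and x0: "\<bar>x0\<bar> <= 3/2"
  and D: "\<And>w. w \<in> space M \<Longrightarrow> D w = area A (\<lambda>t. X t w) - area A x"
  and \<kappa>: "\<kappa> <= area_rate C" "\<kappa> <= kT"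
 shows "tail_bound M D \<kappa> (2 + tail_const + CT) ((noise_size (1/2000) C)^2) 80 e a0 \<sigma>"
  "a0 <= - e \<Longrightarrow> e / \<bar>ln \<bar>a0\<bar>\<bar> <= H \<Longrightarrow> H <= H2 ((noise_size (1/2000) C)^2) a0 \<Longrightarrow>
   prob {w\<in>space M. \<bar>D w\<bar> \<ge> H} <= (2 + tail_const + CT) / e * exp (- \<kappa> * H / (\<sigma>^2 * \<bar>ln \<bar>a0\<bar>\<bar>))"
proof -
 interpret P: area_problem e C x m M W \<sigma> A X by (rule P)
 have A1: "A <= 1" using A by simp
 have D': "D w = - A * P.G w" if "w \<in> space M" for w using D[OF that] P.area_difference[OF that] by simp
 note le = P.area_tail_le[OF A(1) A1 D']
 have c: "2 + tail_const <= 2 + tail_const + CT" "CT <= 2 + tail_const + CT" "0 <= 2 + tail_const" "0 <= CT"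
  using const_pos(4) CT_pos by auto
 show "tail_bound M D \<kappa> (2 + tail_const + CT) ((noise_size (1/2000) C)^2) 80 e a0 \<sigma>"
  unfolding tail_bound_def
 proof (intro conjI allI impI)
  fix H assume H: "0 <= H \<and> H <= H1 ((noise_size (1/2000) C)^2) e a0"
  have "prob {w\<in>space M. H <= \<bar>D w\<bar>} <= (2 + tail_const) / e * exp (- (area_rate C * (H^2 / (\<sigma>^2 * e))))"
   by (rule order_trans[OF le P.small_tail]) (use H in \<open>auto simp: H1_def m\<close>)
  from weaken_tail[OF this c(1) \<kappa>(1) _ P.eps_pos c(3)]
  show "measure M {w\<in>space M. \<bar>D w\<bar> \<ge> H} <= (2 + tail_const + CT) / e * exp (- \<kappa> * H^2 / (\<sigma>^2 * e))"
   using P.eps_pos by simp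
 next
  fix H :: real assume H: "80 <= H"
  have "prob {w\<in>space M. H <= \<bar>D w\<bar>} <= CT / e * exp (- (kT * (H ^ 4 / \<sigma>^2)))"
   using large_area_tail[OF t0 P A X x0 H D] by simp
  from weaken_tail[OF this c(2) \<kappa>(2) _ P.eps_pos c(4)]
  show "measure M {w\<in>space M. \<bar>D w\<bar> \<ge> H} <= (2 + tail_const + CT) / e * exp (- \<kappa> * H ^ 4 / \<sigma>^2)" by simp
 qed
 assume a0: "a0 <= - e" and H: "e / \<bar>ln \<bar>a0\<bar>\<bar> <= H" "H <= H2 ((noise_size (1/2000) C)^2) a0"
 have ma: "m = \<bar>a0\<bar>" using a0 P.eps_pos by (simp add: m)
 have "prob {w\<in>space M. H <= \<bar>D w\<bar>} <= (2 + tail_const) / e * exp (- (area_rate C * (H / (\<sigma>^2 * \<bar>ln m\<bar>))))"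
  by (rule order_trans[OF le P.mid_tail]) (use H in \<open>auto simp: H2_def ma\<close>)
 from weaken_tail[OF this c(1) \<kappa>(1) _ P.eps_pos c(3)]
 show "prob {w\<in>space M. \<bar>D w\<bar> \<ge> H} <= (2 + tail_const + CT) / e * exp (- \<kappa> * H / (\<sigma>^2 * \<bar>ln \<bar>a0\<bar>\<bar>))"
  using order_trans[OF divide_nonneg_nonneg H(1)] P.eps_pos unfolding ma by simp
qed

end

definition mean_const :: "real \<Rightarrow> real" where
 "mean_const C = 3 * quad_const C * var_const C + 2 + (2 * (lin_const C)^2 + 54 * (quad_const C)^2 * (var_const C)^2 + 5)"

definition upper_const :: "real \<Rightarrow> real \<Rightarrow> real" where
 "upper_const \<gamma> C = 2 * (lin_const C)^2 + 54 * (quad_const C)^2 * (var_const C)^2 * (16 * Ia_const \<gamma>) + 2"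

text \<open>The second and third entries make the exceptional event negligible, the last one the
  third-order part of the variance.\<close>

definition small_eps :: "real \<Rightarrow> real \<Rightarrow> real" where
 "small_eps \<gamma> C = Min {1, exp (- (48 / (tail_rate (1/2000) C * (noise_size (1/2000) C)^2))),
   1 / (sqrt tail_const * (32 / (tail_rate (1/2000) C * (noise_size (1/2000) C)^2)^2) * fourth_const C),
   exp (- (1 + (third_const C * Ia_const \<gamma> + 1) / (9 * exp (- 14) / 32)))}"

lemma final_const_pos: "0 < mean_const C" "0 < upper_const \<gamma> C" "0 < small_eps \<gamma> C"
proof -
 have p: "0 <= quad_const C * var_const C" using area_const_pos[of C] moment_const_pos(1)[of C] by simp
 show "0 < mean_const C" unfolding mean_const_def
  using p zero_le_power2[of "lin_const C"] mult_nonneg_nonneg[OF zero_le_power2[of "quad_const C"] zero_le_power2[of "var_const C"]]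
  by linarith
 show "0 < upper_const \<gamma> C" unfolding upper_const_def Ia_const_def by (intro add_nonneg_pos) auto
 show "0 < small_eps \<gamma> C" unfolding small_eps_def
  using const_pos(2,3)[of "1/2000" C] const_pos(4) moment_const_pos(2)[of C] by simp
qed

context area_problem
begin

text \<open>Passing from \<open>G\<close> to the area difference multiplies the variance by
  \<open>A^2\<close>, which matters for the lower bound because \<open>A\<close> may be
  small.\<close>

lemma area_moment_bounds:
 assumes A: "0 < A" "A <= 1" and m: "m = max \<bar>a0\<bar> e" and a0: "a0 <= \<gamma> * e"
  and D: "\<And>w. w \<in> space M \<Longrightarrow> D w = - A * G w"
  and e: "e < small_eps \<gamma> C" and s: "\<sigma> * \<bar>ln e\<bar> <= m powr (3/4)"
 shows "integrable M D" "integrable M (\<lambda>w. (D w)\<^sup>2)"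
  "\<bar>expectation D\<bar> <= mean_const C * (\<sigma>^2 * \<bar>ln m\<bar>)"
  "a0 \<ge> - e \<or> \<sigma> <= sqrt e / \<bar>ln \<bar>a0\<bar>\<bar> \<Longrightarrow> 9 * exp (- 14) / 32 * A^2 * (\<sigma>^2 * e) <= variance D"
  "a0 \<ge> - e \<or> \<sigma> <= sqrt e / \<bar>ln \<bar>a0\<bar>\<bar> \<Longrightarrow> variance D <= upper_const \<gamma> C * (\<sigma>^2 * e)"
  "\<sigma> \<ge> sqrt e / \<bar>ln m\<bar> \<Longrightarrow> variance D <= mean_const C * (\<sigma> ^ 4 * \<bar>ln m\<bar>\<^sup>2)"
proof -
 have e': "e < 1" "e <= exp (- (48 / (tail_rate (1/2000) C * (noise_size (1/2000) C)^2)))"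
   "e <= 1 / (sqrt tail_const * (32 / (tail_rate (1/2000) C * (noise_size (1/2000) C)^2)^2) * fourth_const C)"
   "e <= exp (- (1 + (third_const C * Ia_const \<gamma> + 1) / (9 * exp (- 14) / 32)))"
  using e unfolding small_eps_def by simp_all
 have inv: "B * e <= 1" if "0 < B" "e <= 1 / B" for B using that by (simp add: pos_le_divide_eq mult.commute)
 have "0 < sqrt tail_const * (32 / (tail_rate (1/2000) C * (noise_size (1/2000) C)^2)^2) * fourth_const C"
  using const_pos(2,3)[of "1/2000" C] const_pos(4) moment_const_pos(2)[of C] by simp
 then have "sqrt tail_const * (32 / (tail_rate (1/2000) C * (noise_size (1/2000) C)^2)^2) * fourth_const C * e <= 1"
  by (rule inv[OF _ e'(3)])
 note R = moments[OF rare_event[OF e'(2) this e'(1) s]]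
 note Dm = difference_moments[where D = D, OF A D R(1,2)]
 have p: "0 <= quad_const C * var_const C" using area_const_pos[of C] moment_const_pos(1)[of C] by simp
 have q: "0 <= (quad_const C)^2 * (var_const C)^2" by simp
 have s4: "\<sigma> ^ 4 = \<sigma>^2 * \<sigma>^2" by (simp add: eval_nat_numeral)
 show "integrable M D" by (rule Dm(1))
 show "integrable M (\<lambda>w. (D w)\<^sup>2)" using Dm(2) .
 have "(3 * quad_const C * var_const C + 2) * (\<sigma>^2 * \<bar>ln m\<bar>) <= mean_const C * (\<sigma>^2 * \<bar>ln m\<bar>)"
  unfolding mean_const_def using q by (intro mult_right_mono) auto
 then show "\<bar>expectation D\<bar> <= mean_const C * (\<sigma>^2 * \<bar>ln m\<bar>)" using R(3) Dm(3) by linarith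
 show "variance D <= mean_const C * (\<sigma> ^ 4 * \<bar>ln m\<bar>\<^sup>2)" if "\<sigma> \<ge> sqrt e / \<bar>ln m\<bar>"
 proof -
  define Y where "Y = \<sigma> ^ 4 * \<bar>ln m\<bar>\<^sup>2"
  \<comment> \<open>In this regime the Gaussian variance \<open>\<sigma>^2 * e\<close> is dominated
    by \<open>\<sigma> ^ 4 * \<bar>ln m\<bar>^2\<close>, the order of the quadratic part.\<close>
  have "sqrt e <= \<sigma> * \<bar>ln m\<bar>" using that ln_m by (simp add: field_simps)
  then have "(sqrt e)^2 <= (\<sigma> * \<bar>ln m\<bar>)^2" using eps_pos by (intro power_mono) auto
  then have "\<sigma>^2 * e <= \<sigma>^2 * (\<sigma>^2 * \<bar>ln m\<bar>\<^sup>2)" using eps_pos by (intro mult_left_mono) (auto simp: power_mult_distrib)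
  then have 1: "\<sigma>^2 * e <= Y" unfolding Y_def s4 by (simp only: mult.assoc)
  have "(2/3)^2 <= \<bar>ln m\<bar>\<^sup>2" using ln_m by (intro power_mono) auto
  then have "\<sigma> ^ 4 * (4/9) <= Y" unfolding Y_def by (intro mult_left_mono) (auto simp: power_divide)
  moreover have "\<sigma> ^ 4 * e <= \<sigma> ^ 4 * 1" using eps_le by (intro mult_left_mono) auto
  moreover have Y0: "0 <= Y" by (simp add: Y_def)
  ultimately have 2: "2 * (\<sigma> ^ 4 * e) <= 5 * Y" by linarith
  have "variance D <= 2 * (lin_const C)^2 * (\<sigma>^2 * e) + 54 * (quad_const C)^2 * (var_const C)^2 * Y + 2 * (\<sigma> ^ 4 * e)"
   using Dm(5) R(4) unfolding Y_def by linarith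
  also have "... <= 2 * (lin_const C)^2 * Y + 54 * (quad_const C)^2 * (var_const C)^2 * Y + 5 * Y"
   by (intro add_mono mult_left_mono 1 2) auto
  also have "... = (2 * (lin_const C)^2 + 54 * (quad_const C)^2 * (var_const C)^2 + 5) * Y" by (simp add: distrib_right)
  also have "... <= mean_const C * Y" unfolding mean_const_def using p Y0 by (intro mult_right_mono) auto
  finally show ?thesis unfolding Y_def .
 qed
 assume Ia: "a0 \<ge> - e \<or> \<sigma> <= sqrt e / \<bar>ln \<bar>a0\<bar>\<bar>"
 have Ia': "m <= Ia_const \<gamma> * e \<or> \<sigma> <= sqrt e / \<bar>ln m\<bar>"
 proof (cases "a0 \<ge> - e")
  case True
  have "\<gamma> * e <= Ia_const \<gamma> * e" "1 * e <= Ia_const \<gamma> * e"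
   using eps_pos by (intro mult_right_mono; simp add: Ia_const_def)+
  then have "m <= Ia_const \<gamma> * e" using True a0 by (auto simp: m abs_le_iff)
  then show ?thesis ..
 next
  case False
  then have "m = \<bar>a0\<bar>" using eps_pos by (simp add: m)
  then show ?thesis using False Ia by simp
 qed
 note I = sigma_case_Ia[OF Ia']
 have "9 * exp (- 14) / 32 * (\<sigma>^2 * e) <= variance G"
  by (rule R(5)[OF third_order_small[OF I(1) s e'(1,4)]])
 then have "A^2 * (9 * exp (- 14) / 32 * (\<sigma>^2 * e)) <= A^2 * variance G" by (intro mult_left_mono) auto
 also have "A^2 * variance G = variance D" by (rule Dm(4)[symmetric])
 finally have "A^2 * (9 * exp (- 14) / 32 * (\<sigma>^2 * e)) <= variance D" .
 then show "9 * exp (- 14) / 32 * A^2 * (\<sigma>^2 * e) <= variance D" by (simp add: ac_simps)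
 have "\<sigma>^2 * (\<sigma>^2 * \<bar>ln m\<bar>\<^sup>2) <= \<sigma>^2 * (16 * Ia_const \<gamma> * e)" by (intro mult_left_mono I(2)) auto
 then have 1: "\<sigma> ^ 4 * \<bar>ln m\<bar>\<^sup>2 <= 16 * Ia_const \<gamma> * (\<sigma>^2 * e)" unfolding s4 by (simp only: ac_simps)
 have 2: "\<sigma> ^ 4 * e <= \<sigma>^2 * e"
  unfolding s4 using sigma_sq(3) eps_pos mult_right_mono[OF sigma_sq(3), of "\<sigma>^2"] by (intro mult_right_mono) auto
 have "variance D <= 2 * (lin_const C)^2 * (\<sigma>^2 * e) + 54 * (quad_const C)^2 * (var_const C)^2 * (\<sigma> ^ 4 * \<bar>ln m\<bar>\<^sup>2) + 2 * (\<sigma> ^ 4 * e)"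
  using Dm(5) R(4) by linarith
 also have "... <= 2 * (lin_const C)^2 * (\<sigma>^2 * e) + 54 * (quad_const C)^2 * (var_const C)^2 * (16 * Ia_const \<gamma> * (\<sigma>^2 * e)) + 2 * (\<sigma>^2 * e)"
  by (intro add_mono mult_left_mono 1 2 order_refl) auto
 also have "... = upper_const \<gamma> C * (\<sigma>^2 * e)" by (simp add: upper_const_def algebra_simps)
 finally show "variance D <= upper_const \<gamma> C * (\<sigma>^2 * e)" .
qed

end

text \<open>Only \<open>cl\<close> may depend on \<open>Amin\<close>: the area difference is
  \<open>- A\<close> times a variable whose variance has a lower bound
  \<open>\<sigma>^2 * \<epsilon>\<close> with uniform constant, and \<open>A\<close> can approach 0
  as \<open>a0\<close> tends to \<open>- lambda_c\<close>.\<close>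

theorem theorem2p3:
  fixes \<gamma>0 \<gamma>1 :: real and xp xm xz :: "real \<Rightarrow> real \<Rightarrow> real \<Rightarrow> real"
  assumes "0 < \<gamma>0" and "\<gamma>0 < \<gamma>1" and "periodic_orbits \<gamma>1 xp xm xz"
  shows "\<exists>\<delta> \<kappa> h1 h2 c0 C K cu \<epsilon>0.
    0 < \<delta> \<and> 0 < \<kappa> \<and> 0 < h1 \<and> 0 < h2 \<and> 0 < c0 \<and> 0 < C \<and> 0 < K \<and> 0 < cu \<and> 0 < \<epsilon>0 \<and>
    (\<forall>Amin>0. \<exists>cl>0. \<forall>\<epsilon> a0 \<sigma> A.
      0 < \<epsilon> \<and> \<epsilon> < \<epsilon>0 \<and> Amin \<le> A \<and> a0 = A - lambda_c \<and> a0 \<le> \<gamma>0 * \<epsilon> \<and>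
      0 < \<sigma> \<and> \<sigma> \<le> (max \<bar>a0\<bar> \<epsilon>) powr (3/4) \<longrightarrow>
      (\<forall>(M :: 'w measure) W. standard_brownian_motion M (-1/2) W \<longrightarrow>
        (\<forall>x0 X. (near_right_well xp \<delta> \<epsilon> a0 x0 \<or> near_left_well xm \<delta> \<epsilon> a0 x0) \<and>
            sde_solution M W \<epsilon> \<sigma> A x0 X \<longrightarrow>
          measure M {\<omega>\<in>space M. \<exists>t\<in>{-1/2..1/2}. X t \<omega> = 0}
            \<le> C / \<epsilon> * exp (- \<kappa> * (max \<bar>a0\<bar> \<epsilon>) powr (3/2) / \<sigma>\<^sup>2)) \<and>
        (\<forall>x0 X x D. 0 < x0 \<and> \<bar>x0 - xp \<epsilon> a0 (-1/2)\<bar> < \<delta> \<and>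
            sde_solution M W \<epsilon> \<sigma> A x0 X \<and>
            ode_solution \<epsilon> A {-1/2..1/2} x \<and> x (-1/2) = x0 \<and>
            D = (\<lambda>\<omega>. area A (\<lambda>t. X t \<omega>) - area A x) \<longrightarrow>
          (a0 \<ge> - \<epsilon> \<or> \<sigma> \<le> sqrt \<epsilon> / \<bar>ln \<bar>a0\<bar>\<bar> \<longrightarrow>
            tail_bound M D \<kappa> C h1 h2 \<epsilon> a0 \<sigma> \<and>
            (\<sigma> * \<bar>ln \<epsilon>\<bar> \<le> c0 * (max \<bar>a0\<bar> \<epsilon>) powr (3/4) \<longrightarrow>
              integrable M D \<and> integrable M (\<lambda>\<omega>. (D \<omega>)\<^sup>2) \<and>
              \<bar>prob_space.expectation M D\<bar> \<le> K * (\<sigma>\<^sup>2 * \<bar>ln (max \<bar>a0\<bar> \<epsilon>)\<bar>) \<and>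
              cl * (\<sigma>\<^sup>2 * \<epsilon>) \<le> prob_space.variance M D \<and>
              prob_space.variance M D \<le> cu * (\<sigma>\<^sup>2 * \<epsilon>))) \<and>
          (a0 \<le> - \<epsilon> \<and> \<sigma> \<ge> sqrt \<epsilon> / \<bar>ln \<bar>a0\<bar>\<bar> \<longrightarrow>
            tail_bound M D \<kappa> C h1 h2 \<epsilon> a0 \<sigma> \<and>
            (\<forall>H. \<epsilon> / \<bar>ln \<bar>a0\<bar>\<bar> \<le> H \<and> H \<le> H2 h1 a0 \<longrightarrow>
              measure M {\<omega>\<in>space M. \<bar>D \<omega>\<bar> \<ge> H}
                \<le> C / \<epsilon> * exp (- \<kappa> * H / (\<sigma>\<^sup>2 * \<bar>ln \<bar>a0\<bar>\<bar>))) \<and>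
            (\<sigma> * \<bar>ln \<epsilon>\<bar> \<le> c0 * (max \<bar>a0\<bar> \<epsilon>) powr (3/4) \<longrightarrow>
              integrable M D \<and> integrable M (\<lambda>\<omega>. (D \<omega>)\<^sup>2) \<and>
              \<bar>prob_space.expectation M D\<bar> \<le> K * (\<sigma>\<^sup>2 * \<bar>ln \<bar>a0\<bar>\<bar>) \<and>
              prob_space.variance M D \<le> K * (\<sigma> ^ 4 * \<bar>ln \<bar>a0\<bar>\<bar>\<^sup>2))))))"
proof -
 have \<gamma>1: "0 < \<gamma>1" using assms(1,2) by simp
 obtain K \<epsilon>1 where K: "0 < K" and e1: "0 < \<epsilon>1" and T: "\<And>\<epsilon> a0 A m. 0 < \<epsilon> \<Longrightarrow> \<epsilon> < \<epsilon>1 \<Longrightarrow> - lambda_c < a0 \<Longrightarrow> a0 \<le> \<gamma>1 * \<epsilon> \<Longrightarrow>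
   A = lambda_c + a0 \<Longrightarrow> m = max \<bar>a0\<bar> \<epsilon> \<Longrightarrow>
   tracked_branch \<epsilon> a0 A m \<gamma>1 K 0 (xp \<epsilon> a0) \<and> tracked_branch \<epsilon> a0 A m \<gamma>1 K (1/2) (\<lambda>t. - xm \<epsilon> a0 t)"
  using periodic_orbits_tracked[OF assms(3) \<gamma>1] by blast
 define C where "C = tracked_branch.C1 \<gamma>1 K"
 \<comment> \<open>Half of \<open>start_size\<close> because a start near an equilibrium may be at
   distance \<open>2 * \<delta>\<close> from the orbit; the second entry is the radius for
   neighbouring solutions; the last two yield \<open>\<delta> * sqrt Kq <= 1/20\<close>.\<close>
 define \<delta> where "\<delta> = Min {start_size (1/1000) C / 2, exp (- (2 * C)) / 25000, 1/20, 1 / (400 * K)}"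
 define Kq where "Kq = max 1 (K / \<delta>)"
 define \<kappa> where "\<kappa> = Min {crossing_rate C, crossing_rate (7600 * Kq ^ 3), area_rate C, kT}"
 \<comment> \<open>The last two entries give \<open>Kq * \<epsilon> <= 18/100\<close> and
   \<open>K * sqrt \<epsilon> <= \<delta>\<close>.\<close>
 define \<epsilon>0 where "\<epsilon>0 = Min {\<epsilon>1, small_eps \<gamma>1 C, 18/100 / Kq, (\<delta> / K)^2}"
 have \<delta>: "0 < \<delta>" "2 * \<delta> \<le> start_size (1/1000) C" "\<delta> \<le> exp (- (2 * C)) / 25000" "\<delta> \<le> 1/20" "\<delta> \<le> 1 / (400 * K)"
  using const_pos(1)[of "1/1000" C] K unfolding \<delta>_def by simp_all
 have \<kappa>: "0 < \<kappa>" "\<kappa> \<le> crossing_rate C" "\<kappa> \<le> crossing_rate (7600 * Kq ^ 3)" "\<kappa> \<le> area_rate C" "\<kappa> \<le> kT"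
  using crossing_rate_pos area_const_pos(4)[of C] kT_pos unfolding \<kappa>_def by simp_all
 have Kq: "1 \<le> Kq" by (simp add: Kq_def)
 have \<epsilon>0: "0 < \<epsilon>0" "\<epsilon>0 \<le> \<epsilon>1" "\<epsilon>0 \<le> small_eps \<gamma>1 C" "\<epsilon>0 \<le> 18/100 / Kq" "\<epsilon>0 \<le> (\<delta> / K)^2"
  using e1 final_const_pos(3)[of \<gamma>1 C] Kq \<delta>(1) K unfolding \<epsilon>0_def by simp_all
 have \<delta>Kq: "\<delta> * sqrt Kq \<le> 1/20"
 proof -
  have "\<delta> * \<delta> \<le> 1/20 * (1/20)" using \<delta> by (intro mult_mono) auto
  moreover have "\<delta> * K \<le> 1/400" using \<delta>(5) K by (simp add: field_simps)
  ultimately have "\<delta>^2 * Kq \<le> 1/400" using \<delta>(1) by (simp add: Kq_def max_def power2_eq_square)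
  then have "(\<delta> * sqrt Kq)^2 \<le> (1/20)^2" using Kq by (simp add: power_mult_distrib power_divide)
  then show ?thesis by (rule power2_le_imp_le) simp
 qed
 have Cpos: "0 < 2 + tail_const + CT" using const_pos(4) CT_pos by linarith
 have h1: "0 < (noise_size (1/2000) C)^2" using const_pos(2)[of "1/2000" C] by simp
 have half: "(-1/2 :: real) = - (1/2)" by simp
 let ?h = "\<lambda>\<epsilon> a0 \<sigma> A Amin :: real. 0 < \<epsilon> \<and> \<epsilon> < \<epsilon>0 \<and> Amin \<le> A \<and> a0 = A - lambda_c \<and> a0 \<le> \<gamma>0 * \<epsilon> \<and> 0 < \<sigma> \<and> \<sigma> \<le> (max \<bar>a0\<bar> \<epsilon>) powr (3/4)"
 let ?x = "\<lambda>(M :: 'w measure) W \<epsilon> a0 \<sigma> A x0 X x D. 0 < x0 \<and> \<bar>x0 - xp \<epsilon> a0 (-1/2)\<bar> < \<delta> \<and> sde_solution M W \<epsilon> \<sigma> A x0 X \<and>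
   ode_solution \<epsilon> A {-1/2..1/2} x \<and> x (-1/2) = x0 \<and> D = (\<lambda>\<omega>. area A (\<lambda>t. X t \<omega>) - area A x)"
 have base: "tracked_branch \<epsilon> a0 A (max \<bar>a0\<bar> \<epsilon>) \<gamma>1 K 0 (xp \<epsilon> a0)"
   "tracked_branch \<epsilon> a0 A (max \<bar>a0\<bar> \<epsilon>) \<gamma>1 K (1/2) (\<lambda>t. - xm \<epsilon> a0 t)" "0 < A" "A \<le> 9/20" "a0 \<le> \<gamma>1 * \<epsilon>"
   "Kq * \<epsilon> \<le> 18/100" "K * sqrt \<epsilon> \<le> \<delta>" "0 < \<sigma>" "\<sigma> \<le> (max \<bar>a0\<bar> \<epsilon>) powr (3/4)"
  if h: "?h \<epsilon> a0 \<sigma> A Amin"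
   and Amin: "0 < Amin" for \<epsilon> a0 \<sigma> A Amin
 proof -
  have "\<gamma>0 * \<epsilon> \<le> \<gamma>1 * \<epsilon>" using h assms(2) by (intro mult_right_mono) auto
  then show a0: "a0 \<le> \<gamma>1 * \<epsilon>" using h by linarith
  have "\<epsilon> < \<epsilon>1" using h \<epsilon>0 by linarith
  then have "tracked_branch \<epsilon> a0 A (max \<bar>a0\<bar> \<epsilon>) \<gamma>1 K 0 (xp \<epsilon> a0) \<and> tracked_branch \<epsilon> a0 A (max \<bar>a0\<bar> \<epsilon>) \<gamma>1 K (1/2) (\<lambda>t. - xm \<epsilon> a0 t)"
   using h Amin a0 by (intro T) auto
  then show T1: "tracked_branch \<epsilon> a0 A (max \<bar>a0\<bar> \<epsilon>) \<gamma>1 K 0 (xp \<epsilon> a0)"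
   and "tracked_branch \<epsilon> a0 A (max \<bar>a0\<bar> \<epsilon>) \<gamma>1 K (1/2) (\<lambda>t. - xm \<epsilon> a0 t)" by blast+
  show "0 < A" "A \<le> 9/20" using tracked_branch.A_bounds(1,2)[OF T1] by auto
  have "\<epsilon> \<le> 18/100 / Kq" using h \<epsilon>0 by linarith
  then show "Kq * \<epsilon> \<le> 18/100" using Kq by (simp add: pos_le_divide_eq ac_simps)
  have "\<epsilon> \<le> (\<delta> / K)^2" using h \<epsilon>0 by linarith
  then have "sqrt \<epsilon> \<le> \<delta> / K" using \<delta>(1) K by (intro real_le_lsqrt) auto
  then show "K * sqrt \<epsilon> \<le> \<delta>" using K by (simp add: pos_le_divide_eq mult.commute)
  show "0 < \<sigma>" "\<sigma> \<le> (max \<bar>a0\<bar> \<epsilon>) powr (3/4)" using h by auto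
 qed
 have area: "area_problem \<epsilon> C x (max \<bar>a0\<bar> \<epsilon>) M W \<sigma> A X \<and> \<bar>x0\<bar> \<le> 3/2"
  if h: "?h \<epsilon> a0 \<sigma> A Amin"
   and Amin: "0 < Amin" and BM: "standard_brownian_motion M (-1/2) W"
   and x: "?x M W \<epsilon> a0 \<sigma> A x0 X x D"
  for \<epsilon> a0 \<sigma> A Amin and M :: "'w measure" and W x0 X x D
 proof -
  interpret standard_brownian_motion M "-1/2" W by (rule BM)
  note b = base[OF h Amin]
  have P: "area_problem \<epsilon> C x (max \<bar>a0\<bar> \<epsilon>) M W \<sigma> A X"
   unfolding C_def by (rule area_problemI[OF half b(1) _ _ _ _ b(8,9)]) (use x \<delta>(3) half C_def in auto)
  interpret P: area_problem \<epsilon> C x "max \<bar>a0\<bar> \<epsilon>" M W \<sigma> A X by (rule P)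
  show ?thesis using P P.z_range[of "- (1/2)"] x half by auto
 qed
 have tails: "tail_bound M D \<kappa> (2 + tail_const + CT) ((noise_size (1/2000) C)^2) 80 \<epsilon> a0 \<sigma>"
   "a0 \<le> - \<epsilon> \<Longrightarrow> \<epsilon> / \<bar>ln \<bar>a0\<bar>\<bar> \<le> H \<Longrightarrow> H \<le> H2 ((noise_size (1/2000) C)^2) a0 \<Longrightarrow>
    measure M {\<omega>\<in>space M. \<bar>D \<omega>\<bar> \<ge> H} \<le> (2 + tail_const + CT) / \<epsilon> * exp (- \<kappa> * H / (\<sigma>^2 * \<bar>ln \<bar>a0\<bar>\<bar>))"
  if h: "?h \<epsilon> a0 \<sigma> A Amin"
   and Amin: "0 < Amin" and BM: "standard_brownian_motion M (-1/2) W"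
   and x: "?x M W \<epsilon> a0 \<sigma> A x0 X x D"
  for \<epsilon> a0 \<sigma> A Amin and M :: "'w measure" and W x0 X x D H
 proof -
  interpret standard_brownian_motion M "-1/2" W by (rule BM)
  note b = base[OF h Amin] and P = area[OF h Amin BM x]
  have D: "D \<omega> = area A (\<lambda>t. X t \<omega>) - area A x" for \<omega> using x by simp
  note t = area_tails[where D = D, OF half conjunct1[OF P] b(3,4) refl _ conjunct2[OF P] D \<kappa>(4,5)]
  show "tail_bound M D \<kappa> (2 + tail_const + CT) ((noise_size (1/2000) C)^2) 80 \<epsilon> a0 \<sigma>"
   by (rule t(1)) (use x in simp)
  assume "a0 \<le> - \<epsilon>" "\<epsilon> / \<bar>ln \<bar>a0\<bar>\<bar> \<le> H" "H \<le> H2 ((noise_size (1/2000) C)^2) a0"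
  then show "measure M {\<omega>\<in>space M. \<bar>D \<omega>\<bar> \<ge> H} \<le> (2 + tail_const + CT) / \<epsilon> * exp (- \<kappa> * H / (\<sigma>^2 * \<bar>ln \<bar>a0\<bar>\<bar>))"
   by (rule t(2)[rotated]) (use x in simp)
 qed
 have moments: "integrable M D" "integrable M (\<lambda>\<omega>. (D \<omega>)\<^sup>2)"
   "\<bar>prob_space.expectation M D\<bar> \<le> mean_const C * (\<sigma>^2 * \<bar>ln (max \<bar>a0\<bar> \<epsilon>)\<bar>)"
   "a0 \<ge> - \<epsilon> \<or> \<sigma> \<le> sqrt \<epsilon> / \<bar>ln \<bar>a0\<bar>\<bar> \<Longrightarrow> 9 * exp (- 14) / 32 * Amin^2 * (\<sigma>^2 * \<epsilon>) \<le> prob_space.variance M D"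
   "a0 \<ge> - \<epsilon> \<or> \<sigma> \<le> sqrt \<epsilon> / \<bar>ln \<bar>a0\<bar>\<bar> \<Longrightarrow> prob_space.variance M D \<le> upper_const \<gamma>1 C * (\<sigma>^2 * \<epsilon>)"
   "\<sigma> \<ge> sqrt \<epsilon> / \<bar>ln (max \<bar>a0\<bar> \<epsilon>)\<bar> \<Longrightarrow> prob_space.variance M D \<le> mean_const C * (\<sigma> ^ 4 * \<bar>ln (max \<bar>a0\<bar> \<epsilon>)\<bar>\<^sup>2)"
  if h: "?h \<epsilon> a0 \<sigma> A Amin"
   and Amin: "0 < Amin" and BM: "standard_brownian_motion M (-1/2) W"
   and x: "?x M W \<epsilon> a0 \<sigma> A x0 X x D"
   and s: "\<sigma> * \<bar>ln \<epsilon>\<bar> \<le> 1 * (max \<bar>a0\<bar> \<epsilon>) powr (3/4)"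
  for \<epsilon> a0 \<sigma> A Amin and M :: "'w measure" and W x0 X x D
 proof -
  interpret P: area_problem \<epsilon> C x "max \<bar>a0\<bar> \<epsilon>" M W \<sigma> A X using area[OF h Amin BM x] by blast
  note b = base[OF h Amin]
  have D: "D \<omega> = - A * P.G \<omega>" if "\<omega> \<in> space M" for \<omega> using x P.area_difference[OF that] by simp
  have A1: "A \<le> 1" and e: "\<epsilon> < small_eps \<gamma>1 C" using b(4) h \<epsilon>0(3) by auto
  have s': "\<sigma> * \<bar>ln \<epsilon>\<bar> \<le> (max \<bar>a0\<bar> \<epsilon>) powr (3/4)" using s by simp
  note m = P.area_moment_bounds[where D = D, OF b(3) A1 refl b(5) D e s']
  show "integrable M D" by (rule m(1))
  show "integrable M (\<lambda>\<omega>. (D \<omega>)\<^sup>2)" by (rule m(2))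
  show "\<bar>prob_space.expectation M D\<bar> \<le> mean_const C * (\<sigma>^2 * \<bar>ln (max \<bar>a0\<bar> \<epsilon>)\<bar>)" by (rule m(3))
  show "prob_space.variance M D \<le> mean_const C * (\<sigma> ^ 4 * \<bar>ln (max \<bar>a0\<bar> \<epsilon>)\<bar>\<^sup>2)" if "\<sigma> \<ge> sqrt \<epsilon> / \<bar>ln (max \<bar>a0\<bar> \<epsilon>)\<bar>"
   by (rule m(6)[OF _ that])
  assume Ia: "a0 \<ge> - \<epsilon> \<or> \<sigma> \<le> sqrt \<epsilon> / \<bar>ln \<bar>a0\<bar>\<bar>"
  show "prob_space.variance M D \<le> upper_const \<gamma>1 C * (\<sigma>^2 * \<epsilon>)" by (rule m(5)[OF _ Ia])
  have "Amin^2 \<le> A^2" using h Amin by (intro power_mono) auto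
  then have "9 * exp (- 14) / 32 * Amin^2 * (\<sigma>^2 * \<epsilon>) \<le> 9 * exp (- 14) / 32 * A^2 * (\<sigma>^2 * \<epsilon>)"
   using P.eps_pos by (intro mult_right_mono mult_left_mono) auto
  also have "9 * exp (- 14) / 32 * A^2 * (\<sigma>^2 * \<epsilon>) \<le> P.variance D" by (rule m(4)[OF _ Ia])
  finally show "9 * exp (- 14) / 32 * Amin^2 * (\<sigma>^2 * \<epsilon>) \<le> prob_space.variance M D" .
 qed
 show ?thesis
 \<comment> \<open>\<open>h2 = 80\<close> is where \<open>large_tail\<close> begins. The choice
   \<open>c0 = 1\<close> suffices because the logarithm already separates the two sides and the
   remaining constants are met by the smallness of \<open>\<epsilon>0\<close>.\<close>
 proof (rule exI[of _ \<delta>], rule exI[of _ \<kappa>], rule exI[of _ "(noise_size (1/2000) C)^2"], rule exI[of _ 80], rule exI[of _ 1],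
   rule exI[of _ "2 + tail_const + CT"], rule exI[of _ "mean_const C"], rule exI[of _ "upper_const \<gamma>1 C"], rule exI[of _ \<epsilon>0],
   intro conjI allI impI, goal_cases)
  case (10 Amin)
  note Amin = this
  show ?case
  proof (rule exI[of _ "9 * exp (- 14) / 32 * Amin^2"], intro conjI allI impI, goal_cases)
   case 1
   then show ?case using Amin by simp
  next
   case (2 \<epsilon> a0 \<sigma> A M W x0 X)
   interpret standard_brownian_motion M "-1/2" W by (rule 2(2))
   note b = base[OF 2(1) Amin]
   have "prob {\<omega>\<in>space M. \<exists>t\<in>TI. X t \<omega> = 0} \<le> tail_const / \<epsilon> * exp (- (\<kappa> * ((max \<bar>a0\<bar> \<epsilon>) powr (3/2) / \<sigma>^2)))"
    by (rule barrier_crossing[OF half b(1,2) _ \<delta>(1) _ \<delta>Kq Kq_def b(6,7) conjunct1[OF 2(3)] conjunct2[OF 2(3)] \<kappa>(2,3)[unfolded C_def]])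
      (use b(8) \<delta>(2) C_def in auto)
   then have "prob {\<omega>\<in>space M. \<exists>t\<in>TI. X t \<omega> = 0} \<le> (2 + tail_const + CT) / \<epsilon> * exp (- (\<kappa> * ((max \<bar>a0\<bar> \<epsilon>) powr (3/2) / \<sigma>^2)))"
    by (rule weaken_tail) (use 2(1) const_pos(4) CT_pos in auto)
   then show ?case by simp
  next
   case 3 then show ?case using tails(1) Amin by blast
  next
   case 9 then show ?case using tails(1) Amin by blast
  next
   case 10 then show ?case using tails(2) Amin by blast
  next
   case (13 \<epsilon> a0)
   then have "max \<bar>a0\<bar> \<epsilon> = \<bar>a0\<bar>" by auto
   then show ?case using moments(3)[OF 13(1) Amin 13(2,3,5)] by simp
  next
   case (14 \<epsilon> a0)
   then have "max \<bar>a0\<bar> \<epsilon> = \<bar>a0\<bar>" by auto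
   then show ?case using moments(6)[OF 14(1) Amin 14(2,3,5)] 14(4) by simp
  qed ((rule moments[OF _ Amin]; assumption)+)
 qed (use \<delta> \<kappa> h1 Cpos \<epsilon>0 final_const_pos in auto)
qed

end
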